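(* The set $\mathcal{W}(\mathbb{R}^3)$ of all three-dimensional elastic Herglotz wave functions is a reproducing kernel Hilbert space with respect to the inner product $$\langle\mathbf{u},\mathbf{v}\rangle_{\mathcal{H}(\mathbb{R}^3)}=\int_{\mathbb{R}^3}\left(\mathbf{u}(x)\cdot\overline{\mathbf{v}(x)}+\nabla_S\mathbf{u}(x):\overline{\nabla_S\mathbf{v}(x)}\right)\frac{dx}{\langle x\rangle^3},\qquad\langle x\rangle=(1+|x|^2)^{1/2}.$$
   Context: Constants: $\rho>0$, $\omega>0$, and the Lamé constants $\lambda,\mu\in\mathbb{R}$ satisfy $\mu>0$ and $2\mu+\lambda>0$; $k_p,k_s>0$ are given by $k_p^2=\frac{\omega^2\rho}{2\mu+\lambda}$, $k_s^2=\frac{\omega^2\rho}{\mu}$. A three-dimensional elastic Herglotz wave function is an entire solution (defined on all of $\mathbb{R}^3$) $\mathbf{u}:\mathbb{R}^3\to\mathbb{C}^3$ of the spectral Navier equation $\mu\Delta\mathbf{u}+(\lambda+\mu)\nabla(\nabla\cdot\mathbf{u})+\rho\,\omega^2\mathbf{u}=0$ such that $$\mathbf{u}(x)=\int_{\mathbb{S}^2}\left(e^{ik_p x\cdot\xi}\mathbf{g}_1(\xi)+e^{ik_s x\cdot\xi}\mathbf{g}_2(\xi)\right)d\sigma(\xi),$$ where $\mathbf{g}_1,\mathbf{g}_2\in[L^2(\mathbb{S}^2)]^3$, $\xi\times\mathbf{g}_1(\xi)=\mathbf{0}$, $\xi\cdot\mathbf{g}_2(\xi)=0$, and $d\sigma$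 is the surface measure of $\mathbb{S}^2$. Spherical gradient: use spherical coordinates $x=(r\sin\theta\cos\varphi,r\sin\theta\sin\varphi,r\cos\theta)$, $r>0$, $0<\theta<\pi$, $0<\varphi<2\pi$, with unit vectors $\widehat{\mathbf r},\widehat{\boldsymbol\theta},\widehat{\boldsymbol\varphi}$, and write $\mathbf{u}=u^r\widehat{\mathbf r}+u^\theta\widehat{\boldsymbol\theta}+u^\varphi\widehat{\boldsymbol\varphi}$. Then $$\nabla_S\mathbf{u}=\left(\tfrac{\partial u^r}{\partial\theta}-u^\theta\right)\widehat{\boldsymbol\theta}\otimes\widehat{\mathbf r}+\left(\tfrac{\partial u^\theta}{\partial\theta}+u^r\right)\widehat{\boldsymbol\theta}\otimes\widehat{\boldsymbol\theta}+\tfrac{\partial u^\varphi}{\partial\theta}\,\widehat{\boldsymbol\theta}\otimes\widehat{\boldsymbol\varphi}+\left(\tfrac{1}{\sin\theta}\tfrac{\partial u^r}{\partial\varphi}-u^\varphi\right)\widehat{\boldsymbol\varphi}\otimes\widehat{\mathbf r}$$ $$+\left(\tfrac{1}{\sin\theta}\tfrac{\partial u^\theta}{\partial\varphi}-u^\varphi\cot\theta\right)\widehat{\boldsymbol\varphi}\otimes\widehat{\boldsymbol\theta}+\left(\tfrac{1}{\sin\theta}\tfrac{\partial u^\varphi}{\partial\varphi}+u^r+u^\theta\cot\theta\right)\widehat{\boldsymbol\varphi}\otimes\widehat{\boldsymbol\varphi}.$$ For tensors with components $A_{ij},B_{ij}$ in an orthonormal basis, $A:B=\sum_{i,j}A_{ij}B_{ij}$.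 The dot $\cdot$ is the bilinear dot product. The ambient Hilbert space $\mathcal{H}(\mathbb{R}^3)$ is the completion of $C_c^\infty(\mathbb{R}^3;\mathbb{C}^3)$ with respect to the norm associated with $\langle\cdot,\cdot\rangle_{\mathcal{H}(\mathbb{R}^3)}$; $\mathcal{W}(\mathbb{R}^3)$ is regarded as a subspace of it. Reproducing kernel Hilbert space: let $H$ be a Hilbert space of functions $\mathbf{u}:X\to\mathbb{C}^d$, $d\in\mathbb{N}$, with inner product $\langle\cdot,\cdot\rangle_H$. $H$ is a reproducing kernel Hilbert space if there is a complex-valued second-order tensor ($d\times d$ matrix) $\Gamma(x,y)$, $(x,y)\in X\times X$, such that (i) for all $x\in X$ and $z\in\mathbb{C}^d$, the function $y\mapsto\Gamma(x,y)z$ belongs to $H$; (ii) for all $\mathbf{u}\in H$, $x\in X$, $z\in\mathbb{C}^d$, $\mathbf{u}(x)\cdot\overline{z}=\langle\mathbf{u},\Gamma(x,\cdot)z\rangle_H$. *)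

theory Defs
  imports "HOL-Analysis.Analysis"
begin

section \<open>Complex vectors and tensors\<close>

text \<open>The dot product is bilinear; conjugations are always written explicitly.\<close>

definition cdot :: "complex^'d::finite \<Rightarrow> complex^'d \<Rightarrow> complex" where
  "cdot a b = (\<Sum>i\<in>UNIV. a $ i * b $ i)"

definition cnj_vec :: "complex^'d::finite \<Rightarrow> complex^'d" where
  "cnj_vec a = (\<chi> i. cnj (a $ i))"

definition ddot :: "complex^'d::finite^'d \<Rightarrow> complex^'d^'d \<Rightarrow> complex" where
  "ddot A B = (\<Sum>i\<in>UNIV. \<Sum>j\<in>UNIV. A $ i $ j * B $ i $ j)"

definition cnj_mat :: "complex^'d::finite^'d \<Rightarrow> complex^'d^'d" where
  "cnj_mat A = (\<chi> i j. cnj (A $ i $ j))"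

definition vec_of_real :: "real^'d::finite \<Rightarrow> complex^'d" where
  "vec_of_real a = (\<chi> i. complex_of_real (a $ i))"

definition tensor :: "real^'d::finite \<Rightarrow> real^'d \<Rightarrow> complex^'d^'d" where
  "tensor a b = (\<chi> i j. complex_of_real (a $ i * b $ j))"

definition scale_mat :: "complex \<Rightarrow> complex^'d::finite^'d \<Rightarrow> complex^'d^'d" where
  "scale_mat c A = (\<chi> i j. c * A $ i $ j)"

definition cross_rc :: "real^3 \<Rightarrow> complex^3 \<Rightarrow> complex^3" where
  "cross_rc a b = vector
     [of_real (a $ 2) * b $ 3 - of_real (a $ 3) * b $ 2,
      of_real (a $ 3) * b $ 1 - of_real (a $ 1) * b $ 3,
      of_real (a $ 1) * b $ 2 - of_real (a $ 2) * b $ 1]"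


section \<open>Cartesian derivatives and the Navier equation\<close>

definition pd :: "3 \<Rightarrow> (real^3 \<Rightarrow> 'b::real_normed_vector) \<Rightarrow> real^3 \<Rightarrow> 'b" where
  "pd i f x = frechet_derivative f (at x) (axis i 1)"

primrec Ck :: "nat \<Rightarrow> (real^3 \<Rightarrow> 'b::real_normed_vector) \<Rightarrow> bool" where
  "Ck 0 f = continuous_on UNIV f"
| "Ck (Suc k) f = ((\<forall>x. f differentiable (at x)) \<and> (\<forall>i. Ck k (pd i f)))"

definition test_functions :: "(real^3 \<Rightarrow> complex^3) set" where
  "test_functions = {f. (\<forall>k. Ck k f) \<and> compact (closure {x. f x \<noteq> 0})}"

definition laplacian :: "(real^3 \<Rightarrow> complex^3) \<Rightarrow> real^3 \<Rightarrow> complex^3" where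
  "laplacian u x = (\<Sum>i\<in>UNIV. pd i (pd i u) x)"

definition divergence :: "(real^3 \<Rightarrow> complex^3) \<Rightarrow> real^3 \<Rightarrow> complex" where
  "divergence u x = (\<Sum>i\<in>UNIV. pd i (\<lambda>y. u y $ i) x)"

definition gradient :: "(real^3 \<Rightarrow> complex) \<Rightarrow> real^3 \<Rightarrow> complex^3" where
  "gradient f x = (\<chi> i. pd i f x)"

definition entire_navier_solution ::
    "real \<Rightarrow> real \<Rightarrow> real \<Rightarrow> real \<Rightarrow> (real^3 \<Rightarrow> complex^3) \<Rightarrow> bool" where
  "entire_navier_solution \<rho> \<omega> lam \<mu> u \<longleftrightarrow> Ck 2 u \<and>
     (\<forall>x. \<mu> *\<^sub>R laplacian u x + (lam + \<mu>) *\<^sub>R gradient (divergence u) x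
           + (\<rho> * \<omega>\<^sup>2) *\<^sub>R u x = 0)"


section \<open>Spherical coordinates\<close>

definition sph_dom :: "(real \<times> real \<times> real) set" where
  "sph_dom = {0<..} \<times> {0<..<pi} \<times> {0<..<2 * pi}"

definition sph_coords :: "real \<times> real \<times> real \<Rightarrow> real^3" where
  "sph_coords = (\<lambda>(r, \<theta>, \<phi>).
     vector [r * sin \<theta> * cos \<phi>, r * sin \<theta> * sin \<phi>, r * cos \<theta>])"

definition e_r :: "real \<Rightarrow> real \<Rightarrow> real^3" where
  "e_r \<theta> \<phi> = vector [sin \<theta> * cos \<phi>, sin \<theta> * sin \<phi>, cos \<theta>]"

definition e_theta :: "real \<Rightarrow> real \<Rightarrow> real^3" where
  "e_theta \<theta> \<phi> = vector [cos \<theta> * cos \<phi>, cos \<theta> * sin \<phi>, - sin \<theta>]"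

definition e_phi :: "real \<Rightarrow> real \<Rightarrow> real^3" where
  "e_phi \<theta> \<phi> = vector [- sin \<phi>, cos \<phi>, 0]"

definition sph_comp ::
    "(real \<Rightarrow> real \<Rightarrow> real^3) \<Rightarrow> (real^3 \<Rightarrow> complex^3) \<Rightarrow> real \<Rightarrow> real \<Rightarrow> real \<Rightarrow> complex" where
  "sph_comp e u r \<theta> \<phi> = cdot (u (sph_coords (r, \<theta>, \<phi>))) (vec_of_real (e \<theta> \<phi>))"

definition d_theta :: "(real \<Rightarrow> real \<Rightarrow> real \<Rightarrow> complex) \<Rightarrow> real \<Rightarrow> real \<Rightarrow> real \<Rightarrow> complex" where
  "d_theta f r \<theta> \<phi> = vector_derivative (\<lambda>t. f r t \<phi>) (at \<theta>)"

definition d_phi :: "(real \<Rightarrow> real \<Rightarrow> real \<Rightarrow> complex) \<Rightarrow> real \<Rightarrow> real \<Rightarrow> real \<Rightarrow> complex" where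
  "d_phi f r \<theta> \<phi> = vector_derivative (\<lambda>t. f r \<theta> t) (at \<phi>)"

definition sph_grad_coords ::
    "(real^3 \<Rightarrow> complex^3) \<Rightarrow> real \<times> real \<times> real \<Rightarrow> complex^3^3" where
  "sph_grad_coords u = (\<lambda>(r, \<theta>, \<phi>).
     let ur = sph_comp e_r u; ut = sph_comp e_theta u; up = sph_comp e_phi u;
         R = e_r \<theta> \<phi>; T = e_theta \<theta> \<phi>; P = e_phi \<theta> \<phi>;
         s = complex_of_real (1 / sin \<theta>); c = complex_of_real (cot \<theta>)
     in scale_mat (d_theta ur r \<theta> \<phi> - ut r \<theta> \<phi>) (tensor T R)
      + scale_mat (d_theta ut r \<theta> \<phi> + ur r \<theta> \<phi>) (tensor T T)
      + scale_mat (d_theta up r \<theta> \<phi>) (tensor T P)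
      + scale_mat (s * d_phi ur r \<theta> \<phi> - up r \<theta> \<phi>) (tensor P R)
      + scale_mat (s * d_phi ut r \<theta> \<phi> - up r \<theta> \<phi> * c) (tensor P T)
      + scale_mat (s * d_phi up r \<theta> \<phi> + ur r \<theta> \<phi> + ut r \<theta> \<phi> * c) (tensor P P))"

text \<open>The spherical coordinates miss only the closed half plane where the second coordinate
  vanishes and the first is nonnegative. It is a null set, and the spherical gradient is put to
  zero there.\<close>

definition sph_grad :: "(real^3 \<Rightarrow> complex^3) \<Rightarrow> real^3 \<Rightarrow> complex^3^3" where
  "sph_grad u x = (if x \<in> sph_coords ` sph_dom
     then sph_grad_coords u (the_inv_into sph_dom sph_coords x) else 0)"

text \<open>Surface measure of the unit sphere: the image of $\sin\theta\,d\theta\,d\varphi$ under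
  the parametrization by angles.\<close>

definition sphere_measure :: "(real^3) measure" where
  "sphere_measure =
     distr (density (restrict_space lborel ({0<..<pi} \<times> {0<..<2 * pi}))
              (\<lambda>(\<theta>, \<phi>). ennreal (sin \<theta>)))
       (restrict_space borel (sphere 0 1)) (\<lambda>(\<theta>, \<phi>). sph_coords (1, \<theta>, \<phi>))"


section \<open>Elastic Herglotz wave functions\<close>

definition L2_sphere :: "(real^3 \<Rightarrow> complex^3) set" where
  "L2_sphere = {g. g \<in> borel_measurable sphere_measure \<and>
                   integrable sphere_measure (\<lambda>\<xi>. (norm (g \<xi>))\<^sup>2)}"

definition herglotz_waves ::
    "real \<Rightarrow> real \<Rightarrow> real \<Rightarrow> real \<Rightarrow> real \<Rightarrow> real \<Rightarrow> (real^3 \<Rightarrow> complex^3) set" where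
  "herglotz_waves \<rho> \<omega> lam \<mu> kp ks = {u. entire_navier_solution \<rho> \<omega> lam \<mu> u \<and>
     (\<exists>g1\<in>L2_sphere. \<exists>g2\<in>L2_sphere.
        (AE \<xi> in sphere_measure. cross_rc \<xi> (g1 \<xi>) = 0) \<and>
        (AE \<xi> in sphere_measure. cdot (vec_of_real \<xi>) (g2 \<xi>) = 0) \<and>
        (\<forall>x. u x = (LINT \<xi>|sphere_measure.
                exp (\<i> * of_real (kp * (x \<bullet> \<xi>))) *s g1 \<xi>
              + exp (\<i> * of_real (ks * (x \<bullet> \<xi>))) *s g2 \<xi>)))}"


section \<open>The inner product and the ambient space\<close>

definition bracket :: "real^3 \<Rightarrow> real" where
  "bracket x = sqrt (1 + (norm x)\<^sup>2)"

definition H_integrand ::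
    "(real^3 \<Rightarrow> complex^3) \<Rightarrow> (real^3 \<Rightarrow> complex^3) \<Rightarrow> real^3 \<Rightarrow> complex" where
  "H_integrand u v x =
     (cdot (u x) (cnj_vec (v x)) + ddot (sph_grad u x) (cnj_mat (sph_grad v x)))
       / of_real (bracket x ^ 3)"

definition H_inner :: "(real^3 \<Rightarrow> complex^3) \<Rightarrow> (real^3 \<Rightarrow> complex^3) \<Rightarrow> complex" where
  "H_inner u v = (LINT x|lborel. H_integrand u v x)"

definition ip_norm :: "(('a \<Rightarrow> complex^'d::finite) \<Rightarrow> ('a \<Rightarrow> complex^'d) \<Rightarrow> complex)
    \<Rightarrow> ('a \<Rightarrow> complex^'d) \<Rightarrow> real" where
  "ip_norm ip u = sqrt (Re (ip u u))"

text \<open>Those elements of the completion of the test functions that are given by continuously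
  differentiable functions: such a function, of finite norm, stands for the class of the
  sequences of test functions converging to it. Integrability is required explicitly because the
  Bochner integral of a non-integrable function is zero.\<close>

definition H_space :: "(real^3 \<Rightarrow> complex^3) set" where
  "H_space = {u. Ck 1 u \<and> integrable lborel (H_integrand u u) \<and>
     (\<exists>f. range f \<subseteq> test_functions \<and>
        (\<forall>n::nat. integrable lborel
            (H_integrand (\<lambda>x. f n x - u x) (\<lambda>x. f n x - u x))) \<and>
        (\<lambda>n. ip_norm H_inner (\<lambda>x. f n x - u x)) \<longlonglongrightarrow> 0)}"


section \<open>Reproducing kernel Hilbert spaces\<close>

definition hilbert_function_space ::
    "('a \<Rightarrow> complex^'d::finite) set \<Rightarrow>
     (('a \<Rightarrow> complex^'d) \<Rightarrow> ('a \<Rightarrow> complex^'d) \<Rightarrow> complex) \<Rightarrow> bool" where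
  "hilbert_function_space H ip \<longleftrightarrow>
     (\<lambda>_. 0) \<in> H \<and>
     (\<forall>u\<in>H. \<forall>v\<in>H. (\<lambda>x. u x + v x) \<in> H) \<and>
     (\<forall>c. \<forall>u\<in>H. (\<lambda>x. c *s u x) \<in> H) \<and>
     (\<forall>u\<in>H. \<forall>v\<in>H. \<forall>w\<in>H. ip (\<lambda>x. u x + v x) w = ip u w + ip v w) \<and>
     (\<forall>c. \<forall>u\<in>H. \<forall>v\<in>H. ip (\<lambda>x. c *s u x) v = c * ip u v) \<and>
     (\<forall>u\<in>H. \<forall>v\<in>H. ip v u = cnj (ip u v)) \<and>
     (\<forall>u\<in>H. 0 \<le> Re (ip u u) \<and> (ip u u = 0 \<longrightarrow> u = (\<lambda>_. 0))) \<and>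
     (\<forall>f::nat \<Rightarrow> 'a \<Rightarrow> complex^'d. range f \<subseteq> H \<longrightarrow>
        (\<forall>e>0. \<exists>N. \<forall>m\<ge>N. \<forall>n\<ge>N. ip_norm ip (\<lambda>x. f m x - f n x) < e) \<longrightarrow>
        (\<exists>u\<in>H. (\<lambda>n. ip_norm ip (\<lambda>x. f n x - u x)) \<longlonglongrightarrow> 0))"

definition is_rkhs ::
    "('a \<Rightarrow> complex^'d::finite) set \<Rightarrow>
     (('a \<Rightarrow> complex^'d) \<Rightarrow> ('a \<Rightarrow> complex^'d) \<Rightarrow> complex) \<Rightarrow> bool" where
  "is_rkhs H ip \<longleftrightarrow> hilbert_function_space H ip \<and>
     (\<exists>\<Gamma> :: 'a \<Rightarrow> 'a \<Rightarrow> complex^'d^'d.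
        (\<forall>x z. (\<lambda>y. \<Gamma> x y *v z) \<in> H) \<and>
        (\<forall>u\<in>H. \<forall>x z. cdot (u x) (cnj_vec z) = ip u (\<lambda>y. \<Gamma> x y *v z)))"

end

theory Submission
  imports Defs "HOL-Probability.Probability"
begin

text \<open>The spherical gradient does not see radial behaviour, and in Cartesian terms its square is the sum
  of the squares of the angular derivatives $x_i\partial_j - x_j\partial_i$ of the components
  (\<open>ddot_sph_grad\<close>). The norm therefore splits into norms of scalar functions, and each component of an
  elastic Herglotz wave is a sum of two scalar Herglotz waves with wave numbers $k_p$ and $k_s$. The whole
  statement follows from one fact: the norm of the wave is equivalent to the $L^2$ norm of its pair
  of densities (\<open>rep_upper\<close>, \<open>rep_lower\<close>). Indeed, point evaluations are clearly bounded by the norm of the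
  densities, so they are bounded for the norm of the wave, and the theorem of Riesz yields the kernel
  (\<open>rkhs\<close>). Completeness of the space of densities, together with the closedness of the constraints on them,
  yields completeness (\<open>rep_complete\<close>). Radial cutoffs are invisible to the spherical gradient, so
  truncations are test functions that converge in norm, which places the waves in the ambient space
  (\<open>H_space_memI\<close>).

  For a single wave $u$ with density $g$ the equivalence rests on a Morawetz identity for the Helmholtz equation
  with multiplier $\nabla s$, where $s$ is the bracket. The divergence \<open>Q\<close> of the corresponding vector field is
  \[ 2s^{-3}\left(|\nabla u|^2 + |x|^2|\nabla u|^2 - |x\cdot\nabla u|^2\right) + \frac{15}{2}s^{-7}|u|^2 , \]
  so the angular derivatives appear with precisely the weight of the inner product. The flux at
  infinity is governed by large scale means of $|u|^2$ and $|\nabla u|^2$. With Gaussian means these can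
  be computed: they are expressed by a Gaussian kernel on the sphere acting on $g$
  (\<open>gauss_energy_wave\<close>), and since the kernels form an approximate identity, the limit is a multiple of
  $\int|g|^2$ (\<open>gauss_energy_wave_tendsto\<close>). As a result the integral of \<open>Q\<close> equals an explicit
  multiple of $\int|g|^2$ (\<open>Q_integral_eq\<close>). The upper estimate of the norm follows, with $u$ itself recovered
  from second derivatives by the Helmholtz equation (\<open>wave_hsq_upper\<close>). For the lower estimate, the
  radial derivative in \<open>Q\<close> is absorbed by an estimate of Caccioppoli type (\<open>wave_hsq_lower\<close>).

  It remains to keep the two waves apart. If $k_p \neq k_s$, convolution with a Gaussian multiplies them by
  different constants, commutes with angular derivatives and is bounded in the weighted norms; hence
  each wave is controlled by the sum (\<open>two_wave_separate\<close>). If $k_p = k_s$, the two densities are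
  orthogonal at every direction, one being parallel and the other perpendicular to it
  (\<open>rep_orthogonal\<close>).\<close>

section \<open>Spherical coordinates\<close>

lemma norm_vec3_sq: "(norm (x::real^3))\<^sup>2 = (x$1)\<^sup>2 + (x$2)\<^sup>2 + (x$3)\<^sup>2"
  by (simp add: norm_vec_def L2_set_def sum_3 real_sqrt_pow2)

lemma sph_coords_nth:
  "sph_coords (r, \<theta>, \<phi>) $ 1 = r * sin \<theta> * cos \<phi>"
  "sph_coords (r, \<theta>, \<phi>) $ 2 = r * sin \<theta> * sin \<phi>"
  "sph_coords (r, \<theta>, \<phi>) $ 3 = r * cos \<theta>"
  by (simp_all add: sph_coords_def)

lemma norm_sph_coords: "norm (sph_coords (r, \<theta>, \<phi>)) = \<bar>r\<bar>"
proof -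
  have "(norm (sph_coords (r, \<theta>, \<phi>)))\<^sup>2 = r\<^sup>2 * ((sin \<theta>)\<^sup>2 * ((cos \<phi>)\<^sup>2 + (sin \<phi>)\<^sup>2) + (cos \<theta>)\<^sup>2)"
    unfolding norm_vec3_sq sph_coords_nth by algebra
  also have "\<dots> = r\<^sup>2"
    by simp
  finally show ?thesis
    by (metis abs_norm_cancel power2_eq_iff_nonneg abs_ge_zero power2_abs)
qed

lemma sph_coords_scale: "sph_coords (r, \<theta>, \<phi>) = r *\<^sub>R sph_coords (1, \<theta>, \<phi>)"
  by (simp add: vec_eq_iff forall_3 sph_coords_nth)

lemma inj_on_sph_coords: "inj_on sph_coords sph_dom"
proof (rule inj_onI)
  fix a b assume "a \<in> sph_dom" "b \<in> sph_dom" and eq: "sph_coords a = sph_coords b"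
  then obtain r t p r' t' p' where a: "a = (r, t, p)" "0 < r" "0 < t" "t < pi" "0 < p" "p < 2*pi"
    and b: "b = (r', t', p')" "0 < r'" "0 < t'" "t' < pi" "0 < p'" "p' < 2*pi"
    by (auto simp: sph_dom_def)
  have r: "r = r'"
    using arg_cong[OF eq, of norm] a b by (simp add: norm_sph_coords)
  have "cos t = cos t'"
    using arg_cong[OF eq, of "\<lambda>x. x$3"] a b r by (simp add: sph_coords_nth)
  then have t: "t = t'"
    using a b cos_inj_pi[of t t'] by auto
  have "sin t > 0"
    using a sin_gt_zero by blast
  then have "cos p = cos p'" "sin p = sin p'"
    using arg_cong[OF eq, of "\<lambda>x. x$1"] arg_cong[OF eq, of "\<lambda>x. x$2"] a b r t
    by (simp_all add: sph_coords_nth)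
  then obtain n :: int where n: "p = p' + 2 * pi * n"
    using sin_cos_eq_iff[of p p'] by (auto simp: mult.assoc mult.left_commute)
  have "\<bar>2 * pi * n\<bar> < 2 * pi * 1"
    using n a b by linarith
  then have "\<bar>real_of_int n\<bar> < 1"
    by (simp add: abs_mult)
  then have "n = 0" by linarith
  then show "a = b" using a b r t n by simp
qed

text \<open>The polar angle is recovered by the arc cosine and the azimuth from a point of the unit circle;
  the image omits a half plane because the azimuth 0 is excluded.\<close>

lemma sph_coords_image: "sph_coords ` sph_dom = {x. x$2 \<noteq> 0 \<or> x$1 < 0}"
proof (intro equalityI subsetI)
  fix x assume "x \<in> sph_coords ` sph_dom"
  then obtain r t p where x: "x = sph_coords (r, t, p)" "0 < r" "0 < t" "t < pi" "0 < p" "p < 2*pi"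
    by (auto simp: sph_dom_def)
  have pos: "r * sin t > 0"
    using x sin_gt_zero[of t] by simp
  show "x \<in> {x. x$2 \<noteq> 0 \<or> x$1 < 0}"
  proof (cases "sin p = 0")
    case True
    have "sin p > 0" if "p < pi" using that x sin_gt_zero by blast
    moreover have "sin p < 0" if "p > pi" using that x sin_lt_zero by blast
    ultimately have "p = pi" using True by (cases p pi rule: linorder_cases) auto
    then show ?thesis using pos x by (auto simp: sph_coords_nth)
  next
    case False
    then show ?thesis using pos x by (auto simp: sph_coords_nth)
  qed
next
  fix x :: "real^3" assume "x \<in> {x. x$2 \<noteq> 0 \<or> x$1 < 0}"
  then have x: "x$2 \<noteq> 0 \<or> x$1 < 0" by simp
  define r where "r = norm x"
  define w where "w = sqrt ((x$1)\<^sup>2 + (x$2)\<^sup>2)"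
  have pos: "(x$1)\<^sup>2 + (x$2)\<^sup>2 > 0"
    using x by (auto simp: sum_power2_gt_zero_iff)
  have w: "w > 0" "w\<^sup>2 = (x$1)\<^sup>2 + (x$2)\<^sup>2"
    using pos by (simp_all add: w_def)
  have r2: "r\<^sup>2 = w\<^sup>2 + (x$3)\<^sup>2"
    by (simp add: r_def norm_vec3_sq w)
  have r: "r > 0"
    using x by (auto simp: r_def)
  have "(x$3)\<^sup>2 < r\<^sup>2" using r2 w pos by linarith
  then have z: "\<bar>x$3\<bar> < r"
    using r by (metis abs_of_pos power2_less_imp_less power2_abs less_eq_real_def)
  define t where "t = arccos (x$3 / r)"
  have zb: "-1 < x$3/r" "x$3/r < 1"
    using z r by (auto simp: field_simps abs_less_iff)
  have t: "0 < t" "t < pi" "cos t = x$3/r"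
    using arccos_lt_bounded[OF zb] zb by (auto simp: t_def)
  have rc: "r * cos t = x$3"
    using t r by simp
  have "(r * sin t)\<^sup>2 = r\<^sup>2 - (r * cos t)\<^sup>2"
    by (simp add: power_mult_distrib sin_squared_eq algebra_simps)
  then have "(r * sin t)\<^sup>2 = r\<^sup>2 - (x$3)\<^sup>2"
    unfolding rc .
  then have "(r * sin t)\<^sup>2 = w\<^sup>2" using r2 by simp
  moreover have "r * sin t > 0" using r t sin_gt_zero by simp
  ultimately have rs: "r * sin t = w"
    using w by (metis power2_eq_iff_nonneg less_eq_real_def)
  have "(x$1/w)\<^sup>2 + (x$2/w)\<^sup>2 = 1"
    unfolding power_divide add_divide_distrib[symmetric] w(2)[symmetric] using w(1) by simp
  then obtain p where p: "0 \<le> p" "p < 2*pi" "x$1/w = cos p" "x$2/w = sin p"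
    by (rule sincos_total_2pi)
  \<comment> \<open>An azimuth 0 would put the point into the omitted half plane.\<close>
  have "p \<noteq> 0"
  proof
    assume "p = 0"
    then have "x$1/w = 1" "x$2/w = 0" using p by auto
    then show False using x w by auto
  qed
  have "sph_coords (r, t, p) = x"
  proof -
    have "w * cos p = x$1" "w * sin p = x$2"
      using p(3,4) w by (metis less_irrefl nonzero_mult_div_cancel_left times_divide_eq_right)+
    then show ?thesis
      using rs t r by (simp add: vec_eq_iff forall_3 sph_coords_nth)
  qed
  moreover have "(r, t, p) \<in> sph_dom"
    using r t p \<open>p \<noteq> 0\<close> by (simp add: sph_dom_def)
  ultimately show "x \<in> sph_coords ` sph_dom" by (metis imageI)
qed

text \<open>The omitted half plane lies in a hyperplane. Hence it is enough to know integrands on the image.\<close>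

lemma AE_in_sph_image: "AE x in lborel. x \<in> sph_coords ` sph_dom"
proof -
  have "negligible {x::real^3. x \<bullet> axis 2 1 = 0}"
    by (rule negligible_standard_hyperplane) (simp add: axis_in_Basis_iff)
  then have "{x::real^3. x \<bullet> axis 2 1 = 0} \<in> null_sets lebesgue"
    by (simp add: negligible_iff_null_sets)
  then have "{x::real^3. x$2 = 0} \<in> null_sets lebesgue"
    by (simp add: inner_axis)
  moreover have m: "{x::real^3. x$2 = 0} \<in> sets borel"
    by measurable
  ultimately have "{x::real^3. x$2 = 0} \<in> null_sets lborel"
    by (auto simp: null_sets_def)
  then have "AE x in lborel. x \<notin> {x::real^3. x$2 = 0}"
    by (rule AE_not_in)
  then show ?thesis
    by eventually_elim (simp add: sph_coords_image)
qed

lemma open_sph_image: "open (sph_coords ` sph_dom)"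
proof -
  have "sph_coords ` sph_dom = {x. x$2 < 0} \<union> {x. x$2 > 0} \<union> {x. x$1 < 0}"
    unfolding sph_coords_image by auto
  then show ?thesis
    by (auto intro!: open_Un open_Collect_less continuous_intros)
qed

lemma continuous_on_vec3I:
  fixes f :: "'a::topological_space \<Rightarrow> real^3"
  assumes "\<And>i. continuous_on S (\<lambda>x. f x $ i)"
  shows "continuous_on S f"
  using continuous_on_vec_lambda[of S "\<lambda>i x. f x $ i"] assms by simp

lemma continuous_sph_coords: "continuous_on UNIV (\<lambda>(\<theta>, \<phi>). sph_coords (1, \<theta>, \<phi>))"
proof (rule continuous_on_vec3I)
  fix i :: 3
  show "continuous_on UNIV (\<lambda>z. (case z of (\<theta>, \<phi>) \<Rightarrow> sph_coords (1, \<theta>, \<phi>)) $ i)"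
    unfolding case_prod_unfold using exhaust_3[of i]
    by (elim disjE; simp only: sph_coords_nth; intro continuous_intros)
qed

lemma borel_measurable_sph_coords [measurable]: "(\<lambda>(\<theta>, \<phi>). sph_coords (1, \<theta>, \<phi>)) \<in> borel \<rightarrow>\<^sub>M borel"
  by (rule borel_measurable_continuous_onI[OF continuous_sph_coords])


text \<open>Product measure theorems speak about pairs; this equality carries them over to vectors with three
  components.\<close>

lemma lborel_vec3: "distr lborel borel (\<lambda>x::real^3. (x$1, x$2, x$3)) = lborel"
proof (rule lborel_eqI[symmetric])
  fix l u :: "real \<times> real \<times> real"
  assume le: "\<And>b. b \<in> Basis \<Longrightarrow> l \<bullet> b \<le> u \<bullet> b"
  obtain l1 l2 l3 where l: "l = (l1, l2, l3)" by (cases l)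
  obtain u1 u2 u3 where u: "u = (u1, u2, u3)" by (cases u)
  have le': "l1 \<le> u1" "l2 \<le> u2" "l3 \<le> u3"
    using le[of "(1,0,0)"] le[of "(0,1,0)"] le[of "(0,0,1)"] by (auto simp: l u Basis_prod_def zero_prod_def)
  have [measurable]: "(\<lambda>x::real^3. (x$1, x$2, x$3)) \<in> borel \<rightarrow>\<^sub>M borel"
    by (auto intro!: borel_measurable_continuous_onI continuous_intros)
  have "(\<lambda>x::real^3. (x$1, x$2, x$3)) -` box l u = box (vector [l1, l2, l3]) (vector [u1, u2, u3])"
    by (auto simp: l u box_def Basis_prod_def Basis_vec_def inner_axis forall_3)
  then have "emeasure (distr lborel borel (\<lambda>x::real^3. (x$1, x$2, x$3))) (box l u) =
      emeasure lborel (box (vector [l1, l2, l3] :: real^3) (vector [u1, u2, u3]))"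
    by (simp add: emeasure_distr)
  also have "\<dots> = ennreal (\<Prod>b\<in>Basis. (vector [u1, u2, u3] - vector [l1, l2, l3] :: real^3) \<bullet> b)"
  proof (rule emeasure_lborel_box)
    fix b :: "real^3" assume "b \<in> Basis"
    then obtain i where b: "b = axis i 1" by (auto simp: Basis_vec_def)
    show "vector [l1, l2, l3] \<bullet> b \<le> vector [u1, u2, u3] \<bullet> b"
      using exhaust_3[of i] le' by (auto simp: b inner_axis)
  qed
  also have "(\<Prod>b\<in>Basis. (vector [u1, u2, u3] - vector [l1, l2, l3] :: real^3) \<bullet> b) =
      (\<Prod>i\<in>UNIV. (vector [u1, u2, u3] - vector [l1, l2, l3] :: real^3) $ i)"
  proof -
    have B: "(Basis :: (real^3) set) = (\<lambda>i. axis i 1) ` UNIV"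
      by (auto simp: Basis_vec_def)
    show ?thesis
      unfolding B by (subst prod.reindex) (auto simp: inj_on_def axis_eq_axis inner_axis)
  qed
  also have "\<dots> = (\<Prod>b\<in>Basis. (u - l) \<bullet> b)"
  proof -
    have B: "(Basis :: (real \<times> real \<times> real) set) = {(1,0,0), (0,1,0), (0,0,1)}"
      by (auto simp: Basis_prod_def zero_prod_def)
    show ?thesis
      unfolding B UNIV_3 by (simp add: l u)
  qed
  finally show "emeasure (distr lborel borel (\<lambda>x::real^3. (x$1, x$2, x$3))) (box l u) = (\<Prod>b\<in>Basis. (u - l) \<bullet> b)" .
qed simp

lemma has_derivative_vec3I:
  fixes f :: "'a::euclidean_space \<Rightarrow> 'b::euclidean_space^3"
  assumes "\<And>i. ((\<lambda>x. f x $ i) has_derivative (\<lambda>h. f' h $ i)) (at x within S)"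
  shows "(f has_derivative f') (at x within S)"
  unfolding has_derivative_componentwise_within[of f]
proof
  fix b :: "'b^3" assume "b \<in> Basis"
  then obtain i c where b: "b = axis i c" by (auto simp: Basis_vec_def)
  show "((\<lambda>x. f x \<bullet> b) has_derivative (\<lambda>x. f' x \<bullet> b)) (at x within S)"
    unfolding b inner_axis by (intro has_derivative_inner_left assms)
qed

text \<open>The coordinate map as a self-map of the Euclidean space, the form in which the change of variables
  theorem is stated.\<close>

definition sph_vec :: "real^3 \<Rightarrow> real^3" where
  "sph_vec x = sph_coords (x$1, x$2, x$3)"

text \<open>Writing the derivative of the coordinate map in the moving frame makes its Jacobian the product of
  the scale factors $1$, $r$ and $r\sin\theta$.\<close>

definition sph_vec' :: "real^3 \<Rightarrow> real^3 \<Rightarrow> real^3" where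
  "sph_vec' x h = (h$1) *\<^sub>R e_r (x$2) (x$3) + (x$1 * h$2) *\<^sub>R e_theta (x$2) (x$3)
      + (x$1 * sin (x$2) * h$3) *\<^sub>R e_phi (x$2) (x$3)"

lemma has_derivative_sph_vec: "(sph_vec has_derivative sph_vec' x) (at x within S)"
proof (rule has_derivative_vec3I)
  fix i :: 3
  show "((\<lambda>x. sph_vec x $ i) has_derivative (\<lambda>h. sph_vec' x h $ i)) (at x within S)"
    using exhaust_3[of i]
    by (elim disjE; simp only: sph_vec_def sph_coords_nth)
       (auto simp: sph_vec'_def e_r_def e_theta_def e_phi_def algebra_simps
        intro!: derivative_eq_intros bounded_linear_imp_has_derivative[OF bounded_linear_vec_nth])
qed

lemma det_sph_vec': "det (matrix (sph_vec' x)) = (x$1)\<^sup>2 * sin (x$2)"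
proof -
  have "det (matrix (sph_vec' x)) = (x$1)\<^sup>2 * sin (x$2) *
     (((sin (x$2))\<^sup>2 + (cos (x$2))\<^sup>2) * ((sin (x$3))\<^sup>2 + (cos (x$3))\<^sup>2))"
    by (simp add: det_3 matrix_def sph_vec'_def e_r_def e_theta_def e_phi_def axis_def
       algebra_simps power2_eq_square
       del: sin_cos_squared_add sin_cos_squared_add2 sin_cos_squared_add3)
  then show ?thesis by simp
qed

section \<open>Rotation invariance of the surface measure\<close>

abbreviation sph_box :: "(real \<times> real) set" where
  "sph_box \<equiv> {0<..<pi} \<times> {0<..<2 * pi}"

lemma sph_box_measurable [measurable]: "sph_box \<in> sets borel"
  by (intro borel_open open_Times) auto

lemma sphere_param_measurable:
  "(\<lambda>(\<theta>, \<phi>). sph_coords (1, \<theta>, \<phi>)) \<in>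
     density (restrict_space lborel sph_box) (\<lambda>(\<theta>, \<phi>). ennreal (sin \<theta>)) \<rightarrow>\<^sub>M restrict_space borel (sphere 0 1)"
proof (rule measurable_restrict_space2)
  show "(\<lambda>(\<theta>, \<phi>). sph_coords (1, \<theta>, \<phi>)) \<in> space (density (restrict_space lborel sph_box) (\<lambda>(\<theta>, \<phi>). ennreal (sin \<theta>))) \<rightarrow> sphere 0 1"
    by (auto simp: norm_sph_coords)
  show "(\<lambda>(\<theta>, \<phi>). sph_coords (1, \<theta>, \<phi>)) \<in>
     density (restrict_space lborel sph_box) (\<lambda>(\<theta>, \<phi>). ennreal (sin \<theta>)) \<rightarrow>\<^sub>M borel"
    unfolding measurable_density_eq1 by (rule measurable_restrict_space1) simp
qed

lemma space_sphere_measure: "space sphere_measure = sphere 0 1"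
  by (simp add: sphere_measure_def space_restrict_space)

lemma sets_sphere_measure: "sets sphere_measure = sets (restrict_space borel (sphere 0 1))"
  by (simp add: sphere_measure_def)

lemma borel_measurable_sphereI:
  assumes "f \<in> borel \<rightarrow>\<^sub>M N"
  shows "f \<in> sphere_measure \<rightarrow>\<^sub>M N"
  using measurable_restrict_space1[OF assms, of "sphere 0 1"]
  unfolding measurable_cong_sets[OF sets_sphere_measure refl] .

lemma sin_measurable2: "(\<lambda>(\<theta>::real, \<phi>::real). ennreal (sin \<theta>)) \<in> borel_measurable borel"
  unfolding case_prod_unfold
  by (intro measurable_compose[OF borel_measurable_continuous_onI measurable_ennreal] continuous_intros)

lemma sph_coords1_eq: "(\<lambda>(\<theta>, \<phi>). sph_coords (1, \<theta>, \<phi>)) = (\<lambda>z. sph_coords (1, z))"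
  by auto

lemma borel_measurable_sph_coords1 [measurable]: "(\<lambda>z. sph_coords (1, z)) \<in> borel \<rightarrow>\<^sub>M borel"
  using borel_measurable_sph_coords unfolding sph_coords1_eq .

lemma borel_measurable_orthogonal_transformation:
  fixes f :: "real^3 \<Rightarrow> real^3"
  assumes "orthogonal_transformation f"
  shows "f \<in> borel \<rightarrow>\<^sub>M borel"
  using assms orthogonal_transformation_linear[of f] linear_continuous_on[of f UNIV]
  by (intro borel_measurable_continuous_onI) (simp add: linear_linear)

lemma nn_integral_sphere:
  assumes f: "f \<in> borel_measurable borel"
  shows "(\<integral>\<^sup>+\<xi>. f \<xi> \<partial>sphere_measure) =
    (\<integral>\<^sup>+z. ennreal (sin (fst z)) * f (sph_coords (1, z)) * indicator sph_box z \<partial>lborel)"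
proof -
  have f': "f \<in> borel_measurable (restrict_space borel (sphere 0 1))"
    by (rule measurable_restrict_space1[OF f])
  note p = borel_measurable_sph_coords1
  have [measurable]: "(\<lambda>z. f (sph_coords (1, z))) \<in> borel_measurable borel"
    by (rule measurable_compose[OF p f])
  have [measurable]: "(\<lambda>z::real\<times>real. ennreal (sin (fst z))) \<in> borel_measurable borel"
    using sin_measurable2 by (simp add: case_prod_unfold)
  have "(\<integral>\<^sup>+\<xi>. f \<xi> \<partial>sphere_measure) =
    (\<integral>\<^sup>+z. f (sph_coords (1, z))
       \<partial>density (restrict_space lborel sph_box) (\<lambda>(\<theta>, \<phi>). ennreal (sin \<theta>)))"
    unfolding sphere_measure_def using nn_integral_distr[OF sphere_param_measurable, of f] f'
    by (simp add: sph_coords1_eq)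
  also have "\<dots> = (\<integral>\<^sup>+z. ennreal (sin (fst z)) * f (sph_coords (1, z)) \<partial>restrict_space lborel sph_box)"
    unfolding case_prod_unfold
    by (subst nn_integral_density) (auto intro!: measurable_restrict_space1)
  also have "\<dots> = (\<integral>\<^sup>+z. ennreal (sin (fst z)) * f (sph_coords (1, z)) * indicator sph_box z \<partial>lborel)"
    by (subst nn_integral_restrict_space) (auto simp: sph_box_measurable)
  finally show ?thesis .
qed

lemma emeasure_sphere:
  assumes A: "A \<in> sets borel"
  shows "emeasure sphere_measure (A \<inter> sphere 0 1) =
    (\<integral>\<^sup>+z. ennreal (sin (fst z)) * indicator A (sph_coords (1, z)) * indicator sph_box z \<partial>lborel)"
proof -
  have AS: "A \<inter> sphere 0 1 \<in> sets sphere_measure"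
    unfolding sets_sphere_measure sets_restrict_space using A by (auto simp: Int_commute)
  have "emeasure sphere_measure (A \<inter> sphere 0 1) = (\<integral>\<^sup>+\<xi>. indicator (A \<inter> sphere 0 1) \<xi> \<partial>sphere_measure)"
    using AS by simp
  also have "\<dots> = (\<integral>\<^sup>+\<xi>. indicator A \<xi> \<partial>sphere_measure)"
    by (rule nn_integral_cong) (auto simp: space_sphere_measure indicator_def)
  also have "\<dots> = (\<integral>\<^sup>+z. ennreal (sin (fst z)) * indicator A (sph_coords (1, z)) * indicator sph_box z \<partial>lborel)"
    using A by (intro nn_integral_sphere) simp
  finally show ?thesis .
qed

text \<open>For zonal functions the integration over the azimuth contributes the factor $2\pi$.\<close>

lemma nn_integral_sin_times:
  assumes [measurable]: "F \<in> borel_measurable borel"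
  shows "(\<integral>\<^sup>+z. ennreal (sin (fst z)) * F (fst z) * indicator sph_box z \<partial>lborel) =
     ennreal (2 * pi) * (\<integral>\<^sup>+t. ennreal (sin t) * F t * indicator {0<..<pi} t \<partial>lborel)"
proof -
  have "(\<integral>\<^sup>+z. ennreal (sin (fst z)) * F (fst z) * indicator sph_box z \<partial>lborel) =
    (\<integral>\<^sup>+z. (ennreal (sin (fst z)) * F (fst z) * indicator {0<..<pi} (fst z)) * indicator {0<..<2*pi} (snd z) \<partial>(lborel \<Otimes>\<^sub>M lborel))"
    by (subst lborel_prod) (intro nn_integral_cong, auto simp: indicator_def)
  also have "\<dots> = (\<integral>\<^sup>+t. \<integral>\<^sup>+p. (ennreal (sin t) * F t * indicator {0<..<pi} t) * indicator {0<..<2*pi} p \<partial>lborel \<partial>lborel)"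
    by (subst lborel.nn_integral_fst[symmetric]) auto
  also have "\<dots> = (\<integral>\<^sup>+t. ennreal (2*pi) * (ennreal (sin t) * F t * indicator {0<..<pi} t) \<partial>lborel)"
    by (intro nn_integral_cong, subst nn_integral_cmult) (auto simp: mult.commute)
  also have "\<dots> = ennreal (2 * pi) * (\<integral>\<^sup>+t. ennreal (sin t) * F t * indicator {0<..<pi} t \<partial>lborel)"
    by (subst nn_integral_cmult) auto
  finally show ?thesis .
qed

lemma emeasure_sphere_space: "emeasure sphere_measure (sphere 0 1) = ennreal (4 * pi)"
proof -
  have "emeasure sphere_measure (UNIV \<inter> sphere 0 1) =
    (\<integral>\<^sup>+z. ennreal (sin (fst z)) * 1 * indicator sph_box z \<partial>lborel)"
    by (subst emeasure_sphere) auto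
  also have "\<dots> = ennreal (2 * pi) * (\<integral>\<^sup>+t. ennreal (sin t) * 1 * indicator {0<..<pi} t \<partial>lborel)"
    by (rule nn_integral_sin_times) simp
  also have "(\<integral>\<^sup>+t. ennreal (sin t) * 1 * indicator {0<..<pi} t \<partial>lborel) = (\<integral>\<^sup>+t. ennreal (sin t) * indicator {0..pi} t \<partial>lborel)"
  proof (rule nn_integral_cong_AE)
    show "AE t in lborel. ennreal (sin t) * 1 * indicator {0<..<pi} t = ennreal (sin t) * indicator {0..pi} t"
      using AE_lborel_singleton[of 0] AE_lborel_singleton[of pi]
      by eventually_elim (auto simp: indicator_def)
  qed
  also have "\<dots> = ennreal (- cos pi - (- cos 0))"
    by (rule nn_integral_FTC_Icc) (auto intro!: derivative_eq_intros sin_ge_zero)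
  also have "ennreal (2 * pi) * \<dots> = ennreal (2 * pi * (- cos pi - (- cos 0)))"
    by (intro ennreal_mult[symmetric]) auto
  finally show ?thesis
    by simp
qed

lemma finite_measure_sphere: "finite_measure sphere_measure"
  by (rule finite_measureI) (simp add: space_sphere_measure emeasure_sphere_space)

interpretation sphere: finite_measure sphere_measure
  by (rule finite_measure_sphere)

text \<open>The points of the punctured unit ball whose direction lies in the given set. Volumes of such cones
  express the surface measure through Lebesgue measure.\<close>

definition direction_cone :: "(real^3) set \<Rightarrow> (real^3) set" where
  "direction_cone A = {x. 0 < norm x \<and> norm x < 1 \<and> x /\<^sub>R norm x \<in> A}"

lemma direction_cone_measurable:
  assumes "A \<in> sets borel"
  shows "direction_cone A \<in> sets borel"
proof -
  have [measurable]: "(\<lambda>x::real^3. x /\<^sub>R norm x) \<in> borel \<rightarrow>\<^sub>M borel"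
    by measurable
  show ?thesis
    unfolding direction_cone_def using assms by measurable
qed

text \<open>In polar coordinates the volume element is $r^2\,dr$ times the surface element, and $r^2$ integrates
  to $1/3$ over the unit interval. Rotation invariance is invisible in the definition of the surface
  measure by angles, but the cone of a rotated set is the rotated cone, so it is inherited from
  Lebesgue measure.\<close>

lemma emeasure_direction_cone:
  assumes A: "A \<in> sets borel"
  shows "emeasure lborel (direction_cone A) = ennreal (1/3) * emeasure sphere_measure (A \<inter> sphere 0 1)"
proof -
  \<comment> \<open>The coordinates that are mapped onto the cone.\<close>
  define S where "S = {x::real^3. 0 < x$1 \<and> x$1 < 1 \<and> (x$2, x$3) \<in> sph_box \<and> sph_coords (1, x$2, x$3) \<in> A}"
  have p: "(\<lambda>x::real^3. (x$2, x$3)) \<in> borel \<rightarrow>\<^sub>M borel" "(\<lambda>x::real^3. (x$1, x$2, x$3)) \<in> borel \<rightarrow>\<^sub>M borel"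
    by (auto intro!: borel_measurable_continuous_onI continuous_intros)
  have [measurable]: "(\<lambda>x::real^3. sph_coords (1, x$2, x$3)) \<in> borel \<rightarrow>\<^sub>M borel"
    using measurable_compose[OF p(1) borel_measurable_sph_coords] by simp
  have [measurable]: "S \<in> sets borel"
    using A unfolding S_def by simp
  have inj: "inj_on sph_vec S"
  proof (rule inj_onI)
    fix x y assume xy: "x \<in> S" "y \<in> S" "sph_vec x = sph_vec y"
    have "(x$1, x$2, x$3) = (y$1, y$2, y$3)"
      by (rule inj_onD[OF inj_on_sph_coords]) (use xy in \<open>auto simp: S_def sph_dom_def sph_vec_def\<close>)
    then show "x = y" by (simp add: vec_eq_iff forall_3)
  qed
  have img: "sph_vec ` S = direction_cone A \<inter> sph_coords ` sph_dom"
  proof (intro equalityI subsetI)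
    fix y assume "y \<in> sph_vec ` S"
    then obtain x where x: "x \<in> S" "y = sph_vec x" by auto
    have n: "norm y = x$1" using x by (simp add: sph_vec_def norm_sph_coords S_def)
    have "y = (x$1) *\<^sub>R sph_coords (1, x$2, x$3)" using x sph_coords_scale[of "x$1" "x$2" "x$3"] by (simp only: sph_vec_def)
    then have "y /\<^sub>R norm y \<in> A" using x n by (simp add: S_def)
    moreover have "(x$1, x$2, x$3) \<in> sph_dom" using x by (auto simp: S_def sph_dom_def)
    ultimately show "y \<in> direction_cone A \<inter> sph_coords ` sph_dom"
      using x n by (auto simp: direction_cone_def S_def sph_vec_def)
  next
    fix y assume y: "y \<in> direction_cone A \<inter> sph_coords ` sph_dom"
    then obtain r t p where y': "y = sph_coords (r, t, p)" "(r,t,p) \<in> sph_dom" by auto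
    have r: "norm y = r" "r > 0" using y' by (auto simp: norm_sph_coords sph_dom_def)
    have "y /\<^sub>R norm y = sph_coords (1, t, p)"
      using r y' sph_coords_scale[of r t p] by simp
    then have "vector [r, t, p] \<in> S"
      using y y' r by (auto simp: S_def direction_cone_def sph_dom_def)
    moreover have "sph_vec (vector [r,t,p]) = y" using y' by (simp add: sph_vec_def)
    ultimately show "y \<in> sph_vec ` S" by (metis imageI)
  qed
  define G where "G z = ennreal (sin (fst z)) * indicator A (sph_coords (1, z)) * indicator sph_box z" for z
  note p' = borel_measurable_sph_coords1
  have "(\<lambda>z. indicator A (sph_coords (1, z)) :: ennreal) \<in> borel_measurable borel"
    by (rule measurable_compose[OF p']) (use A in simp)
  then have G [measurable]: "G \<in> borel_measurable borel"
    unfolding G_def using sin_measurable2 by (simp add: case_prod_unfold)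
  have Gm: "(\<lambda>z. ennreal ((fst z)\<^sup>2) * indicator {0<..<1} (fst z) * G (snd z)) \<in> borel_measurable (borel :: (real \<times> real \<times> real) measure)"
  proof -
    have [measurable]: "(\<lambda>z::real \<times> real \<times> real. fst z) \<in> borel \<rightarrow>\<^sub>M borel" "(\<lambda>z::real \<times> real \<times> real. snd z) \<in> borel \<rightarrow>\<^sub>M borel"
      by (auto intro!: borel_measurable_continuous_onI continuous_intros)
    show ?thesis by measurable
  qed
  have fin: "emeasure sphere_measure (A \<inter> sphere 0 1) \<noteq> \<infinity>"
    by simp
  define m where "m = measure sphere_measure (A \<inter> sphere 0 1)"
  have m: "(\<integral>\<^sup>+z. G z \<partial>lborel) = ennreal m" "m \<ge> 0"
    unfolding G_def m_def using emeasure_sphere[OF A] fin by (simp_all add: sphere.emeasure_eq_measure)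
  have "(\<integral>\<^sup>+x. ennreal (indicator S x * ((x$1)\<^sup>2 * sin (x$2))) \<partial>lborel) =
    nn_integral lborel (\<lambda>x::real^3. ennreal ((x$1)\<^sup>2) * indicator {0<..<1} (x$1) * G (x$2, x$3))"
  proof (intro nn_integral_cong)
    fix x :: "real^3"
    show "ennreal (indicator S x * ((x$1)\<^sup>2 * sin (x$2))) = ennreal ((x$1)\<^sup>2) * indicator {0<..<1} (x$1) * G (x$2, x$3)"
    proof (cases "x \<in> S")
      case True
      then show ?thesis
        using sin_ge_zero[of "x$2"] by (simp add: S_def G_def ennreal_mult)
    next
      case False
      then have "indicator {0<..<1} (x$1) * G (x$2, x$3) = 0"
        by (auto simp: S_def G_def indicator_def)
      then show ?thesis using False by (simp add: mult.assoc)
    qed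
  qed
  also have "\<dots> = (\<integral>\<^sup>+z. ennreal ((fst z)\<^sup>2) * indicator {0<..<1} (fst z) * G (snd z) \<partial>(distr lborel borel (\<lambda>x::real^3. (x$1, x$2, x$3))))"
    by (subst nn_integral_distr) (simp_all add: p Gm)
  also have "\<dots> = (\<integral>\<^sup>+z. ennreal ((fst z)\<^sup>2) * indicator {0<..<1} (fst z) * G (snd z) \<partial>(lborel \<Otimes>\<^sub>M lborel))"
    unfolding lborel_vec3 lborel_prod ..
  also have "\<dots> = (\<integral>\<^sup>+r. \<integral>\<^sup>+w. (ennreal (r\<^sup>2) * indicator {0<..<1} r) * G w \<partial>lborel \<partial>lborel)"
    by (subst lborel.nn_integral_fst[symmetric]) auto
  also have "\<dots> = (\<integral>\<^sup>+r. (ennreal (r\<^sup>2) * indicator {0<..<1} r) * ennreal m \<partial>lborel)"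
    by (intro nn_integral_cong, subst nn_integral_cmult) (auto simp: m)
  also have "\<dots> = (\<integral>\<^sup>+r. ennreal (r\<^sup>2) * indicator {0<..<1} r \<partial>lborel) * ennreal m"
    by (rule nn_integral_multc) auto
  also have "(\<integral>\<^sup>+r. ennreal (r\<^sup>2) * indicator {0<..<1} r \<partial>lborel) = (\<integral>\<^sup>+r. ennreal (r\<^sup>2) * indicator {0..1} r \<partial>lborel)"
  proof (rule nn_integral_cong_AE)
    show "AE r::real in lborel. ennreal (r\<^sup>2) * indicator {0<..<1} r = ennreal (r\<^sup>2) * indicator {0..1} r"
      using AE_lborel_singleton[of 0] AE_lborel_singleton[of 1]
      by eventually_elim (auto simp: indicator_def)
  qed
  also have "\<dots> = ennreal (1^3/3 - 0^3/3)"
    by (rule nn_integral_FTC_Icc[where F="\<lambda>r. r^3/3"]) (auto intro!: derivative_eq_intros)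
  also have "ennreal (1^3/3 - 0^3/3) * ennreal m = ennreal (1/3 * m)"
    using m by (simp add: ennreal_mult[symmetric])
  finally have nn: "(\<integral>\<^sup>+x. ennreal (indicator S x * ((x$1)\<^sup>2 * sin (x$2))) \<partial>lborel) = ennreal (1/3 * m)" .
  \<comment> \<open>The change of variables theorem for measures of images uses the gauge integral of the Jacobian.\<close>
  have "((\<lambda>x. indicator S x * ((x$1)\<^sup>2 * sin (x$2))) has_integral (1/3 * m)) UNIV"
  proof (rule nn_integral_has_integral[OF _ _ nn])
    show "0 \<le> indicator S x * ((x$1)\<^sup>2 * sin (x$2))" for x
      by (auto simp: S_def indicator_def sin_ge_zero)
  qed (use m in auto)
  then have "((\<lambda>x. if x \<in> S then \<bar>det (matrix (sph_vec' x))\<bar> else 0) has_integral (1/3 * m)) UNIV"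
    by (rule has_integral_eq[rotated]) (auto simp: S_def indicator_def det_sph_vec' abs_mult sin_ge_zero)
  then have "((\<lambda>x. \<bar>det (matrix (sph_vec' x))\<bar>) has_integral (1/3 * m)) S"
    by (simp add: has_integral_restrict_UNIV)
  then have "sph_vec ` S \<in> lmeasurable \<and> measure lebesgue (sph_vec ` S) = 1/3 * m"
    by (subst has_measure_differentiable_image[where f'=sph_vec'])
       (auto intro: has_derivative_sph_vec inj)
  then have lm: "sph_vec ` S \<in> lmeasurable" "measure lebesgue (sph_vec ` S) = 1/3 * m"
    by auto
  have "emeasure lebesgue (sph_vec ` S) = ennreal (1/3 * m)"
    unfolding emeasure_eq_measure2[OF lm(1)] lm(2) ..
  moreover have "emeasure lebesgue (sph_vec ` S) = emeasure lborel (direction_cone A \<inter> sph_coords ` sph_dom)"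
    unfolding img using direction_cone_measurable[OF A] open_sph_image by (simp add: borel_open)
  moreover have "emeasure lborel (direction_cone A \<inter> sph_coords ` sph_dom) = emeasure lborel (direction_cone A)"
    using AE_in_sph_image direction_cone_measurable[OF A] open_sph_image
    by (intro emeasure_eq_AE) (auto simp: borel_open)
  ultimately show ?thesis
    using m ennreal_mult[of "1/3" m] by (simp add: m_def sphere.emeasure_eq_measure)
qed

lemma emeasure_lborel_orthogonal:
  fixes f :: "real^3 \<Rightarrow> real^3"
  assumes f: "orthogonal_transformation f" and A: "A \<in> sets borel"  "bounded A"
  shows "emeasure lborel (f -` A) = emeasure lborel A"
proof -
  define g where "g = inv f"
  have g: "orthogonal_transformation g"
    unfolding g_def by (rule orthogonal_transformation_inv[OF f])
  have im: "f -` A = g ` A"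
    unfolding g_def by (rule bij_vimage_eq_inv_image[OF orthogonal_transformation_bij[OF f]])
  have Al: "A \<in> lmeasurable"
    using A by (simp add: bounded_set_imp_lmeasurable)
  have "f \<in> borel \<rightarrow>\<^sub>M borel"
    by (rule borel_measurable_orthogonal_transformation[OF f])
  then have "f -` A \<in> sets borel"
    using A measurable_sets[of f borel borel A] by simp
  moreover have "emeasure lebesgue (g ` A) = emeasure lebesgue A"
    unfolding emeasure_eq_measure2[OF measurable_orthogonal_image[OF g Al]] emeasure_eq_measure2[OF Al]
      measure_orthogonal_image[OF g Al] ..
  ultimately show ?thesis using A im by simp
qed

lemma sphere_measure_rotate:
  assumes f: "orthogonal_transformation f" and A: "A \<in> sets borel"
  shows "emeasure sphere_measure ((f -` A) \<inter> sphere 0 1) = emeasure sphere_measure (A \<inter> sphere 0 1)"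
proof -
  have fm: "f \<in> borel \<rightarrow>\<^sub>M borel"
    by (rule borel_measurable_orthogonal_transformation[OF f])
  then have fA: "f -` A \<in> sets borel"
    using A measurable_sets[of f borel borel A] by simp
  have "direction_cone (f -` A) = f -` direction_cone A"
    by (simp only: direction_cone_def orthogonal_transformation_norm[OF f]
      linear_scale[OF orthogonal_transformation_linear[OF f]] vimage_def mem_Collect_eq)
  moreover have "bounded (direction_cone A)"
    unfolding bounded_iff direction_cone_def by (intro exI[of _ 1]) auto
  ultimately have "emeasure lborel (direction_cone (f -` A)) = emeasure lborel (direction_cone A)"
    using emeasure_lborel_orthogonal[OF f direction_cone_measurable[OF A]] by simp
  then have "ennreal (1/3) * emeasure sphere_measure ((f -` A) \<inter> sphere 0 1) = ennreal (1/3) * emeasure sphere_measure (A \<inter> sphere 0 1)"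
    unfolding emeasure_direction_cone[OF A] emeasure_direction_cone[OF fA] .
  then show ?thesis
    by (simp add: ennreal_mult_cancel_left)
qed

lemma nn_integral_sphere_rotate:
  assumes f: "orthogonal_transformation f" and h: "h \<in> borel_measurable borel"
  shows "(\<integral>\<^sup>+\<xi>. h (f \<xi>) \<partial>sphere_measure) = (\<integral>\<^sup>+\<xi>. h \<xi> \<partial>sphere_measure)"
proof -
  have fm: "f \<in> borel \<rightarrow>\<^sub>M borel"
    by (rule borel_measurable_orthogonal_transformation[OF f])
  have fs: "f \<in> sphere_measure \<rightarrow>\<^sub>M borel"
    by (rule borel_measurable_sphereI[OF fm])
  have idm: "(\<lambda>x. x) \<in> sphere_measure \<rightarrow>\<^sub>M borel"
    by (rule borel_measurable_sphereI) simp
  have "distr sphere_measure borel f = distr sphere_measure borel (\<lambda>x. x)"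
  proof (rule measure_eqI)
    fix A assume "A \<in> sets (distr sphere_measure borel f)"
    then have A: "A \<in> sets borel" by simp
    show "emeasure (distr sphere_measure borel f) A = emeasure (distr sphere_measure borel (\<lambda>x. x)) A"
      using sphere_measure_rotate[OF f A] A fs idm by (simp add: emeasure_distr space_sphere_measure)
  qed simp
  then have "nn_integral (distr sphere_measure borel f) h = nn_integral (distr sphere_measure borel (\<lambda>x. x)) h"
    by simp
  then show ?thesis
    by (simp add: nn_integral_distr fs idm h)
qed

text \<open>By rotation invariance the centre may be moved to the north pole. There the squared distance is
  $2 - 2\cos\theta$, and $\sin\theta$ times the Gaussian is an exact derivative in $\theta$.\<close>

lemma nn_integral_sphere_gauss:
  assumes b: "b > 0" and \<eta>: "norm \<eta> = 1"
  shows "(\<integral>\<^sup>+\<xi>. ennreal (exp (- b * (norm (\<xi> - \<eta>))\<^sup>2)) \<partial>sphere_measure) = ennreal (pi * (1 - exp (- 4 * b)) / b)"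
proof -
  define e :: "real^3" where "e = axis 3 1"
  have "norm e = 1" by (simp add: e_def)
  then obtain f where f: "orthogonal_transformation f" "f e = \<eta>"
    using \<eta> by (rule orthogonal_transformation_exists_1)
  have lin: "linear f" using f orthogonal_transformation_linear by blast
  have "(\<integral>\<^sup>+\<xi>. ennreal (exp (- b * (norm (\<xi> - \<eta>))\<^sup>2)) \<partial>sphere_measure) =
     (\<integral>\<^sup>+\<xi>. ennreal (exp (- b * (norm (f \<xi> - \<eta>))\<^sup>2)) \<partial>sphere_measure)"
    by (rule nn_integral_sphere_rotate[OF f(1), symmetric]) auto
  also have "\<dots> = (\<integral>\<^sup>+\<xi>. ennreal (exp (- b * (norm (\<xi> - e))\<^sup>2)) \<partial>sphere_measure)"
  proof -
    have "norm (f \<xi> - \<eta>) = norm (\<xi> - e)" for \<xi>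
      using orthogonal_transformation_norm[OF f(1), of "\<xi> - e"] by (simp only: linear_diff[OF lin] f(2))
    then show ?thesis by simp
  qed
  also have "\<dots> = (\<integral>\<^sup>+z. ennreal (sin (fst z)) * ennreal (exp (- b * (norm (sph_coords (1, z) - e))\<^sup>2)) * indicator sph_box z \<partial>lborel)"
    by (rule nn_integral_sphere) auto
  also have "\<dots> = (\<integral>\<^sup>+z. ennreal (sin (fst z)) * ennreal (exp (- b * (2 - 2 * cos (fst z)))) * indicator sph_box z \<partial>lborel)"
  proof -
    have "(norm (sph_coords (1, t, p) - e))\<^sup>2 = 2 - 2 * cos t" for t p
    proof -
      have "(norm (sph_coords (1, t, p) - e))\<^sup>2 = (norm (sph_coords (1,t,p)))\<^sup>2 + (norm e)\<^sup>2 - 2 * (sph_coords (1,t,p) \<bullet> e)"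
        by (simp add: power2_norm_eq_inner inner_diff inner_commute)
      then show ?thesis
        unfolding norm_sph_coords \<open>norm e = 1\<close> by (simp add: e_def inner_axis sph_coords_nth)
    qed
    then have "(norm (sph_coords (1, z) - e))\<^sup>2 = 2 - 2 * cos (fst z)" for z
      by (cases z) simp
    then show ?thesis by simp
  qed
  also have "\<dots> = ennreal (2 * pi) * (\<integral>\<^sup>+t. ennreal (sin t) * ennreal (exp (- b * (2 - 2 * cos t))) * indicator {0<..<pi} t \<partial>lborel)"
    by (rule nn_integral_sin_times) measurable
  also have "(\<integral>\<^sup>+t. ennreal (sin t) * ennreal (exp (- b * (2 - 2 * cos t))) * indicator {0<..<pi} t \<partial>lborel) =
     (\<integral>\<^sup>+t. ennreal (sin t * exp (- b * (2 - 2 * cos t))) * indicator {0..pi} t \<partial>lborel)"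
  proof (rule nn_integral_cong_AE)
    show "AE t in lborel. ennreal (sin t) * ennreal (exp (- b * (2 - 2 * cos t))) * indicator {0<..<pi} t =
       ennreal (sin t * exp (- b * (2 - 2 * cos t))) * indicator {0..pi} t"
      using AE_lborel_singleton[of 0] AE_lborel_singleton[of pi]
      by eventually_elim (auto simp: indicator_def ennreal_mult' sin_ge_zero)
  qed
  also have "\<dots> = ennreal (- exp (- b * (2 - 2 * cos pi)) / (2*b) - (- exp (- b * (2 - 2 * cos 0)) / (2*b)))"
    by (rule nn_integral_FTC_Icc[where F="\<lambda>t. - exp (- b * (2 - 2 * cos t)) / (2*b)"])
       (use b in \<open>auto intro!: derivative_eq_intros mult_nonneg_nonneg sin_ge_zero\<close>)
  also have "\<dots> = ennreal ((1 - exp (- 4 * b)) / (2 * b))"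
    using b by (simp add: diff_divide_distrib mult.commute)
  also have "ennreal (2 * pi) * \<dots> = ennreal (2 * pi * ((1 - exp (- 4 * b)) / (2 * b)))"
    using b by (intro ennreal_mult[symmetric]) auto
  also have "2 * pi * ((1 - exp (- 4 * b)) / (2 * b)) = pi * (1 - exp (- 4 * b)) / b"
    using b by (simp add: field_simps)
  finally show ?thesis .
qed

section \<open>The Fourier transform of a Gaussian\<close>

lemma cis_measurable [measurable]: "cis \<in> borel_measurable borel"
  by (intro borel_measurable_continuous_onI continuous_intros)

text \<open>A rescaling of the characteristic function of the standard normal distribution.\<close>

lemma gauss_fourier_real:
  assumes e: "e > 0"
  shows "integrable lborel (\<lambda>t::real. exp (- e * t\<^sup>2) *\<^sub>R cis (z * t))"
    and "(\<integral>t. exp (- e * t\<^sup>2) *\<^sub>R cis (z * t) \<partial>lborel) = of_real (sqrt (pi / e) * exp (- z\<^sup>2 / (4 * e)))"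
proof -
  define c where "c = sqrt (2 * e)"
  have c: "c > 0" "c\<^sup>2 = 2 * e" using e by (auto simp: c_def)
  define f where "f x = std_normal_density x *\<^sub>R cis ((z / c) * x)" for x
  have fi: "integrable lborel f"
    unfolding f_def
    by (rule Bochner_Integration.integrable_bound[OF integrable_std_normal_moment_abs[of 0]]) auto
  have ft: "f (0 + c * t) = (1 / sqrt (2 * pi)) *\<^sub>R (exp (- e * t\<^sup>2) *\<^sub>R cis (z * t))" for t
    using c by (simp add: f_def std_normal_density_def power_mult_distrib)
  have "integrable lborel (\<lambda>t. f (0 + c * t))"
    by (rule lborel_integrable_real_affine[OF fi]) (use c in simp)
  then have "integrable lborel (\<lambda>t. sqrt (2 * pi) *\<^sub>R f (0 + c * t))"
    by simp
  then show "integrable lborel (\<lambda>t::real. exp (- e * t\<^sup>2) *\<^sub>R cis (z * t))"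
    unfolding ft by simp
  have "(\<integral>x. f x \<partial>lborel) = char std_normal_distribution (z / c)"
    unfolding char_def f_def
    by (subst integral_density) (auto simp: cis_conv_exp mult.commute)
  also have "\<dots> = of_real (exp (- z\<^sup>2 / (4 * e)))"
    using c by (simp add: char_std_normal_distribution power_divide)
  finally have "of_real (exp (- z\<^sup>2 / (4 * e))) = \<bar>c\<bar> *\<^sub>R (\<integral>t. f (0 + c * t) \<partial>lborel)"
    using lborel_integral_real_affine[of c f 0] c by simp
  also have "\<dots> = (c / sqrt (2 * pi)) *\<^sub>R (\<integral>t. exp (- e * t\<^sup>2) *\<^sub>R cis (z * t) \<partial>lborel)"
    unfolding ft integral_scaleR_right using c by simp
  finally have "(sqrt (2 * pi) / c) *\<^sub>R complex_of_real (exp (- z\<^sup>2 / (4 * e))) =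
      (\<integral>t. exp (- e * t\<^sup>2) *\<^sub>R cis (z * t) \<partial>lborel)"
    using c by simp
  moreover have "sqrt (2 * pi) / c = sqrt (pi / e)"
    using e by (simp add: c_def real_sqrt_divide real_sqrt_mult)
  ultimately show "(\<integral>t. exp (- e * t\<^sup>2) *\<^sub>R cis (z * t) \<partial>lborel) = of_real (sqrt (pi / e) * exp (- z\<^sup>2 / (4 * e)))"
    by (simp add: scaleR_conv_of_real)
qed

lemma pair_integral_times:
  fixes f :: "'a \<Rightarrow> complex" and g :: "'b \<Rightarrow> complex"
  assumes M: "sigma_finite_measure M" "sigma_finite_measure N"
    and f: "integrable M f" and g: "integrable N g"
  shows "integrable (M \<Otimes>\<^sub>M N) (\<lambda>z. f (fst z) * g (snd z))"
    and "(\<integral>z. f (fst z) * g (snd z) \<partial>(M \<Otimes>\<^sub>M N)) = (\<integral>x. f x \<partial>M) * (\<integral>y. g y \<partial>N)"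
proof -
  interpret P: pair_sigma_finite M N
    using M by (simp add: pair_sigma_finite_def)
  have [measurable]: "f \<in> borel_measurable M" "g \<in> borel_measurable N"
    using f g by auto
  show I: "integrable (M \<Otimes>\<^sub>M N) (\<lambda>z. f (fst z) * g (snd z))"
  proof (rule P.Fubini_integrable)
    show "integrable M (\<lambda>x. \<integral>y. norm (f (fst (x, y)) * g (snd (x, y))) \<partial>N)"
      using f g by (simp add: norm_mult)
    show "AE x in M. integrable N (\<lambda>y. f (fst (x, y)) * g (snd (x, y)))"
      using g by simp
  qed measurable
  have "(\<integral>x. (\<integral>y. f (fst (x, y)) * g (snd (x, y)) \<partial>N) \<partial>M) = (\<integral>z. f (fst z) * g (snd z) \<partial>(M \<Otimes>\<^sub>M N))"
    by (rule P.integral_fst'[OF I])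
  then show "(\<integral>z. f (fst z) * g (snd z) \<partial>(M \<Otimes>\<^sub>M N)) = (\<integral>x. f x \<partial>M) * (\<integral>y. g y \<partial>N)"
    by simp
qed

lemmas lborel_integral_times =
  pair_integral_times[OF lborel.sigma_finite_measure_axioms lborel.sigma_finite_measure_axioms, unfolded lborel_prod]

text \<open>The integrand is a product of three functions of one coordinate each.\<close>

lemma gauss_fourier:
  fixes z :: "real^3"
  assumes e: "e > 0"
  shows "integrable lborel (\<lambda>x::real^3. exp (- e * (norm x)\<^sup>2) *\<^sub>R cis (z \<bullet> x))"
    and "(\<integral>x. exp (- e * (norm x)\<^sup>2) *\<^sub>R cis (z \<bullet> x) \<partial>lborel) =
      of_real (sqrt (pi / e) ^ 3 * exp (- (norm z)\<^sup>2 / (4 * e)))"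
proof -
  define f where "f w t = exp (- e * t\<^sup>2) *\<^sub>R cis (w * t)" for w t :: real
  define T where "T x = (x$1, x$2, x$3)" for x :: "real^3"
  have T: "T \<in> lborel \<rightarrow>\<^sub>M borel"
    unfolding T_def by (auto intro!: borel_measurable_continuous_onI continuous_intros)
  define F where "F y = f (z$1) (fst y) * (f (z$2) (fst (snd y)) * f (z$3) (snd (snd y)))" for y
  have FT: "F (T x) = exp (- e * (norm x)\<^sup>2) *\<^sub>R cis (z \<bullet> x)" for x
    by (simp add: F_def T_def f_def norm_vec3_sq inner_vec_def sum_3 scaleR_conv_of_real
        cis_mult[symmetric] exp_add[symmetric] algebra_simps exp_of_real[symmetric])
  note fi = gauss_fourier_real[OF e, folded f_def]
  have I: "integrable lborel F"
    unfolding F_def by (intro lborel_integral_times fi)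
  have V: "(\<integral>y. F y \<partial>lborel) = of_real (sqrt (pi / e) * exp (- (z$1)\<^sup>2 / (4 * e))) *
     (of_real (sqrt (pi / e) * exp (- (z$2)\<^sup>2 / (4 * e))) * of_real (sqrt (pi / e) * exp (- (z$3)\<^sup>2 / (4 * e))))"
    unfolding F_def by (subst lborel_integral_times(2); (intro lborel_integral_times fi)?)
      (subst lborel_integral_times(2); (intro fi)?; simp only: fi(2))
  have L: "distr lborel borel T = lborel"
    unfolding T_def by (rule lborel_vec3)
  have Fm: "F \<in> borel_measurable borel" using I by (simp add: borel_measurable_integrable)
  have "integrable (distr lborel borel T) F" using I unfolding L .
  then show "integrable lborel (\<lambda>x::real^3. exp (- e * (norm x)\<^sup>2) *\<^sub>R cis (z \<bullet> x))"
    unfolding integrable_distr_eq[OF T Fm] FT .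
  have "(\<integral>x. F (T x) \<partial>lborel) = (\<integral>y. F y \<partial>lborel)"
    using integral_distr[OF T Fm] unfolding L ..
  also have "\<dots> = of_real (sqrt (pi / e) ^ 3 * exp (- (norm z)\<^sup>2 / (4 * e)))"
  proof -
    have "- (norm z)\<^sup>2 / (4 * e) = - (z$1)\<^sup>2 / (4 * e) + - (z$2)\<^sup>2 / (4 * e) + - (z$3)\<^sup>2 / (4 * e)"
      unfolding norm_vec3_sq by (simp only: add_divide_distrib[symmetric]) simp
    then have "exp (- (norm z)\<^sup>2 / (4 * e)) = exp (- (z$1)\<^sup>2 / (4 * e)) * exp (- (z$2)\<^sup>2 / (4 * e)) * exp (- (z$3)\<^sup>2 / (4 * e))"
      by (simp only: exp_add)
    then show ?thesis
      unfolding V of_real_mult[symmetric] by (simp only: power3_eq_cube mult.assoc mult.left_commute)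
  qed
  finally show "(\<integral>x. exp (- e * (norm x)\<^sup>2) *\<^sub>R cis (z \<bullet> x) \<partial>lborel) =
      of_real (sqrt (pi / e) ^ 3 * exp (- (norm z)\<^sup>2 / (4 * e)))"
    unfolding FT .
qed

lemma gauss_integral:
  assumes e: "e > 0"
  shows "integrable lborel (\<lambda>x::real^3. exp (- e * (norm x)\<^sup>2))"
    and "integral\<^sup>L lborel (\<lambda>x::real^3. exp (- e * (norm x)\<^sup>2)) = sqrt (pi / e) ^ 3"
proof -
  have I: "integrable lborel (\<lambda>x::real^3. complex_of_real (exp (- e * (norm x)\<^sup>2)))"
    using gauss_fourier(1)[OF e, of 0] by (simp add: scaleR_conv_of_real)
  then show J: "integrable lborel (\<lambda>x::real^3. exp (- e * (norm x)\<^sup>2))"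
    using integrable_Re[OF I] by simp
  have "integral\<^sup>L lborel (\<lambda>x::real^3. complex_of_real (exp (- e * (norm x)\<^sup>2))) = of_real (sqrt (pi / e) ^ 3)"
    using gauss_fourier(2)[OF e, of 0] by (simp add: scaleR_conv_of_real)
  then show "integral\<^sup>L lborel (\<lambda>x::real^3. exp (- e * (norm x)\<^sup>2)) = sqrt (pi / e) ^ 3"
    by (metis integral_complex_of_real of_real_eq_iff)
qed

section \<open>Scalar Herglotz waves\<close>

text \<open>The scalar Herglotz wave with wave number \<open>k\<close>: a superposition of plane waves that travel in all
  directions of the sphere, with amplitude \<open>g\<close>. It solves the Helmholtz equation.\<close>

definition wave :: "real \<Rightarrow> (real^3 \<Rightarrow> complex) \<Rightarrow> real^3 \<Rightarrow> complex" where
  "wave k g x = (LINT \<xi>|sphere_measure. cis (k * (x \<bullet> \<xi>)) * g \<xi>)"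

text \<open>Differentiating a plane wave in the coordinate direction \<open>i\<close> multiplies its amplitude by
  $ik\xi_i$. Partial derivatives of waves are thus waves, with this density.\<close>

definition dens :: "real \<Rightarrow> 3 \<Rightarrow> (real^3 \<Rightarrow> complex) \<Rightarrow> real^3 \<Rightarrow> complex" where
  "dens k i g \<xi> = \<i> * of_real (k * \<xi>$i) * g \<xi>"

lemma sphere_norm: "\<xi> \<in> space sphere_measure \<Longrightarrow> norm \<xi> = 1"
  by (simp add: space_sphere_measure)

lemma sphere_comp_le: "\<xi> \<in> space sphere_measure \<Longrightarrow> \<bar>\<xi>$i\<bar> \<le> 1"
  using component_le_norm_cart[of \<xi> i] by (simp add: sphere_norm)

lemma borel_measurable_sphere_simps [measurable]:
  "(\<lambda>\<xi>. \<xi> $ i) \<in> borel_measurable sphere_measure"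
  "(\<lambda>\<xi>. x \<bullet> \<xi>) \<in> borel_measurable sphere_measure"
  "(\<lambda>\<xi>. \<xi>) \<in> sphere_measure \<rightarrow>\<^sub>M borel"
  by (auto intro!: borel_measurable_sphereI)

lemma integrable_bounded_mult:
  fixes g h :: "real^3 \<Rightarrow> complex"
  assumes g: "integrable sphere_measure g" and h [measurable]: "h \<in> borel_measurable sphere_measure"
    and C: "\<And>\<xi>. \<xi> \<in> space sphere_measure \<Longrightarrow> cmod (h \<xi>) \<le> C"
  shows "integrable sphere_measure (\<lambda>\<xi>. h \<xi> * g \<xi>)"
proof (rule Bochner_Integration.integrable_bound)
  show "integrable sphere_measure (\<lambda>\<xi>. C * cmod (g \<xi>))" using g by auto
  show "(\<lambda>\<xi>. h \<xi> * g \<xi>) \<in> borel_measurable sphere_measure"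
    using g by measurable
  show "AE \<xi> in sphere_measure. norm (h \<xi> * g \<xi>) \<le> norm (C * cmod (g \<xi>))"
  proof (rule AE_I2)
    fix \<xi> assume "\<xi> \<in> space sphere_measure"
    then have "cmod (h \<xi>) \<le> \<bar>C\<bar>" using C by force
    then show "norm (h \<xi> * g \<xi>) \<le> norm (C * cmod (g \<xi>))"
      by (simp add: norm_mult abs_mult mult_right_mono)
  qed
qed

lemma wave_integrable:
  assumes "integrable sphere_measure g"
  shows "integrable sphere_measure (\<lambda>\<xi>. cis (k * (x \<bullet> \<xi>)) * g \<xi>)"
  by (rule integrable_bounded_mult[where C=1]) (use assms in auto)

lemma dens_integrable:
  assumes "integrable sphere_measure g"
  shows "integrable sphere_measure (dens k i g)"
  unfolding dens_def
  by (rule integrable_bounded_mult[where C="\<bar>k\<bar>"])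
     (use assms sphere_comp_le in \<open>auto simp: norm_mult abs_mult intro!: mult_left_le\<close>)

lemma norm_wave_le: "cmod (wave k g x) \<le> (LINT \<xi>|sphere_measure. cmod (g \<xi>))"
  unfolding wave_def by (rule integral_norm_bound[THEN order_trans]) (simp add: norm_mult)

lemma has_derivative_quadratic_bound:
  fixes f :: "'a::real_normed_vector \<Rightarrow> 'b::real_normed_vector"
  assumes D: "bounded_linear D" and b: "\<And>h. norm (f (x + h) - f x - D h) \<le> C * (norm h)\<^sup>2"
  shows "(f has_derivative D) (at x)"
  unfolding has_derivative_at
proof
  show "(\<lambda>h. norm (f (x + h) - f x - D h) / norm h) \<midarrow>0\<rightarrow> 0"
  proof (rule tendsto_sandwich)
    show "\<forall>\<^sub>F h in at 0. 0 \<le> norm (f (x + h) - f x - D h) / norm h" by simp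
    show "\<forall>\<^sub>F h in at 0. norm (f (x + h) - f x - D h) / norm h \<le> C * norm h"
      unfolding eventually_at_filter
      using b by (auto intro!: always_eventually simp: divide_le_eq power2_eq_square mult.assoc)
    show "(\<lambda>h::'a. C * norm h) \<midarrow>0\<rightarrow> 0" by (auto intro!: tendsto_eq_intros)
  qed simp
qed (rule D)

text \<open>The second order Taylor bound $|e^{it} - 1 - it| \le t^2/2$ is uniform over the sphere, so
  differentiation under the integral sign works for merely integrable densities.\<close>

lemma wave_has_derivative:
  assumes g: "integrable sphere_measure g"
  shows "(wave k g has_derivative (\<lambda>h. \<Sum>i\<in>UNIV. (h$i) *\<^sub>R wave k (dens k i g) x)) (at x)"
proof (rule has_derivative_quadratic_bound)
  show "bounded_linear (\<lambda>h::real^3. \<Sum>i\<in>UNIV. (h$i) *\<^sub>R wave k (dens k i g) x)"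
    by (intro bounded_linear_sum bounded_linear_scaleR_left[THEN bounded_linear_compose] bounded_linear_vec_nth)
next
  fix h :: "real^3"
  let ?C = "LINT \<xi>|sphere_measure. k\<^sup>2 / 2 * cmod (g \<xi>)"
  have di: "integrable sphere_measure (\<lambda>\<xi>. (h$i) *\<^sub>R (cis (k * (x \<bullet> \<xi>)) * dens k i g \<xi>))" for i
    using wave_integrable[OF dens_integrable[OF g]] by simp
  have "wave k g (x + h) - wave k g x - (\<Sum>i\<in>UNIV. (h$i) *\<^sub>R wave k (dens k i g) x) =
    (LINT \<xi>|sphere_measure. cis (k * ((x + h) \<bullet> \<xi>)) * g \<xi> - cis (k * (x \<bullet> \<xi>)) * g \<xi>
      - (\<Sum>i\<in>UNIV. (h$i) *\<^sub>R (cis (k * (x \<bullet> \<xi>)) * dens k i g \<xi>)))"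
    unfolding wave_def
    by (subst Bochner_Integration.integral_diff, intro Bochner_Integration.integrable_diff wave_integrable g,
        intro Bochner_Integration.integrable_sum di, subst Bochner_Integration.integral_diff, (intro wave_integrable g)+,
        subst Bochner_Integration.integral_sum, intro di, simp)
  also have "\<dots> = (LINT \<xi>|sphere_measure. cis (k * (x \<bullet> \<xi>)) * (iexp (k * (h \<bullet> \<xi>)) - 1 - \<i> * of_real (k * (h \<bullet> \<xi>))) * g \<xi>)"
  proof (intro Bochner_Integration.integral_cong refl)
    fix \<xi> :: "real^3"
    have "cis (k * ((x + h) \<bullet> \<xi>)) = cis (k * (x \<bullet> \<xi>)) * iexp (k * (h \<bullet> \<xi>))"
      unfolding cis_conv_exp[symmetric] by (simp add: inner_add_left distrib_left cis_mult)
    moreover have "(\<Sum>i\<in>UNIV. (h$i) *\<^sub>R (cis (k * (x \<bullet> \<xi>)) * dens k i g \<xi>)) = cis (k * (x \<bullet> \<xi>)) * (\<i> * of_real (k * (h \<bullet> \<xi>))) * g \<xi>"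
      by (simp add: dens_def sum_3 inner_vec_def scaleR_conv_of_real algebra_simps)
    ultimately show "cis (k * ((x + h) \<bullet> \<xi>)) * g \<xi> - cis (k * (x \<bullet> \<xi>)) * g \<xi>
      - (\<Sum>i\<in>UNIV. (h$i) *\<^sub>R (cis (k * (x \<bullet> \<xi>)) * dens k i g \<xi>)) =
      cis (k * (x \<bullet> \<xi>)) * (iexp (k * (h \<bullet> \<xi>)) - 1 - \<i> * of_real (k * (h \<bullet> \<xi>))) * g \<xi>"
      by (simp only: algebra_simps mult_1)
  qed
  also have "cmod \<dots> \<le> (LINT \<xi>|sphere_measure. (norm h)\<^sup>2 * (k\<^sup>2 / 2 * cmod (g \<xi>)))"
  proof (rule Bochner_Integration.integral_norm_bound_integral)
    have b: "cmod (iexp (k * (h \<bullet> \<xi>)) - 1 - \<i> * of_real (k * (h \<bullet> \<xi>))) \<le> (norm h)\<^sup>2 * (k\<^sup>2 / 2)" if "\<xi> \<in> space sphere_measure" for \<xi>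
    proof -
      let ?t = "k * (h \<bullet> \<xi>)"
      have "cmod (iexp ?t - 1 - \<i> * of_real ?t) \<le> \<bar>?t\<bar>\<^sup>2 / 2"
        using iexp_approx1[of ?t 1] by (simp add: numeral_2_eq_2 diff_diff_eq)
      also have "\<bar>h \<bullet> \<xi>\<bar> \<le> norm h"
        using Cauchy_Schwarz_ineq2[of h \<xi>] sphere_norm[OF that] by simp
      then have "\<bar>h \<bullet> \<xi>\<bar>\<^sup>2 \<le> (norm h)\<^sup>2" by (intro power_mono) auto
      then have "\<bar>?t\<bar>\<^sup>2 / 2 \<le> (norm h)\<^sup>2 * (k\<^sup>2 / 2)"
        using mult_left_mono[of "(h \<bullet> \<xi>)\<^sup>2" "(norm h)\<^sup>2" "k\<^sup>2"] by (simp add: power_mult_distrib abs_mult mult.commute)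
      finally show ?thesis .
    qed
    show "cmod (cis (k * (x \<bullet> \<xi>)) * (iexp (k * (h \<bullet> \<xi>)) - 1 - \<i> * of_real (k * (h \<bullet> \<xi>))) * g \<xi>)
        \<le> (norm h)\<^sup>2 * (k\<^sup>2 / 2 * cmod (g \<xi>))" if "\<xi> \<in> space sphere_measure" for \<xi>
      using mult_right_mono[OF b[OF that], of "cmod (g \<xi>)"] by (simp add: norm_mult mult.assoc)
    show "integrable sphere_measure (\<lambda>\<xi>. cis (k * (x \<bullet> \<xi>)) * (iexp (k * (h \<bullet> \<xi>)) - 1 - \<i> * of_real (k * (h \<bullet> \<xi>))) * g \<xi>)"
    proof (rule integrable_bounded_mult[OF g])
      show "(\<lambda>\<xi>. cis (k * (x \<bullet> \<xi>)) * (iexp (k * (h \<bullet> \<xi>)) - 1 - \<i> * of_real (k * (h \<bullet> \<xi>)))) \<in> borel_measurable sphere_measure"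
        by (intro borel_measurable_sphereI borel_measurable_continuous_onI continuous_intros)
      show "cmod (cis (k * (x \<bullet> \<xi>)) * (iexp (k * (h \<bullet> \<xi>)) - 1 - \<i> * of_real (k * (h \<bullet> \<xi>)))) \<le> (norm h)\<^sup>2 * (k\<^sup>2 / 2)"
        if "\<xi> \<in> space sphere_measure" for \<xi>
        using b[OF that] by (simp add: norm_mult)
    qed
    show "integrable sphere_measure (\<lambda>\<xi>. (norm h)\<^sup>2 * (k\<^sup>2 / 2 * cmod (g \<xi>)))" using g by simp
  qed
  finally show "cmod (wave k g (x + h) - wave k g x - (\<Sum>i\<in>UNIV. (h$i) *\<^sub>R wave k (dens k i g) x)) \<le> ?C * (norm h)\<^sup>2"
    by (simp add: mult.commute mult.left_commute)
qed

lemma pd_eq_derivative: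
  assumes "(f has_derivative D) (at x)"
  shows "pd i f x = D (axis i 1)"
  using frechet_derivative_at[OF assms] by (simp add: pd_def)

lemma pd_wave:
  assumes g: "integrable sphere_measure g"
  shows "pd i (wave k g) = wave k (dens k i g)"
proof
  fix x
  show "pd i (wave k g) x = wave k (dens k i g) x"
    unfolding pd_eq_derivative[OF wave_has_derivative[OF g]]
    by (simp add: axis_def if_distrib[of "\<lambda>c. c *\<^sub>R _"] cong: if_cong)
qed

lemma wave_continuous:
  assumes g: "integrable sphere_measure g"
  shows "continuous_on UNIV (wave k g)"
  using has_derivative_continuous[OF wave_has_derivative[OF g]] by (auto simp: continuous_on_eq_continuous_at)

lemma Ck_wave: "integrable sphere_measure g \<Longrightarrow> Ck n (wave k g)"
proof (induction n arbitrary: g)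
  case 0
  then show ?case by (simp add: wave_continuous)
next
  case (Suc n)
  then show ?case
    using wave_has_derivative[OF Suc.prems, of k]
    by (auto simp: pd_wave differentiable_def dens_integrable)
qed

lemma wave_measurable: "integrable sphere_measure g \<Longrightarrow> wave k g \<in> borel_measurable borel"
  by (intro borel_measurable_continuous_onI wave_continuous)

section \<open>Square integrable densities\<close>

definition L2S :: "(real^3 \<Rightarrow> complex) set" where
  "L2S = {g. g \<in> borel_measurable sphere_measure \<and> integrable sphere_measure (\<lambda>\<xi>. (cmod (g \<xi>))\<^sup>2)}"

text \<open>The square of the norm. All estimates below compare quadratic quantities, so that constants may be
  generous and roots are avoided.\<close>

definition nsq :: "(real^3 \<Rightarrow> complex) \<Rightarrow> real" where
  "nsq g = (LINT \<xi>|sphere_measure. (cmod (g \<xi>))\<^sup>2)"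

lemma nsq_nonneg: "nsq g \<ge> 0"
  by (simp add: nsq_def)

lemma L2S_measurable: "g \<in> L2S \<Longrightarrow> g \<in> borel_measurable sphere_measure"
  by (simp add: L2S_def)

lemma L2S_integrable: 
  assumes "g \<in> L2S" shows "integrable sphere_measure g"
proof (rule Bochner_Integration.integrable_bound)
  show "integrable sphere_measure (\<lambda>\<xi>. 1 + (cmod (g \<xi>))\<^sup>2)"
    using assms by (simp add: L2S_def)
  show "AE \<xi> in sphere_measure. norm (g \<xi>) \<le> norm (1 + (cmod (g \<xi>))\<^sup>2)"
  proof (rule AE_I2)
    fix \<xi>
    have "0 \<le> (cmod (g \<xi>) - 1)\<^sup>2 + (cmod (g \<xi>))\<^sup>2 + 1" by (simp add: add_nonneg_nonneg)
    then show "norm (g \<xi>) \<le> norm (1 + (cmod (g \<xi>))\<^sup>2)"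
      by (simp add: power2_eq_square algebra_simps)
  qed
qed (use assms in \<open>simp add: L2S_def\<close>)

lemma cmod_add_sq: "(cmod (a + b))\<^sup>2 \<le> 2 * (cmod a)\<^sup>2 + 2 * (cmod b)\<^sup>2"
proof -
  have "(cmod (a + b))\<^sup>2 \<le> (cmod a + cmod b)\<^sup>2"
    by (intro power_mono norm_triangle_ineq) simp
  moreover have "0 \<le> (cmod a - cmod b)\<^sup>2" by simp
  ultimately show ?thesis by (simp add: power2_eq_square algebra_simps)
qed

lemma L2S_add:
  assumes "g \<in> L2S" "h \<in> L2S" shows "(\<lambda>\<xi>. g \<xi> + h \<xi>) \<in> L2S" "nsq (\<lambda>\<xi>. g \<xi> + h \<xi>) \<le> 2 * nsq g + 2 * nsq h"
proof -
  have [measurable]: "g \<in> borel_measurable sphere_measure" "h \<in> borel_measurable sphere_measure"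
    using assms by (auto simp: L2S_def)
  have I: "integrable sphere_measure (\<lambda>\<xi>. 2 * (cmod (g \<xi>))\<^sup>2 + 2 * (cmod (h \<xi>))\<^sup>2)"
    using assms by (simp add: L2S_def)
  have J: "integrable sphere_measure (\<lambda>\<xi>. (cmod (g \<xi> + h \<xi>))\<^sup>2)"
    by (rule Bochner_Integration.integrable_bound[OF I]) (auto simp: cmod_add_sq)
  then show "(\<lambda>\<xi>. g \<xi> + h \<xi>) \<in> L2S" by (simp add: L2S_def)
  have "nsq (\<lambda>\<xi>. g \<xi> + h \<xi>) \<le> (LINT \<xi>|sphere_measure. 2 * (cmod (g \<xi>))\<^sup>2 + 2 * (cmod (h \<xi>))\<^sup>2)"
    unfolding nsq_def by (rule integral_mono[OF J I]) (simp add: cmod_add_sq)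
  also have "\<dots> = 2 * nsq g + 2 * nsq h"
    using assms by (simp add: L2S_def nsq_def)
  finally show "nsq (\<lambda>\<xi>. g \<xi> + h \<xi>) \<le> 2 * nsq g + 2 * nsq h" .
qed

lemma L2S_mult:
  assumes g: "g \<in> L2S" and h [measurable]: "h \<in> borel_measurable sphere_measure"
    and C: "\<And>\<xi>. \<xi> \<in> space sphere_measure \<Longrightarrow> cmod (h \<xi>) \<le> C"
  shows "(\<lambda>\<xi>. h \<xi> * g \<xi>) \<in> L2S" "nsq (\<lambda>\<xi>. h \<xi> * g \<xi>) \<le> C\<^sup>2 * nsq g"
proof -
  have [measurable]: "g \<in> borel_measurable sphere_measure"
    using g by (auto simp: L2S_def)
  have I: "integrable sphere_measure (\<lambda>\<xi>. C\<^sup>2 * (cmod (g \<xi>))\<^sup>2)"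
    using g by (simp add: L2S_def)
  have b: "(cmod (h \<xi> * g \<xi>))\<^sup>2 \<le> C\<^sup>2 * (cmod (g \<xi>))\<^sup>2" if "\<xi> \<in> space sphere_measure" for \<xi>
    using C[OF that] by (simp add: norm_mult power_mult_distrib mult_right_mono power_mono)
  have J: "integrable sphere_measure (\<lambda>\<xi>. (cmod (h \<xi> * g \<xi>))\<^sup>2)"
    by (rule Bochner_Integration.integrable_bound[OF I]) (auto intro: b)
  then show "(\<lambda>\<xi>. h \<xi> * g \<xi>) \<in> L2S" by (simp add: L2S_def)
  show "nsq (\<lambda>\<xi>. h \<xi> * g \<xi>) \<le> C\<^sup>2 * nsq g"
    unfolding nsq_def integral_mult_right_zero[symmetric] by (rule integral_mono[OF J I]) (rule b)
qed

lemma L2S_cmult: "g \<in> L2S \<Longrightarrow> (\<lambda>\<xi>. c * g \<xi>) \<in> L2S"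
  by (rule L2S_mult(1)[where C="cmod c"]) auto

lemma nsq_cmult: "nsq (\<lambda>\<xi>. c * g \<xi>) = (cmod c)\<^sup>2 * nsq g"
  by (simp add: nsq_def norm_mult power_mult_distrib)

lemma L2S_diff: "g \<in> L2S \<Longrightarrow> h \<in> L2S \<Longrightarrow> (\<lambda>\<xi>. g \<xi> - h \<xi>) \<in> L2S"
  using L2S_add(1)[of g "\<lambda>\<xi>. -1 * h \<xi>"] L2S_cmult[of h "-1"] by simp

lemma L2S_dens: "g \<in> L2S \<Longrightarrow> dens k i g \<in> L2S"
  unfolding dens_def
  by (rule L2S_mult(1)[where C="\<bar>k\<bar>"])
     (use sphere_comp_le in \<open>auto simp: norm_mult abs_mult intro!: mult_left_le\<close>)

section \<open>Gaussian means on the sphere\<close>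

abbreviation sphere_pair :: "((real^3) \<times> (real^3)) measure" where
  "sphere_pair \<equiv> sphere_measure \<Otimes>\<^sub>M sphere_measure"

interpretation sphere_pair: pair_sigma_finite sphere_measure sphere_measure ..

interpretation lborel_sphere_pair: pair_sigma_finite "lborel :: (real^3) measure" sphere_pair
proof -
  have "sigma_finite_measure sphere_pair"
    by (rule sphere_pair.P.sigma_finite_measure_axioms)
  then show "pair_sigma_finite (lborel :: (real^3) measure) sphere_pair"
    by (simp add: pair_sigma_finite_def lborel.sigma_finite_measure_axioms)
qed

lemma sphere_pair_measurable [measurable]:
  "(\<lambda>z. fst z) \<in> sphere_pair \<rightarrow>\<^sub>M borel" "(\<lambda>z. snd z) \<in> sphere_pair \<rightarrow>\<^sub>M borel"
  using measurable_compose[OF measurable_fst borel_measurable_sphere_simps(3)]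
    measurable_compose[OF measurable_snd borel_measurable_sphere_simps(3)] by auto

definition sgauss :: "real \<Rightarrow> (real^3) \<times> (real^3) \<Rightarrow> real" where
  "sgauss b z = exp (- b * (norm (fst z - snd z))\<^sup>2)"

lemma sgauss_measurable [measurable]: "sgauss b \<in> borel_measurable sphere_pair"
  unfolding sgauss_def by measurable

lemma sgauss_bounds: "0 \<le> sgauss b z" "b \<ge> 0 \<Longrightarrow> sgauss b z \<le> 1"
  by (auto simp: sgauss_def)

text \<open>The total mass of the Gaussian kernel around any point of the sphere, as computed above. For large
  \<open>b\<close> it behaves like $\pi/b$.\<close>

definition sgauss_mass :: "real \<Rightarrow> real" where
  "sgauss_mass b = pi * (1 - exp (- 4 * b)) / b"

lemma sgauss_integral:
  assumes b: "b > 0" and \<eta>: "\<eta> \<in> space sphere_measure"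
  shows "integrable sphere_measure (\<lambda>\<xi>. sgauss b (\<xi>, \<eta>))" "(LINT \<xi>|sphere_measure. sgauss b (\<xi>, \<eta>)) = sgauss_mass b"
    "integrable sphere_measure (\<lambda>\<xi>. sgauss b (\<eta>, \<xi>))" "(LINT \<xi>|sphere_measure. sgauss b (\<eta>, \<xi>)) = sgauss_mass b"
proof -
  have nn: "(\<integral>\<^sup>+\<xi>. ennreal (sgauss b (\<xi>, \<eta>)) \<partial>sphere_measure) = ennreal (sgauss_mass b)"
    using nn_integral_sphere_gauss[OF b sphere_norm[OF \<eta>]] by (simp add: sgauss_def sgauss_mass_def)
  have m: "(\<lambda>\<xi>. sgauss b (\<xi>, \<eta>)) \<in> borel_measurable sphere_measure"
    unfolding sgauss_def by (intro borel_measurable_sphereI) simp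
  have "has_bochner_integral sphere_measure (\<lambda>\<xi>. sgauss b (\<xi>, \<eta>)) (sgauss_mass b)"
    by (rule has_bochner_integral_nn_integral[OF m _ _ nn]) (use b in \<open>auto simp: sgauss_bounds sgauss_mass_def\<close>)
  then show "integrable sphere_measure (\<lambda>\<xi>. sgauss b (\<xi>, \<eta>))" "(LINT \<xi>|sphere_measure. sgauss b (\<xi>, \<eta>)) = sgauss_mass b"
    by (auto simp: has_bochner_integral_iff)
  moreover have "sgauss b (\<eta>, \<xi>) = sgauss b (\<xi>, \<eta>)" for \<xi>
    by (simp add: sgauss_def norm_minus_commute)
  ultimately show "integrable sphere_measure (\<lambda>\<xi>. sgauss b (\<eta>, \<xi>))" "(LINT \<xi>|sphere_measure. sgauss b (\<eta>, \<xi>)) = sgauss_mass b"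
    by simp_all
qed

text \<open>Since the kernel has the same mass around every point, one of the two integrations can be carried out.\<close>

lemma sgauss_weighted:
  fixes f :: "real^3 \<Rightarrow> real"
  assumes b: "b > 0" and f: "integrable sphere_measure f"
  shows "integrable sphere_pair (\<lambda>z. sgauss b z * f (fst z))"
    "(LINT z|sphere_pair. sgauss b z * f (fst z)) = sgauss_mass b * (LINT \<xi>|sphere_measure. f \<xi>)"
    "integrable sphere_pair (\<lambda>z. sgauss b z * f (snd z))"
    "(LINT z|sphere_pair. sgauss b z * f (snd z)) = sgauss_mass b * (LINT \<xi>|sphere_measure. f \<xi>)"
proof -
  have [measurable]: "f \<in> borel_measurable sphere_measure" using f by auto
  have m1: "(\<lambda>z. sgauss b z * f (fst z)) \<in> borel_measurable sphere_pair" by measurable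
  have m2: "(\<lambda>z. sgauss b z * f (snd z)) \<in> borel_measurable sphere_pair" by measurable
  have c1: "(LINT \<eta>|sphere_measure. norm (sgauss b (\<xi>, \<eta>) * f (fst (\<xi>, \<eta>)))) = sgauss_mass b * \<bar>f \<xi>\<bar>"
    if "\<xi> \<in> space sphere_measure" for \<xi>
    using sgauss_integral[OF b that] by (simp add: abs_mult sgauss_bounds)
  show I1: "integrable sphere_pair (\<lambda>z. sgauss b z * f (fst z))"
  proof (rule sphere_pair.Fubini_integrable[OF m1])
    show "integrable sphere_measure (\<lambda>\<xi>. LINT \<eta>|sphere_measure. norm (sgauss b (\<xi>, \<eta>) * f (fst (\<xi>, \<eta>))))"
      using f by (subst Bochner_Integration.integrable_cong[OF refl c1]) auto
    show "AE \<xi> in sphere_measure. integrable sphere_measure (\<lambda>\<eta>. sgauss b (\<xi>, \<eta>) * f (fst (\<xi>, \<eta>)))"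
      by (rule AE_I2) (simp add: sgauss_integral[OF b])
  qed
  have "(LINT z|sphere_pair. sgauss b z * f (fst z)) = (LINT \<xi>|sphere_measure. (LINT \<eta>|sphere_measure. sgauss b (\<xi>, \<eta>) * f (fst (\<xi>, \<eta>))))"
    by (rule sphere_pair.integral_fst'[OF I1, symmetric])
  also have "\<dots> = (LINT \<xi>|sphere_measure. sgauss_mass b * f \<xi>)"
    by (intro Bochner_Integration.integral_cong refl) (simp add: sgauss_integral[OF b])
  finally show V1: "(LINT z|sphere_pair. sgauss b z * f (fst z)) = sgauss_mass b * (LINT \<xi>|sphere_measure. f \<xi>)"
    by simp
  have sw: "(\<lambda>z. sgauss b z * f (snd z)) = (\<lambda>(x, y). sgauss b (y, x) * f (fst (y, x)))"
    by (auto simp: sgauss_def norm_minus_commute)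
  have I1': "integrable sphere_pair (\<lambda>(x, y). sgauss b (y, x) * f (fst (y, x)))"
    using sphere_pair.integrable_product_swap[OF I1] by simp
  show "integrable sphere_pair (\<lambda>z. sgauss b z * f (snd z))"
    unfolding sw by (rule I1')
  have "(LINT z|sphere_pair. sgauss b z * f (snd z)) = (LINT z|sphere_pair. sgauss b z * f (fst z))"
    unfolding sw using sphere_pair.integral_product_swap[of "\<lambda>z. sgauss b z * f (fst z)"] m1 by simp
  then show "(LINT z|sphere_pair. sgauss b z * f (snd z)) = sgauss_mass b * (LINT \<xi>|sphere_measure. f \<xi>)"
    using V1 by simp
qed

text \<open>The mean square oscillation of \<open>g\<close> between points at distance about $b^{-1/2}$. The kernel has mass of
  order $1/b$; the factor \<open>b\<close> normalizes it.\<close>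

definition osc :: "real \<Rightarrow> (real^3 \<Rightarrow> complex) \<Rightarrow> real" where
  "osc b g = b * (LINT z|sphere_pair. sgauss b z * (cmod (g (fst z) - g (snd z)))\<^sup>2)"

lemma cmod_diff_sq: "(cmod (a - b))\<^sup>2 \<le> 2 * (cmod a)\<^sup>2 + 2 * (cmod b)\<^sup>2"
  using cmod_add_sq[of a "-b"] by simp

text \<open>The estimate $|p-q|^2 \le 2|p|^2 + 2|q|^2$ bounds the oscillation by the norm, uniformly in \<open>b\<close>. It is
  this uniformity that makes the vanishing of the oscillation stable under limits.\<close>

lemma osc_integrable:
  assumes b: "b > 0" and g: "g \<in> L2S"
  shows "integrable sphere_pair (\<lambda>z. sgauss b z * (cmod (g (fst z) - g (snd z)))\<^sup>2)"
    "osc b g \<le> 4 * pi * nsq g"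
proof -
  have [measurable]: "g \<in> borel_measurable sphere_measure" using g by (rule L2S_measurable)
  have gi: "integrable sphere_measure (\<lambda>\<xi>. (cmod (g \<xi>))\<^sup>2)" using g by (simp add: L2S_def)
  note w = sgauss_weighted[OF b gi]
  have I: "integrable sphere_pair (\<lambda>z. 2 * (sgauss b z * (cmod (g (fst z)))\<^sup>2) + 2 * (sgauss b z * (cmod (g (snd z)))\<^sup>2))"
    using w by (intro Bochner_Integration.integrable_add) auto
  have le: "sgauss b z * (cmod (g (fst z) - g (snd z)))\<^sup>2 \<le> 2 * (sgauss b z * (cmod (g (fst z)))\<^sup>2) + 2 * (sgauss b z * (cmod (g (snd z)))\<^sup>2)" for z
    using mult_left_mono[OF cmod_diff_sq[of "g (fst z)" "g (snd z)"] sgauss_bounds(1)[of b z]] by (simp add: algebra_simps)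
  show J: "integrable sphere_pair (\<lambda>z. sgauss b z * (cmod (g (fst z) - g (snd z)))\<^sup>2)"
    by (rule Bochner_Integration.integrable_bound[OF I]) (use le in \<open>auto simp: sgauss_bounds\<close>)
  have "(LINT z|sphere_pair. sgauss b z * (cmod (g (fst z) - g (snd z)))\<^sup>2) \<le>
     (LINT z|sphere_pair. 2 * (sgauss b z * (cmod (g (fst z)))\<^sup>2) + 2 * (sgauss b z * (cmod (g (snd z)))\<^sup>2))"
    by (rule integral_mono[OF J I le])
  also have "\<dots> = 4 * sgauss_mass b * nsq g"
    using w by (subst Bochner_Integration.integral_add) (auto simp: nsq_def)
  finally have "osc b g \<le> b * (4 * sgauss_mass b * nsq g)"
    unfolding osc_def using b by (intro mult_left_mono) auto
  also have "\<dots> = 4 * pi * (1 - exp (- 4 * b)) * nsq g"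
    using b by (simp add: sgauss_mass_def)
  also have "\<dots> \<le> 4 * pi * 1 * nsq g"
    using nsq_nonneg[of g] by (intro mult_right_mono mult_left_mono) auto
  finally show "osc b g \<le> 4 * pi * nsq g" by simp
qed

lemma osc_nonneg: "b > 0 \<Longrightarrow> osc b g \<ge> 0"
  unfolding osc_def by (intro mult_nonneg_nonneg integral_nonneg_AE) (auto simp: sgauss_bounds)

lemma osc_add:
  assumes b: "b > 0" and g: "g \<in> L2S" and h: "h \<in> L2S"
  shows "osc b (\<lambda>\<xi>. g \<xi> + h \<xi>) \<le> 2 * osc b g + 2 * osc b h"
proof -
  note i = osc_integrable(1)[OF b g] osc_integrable(1)[OF b h] osc_integrable(1)[OF b L2S_add(1)[OF g h]]
  have "(LINT z|sphere_pair. sgauss b z * (cmod (g (fst z) + h (fst z) - (g (snd z) + h (snd z))))\<^sup>2) \<le>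
     (LINT z|sphere_pair. 2 * (sgauss b z * (cmod (g (fst z) - g (snd z)))\<^sup>2) + 2 * (sgauss b z * (cmod (h (fst z) - h (snd z)))\<^sup>2))"
  proof (rule integral_mono)
    fix z
    show "sgauss b z * (cmod (g (fst z) + h (fst z) - (g (snd z) + h (snd z))))\<^sup>2 \<le>
      2 * (sgauss b z * (cmod (g (fst z) - g (snd z)))\<^sup>2) + 2 * (sgauss b z * (cmod (h (fst z) - h (snd z)))\<^sup>2)"
      using mult_left_mono[OF cmod_add_sq[of "g (fst z) - g (snd z)" "h (fst z) - h (snd z)"] sgauss_bounds(1)[of b z]]
      by (simp add: algebra_simps)
  qed (use i in auto)
  also have "\<dots> = 2 * (LINT z|sphere_pair. sgauss b z * (cmod (g (fst z) - g (snd z)))\<^sup>2) + 2 * (LINT z|sphere_pair. sgauss b z * (cmod (h (fst z) - h (snd z)))\<^sup>2)"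
    using i by (subst Bochner_Integration.integral_add) auto
  finally show ?thesis
    unfolding osc_def using b mult_left_mono[of _ _ b] by (fastforce simp: algebra_simps)
qed

lemma osc_cong:
  assumes "\<And>\<xi>. \<xi> \<in> space sphere_measure \<Longrightarrow> g \<xi> = h \<xi>"
  shows "osc b g = osc b h"
  unfolding osc_def
  by (rule arg_cong[where f="\<lambda>x. b * x"], rule Bochner_Integration.integral_cong[OF refl]) (auto simp: space_pair_measure assms)

text \<open>The densities on which the kernels act as an approximate identity. They form a closed subspace, which
  is shown to contain Lipschitz functions, then indicators, and finally everything.\<close>

definition osc_vanishing :: "(real^3 \<Rightarrow> complex) set" where
  "osc_vanishing = {g \<in> L2S. ((\<lambda>b. osc b g) \<longlongrightarrow> 0) at_top}"

lemma osc_vanishing_add: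
  assumes g: "g \<in> osc_vanishing" and h: "h \<in> osc_vanishing"
  shows "(\<lambda>\<xi>. g \<xi> + h \<xi>) \<in> osc_vanishing"
proof -
  have L: "g \<in> L2S" "h \<in> L2S" and lim: "((\<lambda>b. osc b g) \<longlongrightarrow> 0) at_top" "((\<lambda>b. osc b h) \<longlongrightarrow> 0) at_top"
    using g h by (auto simp: osc_vanishing_def)
  have "((\<lambda>b. osc b (\<lambda>\<xi>. g \<xi> + h \<xi>)) \<longlongrightarrow> 0) at_top"
  proof (rule tendsto_sandwich)
    show "\<forall>\<^sub>F b in at_top. 0 \<le> osc b (\<lambda>\<xi>. g \<xi> + h \<xi>)"
      using eventually_gt_at_top[of 0] by eventually_elim (rule osc_nonneg)
    show "\<forall>\<^sub>F b in at_top. osc b (\<lambda>\<xi>. g \<xi> + h \<xi>) \<le> 2 * osc b g + 2 * osc b h"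
      using eventually_gt_at_top[of 0] by eventually_elim (intro osc_add L)
    show "((\<lambda>b. 2 * osc b g + 2 * osc b h) \<longlongrightarrow> 0) at_top"
      by (rule tendsto_eq_intros lim refl | simp)+
  qed simp
  then show ?thesis using L L2S_add(1) by (auto simp: osc_vanishing_def)
qed

lemma osc_cmult: "osc b (\<lambda>\<xi>. c * g \<xi>) = (cmod c)\<^sup>2 * osc b g"
proof -
  have "(LINT z|sphere_pair. sgauss b z * (cmod (c * g (fst z) - c * g (snd z)))\<^sup>2) =
    (LINT z|sphere_pair. (cmod c)\<^sup>2 * (sgauss b z * (cmod (g (fst z) - g (snd z)))\<^sup>2))"
    unfolding right_diff_distrib[symmetric] by (simp add: norm_mult power_mult_distrib mult.left_commute)
  then show ?thesis by (simp add: osc_def)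
qed

lemma osc_vanishing_cmult:
  assumes g: "g \<in> osc_vanishing"
  shows "(\<lambda>\<xi>. c * g \<xi>) \<in> osc_vanishing"
  using g tendsto_mult_left[of "\<lambda>b. osc b g" 0 at_top "(cmod c)\<^sup>2"]
  by (auto simp: osc_vanishing_def L2S_cmult osc_cmult)

lemma L2S_const: "(\<lambda>\<xi>. c) \<in> L2S"
  by (simp add: L2S_def)

lemma osc_vanishing_const: "(\<lambda>\<xi>. c) \<in> osc_vanishing"
  by (simp add: osc_vanishing_def L2S_const osc_def)

lemma osc_vanishing_sum:
  assumes "finite I" "\<And>i. i \<in> I \<Longrightarrow> g i \<in> osc_vanishing"
  shows "(\<lambda>\<xi>. \<Sum>i\<in>I. g i \<xi>) \<in> osc_vanishing"
  using assms by (induction I rule: finite_induct) (auto intro: osc_vanishing_const osc_vanishing_add)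

text \<open>A small perturbation of the density changes the oscillation little, at all scales simultaneously.\<close>

lemma osc_vanishing_limit:
  assumes g: "g \<in> L2S" and h: "\<And>n::nat. h n \<in> osc_vanishing"
    and lim: "(\<lambda>n. nsq (\<lambda>\<xi>. g \<xi> - h n \<xi>)) \<longlonglongrightarrow> 0"
  shows "g \<in> osc_vanishing"
proof -
  have "((\<lambda>b. osc b g) \<longlongrightarrow> 0) at_top"
  proof (rule tendstoI)
    fix e :: real assume e: "e > 0"
    have e': "e / (16 * pi) > 0" using e by simp
    obtain n where n: "nsq (\<lambda>\<xi>. g \<xi> - h n \<xi>) < e / (16 * pi)"
      using order_tendstoD(2)[OF lim e'] by (auto simp: eventually_sequentially)
    have hn: "h n \<in> L2S" "((\<lambda>b. osc b (h n)) \<longlongrightarrow> 0) at_top"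
      using h by (auto simp: osc_vanishing_def)
    have "\<forall>\<^sub>F b in at_top. osc b (h n) < e / 4"
      using order_tendstoD(2)[OF hn(2), of "e/4"] e by simp
    then show "\<forall>\<^sub>F b in at_top. dist (osc b g) 0 < e"
      using eventually_gt_at_top[of 0]
    proof eventually_elim
      case (elim b)
      have d: "(\<lambda>\<xi>. g \<xi> - h n \<xi>) \<in> L2S" using g hn by (intro L2S_diff)
      have "osc b g = osc b (\<lambda>\<xi>. h n \<xi> + (g \<xi> - h n \<xi>))" by simp
      also have "\<dots> \<le> 2 * osc b (h n) + 2 * osc b (\<lambda>\<xi>. g \<xi> - h n \<xi>)"
        using elim hn d by (intro osc_add) auto
      also have "\<dots> \<le> 2 * osc b (h n) + 2 * (4 * pi * nsq (\<lambda>\<xi>. g \<xi> - h n \<xi>))"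
        using osc_integrable(2)[OF _ d, of b] elim by simp
      also have "\<dots> < 2 * (e / 4) + 2 * (4 * pi * (e / (16 * pi)))"
        using elim n by (intro add_strict_mono mult_strict_left_mono) auto
      also have "\<dots> = e" by simp
      finally show ?case using osc_nonneg[of b g] elim by simp
    qed
  qed
  then show ?thesis using g by (simp add: osc_vanishing_def)
qed

lemma sphere_dominated_nsq:
  assumes g: "g \<in> L2S" and h: "\<And>n::nat. h n \<in> L2S" and G: "G \<in> L2S"
    and lim: "\<And>\<xi>. \<xi> \<in> space sphere_measure \<Longrightarrow> (\<lambda>n. h n \<xi>) \<longlonglongrightarrow> g \<xi>"
    and b: "\<And>n \<xi>. \<xi> \<in> space sphere_measure \<Longrightarrow> cmod (g \<xi> - h n \<xi>) \<le> cmod (G \<xi>)"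
  shows "(\<lambda>n. nsq (\<lambda>\<xi>. g \<xi> - h n \<xi>)) \<longlonglongrightarrow> 0"
proof -
  have [measurable]: "g \<in> borel_measurable sphere_measure" "\<And>n. h n \<in> borel_measurable sphere_measure"
    using g h by (auto simp: L2S_def)
  have "(\<lambda>n. LINT \<xi>|sphere_measure. (cmod (g \<xi> - h n \<xi>))\<^sup>2) \<longlonglongrightarrow> (LINT \<xi>|sphere_measure. 0)"
  proof (rule integral_dominated_convergence[where w="\<lambda>\<xi>. (cmod (G \<xi>))\<^sup>2"])
    show "integrable sphere_measure (\<lambda>\<xi>. (cmod (G \<xi>))\<^sup>2)" using G by (simp add: L2S_def)
    show "AE \<xi> in sphere_measure. (\<lambda>n. (cmod (g \<xi> - h n \<xi>))\<^sup>2) \<longlonglongrightarrow> 0"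
    proof (rule AE_I2)
      fix \<xi> assume "\<xi> \<in> space sphere_measure"
      then have "(\<lambda>n. g \<xi> - h n \<xi>) \<longlonglongrightarrow> g \<xi> - g \<xi>"
        by (intro tendsto_intros lim)
      then have "(\<lambda>n. (cmod (g \<xi> - h n \<xi>))\<^sup>2) \<longlonglongrightarrow> (cmod (g \<xi> - g \<xi>))\<^sup>2"
        by (intro tendsto_power tendsto_norm)
      then show "(\<lambda>n. (cmod (g \<xi> - h n \<xi>))\<^sup>2) \<longlonglongrightarrow> 0"
        by (simp only: diff_self norm_zero zero_power2)
    qed
    show "AE \<xi> in sphere_measure. norm ((cmod (g \<xi> - h n \<xi>))\<^sup>2) \<le> (cmod (G \<xi>))\<^sup>2" for n
      by (rule AE_I2) (use b in \<open>auto intro!: power_mono\<close>)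
  qed measurable
  then show ?thesis by (simp add: nsq_def)
qed

lemma L2S_bounded:
  assumes [measurable]: "g \<in> borel_measurable sphere_measure" and "\<And>\<xi>. cmod (g \<xi>) \<le> C"
  shows "g \<in> L2S"
  using L2S_mult(1)[OF L2S_const[of 1] assms(1), of C] assms(2) by simp

text \<open>For a Lipschitz function the squared difference is at most a multiple of the squared distance, which
  the Gaussian confines to size about $1/b$.\<close>

lemma osc_vanishing_lipschitz:
  assumes L: "\<And>x y. cmod (h x - h y) \<le> L * norm (x - y)" and bd: "\<And>x. cmod (h x) \<le> C"
    and m: "h \<in> borel_measurable borel"
  shows "h \<in> osc_vanishing"
proof -
  have hL: "h \<in> L2S"
    by (rule L2S_bounded[OF borel_measurable_sphereI[OF m] bd])
  have one: "integrable sphere_measure (\<lambda>\<xi>. 1::real)" by simp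
  have mass1: "(LINT \<xi>|sphere_measure. (1::real)) = 4 * pi"
    by (simp add: measure_def space_sphere_measure emeasure_sphere_space)
  have "((\<lambda>b. osc b h) \<longlongrightarrow> 0) at_top"
  proof (rule tendsto_sandwich)
    show "\<forall>\<^sub>F b in at_top. 0 \<le> osc b h"
      using eventually_gt_at_top[of 0] by eventually_elim (rule osc_nonneg)
    show "\<forall>\<^sub>F b in at_top. osc b h \<le> L\<^sup>2 * (16 * pi\<^sup>2) / b"
      using eventually_gt_at_top[of 0]
    proof eventually_elim
      case (elim b)
      have b2: "b / 2 > 0" using elim by simp
      note w = sgauss_weighted(1,2)[OF b2 one]
      have "b * (LINT z|sphere_pair. sgauss b z * (cmod (h (fst z) - h (snd z)))\<^sup>2) =
        (LINT z|sphere_pair. b * (sgauss b z * (cmod (h (fst z) - h (snd z)))\<^sup>2))"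
        by simp
      also have "\<dots> \<le> (LINT z|sphere_pair. (2 * L\<^sup>2) * (sgauss (b/2) z * 1))"
      proof (rule integral_mono)
        fix z :: "(real^3) \<times> (real^3)"
        let ?r = "(norm (fst z - snd z))\<^sup>2"
        have "(cmod (h (fst z) - h (snd z)))\<^sup>2 \<le> (L * norm (fst z - snd z))\<^sup>2"
          by (intro power_mono L) simp
        then have 1: "b * (sgauss b z * (cmod (h (fst z) - h (snd z)))\<^sup>2) \<le> b * (sgauss b z * (L\<^sup>2 * ?r))"
          using elim by (intro mult_left_mono) (auto simp: sgauss_bounds power_mult_distrib)
        \<comment> \<open>The factor \<open>b * ?r\<close> is paid for by half of the exponential rate.\<close>
        have "b * ?r / 2 \<le> exp (b * ?r / 2)"
          using exp_ge_add_one_self[of "b * ?r / 2"] by linarith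
        then have "b * ?r * exp (- (b * ?r)) \<le> 2 * exp (b * ?r / 2) * exp (- (b * ?r))"
          by (intro mult_right_mono) auto
        also have "\<dots> = 2 * sgauss (b/2) z"
          by (simp add: sgauss_def exp_add[symmetric] mult.assoc)
        finally have "b * ?r * sgauss b z \<le> 2 * sgauss (b/2) z"
          by (simp add: sgauss_def)
        then have "L\<^sup>2 * (b * ?r * sgauss b z) \<le> L\<^sup>2 * (2 * sgauss (b/2) z)"
          by (intro mult_left_mono) auto
        then show "b * (sgauss b z * (cmod (h (fst z) - h (snd z)))\<^sup>2) \<le> (2 * L\<^sup>2) * (sgauss (b/2) z * 1)"
          using 1 by (simp add: algebra_simps)
      qed (use osc_integrable(1)[OF elim hL] w in auto)
      also have "\<dots> = 2 * L\<^sup>2 * (sgauss_mass (b/2) * (4 * pi))"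
        using w(2) mass1 by simp
      also have "\<dots> = L\<^sup>2 * (16 * pi\<^sup>2) / b * (1 - exp (- 4 * (b/2)))"
        by (simp add: sgauss_mass_def power2_eq_square field_simps)
      also have "\<dots> \<le> L\<^sup>2 * (16 * pi\<^sup>2) / b * 1"
        using elim by (intro mult_left_mono) auto
      finally show ?case by (simp add: osc_def)
    qed
    show "((\<lambda>b. L\<^sup>2 * (16 * pi\<^sup>2) / b) \<longlongrightarrow> 0) at_top"
      by (intro tendsto_divide_0[OF tendsto_const] filterlim_at_top_imp_at_infinity filterlim_ident)
  qed simp
  then show ?thesis using hL by (simp add: osc_vanishing_def)
qed

text \<open>The indicator of a closed set is a pointwise limit of Lipschitz functions of the distance to the set.\<close>

lemma osc_vanishing_closed_indicator:
  assumes F: "closed (F :: (real^3) set)"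
  shows "(\<lambda>\<xi>. indicator F \<xi>) \<in> osc_vanishing"
proof (cases "F = {}")
  case True
  then show ?thesis using osc_vanishing_const[of 0] by (simp add: indicator_def[abs_def])
next
  case False
  define h :: "nat \<Rightarrow> real^3 \<Rightarrow> complex" where "h n \<xi> = of_real (max 0 (1 - real n * infdist \<xi> F))" for n \<xi>
  have cont: "continuous_on UNIV (h n)" for n
    unfolding h_def by (intro continuous_intros)
  have hb: "cmod (h n \<xi>) \<le> 1" for n \<xi>
    by (auto simp: h_def infdist_nonneg)
  have hv: "h n \<in> osc_vanishing" for n
  proof (rule osc_vanishing_lipschitz[OF _ hb borel_measurable_continuous_onI[OF cont]])
    fix x y :: "real^3"
    have "\<bar>infdist x F - infdist y F\<bar> \<le> dist x y"
      by (rule infdist_triangle_abs)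
    then have d: "real n * \<bar>infdist x F - infdist y F\<bar> \<le> real n * norm (x - y)"
      by (intro mult_left_mono) (auto simp: dist_norm)
    have "cmod (h n x - h n y) = \<bar>max 0 (1 - real n * infdist x F) - max 0 (1 - real n * infdist y F)\<bar>"
      unfolding h_def of_real_diff[symmetric] norm_of_real ..
    also have "\<dots> \<le> \<bar>real n * infdist x F - real n * infdist y F\<bar>"
      by (smt (verit))
    also have "\<dots> = real n * \<bar>infdist x F - infdist y F\<bar>"
      unfolding right_diff_distrib[symmetric] by (simp add: abs_mult)
    finally show "cmod (h n x - h n y) \<le> real n * norm (x - y)" using d by linarith
  qed
  have Fm: "F \<in> sets borel" using F by simp
  have ind: "(\<lambda>\<xi>. indicator F \<xi> :: complex) \<in> L2S"
    by (rule L2S_bounded[where C=1], rule borel_measurable_sphereI) (use Fm in \<open>auto simp: indicator_def\<close>)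
  show ?thesis
  proof (rule osc_vanishing_limit[OF ind hv sphere_dominated_nsq[OF ind _ L2S_const[of 2]]])
    show "h n \<in> L2S" for n using hv by (simp add: osc_vanishing_def)
    show "(\<lambda>n. h n \<xi>) \<longlonglongrightarrow> indicator F \<xi>" for \<xi>
    proof (cases "\<xi> \<in> F")
      case True
      then show ?thesis by (simp add: h_def)
    next
      case False2: False
      then have pos: "infdist \<xi> F > 0"
        using F False infdist_pos_not_in_closed by blast
      obtain N :: nat where N: "1 / infdist \<xi> F < real N" using reals_Archimedean2 by blast
      have "h n \<xi> = 0" if "n \<ge> N" for n
      proof -
        have "1 < real N * infdist \<xi> F" using N pos by (simp add: field_simps)
        also have "\<dots> \<le> real n * infdist \<xi> F" using that pos by (intro mult_right_mono) auto
        finally show ?thesis by (simp add: h_def)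
      qed
      then have "\<forall>\<^sub>F n in sequentially. h n \<xi> = indicator F \<xi>"
        using False2 by (auto simp: eventually_sequentially)
      then show ?thesis by (rule tendsto_eventually)
    qed
    show "cmod (indicator F \<xi> - h n \<xi>) \<le> cmod 2" for n \<xi>
    proof -
      have "cmod (indicator F \<xi> - h n \<xi>) \<le> cmod (indicator F \<xi>) + cmod (h n \<xi>)" by (rule norm_triangle_ineq4)
      also have "\<dots> \<le> 1 + 1" by (intro add_mono hb) (simp add: indicator_def)
      finally show ?thesis by simp
    qed
  qed
qed

text \<open>Closed sets are an intersection stable generator of the Borel sets, and complements and countable
  disjoint unions stay inside a closed subspace that contains the constants.\<close>

lemma osc_vanishing_indicator:
  assumes "A \<in> sets (borel :: (real^3) measure)"
  shows "(\<lambda>\<xi>. indicator A \<xi>) \<in> osc_vanishing"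
proof -
  have "Int_stable (Collect (closed :: (real^3) set \<Rightarrow> bool))" by (auto simp: Int_stable_def)
  moreover have "Collect closed \<subseteq> Pow (UNIV :: (real^3) set)" by simp
  moreover have "A \<in> sigma_sets UNIV (Collect closed)"
    using assms by (simp add: borel_eq_closed)
  ultimately show ?thesis
  proof (induction rule: sigma_sets_induct_disjoint)
    case (basic A) then show ?case using osc_vanishing_closed_indicator by simp
  next
    case empty then show ?case using osc_vanishing_const[of 0] by (simp add: indicator_def[abs_def])
  next
    case (compl A)
    have "(\<lambda>\<xi>. 1 + (-1) * indicator A \<xi>) \<in> osc_vanishing"
      by (intro osc_vanishing_add osc_vanishing_const osc_vanishing_cmult compl)
    moreover have "(\<lambda>\<xi>. 1 + (-1) * indicator A \<xi>) = (\<lambda>\<xi>. indicator (UNIV - A) \<xi> :: complex)"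
      by (auto simp: indicator_def)
    ultimately show ?case by simp
  next
    case (union A)
    have Am: "range A \<subseteq> sets borel" using union by (simp add: borel_eq_closed)
    have ind: "(\<lambda>\<xi>. indicator B \<xi> :: complex) \<in> L2S" if "B \<in> sets borel" for B
      by (rule L2S_bounded[where C=1], rule borel_measurable_sphereI) (use that in \<open>auto simp: indicator_def\<close>)
    have eq: "(\<Sum>i<n. indicator (A i) \<xi>) = (indicator (\<Union>i<n. A i) \<xi> :: complex)" for n \<xi>
      using union(1) by (subst indicator_UN_disjoint) (auto simp: disjoint_family_on_def)
    show ?case
    proof (rule osc_vanishing_limit[OF ind, where h="\<lambda>n \<xi>. \<Sum>i<n. indicator (A i) \<xi>"])
      show "(\<Union>i. A i) \<in> sets borel" using Am by auto
      show "(\<lambda>\<xi>. \<Sum>i<n. indicator (A i) \<xi>) \<in> osc_vanishing" for n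
        by (intro osc_vanishing_sum union) auto
      show "(\<lambda>n. nsq (\<lambda>\<xi>. indicator (\<Union>i. A i) \<xi> - (\<Sum>i<n. indicator (A i) \<xi>))) \<longlonglongrightarrow> 0"
        unfolding eq
      proof (rule sphere_dominated_nsq[OF ind ind L2S_const[of 1]])
        show "(\<Union>i. A i) \<in> sets borel" "\<And>n. (\<Union>i<n. A i) \<in> sets borel" using Am by auto
        show "(\<lambda>n. indicator (\<Union>i<n. A i) \<xi>) \<longlonglongrightarrow> (indicator (\<Union>i. A i) \<xi> :: complex)" for \<xi>
          by (rule LIMSEQ_indicator_UN)
        show "cmod (indicator (\<Union>i. A i) \<xi> - indicator (\<Union>i<n. A i) \<xi>) \<le> cmod 1" for n \<xi>
          by (auto simp: indicator_def)
      qed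
    qed
  qed
qed

lemma L2S_cong:
  assumes "\<And>\<xi>. \<xi> \<in> space sphere_measure \<Longrightarrow> g \<xi> = h \<xi>"
  shows "g \<in> L2S \<longleftrightarrow> h \<in> L2S"
proof -
  have "g \<in> borel_measurable sphere_measure \<longleftrightarrow> h \<in> borel_measurable sphere_measure"
    by (rule measurable_cong) (rule assms)
  moreover have "integrable sphere_measure (\<lambda>\<xi>. (cmod (g \<xi>))\<^sup>2) \<longleftrightarrow> integrable sphere_measure (\<lambda>\<xi>. (cmod (h \<xi>))\<^sup>2)"
    by (rule Bochner_Integration.integrable_cong[OF refl]) (simp add: assms)
  ultimately show ?thesis by (simp add: L2S_def)
qed

text \<open>Simple functions are dense, so the Gaussian kernels are an approximate identity on all square
  integrable densities.\<close>

lemma L2S_osc_vanishing: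
  assumes g: "g \<in> L2S"
  shows "g \<in> osc_vanishing"
proof -
  obtain F where F: "\<And>i::nat. simple_function sphere_measure (F i)"
    "\<And>\<xi>. \<xi> \<in> space sphere_measure \<Longrightarrow> (\<lambda>i. F i \<xi>) \<longlonglongrightarrow> g \<xi>"
    "\<And>i \<xi>. \<xi> \<in> space sphere_measure \<Longrightarrow> dist (F i \<xi>) 0 \<le> 2 * dist (g \<xi>) 0"
    using borel_measurable_implies_sequence_metric[OF L2S_measurable[OF g], of 0] by blast
  have Fv: "F i \<in> osc_vanishing" for i
  proof -
    let ?Y = "F i ` space sphere_measure"
    have fin: "finite ?Y" using F(1)[of i] by (simp add: simple_function_def)
    have S: "\<exists>B\<in>sets borel. F i -` {y} \<inter> space sphere_measure = B \<inter> sphere 0 1" if "y \<in> ?Y" for y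
    proof -
      have "F i -` {y} \<inter> space sphere_measure \<in> sets sphere_measure"
        by (rule simple_functionD(2)[OF F(1)])
      then show ?thesis unfolding sets_sphere_measure sets_restrict_space by (auto simp: Int_commute)
    qed
    then obtain B where B: "\<And>y. y \<in> ?Y \<Longrightarrow> B y \<in> sets borel \<and> F i -` {y} \<inter> space sphere_measure = B y \<inter> sphere 0 1"
      by metis
    have v: "(\<lambda>\<xi>. \<Sum>y\<in>?Y. y * indicator (B y) \<xi>) \<in> osc_vanishing" (is "?G \<in> _")
      by (intro osc_vanishing_sum fin osc_vanishing_cmult osc_vanishing_indicator) (use B in auto)
    have eq: "F i \<xi> = ?G \<xi>" if x: "\<xi> \<in> space sphere_measure" for \<xi>
    proof -
      have "indicator (B y) \<xi> = (if y = F i \<xi> then 1 else 0 :: complex)" if "y \<in> ?Y" for y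
      proof -
        have "\<xi> \<in> B y \<longleftrightarrow> F i \<xi> = y"
        proof -
          have "\<xi> \<in> F i -` {y} \<inter> space sphere_measure \<longleftrightarrow> \<xi> \<in> B y \<inter> sphere 0 1"
            using conjunct2[OF B[OF that]] by (rule arg_cong)
          then show ?thesis
            using x unfolding space_sphere_measure Int_iff vimage_singleton_eq by blast
        qed
        then show ?thesis by (auto simp: indicator_def)
      qed
      then have "?G \<xi> = (\<Sum>y\<in>?Y. y * (if y = F i \<xi> then 1 else 0))"
        by (intro sum.cong[OF refl]) (simp only:)
      also have "\<dots> = (\<Sum>y\<in>?Y. if y = F i \<xi> then y else 0)"
        by (intro sum.cong) auto
      also have "\<dots> = F i \<xi>" using fin x by (subst sum.delta) auto
      finally show ?thesis by simp
    qed
    have "F i \<in> L2S"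
      using v unfolding osc_vanishing_def by (subst L2S_cong[OF eq]) auto
    then show ?thesis using v osc_cong[OF eq] by (simp add: osc_vanishing_def)
  qed
  show ?thesis
  proof (rule osc_vanishing_limit[OF g Fv sphere_dominated_nsq[OF g _ L2S_cmult[OF g, of 3] F(2)]])
    show "F n \<in> L2S" for n using Fv by (simp add: osc_vanishing_def)
    show "cmod (g \<xi> - F n \<xi>) \<le> cmod (3 * g \<xi>)" if "\<xi> \<in> space sphere_measure" for n \<xi>
    proof -
      have "cmod (g \<xi> - F n \<xi>) \<le> cmod (g \<xi>) + cmod (F n \<xi>)" by (rule norm_triangle_ineq4)
      then show ?thesis using F(3)[OF that, of n] by (simp add: norm_mult)
    qed
  qed auto
qed

section \<open>The Gaussian energy of a wave\<close>

text \<open>Up to a constant, a smooth version of the mean $R^{-1}\int_{|x|<R}|u|^2$ with \<open>R = 1 / sqrt e\<close>. By the theory of Agmon and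
  Hoermander this average is of the size of the squared norm of the density. With a Gaussian in place
  of the ball it can be computed exactly.\<close>

definition gauss_energy :: "real \<Rightarrow> (real^3 \<Rightarrow> complex) \<Rightarrow> real" where
  "gauss_energy e u = sqrt e * (LINT x|lborel. exp (- e * (norm x)\<^sup>2) * (cmod (u x))\<^sup>2)"

lemma gauss_bounded_integrable:
  fixes f :: "real^3 \<Rightarrow> 'b::{banach, second_countable_topology}"
  assumes e: "e > 0" and m: "f \<in> borel_measurable borel" and b: "\<And>x. norm (f x) \<le> C"
  shows "integrable lborel (\<lambda>x. exp (- e * (norm x)\<^sup>2) *\<^sub>R f x)"
proof (rule Bochner_Integration.integrable_bound)
  show "integrable lborel (\<lambda>x::real^3. exp (- e * (norm x)\<^sup>2) * C)"
    using gauss_integral(1)[OF e] by (rule integrable_mult_left)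
  show "(\<lambda>x. exp (- e * (norm x)\<^sup>2) *\<^sub>R f x) \<in> borel_measurable lborel"
    using m by simp
  show "AE x in lborel. norm (exp (- e * (norm x)\<^sup>2) *\<^sub>R f x) \<le> norm (exp (- e * (norm x)\<^sup>2) * C)"
  proof (rule AE_I2)
    fix x :: "real^3"
    have "0 \<le> C" using b[of x] norm_ge_zero order_trans by blast
    then show "norm (exp (- e * (norm x)\<^sup>2) *\<^sub>R f x) \<le> norm (exp (- e * (norm x)\<^sup>2) * C)"
      using b[of x] by (simp add: abs_mult)
  qed
qed

text \<open>The square of the wave is a double integral over the sphere; integrating the Gaussian in space first
  leaves the kernel \<open>sgauss\<close> between the two directions. Polarization of the product of the densities
  then separates the main term from the oscillation.\<close>

lemma gauss_energy_wave:
  assumes e: "e > 0" and k: "k \<noteq> 0" and g: "g \<in> L2S"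
  defines "b \<equiv> k\<^sup>2 / (4 * e)"
  shows "gauss_energy e (wave k g) = 4 * sqrt pi ^ 3 / k\<^sup>2 * (pi * (1 - exp (- 4 * b)) * nsq g - osc b g / 2)"
proof -
  have b: "b > 0" using e k by (simp add: b_def)
  have gi: "integrable sphere_measure g" by (rule L2S_integrable[OF g])
  have [measurable]: "g \<in> borel_measurable sphere_measure" by (rule L2S_measurable[OF g])
  define f where "f x \<xi> = cis (k * (x \<bullet> \<xi>)) * g \<xi>" for x \<xi>
  have fi: "integrable sphere_measure (f x)" for x
    unfolding f_def by (rule wave_integrable[OF gi])
  have fci: "integrable sphere_measure (\<lambda>\<eta>. cnj (f x \<eta>))" for x
    using fi by (simp add: complex_integrable_cnj)
  \<comment> \<open>Integrating \<open>H\<close> over the directions first gives the square of the wave, integrating over the space first gives the kernel.\<close>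
  define H where "H p = exp (- e * (norm (fst p))\<^sup>2) *\<^sub>R (f (fst p) (fst (snd p)) * cnj (f (fst p) (snd (snd p))))" for p
  have [measurable]: "(\<lambda>p. fst p) \<in> lborel \<Otimes>\<^sub>M sphere_pair \<rightarrow>\<^sub>M (borel :: (real^3) measure)"
    using measurable_fst[of lborel sphere_pair] by simp
  have [measurable]: "(\<lambda>p. fst (snd p)) \<in> (lborel :: (real^3) measure) \<Otimes>\<^sub>M sphere_pair \<rightarrow>\<^sub>M borel"
      "(\<lambda>p. snd (snd p)) \<in> (lborel :: (real^3) measure) \<Otimes>\<^sub>M sphere_pair \<rightarrow>\<^sub>M borel"
    by (rule measurable_compose[OF measurable_snd]; rule sphere_pair_measurable)+
  have [measurable]: "(\<lambda>p. g (fst (snd p))) \<in> borel_measurable ((lborel :: (real^3) measure) \<Otimes>\<^sub>M sphere_pair)"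
      "(\<lambda>p. g (snd (snd p))) \<in> borel_measurable ((lborel :: (real^3) measure) \<Otimes>\<^sub>M sphere_pair)"
    using measurable_compose[OF measurable_compose[OF measurable_snd measurable_fst] L2S_measurable[OF g]]
      measurable_compose[OF measurable_compose[OF measurable_snd measurable_snd] L2S_measurable[OF g]] by simp_all
  have [measurable]: "cnj \<in> borel_measurable borel"
    by (intro borel_measurable_continuous_onI continuous_intros)
  have [measurable]: "H \<in> borel_measurable (lborel \<Otimes>\<^sub>M sphere_pair)"
    unfolding H_def f_def by measurable
  note sf = sphere.sigma_finite_measure_axioms
  have Hz: "integrable sphere_pair (\<lambda>z. H (x, z))"
    "(LINT z|sphere_pair. H (x, z)) = of_real (exp (- e * (norm x)\<^sup>2) * (cmod (wave k g x))\<^sup>2)" for x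
  proof -
    show "integrable sphere_pair (\<lambda>z. H (x, z))"
      using pair_integral_times(1)[OF sf sf fi fci, of x x] by (simp add: H_def)
    have "(LINT z|sphere_pair. H (x, z)) = exp (- e * (norm x)\<^sup>2) *\<^sub>R ((LINT \<xi>|sphere_measure. f x \<xi>) * (LINT \<eta>|sphere_measure. cnj (f x \<eta>)))"
      using pair_integral_times(2)[OF sf sf fi fci, of x x] by (simp add: H_def)
    also have "(LINT \<eta>|sphere_measure. cnj (f x \<eta>)) = cnj (LINT \<xi>|sphere_measure. f x \<xi>)"
      by (rule Bochner_Integration.integral_cnj)
    also have "(LINT \<xi>|sphere_measure. f x \<xi>) = wave k g x" by (simp add: f_def wave_def)
    finally show "(LINT z|sphere_pair. H (x, z)) = of_real (exp (- e * (norm x)\<^sup>2) * (cmod (wave k g x))\<^sup>2)"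
      by (simp only: of_real_mult complex_norm_square scaleR_conv_of_real)
  qed
  have Hn: "(LINT z|sphere_pair. norm (H (x, z))) = exp (- e * (norm x)\<^sup>2) * (LINT z|sphere_pair. cmod (g (fst z)) * cmod (g (snd z)))" for x
    by (simp add: H_def f_def norm_mult)
  have HI: "integrable (lborel \<Otimes>\<^sub>M sphere_pair) H"
  proof (rule lborel_sphere_pair.Fubini_integrable)
    show "integrable lborel (\<lambda>x. LINT z|sphere_pair. norm (H (x, z)))"
      unfolding Hn using gauss_integral(1)[OF e] by simp
  qed (use Hz in auto)
  define c where "c = sqrt (pi / e) ^ 3"
  have Hx: "(LINT x|lborel. H (x, z)) = of_real (c * sgauss b z) * (g (fst z) * cnj (g (snd z)))" for z
  proof -
    have "H (x, z) = (exp (- e * (norm x)\<^sup>2) *\<^sub>R cis ((k *\<^sub>R (fst z - snd z)) \<bullet> x)) * (g (fst z) * cnj (g (snd z)))" for x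
    proof -
      have ce: "cis (k * (x \<bullet> fst z)) * cnj (cis (k * (x \<bullet> snd z))) = cis ((k *\<^sub>R (fst z - snd z)) \<bullet> x)"
        by (simp add: cis_cnj cis_mult inner_diff_left inner_commute algebra_simps)
      show ?thesis
        unfolding H_def f_def fst_conv snd_conv complex_cnj_mult ce[symmetric]
        by (simp only: scaleR_conv_of_real mult_ac)
    qed
    then have "(LINT x|lborel. H (x, z)) = (LINT x|lborel. exp (- e * (norm x)\<^sup>2) *\<^sub>R cis ((k *\<^sub>R (fst z - snd z)) \<bullet> x)) * (g (fst z) * cnj (g (snd z)))"
      by (simp only: integral_mult_left_zero)
    also have "(LINT x|lborel. exp (- e * (norm x)\<^sup>2) *\<^sub>R cis ((k *\<^sub>R (fst z - snd z)) \<bullet> x)) =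
      of_real (c * exp (- (norm (k *\<^sub>R (fst z - snd z)))\<^sup>2 / (4 * e)))"
      unfolding c_def by (rule gauss_fourier(2)[OF e])
    also have "exp (- (norm (k *\<^sub>R (fst z - snd z)))\<^sup>2 / (4 * e)) = sgauss b z"
      by (simp add: sgauss_def b_def power_mult_distrib)
    finally show ?thesis .
  qed
  have "of_real (LINT x|lborel. exp (- e * (norm x)\<^sup>2) * (cmod (wave k g x))\<^sup>2) =
     (LINT x|lborel. (LINT z|sphere_pair. H (x, z)))"
    unfolding Hz(2) by (rule integral_complex_of_real[symmetric])
  also have "\<dots> = (LINT z|sphere_pair. (LINT x|lborel. H (x, z)))"
    using lborel_sphere_pair.Fubini_integral[of "\<lambda>x z. H (x, z)"] HI by simp
  also have "\<dots> = (LINT z|sphere_pair. of_real (c * sgauss b z) * (g (fst z) * cnj (g (snd z))))"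
    unfolding Hx ..
  finally have eq: "complex_of_real (LINT x|lborel. exp (- e * (norm x)\<^sup>2) * (cmod (wave k g x))\<^sup>2) = \<dots>" .
  have HzI: "integrable sphere_pair (\<lambda>z. of_real (c * sgauss b z) * (g (fst z) * cnj (g (snd z))))"
    using lborel_sphere_pair.integrable_snd[of "\<lambda>x z. H (x, z)"] HI unfolding Hx by simp
  have gI: "integrable sphere_measure (\<lambda>\<xi>. (cmod (g \<xi>))\<^sup>2)" using g by (simp add: L2S_def)
  note w = sgauss_weighted[OF b gI] osc_integrable(1)[OF b g]
  have "(LINT x|lborel. exp (- e * (norm x)\<^sup>2) * (cmod (wave k g x))\<^sup>2) = Re (LINT z|sphere_pair. of_real (c * sgauss b z) * (g (fst z) * cnj (g (snd z))))"
    using arg_cong[OF eq, of Re] by simp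
  also have "\<dots> = (LINT z|sphere_pair. Re (of_real (c * sgauss b z) * (g (fst z) * cnj (g (snd z)))))"
    by (rule integral_Re[OF HzI, symmetric])
  also have "\<dots> = (LINT z|sphere_pair. (c / 2) * ((sgauss b z * (cmod (g (fst z)))\<^sup>2 + sgauss b z * (cmod (g (snd z)))\<^sup>2)
      - sgauss b z * (cmod (g (fst z) - g (snd z)))\<^sup>2))"
  proof (intro Bochner_Integration.integral_cong refl)
    fix z
    \<comment> \<open>Polarization.\<close>
    have p: "Re (a * cnj d) = ((cmod a)\<^sup>2 + (cmod d)\<^sup>2 - (cmod (a - d))\<^sup>2) / 2" for a d
      unfolding cmod_power2 by (simp add: power2_eq_square algebra_simps)
    have r: "Re (complex_of_real r * w) = r * Re w" for r w by simp
    show "Re (of_real (c * sgauss b z) * (g (fst z) * cnj (g (snd z)))) = (c / 2) * ((sgauss b z * (cmod (g (fst z)))\<^sup>2 + sgauss b z * (cmod (g (snd z)))\<^sup>2)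
      - sgauss b z * (cmod (g (fst z) - g (snd z)))\<^sup>2)"
      unfolding r p by (simp add: field_simps)
  qed
  also have "\<dots> = (c / 2) * ((sgauss_mass b * nsq g + sgauss_mass b * nsq g) - osc b g / b)"
    using w b by (simp add: nsq_def osc_def)
  also have "\<dots> = c / b * (pi * (1 - exp (- 4 * b)) * nsq g - osc b g / 2)"
    using b by (simp add: sgauss_mass_def field_simps)
  finally have "gauss_energy e (wave k g) = (sqrt e * c / b) * (pi * (1 - exp (- 4 * b)) * nsq g - osc b g / 2)"
    by (simp add: gauss_energy_def)
  moreover have "sqrt e * c / b = 4 * sqrt pi ^ 3 / k\<^sup>2"
  proof -
    have "sqrt e * c = sqrt pi ^ 3 * (sqrt e / sqrt e ^ 3)"
      by (simp add: c_def real_sqrt_divide power_divide)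
    also have "sqrt e / sqrt e ^ 3 = 1 / e"
      using e by (simp add: power3_eq_cube)
    finally show ?thesis using e by (simp add: b_def)
  qed
  ultimately show ?thesis by simp
qed

lemma gauss_energy_wave_le:
  assumes e: "e > 0" and k: "k \<noteq> 0" and g: "g \<in> L2S"
  shows "gauss_energy e (wave k g) \<le> 4 * sqrt pi ^ 3 * pi / k\<^sup>2 * nsq g"
proof -
  define b where "b = k\<^sup>2 / (4 * e)"
  have b: "b > 0" using e k by (simp add: b_def)
  have "gauss_energy e (wave k g) = 4 * sqrt pi ^ 3 / k\<^sup>2 * (pi * (1 - exp (- 4 * b)) * nsq g - osc b g / 2)"
    unfolding b_def by (rule gauss_energy_wave[OF e k g])
  also have "\<dots> \<le> 4 * sqrt pi ^ 3 / k\<^sup>2 * (pi * 1 * nsq g - 0)"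
    using osc_nonneg[OF b, of g] nsq_nonneg[of g]
    by (intro mult_left_mono diff_mono mult_right_mono) auto
  finally show ?thesis by (simp add: mult.assoc)
qed

text \<open>As the Gaussian spreads out, the kernel on the sphere concentrates and the oscillation disappears.\<close>

lemma gauss_energy_wave_tendsto:
  assumes k: "k \<noteq> 0" and g: "g \<in> L2S"
  shows "((\<lambda>e. gauss_energy e (wave k g)) \<longlongrightarrow> 4 * sqrt pi ^ 3 * pi / k\<^sup>2 * nsq g) (at_right 0)"
proof -
  have fl: "filterlim (\<lambda>e. k\<^sup>2 / (4 * e)) at_top (at_right 0)"
    using k by real_asymp
  have o: "((\<lambda>e. osc (k\<^sup>2 / (4 * e)) g) \<longlongrightarrow> 0) (at_right 0)"
    using L2S_osc_vanishing[OF g] filterlim_compose[OF _ fl] by (auto simp: osc_vanishing_def)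
  have ex: "((\<lambda>e. exp (- 4 * (k\<^sup>2 / (4 * e)))) \<longlongrightarrow> 0) (at_right 0)"
    using k by real_asymp
  have "((\<lambda>e. 4 * sqrt pi ^ 3 / k\<^sup>2 * (pi * (1 - exp (- 4 * (k\<^sup>2 / (4 * e)))) * nsq g - osc (k\<^sup>2 / (4 * e)) g / 2))
      \<longlongrightarrow> 4 * sqrt pi ^ 3 / k\<^sup>2 * (pi * (1 - 0) * nsq g - 0 / 2)) (at_right 0)"
    by (intro tendsto_intros ex o) auto
  moreover have "\<forall>\<^sub>F e in at_right 0. 4 * sqrt pi ^ 3 / k\<^sup>2 * (pi * (1 - exp (- 4 * (k\<^sup>2 / (4 * e)))) * nsq g - osc (k\<^sup>2 / (4 * e)) g / 2) = gauss_energy e (wave k g)"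
    using eventually_at_right_less by eventually_elim (rule gauss_energy_wave[OF _ k g, symmetric])
  ultimately have "((\<lambda>e. gauss_energy e (wave k g)) \<longlongrightarrow> 4 * sqrt pi ^ 3 / k\<^sup>2 * (pi * (1 - 0) * nsq g - 0 / 2)) (at_right 0)"
    by (rule Lim_transform_eventually)
  then show ?thesis by (simp add: mult.assoc)
qed

section \<open>Integrals of partial derivatives\<close>

lemma lborel_translate:
  fixes f :: "'a::euclidean_space \<Rightarrow> real"
  assumes f: "integrable lborel f"
  shows "integrable lborel (\<lambda>x. f (x + a))" "(LINT x|lborel. f (x + a)) = (LINT x|lborel. f x)"
proof -
  have [measurable]: "f \<in> borel_measurable borel" using f by auto
  have "integrable (distr lborel borel ((+) a)) f"
    using f by (simp add: lborel_distr_plus)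
  then show "integrable lborel (\<lambda>x. f (x + a))"
    by (simp add: integrable_distr_eq add.commute)
  have "(LINT x|lborel. f x) = (LINT x|distr lborel borel ((+) a). f x)"
    by (simp add: lborel_distr_plus)
  then show "(LINT x|lborel. f (x + a)) = (LINT x|lborel. f x)"
    by (simp add: integral_distr add.commute)
qed

text \<open>The integral of the derivative over a segment in direction \<open>a\<close> is a difference of translates. After
  integration over the space, the translates cancel and the segment contributes the length 1. In this
  form no decay at infinity beyond integrability is required.\<close>

lemma integral_partial_derivative_zero:
  fixes F F' :: "real^3 \<Rightarrow> real"
  assumes der: "\<And>x. ((\<lambda>t. F (x + t *\<^sub>R a)) has_real_derivative F' x) (at 0)"
    and F: "integrable lborel F" and F': "integrable lborel F'" and cont: "continuous_on UNIV F'"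
  shows "(LINT x|lborel. F' x) = 0"
proof -
  have [measurable]: "F' \<in> borel_measurable borel" using F' by auto
  define \<Phi> where "\<Phi> t x = indicator {0..1} t * F' (x + t *\<^sub>R a)" for t x
  have ftc: "(LINT t|lborel. \<Phi> t x) = F (x + a) - F x" for x
  proof -
    have "has_bochner_integral lborel (\<lambda>t. indicator {0..1} t *\<^sub>R F' (x + t *\<^sub>R a)) (F (x + 1 *\<^sub>R a) - F (x + 0 *\<^sub>R a))"
    proof (rule has_bochner_integral_FTC_Icc)
      show "((\<lambda>t. F (x + t *\<^sub>R a)) has_vector_derivative F' (x + t *\<^sub>R a)) (at t within {0..1})" for t
      proof -
        have "((\<lambda>s. F ((x + t *\<^sub>R a) + s *\<^sub>R a)) has_real_derivative F' (x + t *\<^sub>R a)) (at 0)" by (rule der)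
        then have "((\<lambda>s. F (x + (s + t) *\<^sub>R a)) has_real_derivative F' (x + t *\<^sub>R a)) (at 0)"
          by (simp add: algebra_simps)
        then have "((\<lambda>s. F (x + s *\<^sub>R a)) has_real_derivative F' (x + t *\<^sub>R a)) (at t)"
          using DERIV_shift[of "\<lambda>s. F (x + s *\<^sub>R a)" _ 0 t] by simp
        then show ?thesis
          by (rule has_vector_derivative_at_within[OF has_real_derivative_iff_has_vector_derivative[THEN iffD1]])
      qed
      show "continuous_on {0..1} (\<lambda>t. F' (x + t *\<^sub>R a))"
        by (intro continuous_on_compose2[OF cont] continuous_intros) auto
    qed simp
    then show ?thesis by (simp add: \<Phi>_def has_bochner_integral_iff)
  qed
  have \<Phi>I: "integrable (lborel \<Otimes>\<^sub>M lborel) (\<lambda>p. \<Phi> (fst p) (snd p))"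
  proof (rule lborel_pair.Fubini_integrable)
    have 1: "(LINT x|lborel. norm (\<Phi> (fst (t, x)) (snd (t, x)))) = indicator {0..1} t * (LINT x|lborel. \<bar>F' x\<bar>)" for t
      using lborel_translate(2)[of "\<lambda>x. \<bar>F' x\<bar>" "t *\<^sub>R a"] F' by (simp add: \<Phi>_def abs_mult)
    show "integrable lborel (\<lambda>t. LINT x|lborel. norm (\<Phi> (fst (t, x)) (snd (t, x))))"
      unfolding 1 by simp
    show "AE t in lborel. integrable lborel (\<lambda>x. \<Phi> (fst (t, x)) (snd (t, x)))"
      using lborel_translate(1)[OF F'] by (simp add: \<Phi>_def)
    show "(\<lambda>p. \<Phi> (fst p) (snd p)) \<in> borel_measurable (lborel \<Otimes>\<^sub>M lborel)"
      unfolding \<Phi>_def by measurable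
  qed
  have "(LINT t|lborel. LINT x|lborel. \<Phi> t x) = (LINT x|lborel. LINT t|lborel. \<Phi> t x)"
    using lborel_pair.Fubini_integral[of \<Phi>] \<Phi>I by (simp add: case_prod_unfold)
  moreover have "(LINT x|lborel. \<Phi> t x) = indicator {0..1} t * (LINT x|lborel. F' x)" for t
    using lborel_translate(2)[OF F', of "t *\<^sub>R a"] by (simp add: \<Phi>_def)
  moreover have "(LINT x|lborel. LINT t|lborel. \<Phi> t x) = 0"
    unfolding ftc using lborel_translate[OF F, of a] F by simp
  ultimately show ?thesis by simp
qed

section \<open>Bounded continuous functions and the bracket\<close>

text \<open>Everything that occurs in the identity below is a polynomial in bounded continuous functions. Closure
  rules for this class settle all questions of measurability and integrability against Gaussians.\<close>

definition bc :: "(real^3 \<Rightarrow> real) \<Rightarrow> bool" where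
  "bc f \<longleftrightarrow> continuous_on UNIV f \<and> (\<exists>C. \<forall>x. \<bar>f x\<bar> \<le> C)"

definition bcc :: "(real^3 \<Rightarrow> complex) \<Rightarrow> bool" where
  "bcc f \<longleftrightarrow> continuous_on UNIV f \<and> (\<exists>C. \<forall>x. cmod (f x) \<le> C)"

lemma bc_const [intro]: "bc (\<lambda>x. c)"
  by (auto simp: bc_def)

lemma bc_add [intro]:
  assumes "bc f" "bc g" shows "bc (\<lambda>x. f x + g x)"
proof -
  obtain C C' where "\<And>x. \<bar>f x\<bar> \<le> C" "\<And>x. \<bar>g x\<bar> \<le> C'" using assms by (auto simp: bc_def)
  then have "\<bar>f x + g x\<bar> \<le> C + C'" for x
    by (meson abs_triangle_ineq add_mono order_trans)
  then show ?thesis using assms by (auto simp: bc_def intro!: continuous_intros)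
qed

lemma bc_mult [intro]:
  assumes "bc f" "bc g" shows "bc (\<lambda>x. f x * g x)"
proof -
  obtain C C' where C: "\<And>x. \<bar>f x\<bar> \<le> C" "\<And>x. \<bar>g x\<bar> \<le> C'" using assms by (auto simp: bc_def)
  have "\<bar>f x * g x\<bar> \<le> C * C'" for x
    unfolding abs_mult using C by (intro mult_mono) (auto intro: order_trans[OF abs_ge_zero])
  then show ?thesis using assms by (auto simp: bc_def intro!: continuous_intros)
qed

lemma bc_uminus [intro]: "bc f \<Longrightarrow> bc (\<lambda>x. - f x)"
  by (auto simp: bc_def intro!: continuous_intros)

lemma bc_diff [intro]: "bc f \<Longrightarrow> bc g \<Longrightarrow> bc (\<lambda>x. f x - g x)"
  using bc_add[of f "\<lambda>x. - g x"] bc_uminus[of g] by simp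

lemma bc_power [intro]: "bc f \<Longrightarrow> bc (\<lambda>x. f x ^ n)"
  by (induction n) auto

lemma bc_sum [intro]:
  fixes f :: "'i::finite \<Rightarrow> real^3 \<Rightarrow> real"
  shows "(\<And>i. bc (f i)) \<Longrightarrow> bc (\<lambda>x. \<Sum>i\<in>A. f i x)"
  using finite[of A] by (induction A rule: finite_induct) auto

lemma bc_if [intro]: "bc f \<Longrightarrow> bc g \<Longrightarrow> bc (\<lambda>x. if c then f x else g x)"
  by (cases c; simp)

lemma bc_inner [intro]:
  assumes "bcc f" "bcc g" shows "bc (\<lambda>x. f x \<bullet> g x)"
proof -
  obtain C C' where C: "\<And>x. cmod (f x) \<le> C" "\<And>x. cmod (g x) \<le> C'" using assms by (auto simp: bcc_def)
  have "\<bar>f x \<bullet> g x\<bar> \<le> C * C'" for x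
    using C by (intro order_trans[OF Cauchy_Schwarz_ineq2] mult_mono) (auto intro: order_trans[OF norm_ge_zero])
  then show ?thesis using assms by (auto simp: bc_def bcc_def intro!: continuous_intros)
qed

lemma bc_continuous: "bc f \<Longrightarrow> continuous_on UNIV f"
  by (simp add: bc_def)

lemma bc_measurable: "bc f \<Longrightarrow> f \<in> borel_measurable borel"
  by (simp add: bc_def borel_measurable_continuous_onI)

text \<open>The multiplier is the gradient of the bracket. Its components \<open>zb\<close> and the reciprocal \<open>yb\<close> of the bracket
  are bounded and their derivatives are polynomials in \<open>yb\<close> and \<open>zb\<close> again.\<close>

definition yb :: "real^3 \<Rightarrow> real" where "yb x = 1 / bracket x"
definition zb :: "3 \<Rightarrow> real^3 \<Rightarrow> real" where "zb i x = yb x * x$i"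

lemma bracket_ge1: "bracket x \<ge> 1"
  by (simp add: bracket_def)

lemma bracket_pos: "bracket x > 0"
  using bracket_ge1[of x] by linarith

lemma bracket_sq: "(bracket x)\<^sup>2 = 1 + (norm x)\<^sup>2"
  by (simp add: bracket_def add_nonneg_nonneg)

lemma bracket_continuous: "continuous_on UNIV bracket"
  unfolding bracket_def by (intro continuous_intros)

lemma yb_bounds: "0 < yb x" "yb x \<le> 1" "0 \<le> yb x"
  using bracket_ge1[of x] bracket_pos[of x] by (auto simp: yb_def)

lemma yb_bracket: "yb x * bracket x = 1" "bracket x * yb x = 1"
  using bracket_pos[of x] by (auto simp: yb_def)

lemma zb_sq_sum: "(zb 1 x)\<^sup>2 + (zb 2 x)\<^sup>2 + (zb 3 x)\<^sup>2 = 1 - (yb x)\<^sup>2"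
proof -
  have "(zb 1 x)\<^sup>2 + (zb 2 x)\<^sup>2 + (zb 3 x)\<^sup>2 = (yb x)\<^sup>2 * (norm x)\<^sup>2"
    by (simp add: zb_def power_mult_distrib norm_vec3_sq algebra_simps)
  also have "(norm x)\<^sup>2 = (bracket x)\<^sup>2 - 1" by (simp add: bracket_sq)
  also have "(yb x)\<^sup>2 * ((bracket x)\<^sup>2 - 1) = (yb x * bracket x)\<^sup>2 - (yb x)\<^sup>2"
    by (simp add: power_mult_distrib algebra_simps)
  finally show ?thesis by (simp add: yb_bracket)
qed

lemma zb_le1: "\<bar>zb i x\<bar> \<le> 1"
proof -
  have "(zb i x)\<^sup>2 \<le> 1"
    using zb_sq_sum[of x] exhaust_3[of i] zero_le_power2[of "zb 1 x"] zero_le_power2[of "zb 2 x"]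
      zero_le_power2[of "zb 3 x"] zero_le_power2[of "yb x"] by (elim disjE; hypsubst; linarith)
  then show ?thesis by (simp add: abs_square_le_1)
qed

lemma yb_continuous: "continuous_on UNIV yb"
  unfolding yb_def using bracket_continuous bracket_pos by (auto intro!: continuous_intros simp: less_imp_neq[symmetric])

lemma bc_yb [intro]: "bc yb" "bc (\<lambda>x. yb x)"
proof -
  show "bc yb"
    unfolding bc_def using yb_continuous yb_bounds by (auto intro!: exI[of _ 1] simp: abs_of_pos)
  then show "bc (\<lambda>x. yb x)" .
qed

lemma bc_zb [intro]: "bc (zb i)" "bc (\<lambda>x. zb i x)"
proof -
  have "continuous_on UNIV (\<lambda>x. zb i x)"
    unfolding zb_def by (intro continuous_intros yb_continuous)
  then show "bc (zb i)"
    unfolding bc_def using zb_le1 by (auto intro!: exI[of _ 1])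
  then show "bc (\<lambda>x. zb i x)" .
qed

lemma norm_line_sq: "(norm (x + t *\<^sub>R axis i 1 :: real^3))\<^sup>2 = (norm x)\<^sup>2 + 2 * t * x$i + t\<^sup>2"
  unfolding power2_norm_eq_inner
  by (simp add: inner_add_left inner_add_right inner_axis inner_axis' algebra_simps power2_eq_square)

lemma bracket_line:
  "((\<lambda>t. bracket (x + t *\<^sub>R axis i 1)) has_real_derivative zb i x) (at 0)"
proof -
  have "((\<lambda>t. 1 + ((norm x)\<^sup>2 + 2 * t * x$i + t\<^sup>2)) has_real_derivative 2 * x$i) (at 0)"
    by (auto intro!: derivative_eq_intros)
  moreover have "0 < 1 + ((norm x)\<^sup>2 + 2 * 0 * x$i + 0\<^sup>2)"
    by (simp add: add_pos_nonneg)
  ultimately have "((\<lambda>t. sqrt (1 + ((norm x)\<^sup>2 + 2 * t * x$i + t\<^sup>2))) has_real_derivative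
      inverse (sqrt (1 + ((norm x)\<^sup>2 + 2 * 0 * x$i + 0\<^sup>2))) / 2 * (2 * x$i)) (at 0)"
    by (intro DERIV_chain2[OF DERIV_real_sqrt])
  then show ?thesis
    unfolding bracket_def norm_line_sq by (simp add: zb_def yb_def bracket_def field_simps)
qed

lemma yb_line:
  "((\<lambda>t. yb (x + t *\<^sub>R axis i 1)) has_real_derivative - (yb x)\<^sup>2 * zb i x) (at 0)"
proof -
  have "((\<lambda>t. 1 / bracket (x + t *\<^sub>R axis i 1)) has_real_derivative (0 * bracket x - 1 * zb i x) / (bracket x * bracket x)) (at 0)"
    by (rule derivative_eq_intros bracket_line refl | use bracket_pos[of x] in simp)+
  then show ?thesis
    unfolding yb_def by (simp add: power2_eq_square)
qed

lemma zb_line: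
  "((\<lambda>t. zb j (x + t *\<^sub>R axis i 1)) has_real_derivative (if i = j then yb x else 0) - yb x * zb i x * zb j x) (at 0)"
proof -
  have eq: "(x + t *\<^sub>R axis i 1) $ j = x$j + t * (if i = j then 1 else 0)" for t
    by (auto simp: axis_def)
  have "((\<lambda>t. yb (x + t *\<^sub>R axis i 1) * (x$j + t * (if i = j then 1 else 0))) has_real_derivative
     (- (yb x)\<^sup>2 * zb i x) * (x$j) + yb x * (if i = j then 1 else 0)) (at 0)"
    by (rule derivative_eq_intros yb_line refl | simp)+
  then show ?thesis
    unfolding zb_def[of j] eq by (rule DERIV_cong) (auto simp: power2_eq_square)
qed

section \<open>A cutoff with Gaussian gradient\<close>

text \<open>The Gaussian tail $\int_v^\infty e^{-t^2}\,dt$, shifted to a fixed domain of integration.\<close>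

definition gtail :: "real \<Rightarrow> real" where
  "gtail v = (LINT w|lborel. indicator {0..} w * exp (- (v + w)\<^sup>2))"

lemma half_gauss: "integrable lborel (\<lambda>w::real. indicator {0..} w * exp (- w\<^sup>2))"
    "(LINT w|lborel. indicator {0..} w * exp (- w\<^sup>2)) = sqrt pi / 2"
  using gaussian_moment_0 by (simp_all add: has_bochner_integral_iff)

lemma gtail_0: "gtail 0 = sqrt pi / 2"
  using gaussian_moment_0 by (simp add: gtail_def has_bochner_integral_iff)

lemma gtail_bounds:
  assumes v: "v \<ge> 0"
  shows "integrable lborel (\<lambda>w. indicator {0..} w * exp (- (v + w)\<^sup>2))" "0 \<le> gtail v" "gtail v \<le> exp (- v\<^sup>2) * (sqrt pi / 2)"
proof -
  have I: "integrable lborel (\<lambda>w. exp (- v\<^sup>2) * (indicator {0..} w * exp (- w\<^sup>2)))"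
    using gaussian_moment_0 by (simp add: has_bochner_integral_iff)
  have le: "indicator {0..} w * exp (- (v + w)\<^sup>2) \<le> exp (- v\<^sup>2) * (indicator {0..} w * exp (- w\<^sup>2))" for w
    using v by (auto simp: indicator_def power2_sum exp_add[symmetric])
  show J: "integrable lborel (\<lambda>w. indicator {0..} w * exp (- (v + w)\<^sup>2))"
    by (rule Bochner_Integration.integrable_bound[OF I]) (use le in \<open>auto simp: abs_mult\<close>)
  show "0 \<le> gtail v" unfolding gtail_def by (intro integral_nonneg_AE) auto
  have "gtail v \<le> (LINT w|lborel. exp (- v\<^sup>2) * (indicator {0..} w * exp (- w\<^sup>2)))"
    unfolding gtail_def by (rule integral_mono[OF J I le])
  then show "gtail v \<le> exp (- v\<^sup>2) * (sqrt pi / 2)"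
    unfolding integral_mult_right_zero half_gauss(2) .
qed

lemma gtail_eq:
  assumes v: "v \<ge> 0"
  shows "gtail v = sqrt pi / 2 - integral {0..v} (\<lambda>t. exp (- t\<^sup>2))"
proof -
  have I0: "integrable lborel (\<lambda>w. indicator {0..} w * exp (- w\<^sup>2) :: real)"
    using gaussian_moment_0 by (simp add: has_bochner_integral_iff)
  have S: "set_integrable lborel {0..<v} (\<lambda>t::real. exp (- t\<^sup>2))"
    unfolding set_integrable_def
    by (rule Bochner_Integration.integrable_bound[OF I0]) (auto simp: indicator_def)
  have S1: "set_integrable lborel {v..} (\<lambda>t::real. exp (- t\<^sup>2))"
    unfolding set_integrable_def
    by (rule Bochner_Integration.integrable_bound[OF I0]) (use v in \<open>auto simp: indicator_def\<close>)
  have "gtail v = (LINT w|lborel. indicator {v..} (w + v) * exp (- (w + v)\<^sup>2))"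
    unfolding gtail_def by (intro Bochner_Integration.integral_cong) (auto simp: indicator_def add.commute)
  also have "\<dots> = (LINT w|lborel. indicator {v..} w * exp (- w\<^sup>2))"
    using S1 by (intro lborel_translate(2)) (simp add: set_integrable_def)
  finally have 1: "gtail v = (LINT w|lborel. indicator {v..} w * exp (- w\<^sup>2))" .
  have "gtail 0 = (LINT w|lborel. indicator {0..<v} w * exp (- w\<^sup>2) + indicator {v..} w * exp (- w\<^sup>2))"
    unfolding gtail_def using v by (intro Bochner_Integration.integral_cong) (auto simp: indicator_def)
  also have "\<dots> = (LINT w|lborel. indicator {0..<v} w * exp (- w\<^sup>2)) + gtail v"
    unfolding 1 using S S1 by (intro Bochner_Integration.integral_add) (auto simp: set_integrable_def)
  also have "(LINT w|lborel. indicator {0..<v} w * exp (- w\<^sup>2)) = integral {0..<v} (\<lambda>t. exp (- t\<^sup>2))"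
    using set_borel_integral_eq_integral(2)[OF S] by (simp add: set_lebesgue_integral_def)
  also have "\<dots> = integral {0..v} (\<lambda>t. exp (- t\<^sup>2))"
    by (rule integral_subset_negligible) (auto intro: negligible_subset[of "{v}"])
  finally show ?thesis using gtail_0 by linarith
qed

lemma gtail_deriv:
  assumes v: "v > 0"
  shows "(gtail has_real_derivative - exp (- v\<^sup>2)) (at v)"
proof -
  have "((\<lambda>x. integral {0..x} (\<lambda>t. exp (- t\<^sup>2))) has_real_derivative exp (- v\<^sup>2)) (at v within {0..v+1})"
    by (rule integral_has_real_derivative) (use v in \<open>auto intro!: continuous_intros\<close>)
  then have "((\<lambda>x. integral {0..x} (\<lambda>t. exp (- t\<^sup>2))) has_real_derivative exp (- v\<^sup>2)) (at v)"
    using v by (subst (asm) at_within_interior) auto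
  then have "((\<lambda>x. sqrt pi / 2 - integral {0..x} (\<lambda>t. exp (- t\<^sup>2))) has_real_derivative 0 - exp (- v\<^sup>2)) (at v)"
    by (intro derivative_intros)
  then have "((\<lambda>x. sqrt pi / 2 - integral {0..x} (\<lambda>t. exp (- t\<^sup>2))) has_real_derivative - exp (- v\<^sup>2)) (at v)"
    by simp
  then show ?thesis
    by (rule has_field_derivative_transform_within_open[where S="{0<..}"]) (use v gtail_eq in auto)
qed

lemma gtail_lower:
  assumes v: "v \<ge> 0"
  shows "gtail v \<ge> sqrt pi / 2 - v"
proof -
  have "integral {0..v} (\<lambda>t. exp (- t\<^sup>2)) \<le> integral {0..v} (\<lambda>t. 1::real)"
    by (rule integral_le) (auto intro!: integrable_continuous_interval continuous_intros)
  then show ?thesis using v by (simp add: gtail_eq)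
qed

text \<open>A radial cutoff that tends to the constant $\sqrt\pi/2$ as \<open>e\<close> tends to 0, and whose gradient is
  $-$\<open>psi\<close> times the multiplier. Thus the flux of a vector field through a sphere,
  averaged over radii of order \<open>1 / sqrt e\<close>, becomes an integral against \<open>psi\<close>, to which the Gaussian energy applies.\<close>

definition chi :: "real \<Rightarrow> real^3 \<Rightarrow> real" where "chi e x = gtail (sqrt e * bracket x)"
definition psi :: "real \<Rightarrow> real^3 \<Rightarrow> real" where "psi e x = sqrt e * exp (- e * (bracket x)\<^sup>2)"

lemma chi_line:
  assumes e: "e > 0"
  shows "((\<lambda>t. chi e (x + t *\<^sub>R axis i 1)) has_real_derivative - psi e x * zb i x) (at 0)"
proof -
  have p: "sqrt e * bracket x > 0" using e bracket_pos by simp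
  have "((\<lambda>t. sqrt e * bracket (x + t *\<^sub>R axis i 1)) has_real_derivative sqrt e * zb i x) (at 0)"
    by (rule DERIV_cmult[OF bracket_line])
  then have "((\<lambda>t. gtail (sqrt e * bracket (x + t *\<^sub>R axis i 1))) has_real_derivative
      - exp (- (sqrt e * bracket x)\<^sup>2) * (sqrt e * zb i x)) (at 0)"
    using DERIV_chain2[of gtail "- exp (- (sqrt e * bracket x)\<^sup>2)" "\<lambda>t. sqrt e * bracket (x + t *\<^sub>R axis i 1)" 0 "sqrt e * zb i x" UNIV]
      gtail_deriv[OF p] by simp
  then show ?thesis
    using e by (simp add: chi_def psi_def power_mult_distrib mult.assoc mult.left_commute)
qed

lemma chi_continuous:
  assumes e: "e > 0"
  shows "continuous_on UNIV (chi e)"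
proof -
  have "continuous_on {0<..} gtail"
    using gtail_deriv by (intro continuous_at_imp_continuous_on) (auto intro: DERIV_isCont)
  moreover have "continuous_on UNIV (\<lambda>x. sqrt e * bracket x)"
    by (intro continuous_intros bracket_continuous)
  moreover have "(\<lambda>x. sqrt e * bracket x) ` UNIV \<subseteq> {0<..}"
    using e bracket_pos by auto
  ultimately show ?thesis
    unfolding chi_def by (rule continuous_on_compose2)
qed

lemma chi_bounds:
  assumes e: "e > 0"
  shows "0 \<le> chi e x" "chi e x \<le> exp (- e * (norm x)\<^sup>2) * (sqrt pi / 2)" "chi e x \<le> sqrt pi / 2"
proof -
  have v: "sqrt e * bracket x \<ge> 0" using e bracket_pos[of x] by (simp add: less_imp_le)
  show "0 \<le> chi e x" unfolding chi_def by (rule gtail_bounds(2)[OF v])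
  have "chi e x \<le> exp (- (sqrt e * bracket x)\<^sup>2) * (sqrt pi / 2)"
    unfolding chi_def by (rule gtail_bounds(3)[OF v])
  also have "\<dots> \<le> exp (- e * (norm x)\<^sup>2) * (sqrt pi / 2)"
    using e by (intro mult_right_mono) (auto simp: power_mult_distrib bracket_sq)
  finally show 2: "chi e x \<le> exp (- e * (norm x)\<^sup>2) * (sqrt pi / 2)" .
  also have "\<dots> \<le> 1 * (sqrt pi / 2)"
    using e by (intro mult_right_mono) auto
  finally show "chi e x \<le> sqrt pi / 2" by simp
qed

lemma psi_eq: "psi e x = sqrt e * exp (- e) * exp (- e * (norm x)\<^sup>2)"
proof -
  have "- e * (1 + (norm x)\<^sup>2) = - e + - e * (norm x)\<^sup>2" by (simp add: algebra_simps)
  then show ?thesis by (simp only: psi_def bracket_sq exp_add mult.assoc)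
qed

lemma psi_continuous: "continuous_on UNIV (psi e)"
  unfolding psi_def by (intro continuous_intros bracket_continuous)

lemma psi_nonneg: "e > 0 \<Longrightarrow> psi e x \<ge> 0"
  by (simp add: psi_def)

lemma bc_gauss_integrable:
  assumes e: "e > 0" and f: "bc f"
  shows "integrable lborel (\<lambda>x. exp (- e * (norm x)\<^sup>2) * f x)"
proof -
  obtain C where C: "\<And>x. \<bar>f x\<bar> \<le> C" using f by (auto simp: bc_def)
  have "integrable lborel (\<lambda>x. exp (- e * (norm x)\<^sup>2) *\<^sub>R f x)"
    by (rule gauss_bounded_integrable[OF e bc_measurable[OF f], of C]) (use C in auto)
  then show ?thesis by simp
qed

lemma psi_integrable:
  assumes e: "e > 0" and f: "bc f"
  shows "integrable lborel (\<lambda>x. psi e x * f x)"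
  unfolding psi_eq using bc_gauss_integrable[OF e f] by (simp add: mult.assoc)

lemma chi_integrable:
  assumes e: "e > 0" and f: "bc f"
  shows "integrable lborel (\<lambda>x. chi e x * f x)"
proof (rule Bochner_Integration.integrable_bound)
  show "integrable lborel (\<lambda>x. (sqrt pi / 2) * (exp (- e * (norm x)\<^sup>2) * f x))"
    using bc_gauss_integrable[OF e f] by simp
  show "(\<lambda>x. chi e x * f x) \<in> borel_measurable lborel"
    using borel_measurable_continuous_onI[OF chi_continuous[OF e]] bc_measurable[OF f] by simp
  show "AE x in lborel. norm (chi e x * f x) \<le> norm ((sqrt pi / 2) * (exp (- e * (norm x)\<^sup>2) * f x))"
    using mult_right_mono[OF chi_bounds(2)[OF e] abs_ge_zero] chi_bounds(1)[OF e]
    by (intro AE_I2) (simp add: abs_mult mult.assoc mult.left_commute)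
qed

lemma inner_line:
  fixes f g :: "real^3 \<Rightarrow> complex"
  assumes "((\<lambda>t. f (x + t *\<^sub>R a)) has_vector_derivative f') (at 0)" "((\<lambda>t. g (x + t *\<^sub>R a)) has_vector_derivative g') (at 0)"
  shows "((\<lambda>t. f (x + t *\<^sub>R a) \<bullet> g (x + t *\<^sub>R a)) has_real_derivative f' \<bullet> g x + f x \<bullet> g') (at 0)"
proof -
  have "((\<lambda>t. f (x + t *\<^sub>R a) \<bullet> g (x + t *\<^sub>R a)) has_derivative (\<lambda>h. f (x + 0 *\<^sub>R a) \<bullet> (h *\<^sub>R g') + (h *\<^sub>R f') \<bullet> g (x + 0 *\<^sub>R a))) (at 0)"
    using assms unfolding has_vector_derivative_def by (rule has_derivative_inner)
  moreover have "(\<lambda>h. f (x + 0 *\<^sub>R a) \<bullet> (h *\<^sub>R g') + (h *\<^sub>R f') \<bullet> g (x + 0 *\<^sub>R a)) = (*) (f' \<bullet> g x + f x \<bullet> g')"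
    by (auto simp: algebra_simps)
  ultimately show ?thesis by (simp add: has_field_derivative_def)
qed

section \<open>The Morawetz identity for the Helmholtz equation\<close>

text \<open>Derivatives along coordinate lines suffice for the divergence, and their calculus is that of one
  real variable.\<close>

definition line_deriv :: "3 \<Rightarrow> (real^3 \<Rightarrow> real) \<Rightarrow> real \<Rightarrow> real^3 \<Rightarrow> bool" where
  "line_deriv i f f' x \<longleftrightarrow> ((\<lambda>t. f (x + t *\<^sub>R axis i 1)) has_real_derivative f') (at 0)"

lemma line_deriv_add: "line_deriv i f f' x \<Longrightarrow> line_deriv i g g' x \<Longrightarrow> line_deriv i (\<lambda>x. f x + g x) (f' + g') x"
  unfolding line_deriv_def by (rule DERIV_add)

lemma line_deriv_diff: "line_deriv i f f' x \<Longrightarrow> line_deriv i g g' x \<Longrightarrow> line_deriv i (\<lambda>x. f x - g x) (f' - g') x"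
  unfolding line_deriv_def by (rule DERIV_diff)

lemma line_deriv_cmult: "line_deriv i f f' x \<Longrightarrow> line_deriv i (\<lambda>x. c * f x) (c * f') x"
  unfolding line_deriv_def by (rule DERIV_cmult)

lemma line_deriv_mult:
  assumes "line_deriv i f f' x" "line_deriv i g g' x"
  shows "line_deriv i (\<lambda>x. f x * g x) (f' * g x + f x * g') x"
  using DERIV_mult[OF assms[unfolded line_deriv_def]] unfolding line_deriv_def by (simp add: mult.commute)

lemma line_deriv_sum:
  "(\<And>j. line_deriv i (f j) (f' j) x) \<Longrightarrow> line_deriv i (\<lambda>x. \<Sum>j\<in>A. f j x) (\<Sum>j\<in>A. f' j) x"
  unfolding line_deriv_def by (rule DERIV_sum)

lemma line_deriv_yb: "line_deriv i yb (- (yb x)\<^sup>2 * zb i x) x"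
  unfolding line_deriv_def by (rule yb_line)

lemma line_deriv_zb: "line_deriv i (zb j) ((if i = j then yb x else 0) - yb x * zb i x * zb j x) x"
  unfolding line_deriv_def by (rule zb_line)

lemma line_deriv_zb_same: "line_deriv i (zb i) (yb x - yb x * zb i x * zb i x) x"
  using line_deriv_zb[of i i x] by simp

lemma line_deriv_yb_powers:
  "line_deriv i (\<lambda>x. yb x ^ 2) (2 * yb x * (- (yb x)\<^sup>2 * zb i x)) x"
  "line_deriv i (\<lambda>x. yb x ^ 3) (3 * yb x ^ 2 * (- (yb x)\<^sup>2 * zb i x)) x"
  "line_deriv i (\<lambda>x. yb x ^ 4) (4 * yb x ^ 3 * (- (yb x)\<^sup>2 * zb i x)) x"
  unfolding line_deriv_def
  by (rule DERIV_cong[OF DERIV_power[OF yb_line]]; simp)+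

text \<open>A bounded solution of the Helmholtz equation with bounded derivatives up to second order; \<open>D\<close> and \<open>E\<close> are
  its first and second partial derivatives. The inner product of complex numbers is the real part of
  the Hermitian product, so no separate real part is needed.\<close>

locale helmholtz_solution =
  fixes k :: real and u :: "real^3 \<Rightarrow> complex" and D :: "3 \<Rightarrow> real^3 \<Rightarrow> complex" and E :: "3 \<Rightarrow> 3 \<Rightarrow> real^3 \<Rightarrow> complex"
  assumes u_deriv: "(u has_derivative (\<lambda>h. \<Sum>i\<in>UNIV. (h$i) *\<^sub>R D i x)) (at x)"
    and D_deriv: "(D j has_derivative (\<lambda>h. \<Sum>i\<in>UNIV. (h$i) *\<^sub>R E i j x)) (at x)"
    and bcc: "bcc u" "bcc (D i)" "bcc (E i j)"
    and E_sym: "E i j x = E j i x"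
    and helmholtz: "(\<Sum>i\<in>UNIV. E i i x) = - (k\<^sup>2) *\<^sub>R u x"
begin

lemma line_of_deriv:
  assumes "(f has_derivative (\<lambda>h. \<Sum>i\<in>UNIV. (h$i) *\<^sub>R f' i)) (at x)"
  shows "((\<lambda>t. f (x + t *\<^sub>R axis i (1::real))) has_vector_derivative f' (i::3)) (at 0)"
proof -
  have g: "((\<lambda>t. x + t *\<^sub>R axis i (1::real)) has_derivative (\<lambda>t. t *\<^sub>R axis i 1)) (at 0)"
    by (auto intro!: derivative_eq_intros)
  have "((\<lambda>t. f (x + t *\<^sub>R axis i 1)) has_derivative (\<lambda>t. \<Sum>j\<in>UNIV. ((t *\<^sub>R axis i (1::real)) $ j) *\<^sub>R f' j)) (at 0)"
    by (rule has_derivative_compose[OF g]) (use assms in simp)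
  moreover have "(\<lambda>t. \<Sum>j\<in>UNIV. ((t *\<^sub>R axis i (1::real)) $ j) *\<^sub>R f' j) = (\<lambda>t. t *\<^sub>R f' i)"
  proof
    fix t
    have "((t *\<^sub>R axis i (1::real)) $ j) *\<^sub>R f' j = (if j = i then t *\<^sub>R f' j else 0)" for j
      by (auto simp: axis_def)
    then show "(\<Sum>j\<in>UNIV. ((t *\<^sub>R axis i (1::real)) $ j) *\<^sub>R f' j) = t *\<^sub>R f' i"
      by simp
  qed
  ultimately show ?thesis by (simp add: has_vector_derivative_def)
qed

lemmas u_line = line_of_deriv[OF u_deriv]
lemmas D_line = line_of_deriv[OF D_deriv]

text \<open>With $s$ the bracket, \<open>P\<close> is the Morawetz vector field of the multiplier $\nabla s\cdot\nabla u + \frac12(\Delta s)u$: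
  the first three terms are the usual ones, $\Delta s = 2s^{-1} + s^{-3}$, and the last term is
  $-\frac12\nabla(\Delta s)|u|^2$. Its divergence \<open>Q\<close> is twice the Hessian of $s$ applied to $\nabla u$, minus
  $\frac12(\Delta^2 s)|u|^2$. In three dimensions $\Delta^2 s = -15s^{-7}$ is negative and
  \<open>yb * Lam\<close> is $s^{-3}(|x|^2|\nabla u|^2 - |x\cdot\nabla u|^2)$, the square of the angular derivatives with
  precisely the weight of the inner product. Hence all terms of \<open>Q\<close> are nonnegative.\<close>

definition "uu x = u x \<bullet> u x"
definition "DD x = (\<Sum>i\<in>UNIV. D i x \<bullet> D i x)"
definition "MM x = (\<Sum>i\<in>UNIV. \<Sum>j\<in>UNIV. zb i x * zb j x * (D i x \<bullet> D j x))"
definition "XX x = (\<Sum>i\<in>UNIV. zb i x * (u x \<bullet> D i x))"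
definition "Lam x = (1 - (yb x)\<^sup>2) * DD x - MM x"
definition "Q x = 2 * yb x ^ 3 * DD x + 2 * yb x * Lam x + 15/2 * yb x ^ 7 * uu x"
definition "P i x = 2 * (\<Sum>j\<in>UNIV. zb j x * (D j x \<bullet> D i x)) + (2 * yb x + yb x ^ 3) * (u x \<bullet> D i x)
   + zb i x * (k\<^sup>2 * (u x \<bullet> u x) - (\<Sum>j\<in>UNIV. D j x \<bullet> D j x)) + (yb x ^ 2 + 3/2 * yb x ^ 4) * zb i x * (u x \<bullet> u x)"
definition "G i x = 2 * (\<Sum>j\<in>UNIV. ((if i = j then yb x else 0) - yb x * zb i x * zb j x) * (D j x \<bullet> D i x)
       + zb j x * (E i j x \<bullet> D i x + D j x \<bullet> E i i x))
   + ((2 * (- (yb x)\<^sup>2 * zb i x) + 3 * yb x ^ 2 * (- (yb x)\<^sup>2 * zb i x)) * (u x \<bullet> D i x)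
     + (2 * yb x + yb x ^ 3) * (D i x \<bullet> D i x + u x \<bullet> E i i x))
   + ((yb x - yb x * zb i x * zb i x) * (k\<^sup>2 * (u x \<bullet> u x) - (\<Sum>j\<in>UNIV. D j x \<bullet> D j x))
     + zb i x * (k\<^sup>2 * (D i x \<bullet> u x + u x \<bullet> D i x) - (\<Sum>j\<in>UNIV. E i j x \<bullet> D j x + D j x \<bullet> E i j x)))
   + (((2 * yb x * (- (yb x)\<^sup>2 * zb i x) + 3/2 * (4 * yb x ^ 3 * (- (yb x)\<^sup>2 * zb i x))) * zb i x
       + (yb x ^ 2 + 3/2 * yb x ^ 4) * (yb x - yb x * zb i x * zb i x)) * (u x \<bullet> u x)
     + (yb x ^ 2 + 3/2 * yb x ^ 4) * zb i x * (D i x \<bullet> u x + u x \<bullet> D i x))"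

lemma line_deriv_inner:
  "line_deriv i (\<lambda>x. u x \<bullet> u x) (D i x \<bullet> u x + u x \<bullet> D i x) x"
  "line_deriv i (\<lambda>x. u x \<bullet> D j x) (D i x \<bullet> D j x + u x \<bullet> E i j x) x"
  "line_deriv i (\<lambda>x. D l x \<bullet> D j x) (E i l x \<bullet> D j x + D l x \<bullet> E i j x) x"
  unfolding line_deriv_def by (intro inner_line u_line D_line)+

lemma P_line: "line_deriv i (P i) (G i x) x"
  unfolding P_def[abs_def] G_def
  by (intro line_deriv_add line_deriv_diff line_deriv_cmult line_deriv_sum line_deriv_inner)
     (intro line_deriv_mult line_deriv_add line_deriv_diff line_deriv_cmult line_deriv_sum line_deriv_inner
       line_deriv_yb line_deriv_yb_powers line_deriv_zb_same line_deriv_zb)+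

text \<open>The second derivative \<open>E 3 3\<close> is eliminated by the Helmholtz equation. What then distinguishes the two
  sides is a multiple of the relation between \<open>yb\<close> and the squares of the \<open>zb i\<close>.\<close>

lemma G_sum: "(\<Sum>i\<in>UNIV. G i x) = Q x"
proof -
  have E33: "E 3 3 x = - (k\<^sup>2) *\<^sub>R u x - E 1 1 x - E 2 2 x"
    using helmholtz[of x] by (simp add: sum_3 algebra_simps)
  have sym: "E 2 1 x = E 1 2 x" "E 3 1 x = E 1 3 x" "E 3 2 x = E 2 3 x"
    by (rule E_sym)+
  have comm: "D 2 x \<bullet> D 1 x = D 1 x \<bullet> D 2 x" "D 3 x \<bullet> D 1 x = D 1 x \<bullet> D 3 x" "D 3 x \<bullet> D 2 x = D 2 x \<bullet> D 3 x"
    "D i x \<bullet> u x = u x \<bullet> D i x" "D i x \<bullet> E j l x = E j l x \<bullet> D i x" "u x \<bullet> E j l x = E j l x \<bullet> u x" for i j l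
    by (rule inner_commute)+
  have "(\<Sum>i\<in>UNIV. G i x) - Q x = (yb x * DD x - yb x * k\<^sup>2 * uu x - (3 * yb x ^ 3 + 15/2 * yb x ^ 5) * uu x) *
     ((zb 1 x)\<^sup>2 + (zb 2 x)\<^sup>2 + (zb 3 x)\<^sup>2 + (yb x)\<^sup>2 - 1)"
    unfolding G_def Q_def Lam_def DD_def MM_def uu_def sum_3 E33 sym
    by (simp add: inner_diff_left inner_diff_right comm)
       (simp add: field_simps eval_nat_numeral)
  then show ?thesis by (simp add: zb_sq_sum)
qed

lemma bc_P: "bc (P i)"
  unfolding P_def by (intro bc_add bc_mult bc_const bc_diff bc_sum bc_power bc_inner bc_yb bc_zb bcc)

lemma bc_G: "bc (G i)"
  unfolding G_def by (intro bc_add bc_mult bc_const bc_uminus bc_diff bc_sum bc_power bc_inner bc_yb bc_zb bc_if bcc)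

lemma bc_forms: "bc uu" "bc DD" "bc MM" "bc XX" "bc Lam" "bc Q"
proof -
  show 1: "bc uu" "bc DD" "bc MM" "bc XX"
    unfolding uu_def DD_def MM_def XX_def by (intro bc_mult bc_sum bc_inner bc_zb bcc)+
  show 2: "bc Lam"
    unfolding Lam_def by (intro bc_diff bc_mult bc_const bc_power bc_yb 1)
  show "bc Q"
    unfolding Q_def by (intro bc_add bc_mult bc_const bc_power bc_yb 1 2)
qed

text \<open>The divergence theorem for \<open>chi e\<close> times \<open>P\<close>.\<close>

lemma flux_identity:
  assumes e: "e > 0"
  shows "(LINT x|lborel. chi e x * Q x) = (LINT x|lborel. psi e x * (\<Sum>i\<in>UNIV. zb i x * P i x))"
proof -
  have I1: "integrable lborel (\<lambda>x. chi e x * G i x)" for i by (rule chi_integrable[OF e bc_G])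
  have I2: "integrable lborel (\<lambda>x. psi e x * (zb i x * P i x))" for i
    by (intro psi_integrable[OF e] bc_mult bc_zb bc_P)
  have z: "(LINT x|lborel. chi e x * G i x - psi e x * (zb i x * P i x)) = 0" for i
  proof (rule integral_partial_derivative_zero[where F="\<lambda>x. chi e x * P i x" and a="axis i 1"])
    show "((\<lambda>t. chi e (x + t *\<^sub>R axis i 1) * P i (x + t *\<^sub>R axis i 1)) has_real_derivative
       chi e x * G i x - psi e x * (zb i x * P i x)) (at 0)" for x
      by (rule DERIV_cong[OF DERIV_mult[OF chi_line[OF e] P_line[unfolded line_deriv_def]]]) (simp add: algebra_simps)
    show "integrable lborel (\<lambda>x. chi e x * P i x)" by (rule chi_integrable[OF e bc_P])
    show "integrable lborel (\<lambda>x. chi e x * G i x - psi e x * (zb i x * P i x))"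
      by (intro Bochner_Integration.integrable_diff I1 I2)
    show "continuous_on UNIV (\<lambda>x. chi e x * G i x - psi e x * (zb i x * P i x))"
      by (intro continuous_intros chi_continuous[OF e] psi_continuous bc_continuous bc_G bc_P bc_zb)
  qed
  then have "(LINT x|lborel. chi e x * G i x) = (LINT x|lborel. psi e x * (zb i x * P i x))" for i
    using I1 I2 by (simp add: Bochner_Integration.integral_diff)
  then have "(\<Sum>i\<in>UNIV. LINT x|lborel. chi e x * G i x) = (\<Sum>i\<in>UNIV. LINT x|lborel. psi e x * (zb i x * P i x))"
    by simp
  then show ?thesis
    using I1 I2 by (simp add: Bochner_Integration.integral_sum[symmetric] sum_distrib_left[symmetric] G_sum)
qed

text \<open>The flux density is the energy density up to the angular derivatives, which have a favourable sign, and
  terms that carry a factor \<open>yb\<close>.\<close>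

lemma flux_expand:
  "(\<Sum>i\<in>UNIV. zb i x * P i x) = (1 - (yb x)\<^sup>2) * (DD x + k\<^sup>2 * uu x) - 2 * Lam x + (2 * yb x + yb x ^ 3) * XX x
     + (yb x ^ 2 + 3/2 * yb x ^ 4) * (1 - (yb x)\<^sup>2) * uu x"
proof -
  have comm: "D 2 x \<bullet> D 1 x = D 1 x \<bullet> D 2 x" "D 3 x \<bullet> D 1 x = D 1 x \<bullet> D 3 x" "D 3 x \<bullet> D 2 x = D 2 x \<bullet> D 3 x"
    by (rule inner_commute)+
  have "(\<Sum>i\<in>UNIV. zb i x * P i x) = 2 * MM x + (2 * yb x + yb x ^ 3) * XX x
     + ((zb 1 x)\<^sup>2 + (zb 2 x)\<^sup>2 + (zb 3 x)\<^sup>2) * (k\<^sup>2 * uu x - DD x)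
     + (yb x ^ 2 + 3/2 * yb x ^ 4) * ((zb 1 x)\<^sup>2 + (zb 2 x)\<^sup>2 + (zb 3 x)\<^sup>2) * uu x"
    unfolding P_def MM_def XX_def uu_def DD_def sum_3 comm by (simp add: algebra_simps eval_nat_numeral)
  then show ?thesis unfolding zb_sq_sum Lam_def by (simp add: algebra_simps)
qed

text \<open>The identity of Lagrange for the vectors \<open>zb\<close> and \<open>D\<close>.\<close>

lemma Lam_eq: "Lam x = (\<Sum>i\<in>UNIV. \<Sum>j\<in>UNIV. (cmod (zb i x *\<^sub>R D j x - zb j x *\<^sub>R D i x))\<^sup>2) / 2"
proof -
  have comm: "D 2 x \<bullet> D 1 x = D 1 x \<bullet> D 2 x" "D 3 x \<bullet> D 1 x = D 1 x \<bullet> D 3 x" "D 3 x \<bullet> D 2 x = D 2 x \<bullet> D 3 x"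
    by (rule inner_commute)+
  show ?thesis
    unfolding Lam_def zb_sq_sum[symmetric] DD_def MM_def sum_3 power2_norm_eq_inner
    by (simp add: inner_diff_left inner_diff_right comm) (simp add: algebra_simps power2_eq_square)
qed

lemma forms_nonneg: "uu x \<ge> 0" "DD x \<ge> 0" "Lam x \<ge> 0" "Q x \<ge> 0"
proof -
  show 1: "uu x \<ge> 0" "DD x \<ge> 0" by (auto simp: uu_def DD_def intro!: sum_nonneg)
  show 2: "Lam x \<ge> 0" unfolding Lam_eq by (intro divide_nonneg_pos sum_nonneg) auto
  show "Q x \<ge> 0" unfolding Q_def using 1 2 yb_bounds(3)[of x]
    by (intro add_nonneg_nonneg mult_nonneg_nonneg) auto
qed

lemma XX_bound:
  assumes a: "a > 0"
  shows "\<bar>XX x\<bar> \<le> a * DD x + uu x / (4 * a)"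
proof -
  have b: "\<bar>zb i x * (u x \<bullet> D i x)\<bar> \<le> a * (D i x \<bullet> D i x) + (zb i x)\<^sup>2 * uu x / (4 * a)" for i
  proof -
    have "0 \<le> ((2 * a) *\<^sub>R D i x + zb i x *\<^sub>R u x) \<bullet> ((2 * a) *\<^sub>R D i x + zb i x *\<^sub>R u x)"
      "0 \<le> ((2 * a) *\<^sub>R D i x - zb i x *\<^sub>R u x) \<bullet> ((2 * a) *\<^sub>R D i x - zb i x *\<^sub>R u x)" by simp_all
    then have "0 \<le> 4 * a * (a * (D i x \<bullet> D i x)) + (zb i x)\<^sup>2 * uu x + 4 * a * (zb i x * (u x \<bullet> D i x))"
      "0 \<le> 4 * a * (a * (D i x \<bullet> D i x)) + (zb i x)\<^sup>2 * uu x - 4 * a * (zb i x * (u x \<bullet> D i x))"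
      by (simp_all add: inner_add_left inner_add_right inner_diff_left inner_diff_right inner_commute[of "D i x" "u x"] uu_def power2_eq_square algebra_simps)
    then have "4 * a * \<bar>zb i x * (u x \<bullet> D i x)\<bar> \<le> 4 * a * (a * (D i x \<bullet> D i x)) + (zb i x)\<^sup>2 * uu x"
      using a by (simp add: abs_if)
    then show ?thesis using a by (simp add: field_simps)
  qed
  have "\<bar>XX x\<bar> \<le> (\<Sum>i\<in>UNIV. a * (D i x \<bullet> D i x) + (zb i x)\<^sup>2 * uu x / (4 * a))"
    unfolding XX_def by (rule order_trans[OF sum_abs sum_mono]) (rule b)
  also have "\<dots> = a * DD x + ((zb 1 x)\<^sup>2 + (zb 2 x)\<^sup>2 + (zb 3 x)\<^sup>2) * uu x / (4 * a)"
    by (simp add: sum_3 DD_def algebra_simps add_divide_distrib)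
  also have "\<dots> \<le> a * DD x + 1 * uu x / (4 * a)"
    unfolding zb_sq_sum using a forms_nonneg(1)[of x] by (intro add_left_mono divide_right_mono mult_right_mono) auto
  finally show ?thesis by simp
qed

end

context helmholtz_solution
begin

section \<open>The limit of the Morawetz identity\<close>

text \<open>Gaussian means of the energy. The weights make \<open>V\<close> convenient for upper bounds, whereas \<open>W\<close> is the
  exact leading term of the flux.\<close>

definition "V e = (LINT x|lborel. psi e x * (DD x + uu x))"
definition "W e = (LINT x|lborel. psi e x * (DD x + k\<^sup>2 * uu x))"

lemma gauss_energy_forms:
  assumes e: "e > 0"
  shows "(LINT x|lborel. psi e x * (DD x + c * uu x)) = exp (- e) * ((\<Sum>i\<in>UNIV. gauss_energy e (D i)) + c * gauss_energy e u)"
proof -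
  have I: "integrable lborel (\<lambda>x. exp (- e * (norm x)\<^sup>2) * (cmod (f x))\<^sup>2)" if "bcc f" for f
    using bc_gauss_integrable[OF e bc_inner[OF that that]] by (simp add: power2_norm_eq_inner)
  have "psi e x * (DD x + c * uu x) = exp (- e) * ((\<Sum>i\<in>UNIV. sqrt e * (exp (- e * (norm x)\<^sup>2) * (cmod (D i x))\<^sup>2)) + c * (sqrt e * (exp (- e * (norm x)\<^sup>2) * (cmod (u x))\<^sup>2)))" for x
    unfolding psi_eq DD_def uu_def power2_norm_eq_inner sum_distrib_left[symmetric] by (simp add: algebra_simps)
  then have "(LINT x|lborel. psi e x * (DD x + c * uu x)) = exp (- e) * (LINT x|lborel. (\<Sum>i\<in>UNIV. sqrt e * (exp (- e * (norm x)\<^sup>2) * (cmod (D i x))\<^sup>2)) + c * (sqrt e * (exp (- e * (norm x)\<^sup>2) * (cmod (u x))\<^sup>2)))"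
    by (simp only: integral_mult_right_zero)
  also have "\<dots> = exp (- e) * ((\<Sum>i\<in>UNIV. gauss_energy e (D i)) + c * gauss_energy e u)"
  proof -
    have Id: "integrable lborel (\<lambda>x. exp (- e * (norm x)\<^sup>2) * (cmod (D i x))\<^sup>2)" for i by (rule I[OF bcc(2)])
    have Iu: "integrable lborel (\<lambda>x. exp (- e * (norm x)\<^sup>2) * (cmod (u x))\<^sup>2)" by (rule I[OF bcc(1)])
    show ?thesis
      unfolding gauss_energy_def using Id Iu
      by (simp add: Bochner_Integration.integral_add Bochner_Integration.integral_sum)
  qed
  finally show ?thesis .
qed

lemma remainder_bound:
  "\<bar>(\<Sum>i\<in>UNIV. zb i x * P i x) - (DD x + k\<^sup>2 * uu x) + 2 * Lam x\<bar> \<le> (8 + k\<^sup>2) * (yb x * (DD x + uu x))"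
proof -
  let ?y = "yb x" and ?d = "DD x" and ?u = "uu x" and ?X = "XX x"
  note y = yb_bounds[of x]
  note n = forms_nonneg[of x]
  have p: "?y ^ n \<le> ?y" if "n \<ge> 1" for n
    using power_decreasing[OF that y(3) y(2)] by simp
  have 1: "?y\<^sup>2 * (?d + k\<^sup>2 * ?u) \<le> ?y * ((1 + k\<^sup>2) * (?d + ?u))"
  proof (rule mult_mono)
    show "?d + k\<^sup>2 * ?u \<le> (1 + k\<^sup>2) * (?d + ?u)" using n by (simp add: algebra_simps)
  qed (use p[of 2] n y in auto)
  have X: "\<bar>?X\<bar> \<le> ?d + ?u"
    using XX_bound[of 1 x] n by simp
  have 2: "\<bar>(2 * ?y + ?y ^ 3) * ?X\<bar> \<le> (3 * ?y) * (?d + ?u)"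
    unfolding abs_mult using X p[of 3] y n by (intro mult_mono) auto
  have 3: "(?y ^ 2 + 3/2 * ?y ^ 4) * (1 - ?y\<^sup>2) * ?u \<le> (5/2 * ?y) * 1 * (?d + ?u)"
    using p[of 2] p[of 4] y n by (intro mult_mono) (auto intro!: mult_nonneg_nonneg simp: power_le_one)
  have 30: "0 \<le> (?y ^ 2 + 3/2 * ?y ^ 4) * (1 - ?y\<^sup>2) * ?u" "0 \<le> ?y\<^sup>2 * (?d + k\<^sup>2 * ?u)"
    using y n by (auto intro!: mult_nonneg_nonneg add_nonneg_nonneg simp: power_le_one)
  have "(\<Sum>i\<in>UNIV. zb i x * P i x) - (?d + k\<^sup>2 * ?u) + 2 * Lam x =
    - (?y\<^sup>2 * (?d + k\<^sup>2 * ?u)) + (2 * ?y + ?y ^ 3) * ?X + (?y ^ 2 + 3/2 * ?y ^ 4) * (1 - ?y\<^sup>2) * ?u"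
    unfolding flux_expand by (simp add: algebra_simps)
  then have "\<bar>(\<Sum>i\<in>UNIV. zb i x * P i x) - (?d + k\<^sup>2 * ?u) + 2 * Lam x\<bar> \<le>
     ?y\<^sup>2 * (?d + k\<^sup>2 * ?u) + \<bar>(2 * ?y + ?y ^ 3) * ?X\<bar> + (?y ^ 2 + 3/2 * ?y ^ 4) * (1 - ?y\<^sup>2) * ?u"
    using 30 by linarith
  also have "\<dots> \<le> ?y * ((1 + k\<^sup>2) * (?d + ?u)) + (3 * ?y) * (?d + ?u) + (5/2 * ?y) * 1 * (?d + ?u)"
    by (intro add_mono 1 2 3)
  also have "\<dots> = (13/2 + k\<^sup>2) * (?y * (?d + ?u))" by (simp add: field_simps)
  also have "\<dots> \<le> (8 + k\<^sup>2) * (?y * (?d + ?u))" using y n by (intro mult_right_mono) auto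
  finally show ?thesis .
qed

lemma chi_Q_eq:
  assumes e: "e > 0"
  shows "\<bar>(LINT x|lborel. chi e x * Q x) + 2 * (LINT x|lborel. psi e x * Lam x) - W e\<bar>
     \<le> (8 + k\<^sup>2) * (LINT x|lborel. psi e x * (yb x * (DD x + uu x)))"
proof -
  note pI = psi_integrable[OF e]
  have bP: "bc (\<lambda>x. \<Sum>i\<in>UNIV. zb i x * P i x)" by (intro bc_sum bc_mult bc_zb bc_P)
  have b1: "bc (\<lambda>x. DD x + k\<^sup>2 * uu x)" "bc (\<lambda>x. yb x * (DD x + uu x))" "bc (\<lambda>x. Lam x)" "bc (\<lambda>x. 2 * Lam x)"
    using bc_forms by (auto intro!: bc_add bc_mult bc_const)
  have bR: "bc (\<lambda>x. (\<Sum>i\<in>UNIV. zb i x * P i x) - (DD x + k\<^sup>2 * uu x) + 2 * Lam x)"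
    by (intro bc_add[OF bc_diff[OF bP b1(1)] b1(4)])
  have "(LINT x|lborel. chi e x * Q x) + 2 * (LINT x|lborel. psi e x * Lam x) - W e =
    (LINT x|lborel. psi e x * (\<Sum>i\<in>UNIV. zb i x * P i x)) - (LINT x|lborel. psi e x * (DD x + k\<^sup>2 * uu x)) + (LINT x|lborel. psi e x * (2 * Lam x))"
    unfolding flux_identity[OF e] W_def by (simp add: mult.left_commute)
  also have "\<dots> = (LINT x|lborel. psi e x * ((\<Sum>i\<in>UNIV. zb i x * P i x) - (DD x + k\<^sup>2 * uu x) + 2 * Lam x))"
    using pI[OF bP] pI[OF b1(1)] pI[OF b1(4)]
    by (simp only: distrib_left right_diff_distrib Bochner_Integration.integral_add Bochner_Integration.integral_diff Bochner_Integration.integrable_diff Bochner_Integration.integrable_add)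
  finally have "\<bar>(LINT x|lborel. chi e x * Q x) + 2 * (LINT x|lborel. psi e x * Lam x) - W e\<bar> =
    norm (LINT x|lborel. psi e x * ((\<Sum>i\<in>UNIV. zb i x * P i x) - (DD x + k\<^sup>2 * uu x) + 2 * Lam x))"
    by simp
  also have "\<dots> \<le> (LINT x|lborel. (8 + k\<^sup>2) * (psi e x * (yb x * (DD x + uu x))))"
  proof (rule Bochner_Integration.integral_norm_bound_integral[OF pI[OF bR]])
    show "integrable lborel (\<lambda>x. (8 + k\<^sup>2) * (psi e x * (yb x * (DD x + uu x))))"
      using pI[OF b1(2)] by simp
    fix x
    have "norm (psi e x * ((\<Sum>i\<in>UNIV. zb i x * P i x) - (DD x + k\<^sup>2 * uu x) + 2 * Lam x)) \<le>
       psi e x * ((8 + k\<^sup>2) * (yb x * (DD x + uu x)))"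
      using mult_left_mono[OF remainder_bound psi_nonneg[OF e]] psi_nonneg[OF e] by (simp add: abs_mult)
    then show "norm (psi e x * ((\<Sum>i\<in>UNIV. zb i x * P i x) - (DD x + k\<^sup>2 * uu x) + 2 * Lam x)) \<le> (8 + k\<^sup>2) * (psi e x * (yb x * (DD x + uu x)))"
      by (simp only: mult.left_commute)
  qed
  finally show ?thesis by simp
qed

lemma chi_Q_bound:
  assumes e: "e > 0"
  shows "(LINT x|lborel. chi e x * Q x) \<le> (9 + 2 * k\<^sup>2) * V e"
proof -
  note pI = psi_integrable[OF e]
  have b1: "bc (\<lambda>x. DD x + k\<^sup>2 * uu x)" "bc (\<lambda>x. yb x * (DD x + uu x))" "bc (\<lambda>x. DD x + uu x)"
    using bc_forms by (auto intro!: bc_add bc_mult bc_const)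
  have n: "0 \<le> DD x + uu x" for x using forms_nonneg[of x] by simp
  have 1: "(LINT x|lborel. psi e x * (yb x * (DD x + uu x))) \<le> V e"
    unfolding V_def
  proof (rule integral_mono[OF pI[OF b1(2)] pI[OF b1(3)]])
    fix x show "psi e x * (yb x * (DD x + uu x)) \<le> psi e x * (DD x + uu x)"
      using yb_bounds[of x] n[of x] psi_nonneg[OF e] by (intro mult_left_mono mult_left_le_one_le) auto
  qed
  have 2: "W e \<le> (1 + k\<^sup>2) * V e"
    unfolding V_def W_def integral_mult_right_zero[symmetric]
  proof (rule integral_mono[OF pI[OF b1(1)]])
    show "integrable lborel (\<lambda>x. (1 + k\<^sup>2) * (psi e x * (DD x + uu x)))" using pI[OF b1(3)] by simp
    fix x
    have "DD x + k\<^sup>2 * uu x \<le> (1 + k\<^sup>2) * (DD x + uu x)" using forms_nonneg[of x] by (simp add: algebra_simps)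
    then show "psi e x * (DD x + k\<^sup>2 * uu x) \<le> (1 + k\<^sup>2) * (psi e x * (DD x + uu x))"
      using mult_left_mono[OF _ psi_nonneg[OF e]] by (metis mult.left_commute)
  qed
  have 3: "0 \<le> (LINT x|lborel. psi e x * Lam x)"
    by (intro integral_nonneg_AE AE_I2 mult_nonneg_nonneg psi_nonneg[OF e] forms_nonneg)
  have "(LINT x|lborel. chi e x * Q x) \<le> W e + (8 + k\<^sup>2) * (LINT x|lborel. psi e x * (yb x * (DD x + uu x)))"
    using chi_Q_eq[OF e] 3 by linarith
  also have "\<dots> \<le> (1 + k\<^sup>2) * V e + (8 + k\<^sup>2) * V e"
    using 2 mult_left_mono[OF 1, of "8 + k\<^sup>2"] by simp
  also have "\<dots> = (9 + 2 * k\<^sup>2) * V e" by (simp add: algebra_simps)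
  finally show ?thesis .
qed

lemma chi_tendsto: "(\<lambda>n. chi (1 / real (Suc n)) x) \<longlonglongrightarrow> sqrt pi / 2"
proof (rule tendsto_sandwich)
  have e: "1 / real (Suc n) > 0" for n by simp
  show "\<forall>\<^sub>F n in sequentially. sqrt pi / 2 - sqrt (1 / real (Suc n)) * bracket x \<le> chi (1 / real (Suc n)) x"
    unfolding chi_def using bracket_pos[of x] by (intro always_eventually allI gtail_lower mult_nonneg_nonneg) auto
  show "\<forall>\<^sub>F n in sequentially. chi (1 / real (Suc n)) x \<le> sqrt pi / 2"
    by (intro always_eventually allI chi_bounds(3) e)
  have "(\<lambda>n. sqrt pi / 2 - sqrt (1 / real (Suc n)) * bracket x) \<longlonglongrightarrow> sqrt pi / 2 - sqrt 0 * bracket x"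
    by (intro tendsto_intros LIMSEQ_Suc[OF lim_1_over_n])
  then show "(\<lambda>n. sqrt pi / 2 - sqrt (1 / real (Suc n)) * bracket x) \<longlonglongrightarrow> sqrt pi / 2" by simp
qed simp

text \<open>The flux is at most a multiple of the Gaussian energy, so the integrals against the cutoffs stay
  bounded; as \<open>Q\<close> is nonnegative, the lemma of Fatou applies.\<close>

lemma Q_integrable:
  assumes K: "\<And>e. e > 0 \<Longrightarrow> V e \<le> K"
  shows "integrable lborel Q" "(LINT x|lborel. Q x) \<le> 2 / sqrt pi * ((9 + 2 * k\<^sup>2) * K)"
proof -
  define C where "C = (9 + 2 * k\<^sup>2) * K"
  let ?e = "\<lambda>n. 1 / real (Suc n)"
  have e: "?e n > 0" for n by simp
  have [measurable]: "Q \<in> borel_measurable borel" using bc_measurable[OF bc_forms(6)] .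
  have [measurable]: "chi (?e n) \<in> borel_measurable borel" for n
    by (rule borel_measurable_continuous_onI[OF chi_continuous[OF e]])
  have bound: "(\<integral>\<^sup>+x. ennreal (chi (?e n) x * Q x) \<partial>lborel) \<le> ennreal C" for n
  proof -
    have "(\<integral>\<^sup>+x. ennreal (chi (?e n) x * Q x) \<partial>lborel) = ennreal (LINT x|lborel. chi (?e n) x * Q x)"
      using forms_nonneg chi_bounds(1)[OF e] by (intro nn_integral_eq_integral chi_integrable[OF e bc_forms(6)]) auto
    also have "\<dots> \<le> ennreal C"
      unfolding C_def using chi_Q_bound[OF e, of n] mult_left_mono[OF K[OF e[of n]], of "9 + 2 * k\<^sup>2"]
      by (intro ennreal_leI) simp
    finally show ?thesis .
  qed
  have meas: "(\<lambda>x. ennreal (chi (?e n) x * Q x)) \<in> borel_measurable borel" for n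
    by measurable
  have lim: "liminf (\<lambda>n. ennreal (chi (?e n) x * Q x)) = ennreal (sqrt pi / 2 * Q x)" for x
    by (intro lim_imp_Liminf tendsto_ennrealI tendsto_mult chi_tendsto tendsto_const) simp
  have "(\<integral>\<^sup>+x. ennreal (sqrt pi / 2 * Q x) \<partial>lborel) \<le> liminf (\<lambda>n. \<integral>\<^sup>+x. ennreal (chi (?e n) x * Q x) \<partial>lborel)"
    unfolding lim[symmetric] by (rule nn_integral_liminf) (simp only: measurable_lborel2 meas)
  also have "\<dots> \<le> ennreal C"
    by (rule Liminf_le) (use bound in auto)
  finally have nn: "(\<integral>\<^sup>+x. ennreal (sqrt pi / 2 * Q x) \<partial>lborel) \<le> ennreal C" .
  have I: "integrable lborel (\<lambda>x. sqrt pi / 2 * Q x)"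
    by (rule integrableI_bounded) (use nn forms_nonneg in \<open>auto simp: abs_mult ennreal_less_top le_less_trans\<close>)
  show J: "integrable lborel Q"
    using integrable_mult_right[OF I, of "2 / sqrt pi"] by (simp add: field_simps)
  have C0: "C \<ge> 0"
  proof -
    have "0 \<le> (LINT x|lborel. chi 1 x * Q x)"
      using forms_nonneg chi_bounds(1)[of 1] by (intro integral_nonneg_AE) auto
    also have "\<dots> \<le> (9 + 2 * k\<^sup>2) * V 1" by (rule chi_Q_bound) simp
    also have "\<dots> \<le> C" unfolding C_def using K[of 1] by (intro mult_left_mono) auto
    finally show ?thesis .
  qed
  have "ennreal (LINT x|lborel. sqrt pi / 2 * Q x) \<le> ennreal C"
    using nn nn_integral_eq_integral[OF I] forms_nonneg by simp
  then have "(LINT x|lborel. sqrt pi / 2 * Q x) \<le> C"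
    using C0 by simp
  then have "sqrt pi / 2 * (LINT x|lborel. Q x) \<le> C" by simp
  then have "2 / sqrt pi * (sqrt pi / 2 * (LINT x|lborel. Q x)) \<le> 2 / sqrt pi * C"
    by (rule mult_left_mono) simp
  then show "(LINT x|lborel. Q x) \<le> 2 / sqrt pi * ((9 + 2 * k\<^sup>2) * K)"
    unfolding C_def by simp
qed

text \<open>From $v \le 1 + v^2 \le e^{v^2}$.\<close>

lemma psi_le_yb:
  assumes e: "e > 0" shows "psi e x \<le> yb x"
proof -
  define v where "v = sqrt e * bracket x"
  have v: "v \<ge> 0" using e bracket_pos[of x] by (simp add: v_def less_imp_le)
  have "v \<le> 1 + v\<^sup>2"
    using zero_le_power2[of "v - 1"] v by (simp add: power2_eq_square algebra_simps)
  also have "\<dots> \<le> exp (v\<^sup>2)" by (rule exp_ge_add_one_self)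
  finally have "v * exp (- v\<^sup>2) \<le> exp (v\<^sup>2) * exp (- v\<^sup>2)" by (intro mult_right_mono) auto
  then have "v * exp (- v\<^sup>2) \<le> 1" by (simp add: exp_minus)
  moreover have "psi e x * bracket x = v * exp (- v\<^sup>2)"
    using e by (simp add: psi_def v_def power_mult_distrib)
  ultimately have "psi e x * bracket x \<le> 1" by simp
  then show ?thesis using bracket_pos[of x] by (simp add: yb_def field_simps)
qed

lemma psi_tendsto_0:
  assumes m: "f \<in> borel_measurable borel" and I: "integrable lborel (\<lambda>x. yb x * f x)"
  shows "(\<lambda>n. LINT x|lborel. psi (1 / real (Suc n)) x * f x) \<longlonglongrightarrow> 0"
proof -
  let ?e = "\<lambda>n. 1 / real (Suc n)"
  have e: "?e n > 0" for n by simp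
  have [measurable]: "psi (?e n) \<in> borel_measurable borel" for n
    by (rule borel_measurable_continuous_onI[OF psi_continuous])
  note m [measurable]
  have meas: "(\<lambda>x. psi (?e n) x * f x) \<in> borel_measurable borel" for n
    by measurable
  have "(\<lambda>n. LINT x|lborel. psi (?e n) x * f x) \<longlonglongrightarrow> (LINT x|(lborel :: (real^3) measure). (0::real))"
  proof (rule integral_dominated_convergence[where w="\<lambda>x. \<bar>yb x * f x\<bar>"])
    show "integrable lborel (\<lambda>x. \<bar>yb x * f x\<bar>)" using I by simp
    show "AE x in lborel. norm (psi (?e n) x * f x) \<le> \<bar>yb x * f x\<bar>" for n
      using psi_le_yb[OF e] psi_nonneg[OF e] yb_bounds by (intro AE_I2) (auto simp: abs_mult intro!: mult_right_mono)
    show "AE x in lborel. (\<lambda>n. psi (?e n) x * f x) \<longlonglongrightarrow> 0"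
    proof (rule AE_I2)
      fix x
      have "(\<lambda>n. psi (?e n) x) \<longlonglongrightarrow> 0"
      proof (rule tendsto_sandwich)
        show "\<forall>\<^sub>F n in sequentially. 0 \<le> psi (?e n) x" using psi_nonneg[OF e] by simp
        show "\<forall>\<^sub>F n in sequentially. psi (?e n) x \<le> sqrt (?e n)"
          by (intro always_eventually allI) (auto simp: psi_def intro!: mult_left_le)
        have "(\<lambda>n. sqrt (?e n)) \<longlonglongrightarrow> sqrt 0" by (intro tendsto_intros LIMSEQ_Suc[OF lim_1_over_n])
        then show "(\<lambda>n. sqrt (?e n)) \<longlonglongrightarrow> 0" by simp
      qed simp
      then show "(\<lambda>n. psi (?e n) x * f x) \<longlonglongrightarrow> 0" by (rule tendsto_mult_left_zero)
    qed
  qed (simp_all only: measurable_lborel2 meas borel_measurable_const)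
  then show ?thesis by simp
qed

text \<open>Once \<open>Q\<close> is known to be integrable, the angular part of the flux and the remainder vanish in the
  limit, and the limit of the Gaussian energies gives the exact value of the integral. Exactness is
  what later yields a lower bound.\<close>

lemma Q_integral_eq:
  assumes K: "\<And>e. e > 0 \<Longrightarrow> V e \<le> K"
    and W: "(\<lambda>n. W (1 / real (Suc n))) \<longlonglongrightarrow> L"
    and U: "integrable lborel (\<lambda>x. yb x ^ 3 * uu x)"
  shows "sqrt pi / 2 * (LINT x|lborel. Q x) = L"
proof -
  let ?e = "\<lambda>n. 1 / real (Suc n)"
  have e: "?e n > 0" for n by simp
  have QI: "integrable lborel Q" by (rule Q_integrable(1)[OF K])
  have [measurable]: "Q \<in> borel_measurable borel" "Lam \<in> borel_measurable borel" "DD \<in> borel_measurable borel"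
      "uu \<in> borel_measurable borel" "yb \<in> borel_measurable borel"
    using bc_forms bc_yb by (auto intro: bc_measurable)
  have [measurable]: "chi (?e n) \<in> borel_measurable borel" for n
    by (rule borel_measurable_continuous_onI[OF chi_continuous[OF e]])
  have meas: "(\<lambda>x. chi (?e n) x * Q x) \<in> borel_measurable borel" "(\<lambda>x. sqrt pi / 2 * Q x) \<in> borel_measurable borel" for n
    by measurable
  note nn = forms_nonneg
  have LI: "integrable lborel (\<lambda>x. yb x * Lam x)"
    by (rule Bochner_Integration.integrable_bound[OF QI])
       (use nn yb_bounds in \<open>auto simp: Q_def abs_mult intro!: AE_I2\<close>)
  have DI: "integrable lborel (\<lambda>x. yb x ^ 3 * DD x)"
    by (rule Bochner_Integration.integrable_bound[OF QI])
       (use nn yb_bounds in \<open>auto simp: Q_def abs_mult intro!: AE_I2\<close>)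
  have F2: "integrable lborel (\<lambda>x. yb x * (yb x ^ 2 * (DD x + uu x)))"
    using Bochner_Integration.integrable_add[OF DI U] by (simp add: algebra_simps eval_nat_numeral)
  have lim1: "(\<lambda>n. LINT x|lborel. psi (?e n) x * Lam x) \<longlonglongrightarrow> 0"
    by (rule psi_tendsto_0[OF _ LI]) measurable
  have lim2: "(\<lambda>n. LINT x|lborel. psi (?e n) x * (yb x ^ 2 * (DD x + uu x))) \<longlonglongrightarrow> 0"
    by (rule psi_tendsto_0[OF _ F2]) measurable
  have b: "bc (\<lambda>x. yb x * (DD x + uu x))" "bc (\<lambda>x. DD x + uu x)" "bc (\<lambda>x. yb x ^ 2 * (DD x + uu x))"
    using bc_forms by (auto intro!: bc_add bc_mult bc_power)
  \<comment> \<open>For every positive \<open>d\<close> one has \<open>yb \<le> d + yb\<^sup>2 / (4 * d)\<close>. The first part is a small multiple of the bounded \<open>V\<close>, the second is covered by \<open>lim2\<close>.\<close>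
  have lim3: "(\<lambda>n. LINT x|lborel. psi (?e n) x * (yb x * (DD x + uu x))) \<longlonglongrightarrow> 0"
  proof (rule LIMSEQ_I)
    fix r :: real assume r: "r > 0"
    define K' where "K' = \<bar>K\<bar> + 1"
    have K': "K' > 0" "\<And>e. e > 0 \<Longrightarrow> V e \<le> K'" unfolding K'_def using K by force+
    define d where "d = r / (2 * K')"
    have d: "d > 0" using r K' by (simp add: d_def)
    have "d * r * 2 > 0" using d r by simp
    then obtain N where N: "\<And>n. n \<ge> N \<Longrightarrow> norm ((LINT x|lborel. psi (?e n) x * (yb x ^ 2 * (DD x + uu x))) - 0) < d * r * 2"
      using LIMSEQ_D[OF lim2] by blast
    show "\<exists>N. \<forall>n\<ge>N. norm ((LINT x|lborel. psi (?e n) x * (yb x * (DD x + uu x))) - 0) < r"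
    proof (intro exI allI impI)
      fix n assume n: "n \<ge> N"
      note pI = psi_integrable[OF e[of n]]
      have "(LINT x|lborel. psi (?e n) x * (yb x * (DD x + uu x))) \<le>
        (LINT x|lborel. d * (psi (?e n) x * (DD x + uu x)) + (1 / (4 * d)) * (psi (?e n) x * (yb x ^ 2 * (DD x + uu x))))"
      proof (rule integral_mono[OF pI[OF b(1)]])
        show "integrable lborel (\<lambda>x. d * (psi (?e n) x * (DD x + uu x)) + (1 / (4 * d)) * (psi (?e n) x * (yb x ^ 2 * (DD x + uu x))))"
          using pI[OF b(2)] pI[OF b(3)] by simp
        fix x
        have "0 \<le> (2 * d - yb x)\<^sup>2" by simp
        then have "4 * d * yb x \<le> 4 * d * (d + (1 / (4 * d)) * yb x ^ 2)"
          using d by (simp add: power2_eq_square algebra_simps)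
        then have "yb x \<le> d + (1 / (4 * d)) * yb x ^ 2" using d by simp
        then have "yb x * (psi (?e n) x * (DD x + uu x)) \<le> (d + (1 / (4 * d)) * yb x ^ 2) * (psi (?e n) x * (DD x + uu x))"
          using nn[of x] psi_nonneg[OF e] by (intro mult_right_mono) auto
        then show "psi (?e n) x * (yb x * (DD x + uu x)) \<le> d * (psi (?e n) x * (DD x + uu x)) + (1 / (4 * d)) * (psi (?e n) x * (yb x ^ 2 * (DD x + uu x)))"
          by (simp only: distrib_right mult_ac)
      qed
      also have "\<dots> = d * V (?e n) + (1 / (4 * d)) * (LINT x|lborel. psi (?e n) x * (yb x ^ 2 * (DD x + uu x)))"
        unfolding V_def using pI[OF b(2)] pI[OF b(3)] by simp
      also have "\<dots> < d * K' + (1 / (4 * d)) * (d * r * 2)"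
        using N[OF n] K'(2)[OF e[of n]] d by (intro add_le_less_mono mult_left_mono mult_strict_left_mono) auto
      also have "\<dots> = r" using d K' by (simp add: d_def)
      finally have "(LINT x|lborel. psi (?e n) x * (yb x * (DD x + uu x))) < r" .
      moreover have "0 \<le> (LINT x|lborel. psi (?e n) x * (yb x * (DD x + uu x)))"
        using psi_nonneg[OF e] nn yb_bounds by (intro integral_nonneg_AE) auto
      ultimately show "norm ((LINT x|lborel. psi (?e n) x * (yb x * (DD x + uu x))) - 0) < r" by simp
    qed
  qed
  have lim4: "(\<lambda>n. LINT x|lborel. chi (?e n) x * Q x) \<longlonglongrightarrow> (LINT x|lborel. sqrt pi / 2 * Q x)"
  proof (rule integral_dominated_convergence[where w="\<lambda>x. sqrt pi / 2 * Q x"])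
    show "integrable lborel (\<lambda>x. sqrt pi / 2 * Q x)" using QI by simp
    show "AE x in lborel. (\<lambda>n. chi (?e n) x * Q x) \<longlonglongrightarrow> sqrt pi / 2 * Q x"
      by (intro AE_I2 tendsto_mult chi_tendsto tendsto_const)
    show "AE x in lborel. norm (chi (?e n) x * Q x) \<le> sqrt pi / 2 * Q x" for n
    proof (rule AE_I2)
      fix x
      have "chi (?e n) x * Q x \<le> sqrt pi / 2 * Q x" by (intro mult_right_mono chi_bounds(3)[OF e] nn)
      then show "norm (chi (?e n) x * Q x) \<le> sqrt pi / 2 * Q x"
        using mult_nonneg_nonneg[OF chi_bounds(1)[OF e] nn(4)] by simp
    qed
  qed (simp_all only: measurable_lborel2 meas)
  have "(\<lambda>n. (LINT x|lborel. chi (?e n) x * Q x) + 2 * (LINT x|lborel. psi (?e n) x * Lam x) - W (?e n)) \<longlonglongrightarrow>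
     (LINT x|lborel. sqrt pi / 2 * Q x) + 2 * 0 - L"
    by (intro tendsto_intros lim4 lim1 W)
  moreover have "(\<lambda>n. (LINT x|lborel. chi (?e n) x * Q x) + 2 * (LINT x|lborel. psi (?e n) x * Lam x) - W (?e n)) \<longlonglongrightarrow> 0"
  proof (rule Lim_null_comparison[OF always_eventually])
    show "\<forall>n. norm ((LINT x|lborel. chi (?e n) x * Q x) + 2 * (LINT x|lborel. psi (?e n) x * Lam x) - W (?e n))
       \<le> (8 + k\<^sup>2) * (LINT x|lborel. psi (?e n) x * (yb x * (DD x + uu x)))"
      using chi_Q_eq[OF e] by simp
    show "(\<lambda>n. (8 + k\<^sup>2) * (LINT x|lborel. psi (?e n) x * (yb x * (DD x + uu x)))) \<longlonglongrightarrow> 0"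
      using tendsto_mult_right_zero[OF lim3] by simp
  qed
  ultimately have "(LINT x|lborel. sqrt pi / 2 * Q x) + 2 * 0 - L = 0"
    by (rule LIMSEQ_unique)
  then show ?thesis by simp
qed

text \<open>An estimate of Caccioppoli type: integrate the divergence of $s^{-3}u\nabla u$, where the derivative of
  the weight costs a factor $s^{-1}$ and is absorbed.\<close>

lemma gradient_weighted_bound:
  assumes U: "integrable lborel (\<lambda>x. yb x ^ 3 * uu x)" and DI: "integrable lborel (\<lambda>x. yb x ^ 3 * DD x)"
    and EI: "\<And>i. integrable lborel (\<lambda>x. yb x ^ 3 * (cmod (E i i x))\<^sup>2)"
  shows "(LINT x|lborel. yb x ^ 3 * DD x) \<le> (9 + 2 * k\<^sup>2) * (LINT x|lborel. yb x ^ 3 * uu x)"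
proof -
  define F where "F i x = yb x ^ 3 * (u x \<bullet> D i x)" for i x
  define F' where "F' i x = (3 * yb x ^ 2 * (- (yb x)\<^sup>2 * zb i x)) * (u x \<bullet> D i x) + yb x ^ 3 * (D i x \<bullet> D i x + u x \<bullet> E i i x)" for i x
  have bF: "bc (\<lambda>x. F i x)" "bc (\<lambda>x. F' i x)" for i
    unfolding F_def F'_def by (intro bc_add bc_mult bc_power bc_const bc_uminus bc_yb bc_zb bc_inner bcc)+
  note y = yb_bounds
  have prod: "\<bar>a \<bullet> b\<bar> \<le> (cmod a)\<^sup>2 + (cmod b)\<^sup>2" for a b :: complex
  proof -
    have "\<bar>a \<bullet> b\<bar> \<le> cmod a * cmod b" by (rule Cauchy_Schwarz_ineq2)
    also have "\<dots> \<le> (cmod a)\<^sup>2 + (cmod b)\<^sup>2"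
      using sum_squares_bound[of "cmod a" "cmod b"] mult_nonneg_nonneg[OF norm_ge_zero[of a] norm_ge_zero[of b]]
      unfolding mult.assoc by linarith
    finally show ?thesis .
  qed
  have Di: "integrable lborel (\<lambda>x. yb x ^ 3 * (cmod (D i x))\<^sup>2)" for i
  proof (rule Bochner_Integration.integrable_bound[OF DI])
    show "(\<lambda>x. yb x ^ 3 * (cmod (D i x))\<^sup>2) \<in> borel_measurable lborel"
      using bc_measurable[OF bc_mult[OF bc_power[OF bc_yb(1), of 3] bc_inner[OF bcc(2) bcc(2), of i i]]]
      by (simp add: power2_norm_eq_inner)
    have "D i x \<bullet> D i x \<le> DD x" for x
      unfolding DD_def by (rule member_le_sum) auto
    then show "AE x in lborel. norm (yb x ^ 3 * (cmod (D i x))\<^sup>2) \<le> norm (yb x ^ 3 * DD x)"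
      using y forms_nonneg by (intro AE_I2) (auto simp: abs_mult power2_norm_eq_inner abs_of_nonneg intro!: mult_left_mono)
  qed
  have Uc: "integrable lborel (\<lambda>x. yb x ^ 3 * (cmod (u x))\<^sup>2)"
    using U by (simp add: uu_def power2_norm_eq_inner)
  have pI: "integrable lborel (\<lambda>x. yb x ^ 3 * (f x \<bullet> g x))"
    if "integrable lborel (\<lambda>x. yb x ^ 3 * (cmod (f x))\<^sup>2)" "integrable lborel (\<lambda>x. yb x ^ 3 * (cmod (g x))\<^sup>2)" "bcc f" "bcc g" for f g
  proof (rule Bochner_Integration.integrable_bound[OF Bochner_Integration.integrable_add[OF that(1,2)]])
    show "(\<lambda>x. yb x ^ 3 * (f x \<bullet> g x)) \<in> borel_measurable lborel"
      using bc_measurable[OF bc_mult[OF bc_power[OF bc_yb(1), of 3] bc_inner[OF that(3,4)]]] by simp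
    show "AE x in lborel. norm (yb x ^ 3 * (f x \<bullet> g x)) \<le> norm (yb x ^ 3 * (cmod (f x))\<^sup>2 + yb x ^ 3 * (cmod (g x))\<^sup>2)"
    proof (rule AE_I2)
      fix x
      have "yb x ^ 3 * \<bar>f x \<bullet> g x\<bar> \<le> yb x ^ 3 * ((cmod (f x))\<^sup>2 + (cmod (g x))\<^sup>2)"
        using prod y by (intro mult_left_mono) auto
      then show "norm (yb x ^ 3 * (f x \<bullet> g x)) \<le> norm (yb x ^ 3 * (cmod (f x))\<^sup>2 + yb x ^ 3 * (cmod (g x))\<^sup>2)"
        using y(3)[of x] by (simp add: abs_mult algebra_simps)
    qed
  qed
  have I1: "integrable lborel (F i)" for i
    unfolding F_def by (rule pI[OF Uc Di bcc(1,2)])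
  have I2: "integrable lborel (\<lambda>x. yb x ^ 3 * (u x \<bullet> E i i x))" for i
    by (rule pI[OF Uc EI bcc(1,3)])
  have I3: "integrable lborel (\<lambda>x. yb x * zb i x * F i x)" for i
  proof (rule Bochner_Integration.integrable_bound[OF I1[of i]])
    show "(\<lambda>x. yb x * zb i x * F i x) \<in> borel_measurable lborel"
      using bc_measurable[OF bc_mult[OF bc_mult[OF bc_yb(1) bc_zb(1)] bF(1)], of i i] by simp
    show "AE x in lborel. norm (yb x * zb i x * F i x) \<le> norm (F i x)"
    proof (rule AE_I2)
      fix x
      have "\<bar>yb x * zb i x\<bar> \<le> 1 * 1" unfolding abs_mult using y[of x] zb_le1[of i x] by (intro mult_mono) auto
      then show "norm (yb x * zb i x * F i x) \<le> norm (F i x)"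
        by (simp add: abs_mult mult_left_le_one_le)
    qed
  qed
  have Dii: "integrable lborel (\<lambda>x. yb x ^ 3 * (D i x \<bullet> D i x))" for i
    using Di[of i] by (simp add: power2_norm_eq_inner)
  have F'_eq: "F' i x = (- 3) * (yb x * zb i x * F i x) + (yb x ^ 3 * (D i x \<bullet> D i x) + yb x ^ 3 * (u x \<bullet> E i i x))" for i x
    by (simp add: F'_def F_def algebra_simps eval_nat_numeral)
  have I4: "integrable lborel (F' i)" for i
    unfolding F'_eq by (intro Bochner_Integration.integrable_add Bochner_Integration.integrable_mult_right I3 Dii I2)
  have z: "(LINT x|lborel. F' i x) = 0" for i
  proof (rule integral_partial_derivative_zero[OF _ I1 I4])
    show "((\<lambda>t. F i (x + t *\<^sub>R axis i 1)) has_real_derivative F' i x) (at 0)" for x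
    proof -
      have "line_deriv i (\<lambda>x. F i x) (F' i x) x"
        unfolding F_def F'_def by (intro line_deriv_mult line_deriv_inner line_deriv_yb_powers)
      then show ?thesis by (simp only: line_deriv_def)
    qed
    show "continuous_on UNIV (F' i)" using bF(2)[of i] by (simp add: bc_def)
  qed
  have S: "(\<Sum>i\<in>UNIV. F' i x) = yb x ^ 3 * DD x - k\<^sup>2 * (yb x ^ 3 * uu x) - 3 * (yb x ^ 4 * XX x)" for x
  proof -
    have "(\<Sum>i\<in>UNIV. F' i x) = yb x ^ 3 * DD x + yb x ^ 3 * (u x \<bullet> (\<Sum>i\<in>UNIV. E i i x)) - 3 * (yb x ^ 4 * XX x)"
      unfolding F'_eq F_def DD_def XX_def sum_3 inner_add_right by (simp add: algebra_simps eval_nat_numeral)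
    then show ?thesis unfolding helmholtz by (simp add: uu_def)
  qed
  have "0 = (LINT x|lborel. (\<Sum>i\<in>UNIV. F' i x))"
    using I4 z by (simp add: Bochner_Integration.integral_sum)
  also have "\<dots> \<ge> (LINT x|lborel. (1/2) * (yb x ^ 3 * DD x) - (9/2 + k\<^sup>2) * (yb x ^ 3 * uu x))"
  proof (rule integral_mono)
    show "integrable lborel (\<lambda>x. (1/2) * (yb x ^ 3 * DD x) - (9/2 + k\<^sup>2) * (yb x ^ 3 * uu x))"
      using U DI by simp
    show "integrable lborel (\<lambda>x. \<Sum>i\<in>UNIV. F' i x)" using I4 by simp
    fix x
    have "XX x \<le> (1/6) * DD x + 3/2 * uu x" using XX_bound[of "1/6" x] by simp
    then have "yb x ^ 4 * XX x \<le> yb x ^ 4 * ((1/6) * DD x + 3/2 * uu x)"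
      using y(3)[of x] by (intro mult_left_mono) auto
    also have "\<dots> \<le> yb x ^ 3 * ((1/6) * DD x + 3/2 * uu x)"
      using power_decreasing[of 3 4 "yb x"] y[of x] forms_nonneg[of x] by (intro mult_right_mono) auto
    finally show "(1/2) * (yb x ^ 3 * DD x) - (9/2 + k\<^sup>2) * (yb x ^ 3 * uu x) \<le> (\<Sum>i\<in>UNIV. F' i x)"
      unfolding S by (simp add: algebra_simps)
  qed
  finally have "(LINT x|lborel. (1/2) * (yb x ^ 3 * DD x) - (9/2 + k\<^sup>2) * (yb x ^ 3 * uu x)) \<le> 0" .
  moreover have "(LINT x|lborel. (1/2) * (yb x ^ 3 * DD x) - (9/2 + k\<^sup>2) * (yb x ^ 3 * uu x)) =
    (1/2) * (LINT x|lborel. yb x ^ 3 * DD x) - (9/2 + k\<^sup>2) * (LINT x|lborel. yb x ^ 3 * uu x)"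
    using Bochner_Integration.integral_diff[OF integrable_mult_right[OF DI, of "1/2"] integrable_mult_right[OF U, of "9/2 + k\<^sup>2"]]
    unfolding integral_mult_right_zero by simp
  ultimately show ?thesis by (simp add: algebra_simps)
qed

end

section \<open>Weighted norms of a single wave\<close>

text \<open>Integrability is a separate predicate because the integral of a function that is not integrable is 0.\<close>

definition wint :: "(real^3 \<Rightarrow> complex) \<Rightarrow> bool" where
  "wint f \<longleftrightarrow> integrable lborel (\<lambda>x. yb x ^ 3 * (cmod (f x))\<^sup>2)"

definition wsq :: "(real^3 \<Rightarrow> complex) \<Rightarrow> real" where
  "wsq f = (LINT x|lborel. yb x ^ 3 * (cmod (f x))\<^sup>2)"

text \<open>The generator of the rotations in the plane of the coordinates \<open>i\<close> and \<open>j\<close>. These vector fields are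
  globally defined and span the directions tangential to the spheres around the origin.\<close>

definition rot :: "3 \<Rightarrow> 3 \<Rightarrow> (real^3 \<Rightarrow> complex) \<Rightarrow> real^3 \<Rightarrow> complex" where
  "rot i j f x = (x$i) *\<^sub>R pd j f x - (x$j) *\<^sub>R pd i f x"

definition hint :: "(real^3 \<Rightarrow> complex) \<Rightarrow> bool" where
  "hint f \<longleftrightarrow> wint f \<and> (\<forall>i j. wint (rot i j f))"

text \<open>The scalar version of the squared norm in question. Each pair of indices occurs twice, whence the
  factor one half.\<close>

definition hsq :: "(real^3 \<Rightarrow> complex) \<Rightarrow> real" where
  "hsq f = wsq f + (\<Sum>i\<in>UNIV. \<Sum>j\<in>UNIV. wsq (rot i j f)) / 2"

lemma wsq_nonneg: "wsq f \<ge> 0"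
  unfolding wsq_def using yb_bounds by (intro integral_nonneg_AE AE_I2 mult_nonneg_nonneg) auto

lemma hsq_nonneg: "hsq f \<ge> 0"
  unfolding hsq_def by (intro add_nonneg_nonneg divide_nonneg_pos sum_nonneg wsq_nonneg) auto

lemma wave_cong:
  assumes "\<And>\<xi>. \<xi> \<in> space sphere_measure \<Longrightarrow> g \<xi> = h \<xi>"
  shows "wave k g = wave k h"
  unfolding wave_def by (intro ext Bochner_Integration.integral_cong) (auto simp: assms)

lemma wave_cmult: "wave k (\<lambda>\<xi>. c * g \<xi>) x = c * wave k g x"
  by (simp add: wave_def mult.left_commute)

lemma wave_add:
  assumes "integrable sphere_measure g" "integrable sphere_measure h"
  shows "wave k (\<lambda>\<xi>. g \<xi> + h \<xi>) x = wave k g x + wave k h x"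
  unfolding wave_def by (simp add: distrib_left Bochner_Integration.integral_add wave_integrable assms)

lemma wave_sum:
  assumes "\<And>i::3. integrable sphere_measure (g i)"
  shows "wave k (\<lambda>\<xi>. \<Sum>i\<in>UNIV. g i \<xi>) x = (\<Sum>i\<in>UNIV. wave k (g i) x)"
  unfolding sum_3 by (simp add: wave_add assms Bochner_Integration.integrable_add)

lemma wave_bcc:
  assumes "integrable sphere_measure g" shows "bcc (wave k g)"
  unfolding bcc_def using wave_continuous[OF assms] norm_wave_le by blast

lemma dens_comm: "dens k i (dens k j g) = dens k j (dens k i g)"
  by (simp add: dens_def fun_eq_iff mult.left_commute)

lemma sphere_sum_sq:
  assumes "\<xi> \<in> space sphere_measure" shows "(\<Sum>i\<in>UNIV. (\<xi>$i)\<^sup>2) = 1"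
  using norm_vec3_sq[of \<xi>] sphere_norm[OF assms] by (simp add: sum_3)

lemma wave_helmholtz_sum:
  assumes g: "integrable sphere_measure g"
  shows "(\<Sum>i\<in>UNIV. wave k (dens k i (dens k i g)) x) = - (k\<^sup>2) *\<^sub>R wave k g x"
proof -
  have "(\<Sum>i\<in>UNIV. wave k (dens k i (dens k i g)) x) = wave k (\<lambda>\<xi>. \<Sum>i\<in>UNIV. dens k i (dens k i g) \<xi>) x"
    by (rule wave_sum[symmetric]) (intro dens_integrable g)
  also have "\<dots> = wave k (\<lambda>\<xi>. - of_real (k\<^sup>2) * g \<xi>) x"
  proof (rule fun_cong[OF wave_cong])
    fix \<xi> assume x: "\<xi> \<in> space sphere_measure"
    have "(\<Sum>i\<in>UNIV. dens k i (dens k i g) \<xi>) = - of_real (k\<^sup>2 * (\<Sum>i\<in>UNIV. (\<xi>$i)\<^sup>2)) * g \<xi>"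
      by (simp add: dens_def sum_3 power2_eq_square algebra_simps)
    then show "(\<Sum>i\<in>UNIV. dens k i (dens k i g) \<xi>) = - of_real (k\<^sup>2) * g \<xi>"
      unfolding sphere_sum_sq[OF x] by simp
  qed
  also have "\<dots> = - (k\<^sup>2) *\<^sub>R wave k g x"
    unfolding wave_cmult by (simp add: scaleR_conv_of_real)
  finally show ?thesis .
qed

lemma helmholtz_wave:
  assumes g: "integrable sphere_measure g"
  shows "helmholtz_solution k (wave k g) (\<lambda>i. wave k (dens k i g)) (\<lambda>i j. wave k (dens k i (dens k j g)))"
proof
  show "(wave k g has_derivative (\<lambda>h. \<Sum>i\<in>UNIV. (h$i) *\<^sub>R wave k (dens k i g) x)) (at x)" for x
    by (rule wave_has_derivative[OF g])
  show "(wave k (dens k j g) has_derivative (\<lambda>h. \<Sum>i\<in>UNIV. (h$i) *\<^sub>R wave k (dens k i (dens k j g)) x)) (at x)" for x j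
    by (rule wave_has_derivative[OF dens_integrable[OF g]])
  show "bcc (wave k g)" "bcc (wave k (dens k i g))" "bcc (wave k (dens k i (dens k j g)))" for i j
    by (intro wave_bcc dens_integrable g)+
  show "wave k (dens k i (dens k j g)) x = wave k (dens k j (dens k i g)) x" for i j x
    by (simp add: dens_comm)
  show "(\<Sum>i\<in>UNIV. wave k (dens k i (dens k i g)) x) = - (k\<^sup>2) *\<^sub>R wave k g x" for x
    by (rule wave_helmholtz_sum[OF g])
qed

lemma nsq_dens_sum:
  assumes g: "g \<in> L2S"
  shows "(\<Sum>i\<in>UNIV. nsq (dens k i g)) = k\<^sup>2 * nsq g"
proof -
  have I: "integrable sphere_measure (\<lambda>\<xi>. (cmod (dens k i g \<xi>))\<^sup>2)" for i
    using L2S_dens[OF g] by (simp add: L2S_def)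
  have "(\<Sum>i\<in>UNIV. nsq (dens k i g)) = (LINT \<xi>|sphere_measure. (\<Sum>i\<in>UNIV. (cmod (dens k i g \<xi>))\<^sup>2))"
    unfolding nsq_def by (rule Bochner_Integration.integral_sum[symmetric]) (rule I)
  also have "\<dots> = (LINT \<xi>|sphere_measure. k\<^sup>2 * (cmod (g \<xi>))\<^sup>2)"
  proof (intro Bochner_Integration.integral_cong refl)
    fix \<xi> assume x: "\<xi> \<in> space sphere_measure"
    have "(\<Sum>i\<in>UNIV. (cmod (dens k i g \<xi>))\<^sup>2) = (k\<^sup>2 * (\<Sum>i\<in>UNIV. (\<xi>$i)\<^sup>2)) * (cmod (g \<xi>))\<^sup>2"
      by (simp add: dens_def norm_mult power_mult_distrib sum_3 algebra_simps)
    then show "(\<Sum>i\<in>UNIV. (cmod (dens k i g \<xi>))\<^sup>2) = k\<^sup>2 * (cmod (g \<xi>))\<^sup>2"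
      unfolding sphere_sum_sq[OF x] by simp
  qed
  finally show ?thesis by (simp add: nsq_def)
qed

lemma nsq_dens_le: assumes "g \<in> L2S" shows "nsq (dens k i g) \<le> k\<^sup>2 * nsq g"
  unfolding nsq_dens_sum[OF assms, symmetric] by (rule member_le_sum) (auto simp: nsq_nonneg)

text \<open>The limit of the Gaussian energy is this constant times \<open>nsq g / k\<^sup>2\<close>.\<close>

definition ah_const :: real where "ah_const = 4 * sqrt pi ^ 3 * pi"

lemma ah_const_pos: "ah_const > 0"
  by (simp add: ah_const_def)

definition upper_const :: "real \<Rightarrow> real" where
  "upper_const k = 2 / sqrt pi * ((9 + 2 * k\<^sup>2) * (ah_const * (1 + 1 / k\<^sup>2)))"

lemma upper_const_nonneg: "upper_const k \<ge> 0"
  using ah_const_pos by (simp add: upper_const_def)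

context
  fixes k :: real and g :: "real^3 \<Rightarrow> complex"
  assumes k: "k \<noteq> 0" and g: "g \<in> L2S"
begin

interpretation h: helmholtz_solution k "wave k g" "\<lambda>i. wave k (dens k i g)" "\<lambda>i j. wave k (dens k i (dens k j g))"
  by (rule helmholtz_wave[OF L2S_integrable[OF g]])

lemma V_wave_bound:
  assumes e: "e > 0"
  shows "h.V e \<le> ah_const * (1 + 1 / k\<^sup>2) * nsq g"
proof -
  have ge: "gauss_energy e (wave k h) \<le> ah_const / k\<^sup>2 * nsq h" if "h \<in> L2S" for h
    using gauss_energy_wave_le[OF e k that] by (simp add: ah_const_def)
  have ge0: "gauss_energy e f \<ge> 0" for f
    unfolding gauss_energy_def using e by (intro mult_nonneg_nonneg integral_nonneg_AE) auto
  have "h.V e = exp (- e) * ((\<Sum>i\<in>UNIV. gauss_energy e (wave k (dens k i g))) + gauss_energy e (wave k g))"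
    using h.gauss_energy_forms[OF e, of 1] by (simp add: h.V_def)
  also have "\<dots> \<le> 1 * ((\<Sum>i\<in>UNIV. gauss_energy e (wave k (dens k i g))) + gauss_energy e (wave k g))"
    using e ge0 by (intro mult_right_mono add_nonneg_nonneg sum_nonneg) auto
  also have "\<dots> \<le> (\<Sum>i\<in>UNIV. ah_const / k\<^sup>2 * nsq (dens k i g)) + ah_const / k\<^sup>2 * nsq g"
    unfolding mult_1 by (intro add_mono sum_mono ge L2S_dens g)
  also have "\<dots> = ah_const * (1 + 1 / k\<^sup>2) * nsq g"
    unfolding sum_distrib_left[symmetric] nsq_dens_sum[OF g] using k by (simp add: algebra_simps)
  finally show ?thesis .
qed

lemma Q_wave: "integrable lborel h.Q" "(LINT x|lborel. h.Q x) \<le> upper_const k * nsq g"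
  using h.Q_integrable[OF V_wave_bound] by (simp_all add: upper_const_def mult.assoc)

lemma Q_parts:
  "integrable lborel (\<lambda>x. yb x * h.Lam x)" "(LINT x|lborel. yb x * h.Lam x) \<le> upper_const k * nsq g"
  "integrable lborel (\<lambda>x. yb x ^ 3 * h.DD x)" "(LINT x|lborel. yb x ^ 3 * h.DD x) \<le> upper_const k * nsq g"
proof -
  note nn = h.forms_nonneg
  have y: "0 \<le> yb x ^ n" for n x using yb_bounds(3)[of x] by simp
  have p: "0 \<le> yb x ^ 3 * h.DD x" "0 \<le> yb x * h.Lam x" "0 \<le> yb x ^ 7 * h.uu x" for x
    using nn yb_bounds by (auto intro!: mult_nonneg_nonneg)
  have le: "yb x * h.Lam x \<le> h.Q x" "yb x ^ 3 * h.DD x \<le> h.Q x" for x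
    using p[of x] by (auto simp: h.Q_def)
  show 1: "integrable lborel (\<lambda>x. yb x * h.Lam x)"
  proof (rule Bochner_Integration.integrable_bound[OF Q_wave(1)])
    show "(\<lambda>x. yb x * h.Lam x) \<in> borel_measurable lborel"
      using bc_measurable[OF bc_mult[OF bc_yb(1) h.bc_forms(5)]] by simp
  qed (use p le nn in \<open>auto intro!: AE_I2\<close>)
  show 2: "integrable lborel (\<lambda>x. yb x ^ 3 * h.DD x)"
  proof (rule Bochner_Integration.integrable_bound[OF Q_wave(1)])
    show "(\<lambda>x. yb x ^ 3 * h.DD x) \<in> borel_measurable lborel"
      using bc_measurable[OF bc_mult[OF bc_power[OF bc_yb(1)] h.bc_forms(2)]] by simp
  qed (use p le nn in \<open>auto intro!: AE_I2\<close>)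
  show "(LINT x|lborel. yb x * h.Lam x) \<le> upper_const k * nsq g"
    by (rule order_trans[OF integral_mono[OF 1 Q_wave(1)] Q_wave(2)]) (rule le)
  show "(LINT x|lborel. yb x ^ 3 * h.DD x) \<le> upper_const k * nsq g"
    by (rule order_trans[OF integral_mono[OF 2 Q_wave(1)] Q_wave(2)]) (rule le)
qed

lemma gradient_wint: "wint (wave k (dens k i g))" "wsq (wave k (dens k i g)) \<le> upper_const k * nsq g"
proof -
  have le: "(cmod (wave k (dens k i g) x))\<^sup>2 \<le> h.DD x" for x
    unfolding h.DD_def power2_norm_eq_inner by (rule member_le_sum) auto
  have le': "yb x ^ 3 * (cmod (wave k (dens k i g) x))\<^sup>2 \<le> yb x ^ 3 * h.DD x" for x
    using yb_bounds(3)[of x] by (intro mult_left_mono le) auto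
  show 1: "wint (wave k (dens k i g))"
    unfolding wint_def
  proof (rule Bochner_Integration.integrable_bound[OF Q_parts(3)])
    show "(\<lambda>x. yb x ^ 3 * (cmod (wave k (dens k i g) x))\<^sup>2) \<in> borel_measurable lborel"
      using bc_measurable[OF bc_mult[OF bc_power[OF bc_yb(1), of 3] bc_inner[OF h.bcc(2) h.bcc(2), of i i]]]
      by (simp add: power2_norm_eq_inner)
    show "AE x in lborel. norm (yb x ^ 3 * (cmod (wave k (dens k i g) x))\<^sup>2) \<le> norm (yb x ^ 3 * h.DD x)"
    proof (rule AE_I2)
      fix x
      have "0 \<le> yb x ^ 3 * (cmod (wave k (dens k i g) x))\<^sup>2" using yb_bounds(3)[of x] by simp
      then show "norm (yb x ^ 3 * (cmod (wave k (dens k i g) x))\<^sup>2) \<le> norm (yb x ^ 3 * h.DD x)"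
        using le'[of x] by simp
    qed
  qed
  show "wsq (wave k (dens k i g)) \<le> upper_const k * nsq g"
    unfolding wsq_def
    by (rule order_trans[OF integral_mono[OF 1[unfolded wint_def] Q_parts(3)] Q_parts(4)]) (rule le')
qed

lemma rot_wave: "rot i j (wave k g) x = (x$i) *\<^sub>R wave k (dens k j g) x - (x$j) *\<^sub>R wave k (dens k i g) x"
  by (simp add: rot_def pd_wave[OF L2S_integrable[OF g]])

lemma Lam_rot: "yb x * h.Lam x = (\<Sum>i\<in>UNIV. \<Sum>j\<in>UNIV. yb x ^ 3 * (cmod (rot i j (wave k g) x))\<^sup>2) / 2"
proof -
  have "zb i x *\<^sub>R wave k (dens k j g) x - zb j x *\<^sub>R wave k (dens k i g) x = yb x *\<^sub>R rot i j (wave k g) x" for i j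
    by (simp add: rot_wave zb_def scaleR_diff_right)
  then have "yb x * h.Lam x = (\<Sum>i\<in>UNIV. \<Sum>j\<in>UNIV. yb x * (yb x ^ 2 * (cmod (rot i j (wave k g) x))\<^sup>2)) / 2"
    unfolding h.Lam_eq sum_distrib_left by (simp add: power_mult_distrib sum_distrib_left)
  then show ?thesis by (simp add: power3_eq_cube power2_eq_square mult.assoc)
qed

lemma rot_wave_wint: "wint (rot i j (wave k g))"
  unfolding wint_def
proof (rule Bochner_Integration.integrable_bound[OF integrable_mult_right[OF Q_parts(1), of 2]])
  have c: "continuous_on UNIV (\<lambda>x. (x$i) *\<^sub>R wave k (dens k j g) x - (x$j) *\<^sub>R wave k (dens k i g) x)"
    by (intro continuous_intros wave_continuous dens_integrable L2S_integrable g)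
  have "continuous_on UNIV (\<lambda>x. yb x ^ 3 * (cmod (rot i j (wave k g) x))\<^sup>2)"
    unfolding rot_wave by (intro continuous_intros yb_continuous c)
  then show "(\<lambda>x. yb x ^ 3 * (cmod (rot i j (wave k g) x))\<^sup>2) \<in> borel_measurable lborel"
    by (simp add: borel_measurable_continuous_onI)
  show "AE x in lborel. norm (yb x ^ 3 * (cmod (rot i j (wave k g) x))\<^sup>2) \<le> norm (2 * (yb x * h.Lam x))"
  proof (rule AE_I2)
    fix x
    let ?f = "\<lambda>i j. yb x ^ 3 * (cmod (rot i j (wave k g) x))\<^sup>2"
    have n: "0 \<le> ?f i j" for i j using yb_bounds(3)[of x] by simp
    have "?f i j \<le> (\<Sum>j\<in>UNIV. ?f i j)" by (rule member_le_sum) (auto simp: n)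
    also have "\<dots> \<le> (\<Sum>i\<in>UNIV. \<Sum>j\<in>UNIV. ?f i j)"
      by (rule member_le_sum[where f="\<lambda>i. \<Sum>j\<in>UNIV. ?f i j"]) (auto simp: n intro!: sum_nonneg)
    also have "\<dots> = 2 * (yb x * h.Lam x)" unfolding Lam_rot by simp
    finally show "norm (?f i j) \<le> norm (2 * (yb x * h.Lam x))" using n[of i j] by simp
  qed
qed

lemma rot_wave_sum: "(\<Sum>i\<in>UNIV. \<Sum>j\<in>UNIV. wsq (rot i j (wave k g))) / 2 = (LINT x|lborel. yb x * h.Lam x)"
proof -
  have "(LINT x|lborel. yb x * h.Lam x) = (LINT x|lborel. (\<Sum>i\<in>UNIV. \<Sum>j\<in>UNIV. yb x ^ 3 * (cmod (rot i j (wave k g) x))\<^sup>2)) / 2"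
    unfolding Lam_rot by simp
  also have "(LINT x|lborel. (\<Sum>i\<in>UNIV. \<Sum>j\<in>UNIV. yb x ^ 3 * (cmod (rot i j (wave k g) x))\<^sup>2)) = (\<Sum>i\<in>UNIV. \<Sum>j\<in>UNIV. wsq (rot i j (wave k g)))"
    unfolding wsq_def using rot_wave_wint
    by (subst Bochner_Integration.integral_sum; (subst Bochner_Integration.integral_sum)?; simp add: wint_def)
  finally show ?thesis by simp
qed

end

lemma wint_add:
  assumes "wint f" "wint h" and m: "f \<in> borel_measurable borel" "h \<in> borel_measurable borel"
  shows "wint (\<lambda>x. f x + h x)" "wsq (\<lambda>x. f x + h x) \<le> 2 * wsq f + 2 * wsq h"
proof -
  have [measurable]: "yb \<in> borel_measurable borel" by (rule bc_measurable[OF bc_yb(1)])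
  note m [measurable]
  have I: "integrable lborel (\<lambda>x. 2 * (yb x ^ 3 * (cmod (f x))\<^sup>2) + 2 * (yb x ^ 3 * (cmod (h x))\<^sup>2))"
    using assms by (simp add: wint_def)
  have le: "yb x ^ 3 * (cmod (f x + h x))\<^sup>2 \<le> 2 * (yb x ^ 3 * (cmod (f x))\<^sup>2) + 2 * (yb x ^ 3 * (cmod (h x))\<^sup>2)" for x
    using mult_left_mono[OF cmod_add_sq[of "f x" "h x"], of "yb x ^ 3"] yb_bounds(3)[of x] by (simp add: algebra_simps)
  have meas: "(\<lambda>x. yb x ^ 3 * (cmod (f x + h x))\<^sup>2) \<in> borel_measurable borel" by measurable
  show J: "wint (\<lambda>x. f x + h x)"
    unfolding wint_def
  proof (rule Bochner_Integration.integrable_bound[OF I])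
    show "AE x in lborel. norm (yb x ^ 3 * (cmod (f x + h x))\<^sup>2) \<le> norm (2 * (yb x ^ 3 * (cmod (f x))\<^sup>2) + 2 * (yb x ^ 3 * (cmod (h x))\<^sup>2))"
    proof (rule AE_I2)
      fix x
      have "0 \<le> yb x ^ 3 * (cmod (f x + h x))\<^sup>2" using yb_bounds(3)[of x] by simp
      then show "norm (yb x ^ 3 * (cmod (f x + h x))\<^sup>2) \<le> norm (2 * (yb x ^ 3 * (cmod (f x))\<^sup>2) + 2 * (yb x ^ 3 * (cmod (h x))\<^sup>2))"
        using le[of x] by simp
    qed
  qed (simp add: meas)
  have "wsq (\<lambda>x. f x + h x) \<le> (LINT x|lborel. 2 * (yb x ^ 3 * (cmod (f x))\<^sup>2) + 2 * (yb x ^ 3 * (cmod (h x))\<^sup>2))"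
    unfolding wsq_def by (rule integral_mono[OF J[unfolded wint_def] I le])
  also have "\<dots> = 2 * wsq f + 2 * wsq h"
    using assms by (simp add: wsq_def wint_def)
  finally show "wsq (\<lambda>x. f x + h x) \<le> 2 * wsq f + 2 * wsq h" .
qed

lemma wint_cmult: "wint f \<Longrightarrow> wint (\<lambda>x. c * f x)" "wsq (\<lambda>x. c * f x) = (cmod c)\<^sup>2 * wsq f"
proof -
  have eq: "yb x ^ 3 * (cmod (c * f x))\<^sup>2 = (cmod c)\<^sup>2 * (yb x ^ 3 * (cmod (f x))\<^sup>2)" for x
    by (simp add: norm_mult power_mult_distrib)
  show "wint f \<Longrightarrow> wint (\<lambda>x. c * f x)" "wsq (\<lambda>x. c * f x) = (cmod c)\<^sup>2 * wsq f"
    unfolding wint_def wsq_def eq by simp_all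
qed

text \<open>The Morawetz identity controls derivatives in the weight $s^{-3}$, but the function itself only in
  $s^{-7}$. By the Helmholtz equation $u = -k^{-2}\sum_i\partial_i\partial_i u$, and each summand is a derivative of the
  wave $\partial_i u$.\<close>

lemma wave_wint:
  assumes k: "k \<noteq> 0" and g: "g \<in> L2S"
  shows "wint (wave k g)" "wsq (wave k g) \<le> (10 * upper_const k / k\<^sup>2) * nsq g"
proof -
  define w where "w i = wave k (dens k i (dens k i g))" for i
  have wi: "wint (w i)" "wsq (w i) \<le> upper_const k * (k\<^sup>2 * nsq g)" for i
  proof -
    show "wint (w i)" unfolding w_def by (rule gradient_wint(1)[OF k L2S_dens[OF g]])
    have "wsq (w i) \<le> upper_const k * nsq (dens k i g)"
      unfolding w_def by (rule gradient_wint(2)[OF k L2S_dens[OF g]])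
    also have "\<dots> \<le> upper_const k * (k\<^sup>2 * nsq g)"
      by (intro mult_left_mono nsq_dens_le g upper_const_nonneg)
    finally show "wsq (w i) \<le> upper_const k * (k\<^sup>2 * nsq g)" .
  qed
  have m: "w i \<in> borel_measurable borel" for i
    unfolding w_def by (intro wave_measurable dens_integrable L2S_integrable g)
  have eq: "wave k g = (\<lambda>x. of_real (- 1 / k\<^sup>2) * ((w 1 x + w 2 x) + w 3 x))"
  proof
    fix x
    have "w 1 x + w 2 x + w 3 x = - of_real (k\<^sup>2) * wave k g x"
      using wave_helmholtz_sum[OF L2S_integrable[OF g], of k x] by (simp add: w_def sum_3 scaleR_conv_of_real)
    then show "wave k g x = of_real (- 1 / k\<^sup>2) * ((w 1 x + w 2 x) + w 3 x)"
      using k by simp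
  qed
  have m12: "(\<lambda>x. w 1 x + w 2 x) \<in> borel_measurable borel" using m by measurable
  note a = wint_add[OF wi(1) wi(1) m m, of 1 2]
  note b = wint_add[OF a(1) wi(1) m12 m, of 3]
  show "wint (wave k g)" unfolding eq by (rule wint_cmult(1)[OF b(1)])
  \<comment> \<open>Two applications of the bound for sums give the factor $2(2 + 2) + 2 = 10$.\<close>
  have "wsq (wave k g) = (1 / k\<^sup>2)\<^sup>2 * wsq (\<lambda>x. (w 1 x + w 2 x) + w 3 x)"
    unfolding eq wint_cmult(2) by (simp only: norm_of_real power2_abs) (simp add: power_divide)
  also have "\<dots> \<le> (1 / k\<^sup>2)\<^sup>2 * (10 * (upper_const k * (k\<^sup>2 * nsq g)))"
    using a(2) b(2) wi(2)[of 1] wi(2)[of 2] wi(2)[of 3] by (intro mult_left_mono) auto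
  also have "\<dots> = (10 * upper_const k / k\<^sup>2) * nsq g"
    using k by (simp add: power2_eq_square)
  finally show "wsq (wave k g) \<le> (10 * upper_const k / k\<^sup>2) * nsq g" .
qed

lemma wave_hint: "k \<noteq> 0 \<Longrightarrow> g \<in> L2S \<Longrightarrow> hint (wave k g)"
  by (simp add: hint_def wave_wint rot_wave_wint)

lemma wave_hsq_upper:
  assumes k: "k \<noteq> 0" and g: "g \<in> L2S"
  shows "hsq (wave k g) \<le> (10 * upper_const k / k\<^sup>2 + upper_const k) * nsq g"
  using wave_wint(2)[OF k g] rot_wave_sum[OF k g] Q_parts(2)[OF k g]
  by (simp add: hsq_def distrib_right)

text \<open>The exact value of the integral of \<open>Q\<close> is a multiple of the squared norm of the density. The integral is
  at most a multiple of \<open>hsq\<close>, where the gradient term is controlled by the function itself.\<close>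

lemma wave_hsq_lower:
  assumes k: "k \<noteq> 0" and g: "g \<in> L2S"
  shows "nsq g \<le> (sqrt pi / 2 / (2 * ah_const) * (26 + 4 * k\<^sup>2)) * hsq (wave k g)"
proof -
  interpret h: helmholtz_solution k "wave k g" "\<lambda>i. wave k (dens k i g)" "\<lambda>i j. wave k (dens k i (dens k j g))"
    by (rule helmholtz_wave[OF L2S_integrable[OF g]])
  let ?e = "\<lambda>n. 1 / real (Suc n)"
  have uu: "h.uu x = (cmod (wave k g x))\<^sup>2" for x by (simp add: h.uu_def power2_norm_eq_inner)
  have U: "integrable lborel (\<lambda>x. yb x ^ 3 * h.uu x)"
    using wave_wint(1)[OF k g] by (simp add: uu wint_def)
  have fl: "filterlim ?e (at_right 0) sequentially"
    by (intro tendsto_imp_filterlim_at_right LIMSEQ_Suc[OF lim_1_over_n] always_eventually) auto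
  have geL: "(\<lambda>n. gauss_energy (?e n) (wave k f)) \<longlonglongrightarrow> ah_const / k\<^sup>2 * nsq f" if "f \<in> L2S" for f
    using filterlim_compose[OF gauss_energy_wave_tendsto[OF k that] fl] by (simp add: ah_const_def)
  have "(\<lambda>n. exp (- ?e n) * ((\<Sum>i\<in>UNIV. gauss_energy (?e n) (wave k (dens k i g))) + k\<^sup>2 * gauss_energy (?e n) (wave k g)))
     \<longlonglongrightarrow> exp (- 0) * ((\<Sum>i\<in>UNIV. ah_const / k\<^sup>2 * nsq (dens k i g)) + k\<^sup>2 * (ah_const / k\<^sup>2 * nsq g))"
    by (intro tendsto_intros geL L2S_dens g LIMSEQ_Suc[OF lim_1_over_n])
  moreover have "exp (- 0) * ((\<Sum>i\<in>UNIV. ah_const / k\<^sup>2 * nsq (dens k i g)) + k\<^sup>2 * (ah_const / k\<^sup>2 * nsq g)) = 2 * ah_const * nsq g"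
    unfolding sum_distrib_left[symmetric] nsq_dens_sum[OF g] using k by simp
  moreover have "h.W (?e n) = exp (- ?e n) * ((\<Sum>i\<in>UNIV. gauss_energy (?e n) (wave k (dens k i g))) + k\<^sup>2 * gauss_energy (?e n) (wave k g))" for n
    unfolding h.W_def by (rule h.gauss_energy_forms) simp
  ultimately have W: "(\<lambda>n. h.W (?e n)) \<longlonglongrightarrow> 2 * ah_const * nsq g" by simp
  have eq: "sqrt pi / 2 * (LINT x|lborel. h.Q x) = 2 * ah_const * nsq g"
    by (rule h.Q_integral_eq[OF V_wave_bound[OF k g] W U])
  have DI: "integrable lborel (\<lambda>x. yb x ^ 3 * h.DD x)" by (rule Q_parts(3)[OF k g])
  have LI: "integrable lborel (\<lambda>x. yb x * h.Lam x)" by (rule Q_parts(1)[OF k g])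
  have EI: "integrable lborel (\<lambda>x. yb x ^ 3 * (cmod (wave k (dens k i (dens k i g)) x))\<^sup>2)" for i
    using gradient_wint(1)[OF k L2S_dens[OF g]] by (simp add: wint_def)
  have grad: "(LINT x|lborel. yb x ^ 3 * h.DD x) \<le> (9 + 2 * k\<^sup>2) * wsq (wave k g)"
    using h.gradient_weighted_bound[OF U DI EI] by (simp add: uu wsq_def)
  have "(LINT x|lborel. h.Q x) \<le> (LINT x|lborel. 2 * (yb x ^ 3 * h.DD x) + 2 * (yb x * h.Lam x) + 15/2 * (yb x ^ 3 * h.uu x))"
  proof (rule integral_mono[OF Q_wave(1)[OF k g]])
    show "integrable lborel (\<lambda>x. 2 * (yb x ^ 3 * h.DD x) + 2 * (yb x * h.Lam x) + 15/2 * (yb x ^ 3 * h.uu x))"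
      using DI LI U by simp
    fix x
    have "yb x ^ 7 \<le> yb x ^ 3" using yb_bounds[of x] by (intro power_decreasing) auto
    then have "yb x ^ 7 * h.uu x \<le> yb x ^ 3 * h.uu x" using h.forms_nonneg(1) by (rule mult_right_mono)
    then show "h.Q x \<le> 2 * (yb x ^ 3 * h.DD x) + 2 * (yb x * h.Lam x) + 15/2 * (yb x ^ 3 * h.uu x)"
      unfolding h.Q_def mult.assoc by linarith
  qed
  also have "\<dots> = 2 * (LINT x|lborel. yb x ^ 3 * h.DD x) + 2 * (LINT x|lborel. yb x * h.Lam x) + 15/2 * (LINT x|lborel. yb x ^ 3 * h.uu x)"
    using DI LI U by simp
  also have "(LINT x|lborel. yb x ^ 3 * h.uu x) = wsq (wave k g)" by (simp add: uu wsq_def)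
  also have "(LINT x|lborel. yb x * h.Lam x) = (\<Sum>i\<in>UNIV. \<Sum>j\<in>UNIV. wsq (rot i j (wave k g))) / 2"
    by (rule rot_wave_sum[OF k g, symmetric])
  finally have "(LINT x|lborel. h.Q x) \<le> 2 * ((9 + 2 * k\<^sup>2) * wsq (wave k g)) + 2 * ((\<Sum>i\<in>UNIV. \<Sum>j\<in>UNIV. wsq (rot i j (wave k g))) / 2) + 15/2 * wsq (wave k g)"
    using grad by linarith
  also have "\<dots> \<le> (26 + 4 * k\<^sup>2) * wsq (wave k g) + (26 + 4 * k\<^sup>2) * ((\<Sum>i\<in>UNIV. \<Sum>j\<in>UNIV. wsq (rot i j (wave k g))) / 2)"
  proof -
    have s: "0 \<le> (\<Sum>i\<in>UNIV. \<Sum>j\<in>UNIV. wsq (rot i j (wave k g))) / 2" (is "0 \<le> ?s")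
      by (intro divide_nonneg_pos sum_nonneg wsq_nonneg) auto
    \<comment> \<open>Here $2(9 + 2k^2) + 15/2 \le 26 + 4k^2$.\<close>
    have "2 * ?s \<le> (26 + 4 * k\<^sup>2) * ?s" using s by (intro mult_right_mono) auto
    moreover have "2 * ((9 + 2 * k\<^sup>2) * wsq (wave k g)) + 15/2 * wsq (wave k g) \<le> (26 + 4 * k\<^sup>2) * wsq (wave k g)"
      using wsq_nonneg[of "wave k g"] by (simp add: algebra_simps)
    ultimately show ?thesis by linarith
  qed
  also have "\<dots> = (26 + 4 * k\<^sup>2) * hsq (wave k g)" by (simp add: hsq_def distrib_left)
  finally have "sqrt pi / 2 * (LINT x|lborel. h.Q x) \<le> sqrt pi / 2 * ((26 + 4 * k\<^sup>2) * hsq (wave k g))"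
    by (rule mult_left_mono) simp
  then have "2 * ah_const * nsq g \<le> sqrt pi / 2 * ((26 + 4 * k\<^sup>2) * hsq (wave k g))"
    unfolding eq .
  then have "nsq g \<le> sqrt pi / 2 * ((26 + 4 * k\<^sup>2) * hsq (wave k g)) / (2 * ah_const)"
    using ah_const_pos by (simp add: pos_le_divide_eq mult.commute mult.left_commute)
  then show ?thesis by (simp add: mult.assoc mult.commute mult.left_commute)
qed

section \<open>Separating two wave numbers\<close>

text \<open>Convolution with a Gaussian is a Fourier multiplier, so it acts on waves of wave number \<open>k\<close> as
  multiplication by a constant that depends on \<open>k\<close>, and it preserves the weighted spaces.\<close>

definition gconv :: "(real^3 \<Rightarrow> complex) \<Rightarrow> real^3 \<Rightarrow> complex" where
  "gconv f x = (LINT y|lborel. exp (- (norm y)\<^sup>2) *\<^sub>R f (x + y))"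

definition gfactor :: "real \<Rightarrow> real" where
  "gfactor k = sqrt pi ^ 3 * exp (- k\<^sup>2 / 4)"

lemma gauss1_integrable:
  fixes f :: "real^3 \<Rightarrow> 'b::{banach, second_countable_topology}"
  assumes m: "f \<in> borel_measurable borel" and b: "\<And>x. norm (f x) \<le> C * (1 + norm x)"
  shows "integrable lborel (\<lambda>y. exp (- (norm y)\<^sup>2) *\<^sub>R f y)"
proof (rule Bochner_Integration.integrable_bound)
  show "integrable lborel (\<lambda>y::real^3. exp (- (1/2) * (norm y)\<^sup>2) * (2 * C))"
    by (rule integrable_mult_left[OF gauss_integral(1)]) simp
  show "(\<lambda>y. exp (- (norm y)\<^sup>2) *\<^sub>R f y) \<in> borel_measurable lborel"
    using m by simp
  show "AE y in lborel. norm (exp (- (norm y)\<^sup>2) *\<^sub>R f y) \<le> norm (exp (- (1/2) * (norm y)\<^sup>2) * (2 * C))"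
  proof (rule AE_I2)
    fix y :: "real^3"
    have C: "C \<ge> 0" using order_trans[OF norm_ge_zero b[of 0]] by simp
    have "2 * norm y \<le> 1 + (norm y)\<^sup>2"
      using zero_le_power2[of "norm y - 1"] by (simp add: power2_eq_square algebra_simps)
    then have "norm y \<le> 1 + (norm y)\<^sup>2"
      by (rule order_trans[rotated]) simp
    then have "1 + norm y \<le> 2 * (1 + (norm y)\<^sup>2 / 2)"
      by simp
    also have "\<dots> \<le> 2 * exp ((norm y)\<^sup>2 / 2)"
      using exp_ge_add_one_self[of "(norm y)\<^sup>2 / 2"] by (rule mult_left_mono) simp
    finally have "exp (- (norm y)\<^sup>2) * (C * (1 + norm y)) \<le> exp (- (norm y)\<^sup>2) * (C * (2 * exp ((norm y)\<^sup>2 / 2)))"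
      using C by (intro mult_left_mono) auto
    also have "\<dots> = (exp (- (norm y)\<^sup>2) * exp ((norm y)\<^sup>2 / 2)) * (2 * C)" by simp
    also have "exp (- (norm y)\<^sup>2) * exp ((norm y)\<^sup>2 / 2) = exp (- (1/2) * (norm y)\<^sup>2)"
      by (simp add: exp_add[symmetric])
    finally have "exp (- (norm y)\<^sup>2) * (C * (1 + norm y)) \<le> exp (- (1/2) * (norm y)\<^sup>2) * (2 * C)" .
    moreover have "exp (- (norm y)\<^sup>2) * norm (f y) \<le> exp (- (norm y)\<^sup>2) * (C * (1 + norm y))"
      by (intro mult_left_mono b) simp
    ultimately have "exp (- (norm y)\<^sup>2) * norm (f y) \<le> exp (- (1/2) * (norm y)\<^sup>2) * (2 * C)"
      by (rule order_trans[rotated])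
    then show "norm (exp (- (norm y)\<^sup>2) *\<^sub>R f y) \<le> norm (exp (- (1/2) * (norm y)\<^sup>2) * (2 * C))"
      using C by simp
  qed
qed

interpretation lborel_sphere: pair_sigma_finite "lborel :: (real^3) measure" sphere_measure
  by (simp add: pair_sigma_finite_def lborel.sigma_finite_measure_axioms sphere.sigma_finite_measure_axioms)

lemma translate_measurable:
  fixes f :: "real^3 \<Rightarrow> 'b::topological_space"
  shows "f \<in> borel_measurable borel \<Longrightarrow> (\<lambda>y. f (x + y)) \<in> borel_measurable borel"
  by (rule measurable_compose[of "\<lambda>y. x + y" borel borel f]) auto

lemma wave_gauss_integrable:
  assumes g: "integrable sphere_measure g"
  shows "integrable lborel (\<lambda>y. exp (- (norm y)\<^sup>2) *\<^sub>R wave k g (x + y))"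
proof (rule gauss1_integrable[OF translate_measurable[OF wave_measurable[OF g]]])
  fix y :: "real^3"
  have "0 \<le> (LINT \<xi>|sphere_measure. cmod (g \<xi>))" by simp
  then show "norm (wave k g (x + y)) \<le> (LINT \<xi>|sphere_measure. cmod (g \<xi>)) * (1 + norm y)"
    using norm_wave_le[of k g "x + y"] by (simp add: distrib_left add_increasing2)
qed

lemma gconv_wave:
  assumes g: "integrable sphere_measure g"
  shows "gconv (wave k g) x = of_real (gfactor k) * wave k g x"
proof -
  define H where "H y \<xi> = exp (- (norm y)\<^sup>2) *\<^sub>R (cis (k * ((x + y) \<bullet> \<xi>)) * g \<xi>)" for y \<xi>
  have [measurable]: "(\<lambda>p. fst p) \<in> lborel \<Otimes>\<^sub>M sphere_measure \<rightarrow>\<^sub>M (borel :: (real^3) measure)"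
    using measurable_fst[of lborel sphere_measure] by simp
  have [measurable]: "(\<lambda>p. snd p) \<in> (lborel :: (real^3) measure) \<Otimes>\<^sub>M sphere_measure \<rightarrow>\<^sub>M borel"
    by (rule measurable_compose[OF measurable_snd borel_measurable_sphere_simps(3)])
  have [measurable]: "(\<lambda>p. g (snd p)) \<in> borel_measurable ((lborel :: (real^3) measure) \<Otimes>\<^sub>M sphere_measure)"
    by (rule measurable_compose[OF measurable_snd]) (use g in auto)
  have HI: "integrable (lborel \<Otimes>\<^sub>M sphere_measure) (\<lambda>p. H (fst p) (snd p))"
  proof (rule lborel_sphere.Fubini_integrable)
    show "(\<lambda>p. H (fst p) (snd p)) \<in> borel_measurable (lborel \<Otimes>\<^sub>M sphere_measure)"
      unfolding H_def by measurable
    have "(LINT \<xi>|sphere_measure. norm (H y \<xi>)) = exp (- 1 * (norm y)\<^sup>2) * (LINT \<xi>|sphere_measure. cmod (g \<xi>))" for y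
      by (simp add: H_def norm_mult)
    then show "integrable lborel (\<lambda>y. LINT \<xi>|sphere_measure. norm (H (fst (y, \<xi>)) (snd (y, \<xi>))))"
      using integrable_mult_left[OF gauss_integral(1)[of 1]] by simp
    show "AE y in lborel. integrable sphere_measure (\<lambda>\<xi>. H (fst (y, \<xi>)) (snd (y, \<xi>)))"
      using wave_integrable[OF g] by (simp add: H_def)
  qed
  have "gconv (wave k g) x = (LINT y|lborel. (LINT \<xi>|sphere_measure. H y \<xi>))"
    unfolding gconv_def wave_def H_def by simp
  also have "\<dots> = (LINT \<xi>|sphere_measure. (LINT y|lborel. H y \<xi>))"
    using lborel_sphere.Fubini_integral[of H] HI by (simp add: case_prod_unfold)
  also have "\<dots> = (LINT \<xi>|sphere_measure. of_real (gfactor k) * (cis (k * (x \<bullet> \<xi>)) * g \<xi>))"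
  proof (intro Bochner_Integration.integral_cong refl)
    fix \<xi> assume \<xi>: "\<xi> \<in> space sphere_measure"
    have "H y \<xi> = (exp (- 1 * (norm y)\<^sup>2) *\<^sub>R cis ((k *\<^sub>R \<xi>) \<bullet> y)) * (cis (k * (x \<bullet> \<xi>)) * g \<xi>)" for y
    proof -
      have "cis (k * ((x + y) \<bullet> \<xi>)) = cis ((k *\<^sub>R \<xi>) \<bullet> y) * cis (k * (x \<bullet> \<xi>))"
        by (simp add: cis_mult inner_add_left inner_commute algebra_simps)
      then show ?thesis by (simp add: H_def)
    qed
    then have "(LINT y|lborel. H y \<xi>) = (LINT y|lborel. exp (- 1 * (norm y)\<^sup>2) *\<^sub>R cis ((k *\<^sub>R \<xi>) \<bullet> y)) * (cis (k * (x \<bullet> \<xi>)) * g \<xi>)"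
      by (simp only: integral_mult_left_zero)
    also have "(LINT y|lborel. exp (- 1 * (norm y)\<^sup>2) *\<^sub>R cis ((k *\<^sub>R \<xi>) \<bullet> y)) = of_real (sqrt (pi / 1) ^ 3 * exp (- (norm (k *\<^sub>R \<xi>))\<^sup>2 / (4 * 1)))"
      by (rule gauss_fourier(2)) simp
    also have "\<dots> = of_real (gfactor k)"
      using sphere_norm[OF \<xi>] by (simp add: gfactor_def)
    finally show "(LINT y|lborel. H y \<xi>) = of_real (gfactor k) * (cis (k * (x \<bullet> \<xi>)) * g \<xi>)" .
  qed
  also have "\<dots> = of_real (gfactor k) * wave k g x"
    by (simp add: wave_def)
  finally show ?thesis .
qed

text \<open>Integration by parts, as $y_i e^{-|y|^2}$ is $-\frac12$ times the derivative of the Gaussian.\<close>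

lemma gauss_moment_wave:
  assumes g: "integrable sphere_measure g"
  shows "integrable lborel (\<lambda>y. exp (- (norm y)\<^sup>2) *\<^sub>R ((y$i) *\<^sub>R wave k g (x + y)))"
    "(LINT y|lborel. exp (- (norm y)\<^sup>2) *\<^sub>R ((y$i) *\<^sub>R wave k g (x + y))) = (1/2) *\<^sub>R gconv (wave k (dens k i g)) x"
proof -
  let ?u = "wave k g" and ?D = "wave k (dens k i g)"
  let ?A = "LINT \<xi>|sphere_measure. cmod (g \<xi>)"
  have c: "continuous_on UNIV (\<lambda>y. ?u (x + y))" "continuous_on UNIV (\<lambda>y. ?D (x + y))"
    by (intro continuous_on_compose2[OF wave_continuous] dens_integrable g continuous_intros; simp)+
  have um: "(\<lambda>y. (y$i) *\<^sub>R ?u (x + y)) \<in> borel_measurable borel"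
    by (intro borel_measurable_continuous_onI continuous_intros c)
  have Iy: "integrable lborel (\<lambda>y. exp (- (norm y)\<^sup>2) *\<^sub>R ((y$i) *\<^sub>R ?u (x + y)))"
  proof (rule gauss1_integrable[OF um])
    fix y :: "real^3"
    have "norm ((y$i) *\<^sub>R ?u (x + y)) \<le> norm y * ?A"
      using component_le_norm_cart[of y i] norm_wave_le[of k g "x + y"] by (simp add: mult_mono)
    also have "\<dots> \<le> ?A * (1 + norm y)" by (simp add: algebra_simps)
    finally show "norm ((y$i) *\<^sub>R ?u (x + y)) \<le> ?A * (1 + norm y)" .
  qed
  then show "integrable lborel (\<lambda>y. exp (- (norm y)\<^sup>2) *\<^sub>R ((y$i) *\<^sub>R wave k g (x + y)))" .
  have I0: "integrable lborel (\<lambda>y. exp (- (norm y)\<^sup>2) *\<^sub>R ?u (x + y))" by (rule wave_gauss_integrable[OF g])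
  have I1: "integrable lborel (\<lambda>y. exp (- (norm y)\<^sup>2) *\<^sub>R ?D (x + y))" by (rule wave_gauss_integrable[OF dens_integrable[OF g]])
  have uline: "((\<lambda>t. ?u (x + (y + t *\<^sub>R axis i 1))) has_vector_derivative ?D (x + y)) (at 0)" for y
    using helmholtz_solution.u_line[OF helmholtz_wave[OF g, of k], where i=i and x="x + y"] by (simp add: add.assoc)
  have eline: "((\<lambda>t. exp (- (norm (y + t *\<^sub>R axis i 1 :: real^3))\<^sup>2)) has_real_derivative - 2 * (y$i) * exp (- (norm y)\<^sup>2)) (at 0)" for y
    unfolding norm_line_sq by (auto intro!: derivative_eq_intros)
  \<comment> \<open>The derivative of the Gaussian times the translated wave in direction \<open>i\<close>.\<close>
  define G where "G y = (- 2) *\<^sub>R (exp (- (norm y)\<^sup>2) *\<^sub>R ((y$i) *\<^sub>R ?u (x + y))) + exp (- (norm y)\<^sup>2) *\<^sub>R ?D (x + y)" for y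
  have GI: "integrable lborel G" unfolding G_def by (intro Bochner_Integration.integrable_add integrable_scaleR_right Iy I1)
  have Gc: "continuous_on UNIV G" unfolding G_def by (intro continuous_intros c)
  have line: "((\<lambda>t. exp (- (norm (y + t *\<^sub>R axis i 1 :: real^3))\<^sup>2) *\<^sub>R ?u (x + (y + t *\<^sub>R axis i 1))) has_vector_derivative G y) (at 0)" for y
    using has_vector_derivative_scaleR[OF eline uline, of y y] by (simp add: G_def algebra_simps)
  have z: "(LINT y|lborel. p (G y)) = 0" if p: "bounded_linear p" for p :: "complex \<Rightarrow> real"
  proof (rule integral_partial_derivative_zero[where F="\<lambda>y. p (exp (- (norm y)\<^sup>2) *\<^sub>R ?u (x + y))" and a="axis i 1"])
    show "((\<lambda>t. p (exp (- (norm (y + t *\<^sub>R axis i 1 :: real^3))\<^sup>2) *\<^sub>R ?u (x + (y + t *\<^sub>R axis i 1)))) has_real_derivative p (G y)) (at 0)" for y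
      using bounded_linear.has_vector_derivative[OF p line] by (simp add: has_real_derivative_iff_has_vector_derivative)
    show "integrable lborel (\<lambda>y. p (exp (- (norm y)\<^sup>2) *\<^sub>R ?u (x + y)))" by (rule integrable_bounded_linear[OF p I0])
    show "integrable lborel (\<lambda>y. p (G y))" by (rule integrable_bounded_linear[OF p GI])
    show "continuous_on UNIV (\<lambda>y. p (G y))" by (rule bounded_linear.continuous_on[OF p Gc])
  qed
  have "(LINT y|lborel. G y) = 0"
    using z[OF bounded_linear_Re] z[OF bounded_linear_Im] GI by (simp add: complex_eq_iff)
  moreover have "(LINT y|lborel. G y) = (- 2) *\<^sub>R (LINT y|lborel. exp (- (norm y)\<^sup>2) *\<^sub>R ((y$i) *\<^sub>R ?u (x + y))) + gconv ?D x"
    unfolding G_def gconv_def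
    by (subst Bochner_Integration.integral_add) (use Iy I1 in \<open>auto simp del: scaleR_scaleR\<close>)
  ultimately show "(LINT y|lborel. exp (- (norm y)\<^sup>2) *\<^sub>R ((y$i) *\<^sub>R wave k g (x + y))) = (1/2) *\<^sub>R gconv (wave k (dens k i g)) x"
    by (simp add: scaleR_conv_of_real field_simps)
qed

text \<open>The coefficients of the rotation field at \<open>x + y\<close> are sums. The part with \<open>x\<close> comes out of the
  convolution; the part with \<open>y\<close> consists of first moments, which cancel because second derivatives
  commute. Rotations and convolution with a radial function commute, and this is the infinitesimal form.\<close>

lemma gconv_rot_wave:
  assumes g: "g \<in> L2S"
  shows "integrable lborel (\<lambda>y. exp (- (norm y)\<^sup>2) *\<^sub>R rot i j (wave k g) (x + y))"
    "gconv (rot i j (wave k g)) x = of_real (gfactor k) * rot i j (wave k g) x"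
proof -
  have gi: "integrable sphere_measure g" by (rule L2S_integrable[OF g])
  define A where "A l y = exp (- (norm y)\<^sup>2) *\<^sub>R wave k (dens k l g) (x + y)" for l y
  define B where "B l m y = exp (- (norm y)\<^sup>2) *\<^sub>R ((y$m) *\<^sub>R wave k (dens k l g) (x + y))" for l m y
  have AI: "integrable lborel (A l)" for l
    unfolding A_def by (rule wave_gauss_integrable[OF dens_integrable[OF gi]])
  have BI: "integrable lborel (B l m)" for l m
    unfolding B_def by (rule gauss_moment_wave(1)[OF dens_integrable[OF gi]])
  have eq: "exp (- (norm y)\<^sup>2) *\<^sub>R rot i j (wave k g) (x + y) = (x$i) *\<^sub>R A j y - (x$j) *\<^sub>R A i y + (B j i y - B i j y)" for y
    by (simp add: rot_def pd_wave[OF gi] A_def B_def algebra_simps scaleR_left_commute)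
  show "integrable lborel (\<lambda>y. exp (- (norm y)\<^sup>2) *\<^sub>R rot i j (wave k g) (x + y))"
    unfolding eq using AI BI by simp
  have Aint: "(LINT y|lborel. A l y) = of_real (gfactor k) * wave k (dens k l g) x" for l
    using gconv_wave[OF dens_integrable[OF gi]] by (simp add: A_def gconv_def)
  have Bint: "(LINT y|lborel. B l m y) = (1/2) *\<^sub>R gconv (wave k (dens k m (dens k l g))) x" for l m
    unfolding B_def by (rule gauss_moment_wave(2)[OF dens_integrable[OF gi]])
  have "gconv (rot i j (wave k g)) x = (x$i) *\<^sub>R (LINT y|lborel. A j y) - (x$j) *\<^sub>R (LINT y|lborel. A i y) + ((LINT y|lborel. B j i y) - (LINT y|lborel. B i j y))"
    unfolding gconv_def eq using AI BI by simp
  also have "\<dots> = of_real (gfactor k) * rot i j (wave k g) x"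
    unfolding Aint Bint dens_comm[of k i j] by (simp add: rot_def pd_wave[OF gi] algebra_simps)
  finally show "gconv (rot i j (wave k g)) x = of_real (gfactor k) * rot i j (wave k g) x" .
qed

lemma bracket_add: "bracket (x + y) \<le> 2 * bracket x * bracket y"
proof -
  have "(norm (x + y))\<^sup>2 \<le> (norm x + norm y)\<^sup>2" by (intro power_mono norm_triangle_ineq) simp
  also have "\<dots> \<le> 2 * (norm x)\<^sup>2 + 2 * (norm y)\<^sup>2"
    using zero_le_power2[of "norm x - norm y"] by (simp add: power2_eq_square algebra_simps)
  finally have "(bracket (x + y))\<^sup>2 \<le> 1 + (2 * (norm x)\<^sup>2 + 2 * (norm y)\<^sup>2)"
    by (simp add: bracket_sq)
  also have "\<dots> \<le> 4 * ((1 + (norm x)\<^sup>2) * (1 + (norm y)\<^sup>2))"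
  proof -
    have "0 \<le> (norm x)\<^sup>2 * (norm y)\<^sup>2" by simp
    then show ?thesis by (simp add: algebra_simps)
  qed
  also have "\<dots> = (2 * bracket x * bracket y)\<^sup>2" by (simp add: power_mult_distrib bracket_sq)
  finally show ?thesis
    by (rule power2_le_imp_le) (use bracket_pos[of x] bracket_pos[of y] in simp)
qed

lemma yb_shift: "yb (z - y) \<le> 2 * bracket y * yb z"
proof -
  have "bracket z \<le> 2 * bracket (z - y) * bracket y" using bracket_add[of "z - y" y] by simp
  then have "bracket z * (yb z * yb (z - y)) \<le> 2 * bracket (z - y) * bracket y * (yb z * yb (z - y))"
    using yb_bounds by (intro mult_right_mono) auto
  moreover have "bracket z * (yb z * yb (z - y)) = yb (z - y)" using yb_bracket(2)[of z] by (simp add: mult.assoc[symmetric])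
  moreover have "2 * bracket (z - y) * bracket y * (yb z * yb (z - y)) = (bracket (z - y) * yb (z - y)) * (2 * bracket y * yb z)" by simp
  ultimately show ?thesis unfolding yb_bracket(2) by simp
qed

lemma bracket_gauss_integrable: "integrable lborel (\<lambda>y. exp (- (norm y)\<^sup>2) * bracket y ^ 3)"
proof (rule Bochner_Integration.integrable_bound)
  show "integrable lborel (\<lambda>y::real^3. exp (- (1/2) * (norm y)\<^sup>2) * (16 * exp (1/2)))"
    by (rule integrable_mult_left[OF gauss_integral(1)]) simp
  show "(\<lambda>y. exp (- (norm y)\<^sup>2) * bracket y ^ 3) \<in> borel_measurable lborel"
    using borel_measurable_continuous_onI[OF bracket_continuous] by simp
  show "AE y in lborel. norm (exp (- (norm y)\<^sup>2) * bracket y ^ 3) \<le> norm (exp (- (1/2) * (norm y)\<^sup>2) * (16 * exp (1/2)))"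
  proof (rule AE_I2)
    fix y :: "real^3"
    let ?t = "(bracket y)\<^sup>2"
    have "bracket y ^ 3 \<le> bracket y ^ 4" using bracket_ge1 by (intro power_increasing) auto
    also have "\<dots> = 16 * (?t / 4)\<^sup>2" by (simp add: power_divide power_mult[symmetric])
    also have "\<dots> \<le> 16 * (exp (?t / 4))\<^sup>2"
    proof -
      have "?t / 4 \<le> exp (?t / 4)" using exp_ge_add_one_self[of "?t / 4"] by linarith
      then show ?thesis by (intro mult_left_mono power_mono) auto
    qed
    also have "\<dots> = 16 * exp (?t / 2)" by (simp add: exp_double[symmetric])
    also have "\<dots> = 16 * (exp (1/2) * exp ((norm y)\<^sup>2 / 2))" by (simp add: bracket_sq exp_add[symmetric] add_divide_distrib)
    finally have "exp (- (norm y)\<^sup>2) * bracket y ^ 3 \<le> exp (- (norm y)\<^sup>2) * (16 * (exp (1/2) * exp ((norm y)\<^sup>2 / 2)))"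
      by (intro mult_left_mono) auto
    also have "\<dots> = (exp (- (norm y)\<^sup>2) * exp ((norm y)\<^sup>2 / 2)) * (16 * exp (1/2))" by simp
    also have "exp (- (norm y)\<^sup>2) * exp ((norm y)\<^sup>2 / 2) = exp (- (1/2) * (norm y)\<^sup>2)" by (simp add: exp_add[symmetric])
    finally show "norm (exp (- (norm y)\<^sup>2) * bracket y ^ 3) \<le> norm (exp (- (1/2) * (norm y)\<^sup>2) * (16 * exp (1/2)))"
      using bracket_pos[of y] by simp
  qed
qed

text \<open>The factor 8 is the cube of the constant in \<open>bracket_add\<close>.\<close>

definition gconv_const :: real where
  "gconv_const = 8 * sqrt pi ^ 3 * (LINT y|(lborel :: (real^3) measure). exp (- (norm y)\<^sup>2) * bracket y ^ 3)"

lemma gconv_const_nonneg: "gconv_const \<ge> 0"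
  unfolding gconv_const_def using bracket_pos
  by (intro mult_nonneg_nonneg integral_nonneg_AE AE_I2) (auto simp: less_imp_le)

text \<open>The inequality of Cauchy and Schwarz for the Gaussian, then Fubini; shifting the weight by \<open>y\<close> costs
  a power of the bracket of \<open>y\<close>, which the Gaussian integrates.\<close>

lemma gconv_bound:
  assumes f: "wint f" and m: "f \<in> borel_measurable borel" and gm: "gconv f \<in> borel_measurable borel"
  shows "wint (gconv f)" "wsq (gconv f) \<le> gconv_const * wsq f"
proof -
  note m [measurable] gm [measurable]
  have [measurable]: "yb \<in> borel_measurable borel" "bracket \<in> borel_measurable borel"
    by (rule bc_measurable[OF bc_yb(1)], rule borel_measurable_continuous_onI[OF bracket_continuous])
  define \<gamma> where "\<gamma> y = exp (- (norm y)\<^sup>2)" for y :: "real^3"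
  have \<gamma>m [measurable]: "\<gamma> \<in> borel_measurable borel" unfolding \<gamma>_def by measurable
  have g0: "\<gamma> y \<ge> 0" for y by (simp add: \<gamma>_def)
  have \<gamma>int: "(\<integral>\<^sup>+y. ennreal (\<gamma> y) \<partial>lborel) = ennreal (sqrt pi ^ 3)"
    using nn_integral_eq_integral[OF gauss_integral(1)[of 1]] gauss_integral(2)[of 1] by (simp add: \<gamma>_def)
  have y0: "0 \<le> yb x ^ 3" for x using yb_bounds(3)[of x] by simp
  have cs: "ennreal ((cmod (gconv f x))\<^sup>2) \<le> ennreal (sqrt pi ^ 3) * (\<integral>\<^sup>+y. ennreal (\<gamma> y * (cmod (f (x + y)))\<^sup>2) \<partial>lborel)" for x
  proof -
    have tm [measurable]: "(\<lambda>y. f (x + y)) \<in> borel_measurable borel" by (rule translate_measurable[OF m])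
    have "ennreal (cmod (gconv f x)) \<le> (\<integral>\<^sup>+y. ennreal (norm (\<gamma> y *\<^sub>R f (x + y))) \<partial>lborel)"
    proof (cases "integrable lborel (\<lambda>y. \<gamma> y *\<^sub>R f (x + y))")
      case True
      then show ?thesis
        unfolding gconv_def \<gamma>_def by (rule integral_norm_bound_ennreal)
    next
      case False
      then show ?thesis by (simp add: gconv_def \<gamma>_def not_integrable_integral_eq)
    qed
    also have "\<dots> = (\<integral>\<^sup>+y. ennreal (sqrt (\<gamma> y)) * ennreal (sqrt (\<gamma> y) * cmod (f (x + y))) \<partial>lborel)"
    proof (intro nn_integral_cong)
      fix y
      have "sqrt (\<gamma> y) * (sqrt (\<gamma> y) * cmod (f (x + y))) = norm (\<gamma> y *\<^sub>R f (x + y))"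
        using g0[of y] by (simp add: mult.assoc[symmetric])
      then show "ennreal (norm (\<gamma> y *\<^sub>R f (x + y))) = ennreal (sqrt (\<gamma> y)) * ennreal (sqrt (\<gamma> y) * cmod (f (x + y)))"
        using g0[of y] by (simp add: ennreal_mult[symmetric])
    qed
    finally have "(ennreal (cmod (gconv f x)))\<^sup>2 \<le> (\<integral>\<^sup>+y. ennreal (sqrt (\<gamma> y)) * ennreal (sqrt (\<gamma> y) * cmod (f (x + y))) \<partial>lborel)\<^sup>2"
      by (intro power_mono) auto
    also have "\<dots> \<le> (\<integral>\<^sup>+y. (ennreal (sqrt (\<gamma> y)))\<^sup>2 \<partial>lborel) * (\<integral>\<^sup>+y. (ennreal (sqrt (\<gamma> y) * cmod (f (x + y))))\<^sup>2 \<partial>lborel)"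
    proof (rule Cauchy_Schwarz_nn_integral)
      show "(\<lambda>y. ennreal (sqrt (\<gamma> y))) \<in> borel_measurable lborel"
        "(\<lambda>y. ennreal (sqrt (\<gamma> y) * cmod (f (x + y)))) \<in> borel_measurable lborel"
        unfolding measurable_lborel2 by measurable
    qed
    also have "\<dots> = ennreal (sqrt pi ^ 3) * (\<integral>\<^sup>+y. ennreal (\<gamma> y * (cmod (f (x + y)))\<^sup>2) \<partial>lborel)"
      unfolding \<gamma>int[symmetric] using g0 by (simp add: ennreal_power power_mult_distrib)
    finally show ?thesis by (simp add: ennreal_power)
  qed
  define c where "c = (LINT y|(lborel :: (real^3) measure). exp (- (norm y)\<^sup>2) * bracket y ^ 3)"
  have c: "(\<integral>\<^sup>+y. ennreal (\<gamma> y * bracket y ^ 3) \<partial>lborel) = ennreal c"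
    unfolding c_def \<gamma>_def using bracket_pos
    by (intro nn_integral_eq_integral bracket_gauss_integrable) (auto simp: less_imp_le)
  have c0: "c \<ge> 0" unfolding c_def using bracket_pos
    by (intro integral_nonneg_AE AE_I2) (auto simp: less_imp_le)
  have wf: "(\<integral>\<^sup>+z. ennreal (yb z ^ 3 * (cmod (f z))\<^sup>2) \<partial>lborel) = ennreal (wsq f)"
    unfolding wsq_def using f y0 by (intro nn_integral_eq_integral) (auto simp: wint_def)
  have pm [measurable]: "(\<lambda>p. f (fst p + snd p)) \<in> borel_measurable (lborel \<Otimes>\<^sub>M lborel)"
    by (rule measurable_compose[OF _ m]) measurable
  have "(\<integral>\<^sup>+x. ennreal (yb x ^ 3 * (cmod (gconv f x))\<^sup>2) \<partial>lborel) \<le>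
    (\<integral>\<^sup>+x. ennreal (sqrt pi ^ 3) * (\<integral>\<^sup>+y. ennreal (yb x ^ 3 * (\<gamma> y * (cmod (f (x + y)))\<^sup>2)) \<partial>lborel) \<partial>lborel)"
  proof (rule nn_integral_mono)
    fix x
    have tm [measurable]: "(\<lambda>y. f (x + y)) \<in> borel_measurable borel" by (rule translate_measurable[OF m])
    have "ennreal (yb x ^ 3 * (cmod (gconv f x))\<^sup>2) \<le> ennreal (yb x ^ 3) * (ennreal (sqrt pi ^ 3) * (\<integral>\<^sup>+y. ennreal (\<gamma> y * (cmod (f (x + y)))\<^sup>2) \<partial>lborel))"
      using y0 by (subst ennreal_mult) (auto intro!: mult_left_mono cs)
    also have "\<dots> = ennreal (sqrt pi ^ 3) * (\<integral>\<^sup>+y. ennreal (yb x ^ 3) * ennreal (\<gamma> y * (cmod (f (x + y)))\<^sup>2) \<partial>lborel)"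
      by (subst nn_integral_cmult) (auto simp: mult.left_commute)
    also have "\<dots> = ennreal (sqrt pi ^ 3) * (\<integral>\<^sup>+y. ennreal (yb x ^ 3 * (\<gamma> y * (cmod (f (x + y)))\<^sup>2)) \<partial>lborel)"
      using y0 g0 by (simp add: ennreal_mult)
    finally show "ennreal (yb x ^ 3 * (cmod (gconv f x))\<^sup>2) \<le> ennreal (sqrt pi ^ 3) * (\<integral>\<^sup>+y. ennreal (yb x ^ 3 * (\<gamma> y * (cmod (f (x + y)))\<^sup>2)) \<partial>lborel)" .
  qed
  also have "\<dots> = ennreal (sqrt pi ^ 3) * (\<integral>\<^sup>+x. (\<integral>\<^sup>+y. ennreal (yb x ^ 3 * (\<gamma> y * (cmod (f (x + y)))\<^sup>2)) \<partial>lborel) \<partial>lborel)"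
    by (rule nn_integral_cmult) measurable
  also have "(\<integral>\<^sup>+x. (\<integral>\<^sup>+y. ennreal (yb x ^ 3 * (\<gamma> y * (cmod (f (x + y)))\<^sup>2)) \<partial>lborel) \<partial>lborel) =
     (\<integral>\<^sup>+y. (\<integral>\<^sup>+x. ennreal (yb x ^ 3 * (\<gamma> y * (cmod (f (x + y)))\<^sup>2)) \<partial>lborel) \<partial>lborel)"
    by (rule lborel_pair.Fubini') (simp add: case_prod_unfold)
  also have "\<dots> \<le> (\<integral>\<^sup>+y. ennreal (8 * (\<gamma> y * bracket y ^ 3)) * ennreal (wsq f) \<partial>lborel)"
  proof (rule nn_integral_mono)
    fix y :: "real^3"
    have tm [measurable]: "(\<lambda>x. f (x + y)) \<in> borel_measurable borel"
      using translate_measurable[OF m, of y] by (simp add: add.commute)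
    have "(\<integral>\<^sup>+x. ennreal (yb x ^ 3 * (\<gamma> y * (cmod (f (x + y)))\<^sup>2)) \<partial>lborel) \<le>
      (\<integral>\<^sup>+x. ennreal (8 * (\<gamma> y * bracket y ^ 3)) * ennreal (yb (x + y) ^ 3 * (cmod (f (x + y)))\<^sup>2) \<partial>lborel)"
    proof (rule nn_integral_mono)
      fix x
      have "yb x ^ 3 \<le> (2 * bracket y * yb (x + y)) ^ 3"
        using yb_shift[of "x + y" y] yb_bounds(3)[of x] by (intro power_mono) auto
      also have "\<dots> = 8 * bracket y ^ 3 * yb (x + y) ^ 3" by (simp add: power_mult_distrib)
      finally have "yb x ^ 3 * (\<gamma> y * (cmod (f (x + y)))\<^sup>2) \<le> 8 * bracket y ^ 3 * yb (x + y) ^ 3 * (\<gamma> y * (cmod (f (x + y)))\<^sup>2)"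
        using g0[of y] by (intro mult_right_mono) auto
      also have "\<dots> = (8 * (\<gamma> y * bracket y ^ 3)) * (yb (x + y) ^ 3 * (cmod (f (x + y)))\<^sup>2)" by simp
      finally show "ennreal (yb x ^ 3 * (\<gamma> y * (cmod (f (x + y)))\<^sup>2)) \<le> ennreal (8 * (\<gamma> y * bracket y ^ 3)) * ennreal (yb (x + y) ^ 3 * (cmod (f (x + y)))\<^sup>2)"
        using g0[of y] bracket_pos[of y] y0 by (subst ennreal_mult[symmetric]) (auto intro!: ennreal_leI mult_nonneg_nonneg simp: less_imp_le)
    qed
    also have "\<dots> = ennreal (8 * (\<gamma> y * bracket y ^ 3)) * (\<integral>\<^sup>+x. ennreal (yb (x + y) ^ 3 * (cmod (f (x + y)))\<^sup>2) \<partial>lborel)"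
    proof (rule nn_integral_cmult)
      have [measurable]: "(\<lambda>x. yb (x + y)) \<in> borel_measurable borel"
        using translate_measurable[of yb y] by (simp add: add.commute)
      show "(\<lambda>x. ennreal (yb (x + y) ^ 3 * (cmod (f (x + y)))\<^sup>2)) \<in> borel_measurable lborel"
        unfolding measurable_lborel2 by measurable
    qed
    also have "(\<integral>\<^sup>+x. ennreal (yb (x + y) ^ 3 * (cmod (f (x + y)))\<^sup>2) \<partial>lborel) = (\<integral>\<^sup>+x. ennreal (yb x ^ 3 * (cmod (f x))\<^sup>2) \<partial>(distr lborel borel ((+) y)))"
      by (subst nn_integral_distr) (auto simp: add.commute)
    also have "\<dots> = ennreal (wsq f)" unfolding lborel_distr_plus by (rule wf)
    finally show "(\<integral>\<^sup>+x. ennreal (yb x ^ 3 * (\<gamma> y * (cmod (f (x + y)))\<^sup>2)) \<partial>lborel) \<le> ennreal (8 * (\<gamma> y * bracket y ^ 3)) * ennreal (wsq f)" .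
  qed
  also have "\<dots> = (\<integral>\<^sup>+y. ennreal 8 * ennreal (\<gamma> y * bracket y ^ 3) \<partial>lborel) * ennreal (wsq f)"
  proof -
    have "ennreal (8 * (\<gamma> y * bracket y ^ 3)) = ennreal 8 * ennreal (\<gamma> y * bracket y ^ 3)" for y
      using g0[of y] bracket_pos[of y] by (intro ennreal_mult) auto
    moreover have "(\<lambda>y. ennreal 8 * ennreal (\<gamma> y * bracket y ^ 3)) \<in> borel_measurable lborel"
      unfolding measurable_lborel2 by measurable
    ultimately show ?thesis by (simp only:) (rule nn_integral_multc)
  qed
  also have "(\<integral>\<^sup>+y. ennreal 8 * ennreal (\<gamma> y * bracket y ^ 3) \<partial>lborel) = ennreal 8 * ennreal c"
    unfolding c[symmetric] by (rule nn_integral_cmult, unfold measurable_lborel2) measurable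
  also have "ennreal (sqrt pi ^ 3) * (ennreal 8 * ennreal c * ennreal (wsq f)) = ennreal (gconv_const * wsq f)"
    using c0 wsq_nonneg[of f] unfolding gconv_const_def c_def[symmetric]
    by (simp only: ennreal_mult[symmetric] mult_nonneg_nonneg real_sqrt_ge_zero pi_ge_zero zero_le_power zero_le_numeral mult_ac)
  finally have nn: "(\<integral>\<^sup>+x. ennreal (yb x ^ 3 * (cmod (gconv f x))\<^sup>2) \<partial>lborel) \<le> ennreal (gconv_const * wsq f)"
    by (simp add: mult_left_mono)
  have "integrable lborel (\<lambda>x. yb x ^ 3 * (cmod (gconv f x))\<^sup>2)"
  proof (rule integrableI_bounded)
    show "(\<lambda>x. yb x ^ 3 * (cmod (gconv f x))\<^sup>2) \<in> borel_measurable lborel" by simp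
    show "(\<integral>\<^sup>+x. ennreal (norm (yb x ^ 3 * (cmod (gconv f x))\<^sup>2)) \<partial>lborel) < \<infinity>"
      using le_less_trans[OF nn ennreal_less_top] y0 by simp
  qed
  then show I: "wint (gconv f)" by (simp add: wint_def)
  have "ennreal (wsq (gconv f)) \<le> ennreal (gconv_const * wsq f)"
    unfolding wsq_def[of "gconv f"] using nn nn_integral_eq_integral[OF I[unfolded wint_def]] y0 by simp
  then show "wsq (gconv f) \<le> gconv_const * wsq f"
    using mult_nonneg_nonneg[OF gconv_const_nonneg wsq_nonneg[of f]] by simp
qed

text \<open>Two eigenfunctions of the convolution with distinct eigenvalues are linear combinations of their sum
  and its convolution.\<close>

lemma separate_component:
  assumes ne: "c1 \<noteq> c2" and p: "continuous_on UNIV p" and q: "continuous_on UNIV q" and u: "wint (\<lambda>x. p x + q x)"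
    and cp: "\<And>x. gconv p x = of_real c1 * p x" and cq: "\<And>x. gconv q x = of_real c2 * q x"
    and pI: "\<And>x. integrable lborel (\<lambda>y. exp (- (norm y)\<^sup>2) *\<^sub>R p (x + y))"
    and qI: "\<And>x. integrable lborel (\<lambda>y. exp (- (norm y)\<^sup>2) *\<^sub>R q (x + y))"
  shows "wsq p \<le> (1 / (c1 - c2))\<^sup>2 * (2 * gconv_const + 2 * c2\<^sup>2) * wsq (\<lambda>x. p x + q x)"
proof -
  let ?u = "\<lambda>x. p x + q x"
  have gu: "gconv ?u x = of_real c1 * p x + of_real c2 * q x" for x
    unfolding cp[symmetric] cq[symmetric] gconv_def using pI qI by (simp add: scaleR_add_right)
  have uc: "continuous_on UNIV ?u" by (intro continuous_intros p q)
  have gc: "continuous_on UNIV (gconv ?u)"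
    unfolding gu by (intro continuous_intros p q)
  have um: "?u \<in> borel_measurable borel" "gconv ?u \<in> borel_measurable borel"
    by (intro borel_measurable_continuous_onI uc gc)+
  note b = gconv_bound[OF u um]
  have cm: "(\<lambda>x. of_real (- c2) * ?u x) \<in> borel_measurable borel"
    using um(1) by (intro borel_measurable_times borel_measurable_const)
  note a = wint_add[OF b(1) wint_cmult(1)[OF u] um(2) cm]
  have peq: "p = (\<lambda>x. of_real (1 / (c1 - c2)) * (gconv ?u x + of_real (- c2) * ?u x))"
  proof
    fix x
    have "gconv ?u x + of_real (- c2) * ?u x = of_real (c1 - c2) * p x"
      unfolding gu by (simp add: algebra_simps)
    then show "p x = of_real (1 / (c1 - c2)) * (gconv ?u x + of_real (- c2) * ?u x)"
      using ne by simp
  qed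
  have "wsq p = (1 / (c1 - c2))\<^sup>2 * wsq (\<lambda>x. gconv ?u x + of_real (- c2) * ?u x)"
    by (subst peq, subst wint_cmult(2)) (simp only: norm_of_real power2_abs)
  also have "\<dots> \<le> (1 / (c1 - c2))\<^sup>2 * (2 * (gconv_const * wsq ?u) + 2 * (c2\<^sup>2 * wsq ?u))"
  proof (rule mult_left_mono)
    have "wsq (\<lambda>x. of_real (- c2) * ?u x) = c2\<^sup>2 * wsq ?u"
      by (subst wint_cmult(2)) (simp only: norm_of_real power2_abs power2_minus)
    then show "wsq (\<lambda>x. gconv ?u x + of_real (- c2) * ?u x) \<le> 2 * (gconv_const * wsq ?u) + 2 * (c2\<^sup>2 * wsq ?u)"
      using a(2) b(2) by linarith
  qed simp
  finally show ?thesis by (simp add: algebra_simps)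
qed

lemma gfactor_inj:
  assumes "k1 > 0" "k2 > 0" "k1 \<noteq> k2" shows "gfactor k1 \<noteq> gfactor k2"
proof
  assume "gfactor k1 = gfactor k2"
  then have "k1\<^sup>2 = k2\<^sup>2" by (simp add: gfactor_def)
  then show False using assms by (simp add: power2_eq_iff)
qed

definition sep_const :: "real \<Rightarrow> real \<Rightarrow> real" where
  "sep_const k1 k2 = (1 / (gfactor k1 - gfactor k2))\<^sup>2 * (2 * gconv_const + 2 * (gfactor k2)\<^sup>2)"

lemma rot_continuous:
  assumes "g \<in> L2S" shows "continuous_on UNIV (rot i j (wave k g))"
proof -
  have "rot i j (wave k g) = (\<lambda>x. (x$i) *\<^sub>R wave k (dens k j g) x - (x$j) *\<^sub>R wave k (dens k i g) x)"
    by (simp add: rot_def pd_wave[OF L2S_integrable[OF assms]] fun_eq_iff)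
  then show ?thesis
    by (simp, intro continuous_intros wave_continuous dens_integrable L2S_integrable assms)
qed

lemma rot_add:
  assumes "a \<in> L2S" "b \<in> L2S"
  shows "rot i j (\<lambda>x. wave k1 a x + wave k2 b x) x = rot i j (wave k1 a) x + rot i j (wave k2 b) x"
proof -
  have "pd l (\<lambda>x. wave k1 a x + wave k2 b x) x = pd l (wave k1 a) x + pd l (wave k2 b) x" for l
    unfolding pd_eq_derivative[OF has_derivative_add[OF wave_has_derivative[OF L2S_integrable[OF assms(1)]] wave_has_derivative[OF L2S_integrable[OF assms(2)]]]]
      pd_eq_derivative[OF wave_has_derivative[OF L2S_integrable[OF assms(1)]]] pd_eq_derivative[OF wave_has_derivative[OF L2S_integrable[OF assms(2)]]] ..
  then show ?thesis by (simp add: rot_def algebra_simps)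
qed

lemma two_wave_hint:
  assumes k: "k1 > 0" "k2 > 0" and a: "a \<in> L2S" and b: "b \<in> L2S"
  shows "hint (\<lambda>x. wave k1 a x + wave k2 b x)" 
    "hsq (\<lambda>x. wave k1 a x + wave k2 b x) \<le> 2 * hsq (wave k1 a) + 2 * hsq (wave k2 b)"
proof -
  have k': "k1 \<noteq> 0" "k2 \<noteq> 0" using k by auto
  note h = wave_hint[OF k'(1) a] wave_hint[OF k'(2) b]
  have m: "wave k1 a \<in> borel_measurable borel" "wave k2 b \<in> borel_measurable borel"
     "rot i j (wave k1 a) \<in> borel_measurable borel" "rot i j (wave k2 b) \<in> borel_measurable borel" for i j
    by (intro wave_measurable L2S_integrable a b borel_measurable_continuous_onI rot_continuous)+
  have rw: "rot i j (\<lambda>x. wave k1 a x + wave k2 b x) = (\<lambda>x. rot i j (wave k1 a) x + rot i j (wave k2 b) x)" for i j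
    by (rule ext) (rule rot_add[OF a b])
  note w0 = wint_add[of "wave k1 a" "wave k2 b", OF _ _ m(1,2)]
  note w1 = wint_add[of "rot i j (wave k1 a)" "rot i j (wave k2 b)" for i j, OF _ _ m(3,4)]
  show "hint (\<lambda>x. wave k1 a x + wave k2 b x)"
    unfolding hint_def rw using h w0(1) w1(1) by (auto simp: hint_def)
  have "(\<Sum>i\<in>UNIV. \<Sum>j\<in>UNIV. wsq (\<lambda>x. rot i j (wave k1 a) x + rot i j (wave k2 b) x)) \<le>
     (\<Sum>i\<in>UNIV. \<Sum>j\<in>UNIV. 2 * wsq (rot i j (wave k1 a)) + 2 * wsq (rot i j (wave k2 b)))"
    using h by (intro sum_mono w1(2)) (auto simp: hint_def)
  then show "hsq (\<lambda>x. wave k1 a x + wave k2 b x) \<le> 2 * hsq (wave k1 a) + 2 * hsq (wave k2 b)"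
    using w0(2) h unfolding hsq_def rw by (simp add: hint_def sum.distrib sum_distrib_left[symmetric])
qed

text \<open>The convolution commutes with \<open>rot\<close> on waves, so separation works for each part of \<open>hsq\<close>.\<close>

lemma two_wave_separate:
  assumes k: "k1 > 0" "k2 > 0" and ne: "k1 \<noteq> k2" and a: "a \<in> L2S" and b: "b \<in> L2S"
  shows "hsq (wave k1 a) \<le> sep_const k1 k2 * hsq (\<lambda>x. wave k1 a x + wave k2 b x)"
proof -
  note gn = gfactor_inj[OF k ne]
  have ai: "integrable sphere_measure a" and bi: "integrable sphere_measure b" using a b L2S_integrable by auto
  have H: "hint (\<lambda>x. wave k1 a x + wave k2 b x)" by (rule two_wave_hint(1)[OF k a b])
  have rw: "rot i j (\<lambda>x. wave k1 a x + wave k2 b x) = (\<lambda>x. rot i j (wave k1 a) x + rot i j (wave k2 b) x)" for i j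
    by (rule ext) (rule rot_add[OF a b])
  have 1: "wsq (wave k1 a) \<le> sep_const k1 k2 * wsq (\<lambda>x. wave k1 a x + wave k2 b x)"
    unfolding sep_const_def
    by (rule separate_component[OF gn]) (use H in \<open>auto simp: hint_def intro: wave_continuous gconv_wave wave_gauss_integrable ai bi\<close>)
  have 2: "wsq (rot i j (wave k1 a)) \<le> sep_const k1 k2 * wsq (rot i j (\<lambda>x. wave k1 a x + wave k2 b x))" for i j
    unfolding sep_const_def rw
    by (rule separate_component[OF gn]) (use H in \<open>auto simp: hint_def rw intro: rot_continuous gconv_rot_wave a b\<close>)
  show ?thesis
    unfolding hsq_def distrib_left times_divide_eq_right sum_distrib_left
    by (intro add_mono 1 divide_right_mono sum_mono 2) auto
qed

section \<open>The spherical gradient in Cartesian form\<close>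

lemma frame_ortho:
  "(\<Sum>l\<in>UNIV. (e_r t p $ l) * (e_r t p $ l)) = 1"
  "e_r t p $ i * e_r t p $ l + e_theta t p $ i * e_theta t p $ l + e_phi t p $ i * e_phi t p $ l = (if i = l then 1 else 0)"
proof -
  have s: "sin t * sin t = 1 - cos t * cos t" "sin p * sin p = 1 - cos p * cos p"
    using sin_squared_eq[of t] sin_squared_eq[of p] by (auto simp: power2_eq_square)
  have a: "sin t * (sin t * z) = z - cos t * (cos t * z)" "sin p * (sin p * z) = z - cos p * (cos p * z)" for z
    unfolding mult.assoc[symmetric] s by (auto simp: algebra_simps)
  show "(\<Sum>l\<in>UNIV. (e_r t p $ l) * (e_r t p $ l)) = 1"
    by (simp add: sum_3 e_r_def algebra_simps a s)
  show "e_r t p $ i * e_r t p $ l + e_theta t p $ i * e_theta t p $ l + e_phi t p $ i * e_phi t p $ l = (if i = l then 1 else 0)"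
    using exhaust_3[of i] exhaust_3[of l]
    by (elim disjE; hypsubst) (simp_all add: e_r_def e_theta_def e_phi_def algebra_simps a s)
qed

lemma has_vector_derivative_vec3I:
  fixes f :: "real \<Rightarrow> real^3"
  assumes "\<And>i. ((\<lambda>t. f t $ i) has_real_derivative f' $ i) (at t)"
  shows "(f has_vector_derivative f') (at t)"
  unfolding has_vector_derivative_def
proof (rule has_derivative_vec3I)
  fix i show "((\<lambda>t. f t $ i) has_derivative (\<lambda>h. (h *\<^sub>R f') $ i)) (at t)"
    using assms[of i] by (simp add: has_field_derivative_def mult.commute[of _ "f' $ i"])
qed

lemma frame_derivs:
  "((\<lambda>t. e_r t p) has_vector_derivative e_theta t p) (at t)"
  "((\<lambda>t. e_theta t p) has_vector_derivative - e_r t p) (at t)"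
  "((\<lambda>t. e_phi t p) has_vector_derivative 0) (at t)"
  "((\<lambda>p. e_r t p) has_vector_derivative sin t *\<^sub>R e_phi t p) (at p)"
  "((\<lambda>p. e_theta t p) has_vector_derivative cos t *\<^sub>R e_phi t p) (at p)"
  "((\<lambda>p. e_phi t p) has_vector_derivative - (sin t *\<^sub>R e_r t p + cos t *\<^sub>R e_theta t p)) (at p)"
proof -
  note d = e_r_def e_theta_def e_phi_def
  have a: "sin t * (sin t * z) = z - cos t * (cos t * z)" for z
  proof -
    have s: "sin t * sin t = 1 - cos t * cos t" using sin_squared_eq[of t] by (simp add: power2_eq_square)
    have "sin t * (sin t * z) = (sin t * sin t) * z" by simp
    also have "\<dots> = z - cos t * (cos t * z)" unfolding s by (simp add: left_diff_distrib)
    finally show ?thesis .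
  qed
  show "((\<lambda>t. e_r t p) has_vector_derivative e_theta t p) (at t)"
  proof (rule has_vector_derivative_vec3I)
    fix i :: 3
    show "((\<lambda>t. e_r t p $ i) has_real_derivative (e_theta t p) $ i) (at t)"
      using exhaust_3[of i] by (elim disjE; hypsubst) (auto simp: d intro!: derivative_eq_intros)
  qed
  show "((\<lambda>t. e_theta t p) has_vector_derivative - e_r t p) (at t)"
  proof (rule has_vector_derivative_vec3I)
    fix i :: 3
    show "((\<lambda>t. e_theta t p $ i) has_real_derivative (- e_r t p) $ i) (at t)"
      using exhaust_3[of i] by (elim disjE; hypsubst) (auto simp: d intro!: derivative_eq_intros)
  qed
  show "((\<lambda>t. e_phi t p) has_vector_derivative 0) (at t)"
    by (simp add: d)
  show "((\<lambda>p. e_r t p) has_vector_derivative sin t *\<^sub>R e_phi t p) (at p)"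
  proof (rule has_vector_derivative_vec3I)
    fix i :: 3
    show "((\<lambda>p. e_r t p $ i) has_real_derivative (sin t *\<^sub>R e_phi t p) $ i) (at p)"
      using exhaust_3[of i] by (elim disjE; hypsubst) (auto simp: d intro!: derivative_eq_intros)
  qed
  show "((\<lambda>p. e_theta t p) has_vector_derivative cos t *\<^sub>R e_phi t p) (at p)"
  proof (rule has_vector_derivative_vec3I)
    fix i :: 3
    show "((\<lambda>p. e_theta t p $ i) has_real_derivative (cos t *\<^sub>R e_phi t p) $ i) (at p)"
      using exhaust_3[of i] by (elim disjE; hypsubst) (auto simp: d intro!: derivative_eq_intros)
  qed
  show "((\<lambda>p. e_phi t p) has_vector_derivative - (sin t *\<^sub>R e_r t p + cos t *\<^sub>R e_theta t p)) (at p)"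
  proof (rule has_vector_derivative_vec3I)
    fix i :: 3
    show "((\<lambda>p. e_phi t p $ i) has_real_derivative (- (sin t *\<^sub>R e_r t p + cos t *\<^sub>R e_theta t p)) $ i) (at p)"
      using exhaust_3[of i] by (elim disjE; hypsubst) (auto simp: d a intro!: derivative_eq_intros)
  qed
qed

lemma cdot_deriv:
  fixes U :: "real \<Rightarrow> complex^3" and E :: "real \<Rightarrow> real^3"
  assumes U: "(U has_vector_derivative U') (at t)" and E: "(E has_vector_derivative E') (at t)"
  shows "((\<lambda>t. cdot (U t) (vec_of_real (E t))) has_vector_derivative (cdot U' (vec_of_real (E t)) + cdot (U t) (vec_of_real E'))) (at t)"
proof -
  have Ui: "((\<lambda>t. U t $ i) has_vector_derivative U' $ i) (at t)" for i
    by (rule bounded_linear.has_vector_derivative[OF bounded_linear_vec_nth U])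
  have Ei: "((\<lambda>t. complex_of_real (E t $ i)) has_vector_derivative of_real (E' $ i)) (at t)" for i
    by (intro bounded_linear.has_vector_derivative[OF bounded_linear_of_real] bounded_linear.has_vector_derivative[OF bounded_linear_vec_nth E])
  have "((\<lambda>t. \<Sum>i\<in>UNIV. U t $ i * complex_of_real (E t $ i)) has_vector_derivative
     (\<Sum>i\<in>UNIV. U t $ i * of_real (E' $ i) + U' $ i * of_real (E t $ i))) (at t)"
    by (intro has_vector_derivative_sum has_vector_derivative_mult Ui Ei)
  then show ?thesis
    unfolding cdot_def vec_of_real_def by (simp add: sum.distrib add.commute)
qed

lemma sph_coords_frame: "sph_coords (r, t, p) = r *\<^sub>R e_r t p"
  by (simp add: vec_eq_iff forall_3 sph_coords_nth e_r_def)

lemma derivative_expand: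
  assumes "u differentiable (at (x::real^3))"
  shows "(u has_derivative (\<lambda>h. \<Sum>l\<in>UNIV. (h$l) *\<^sub>R pd l u x)) (at x)"
proof -
  have d: "(u has_derivative frechet_derivative u (at x)) (at x)"
    using assms frechet_derivative_works by blast
  interpret bounded_linear "frechet_derivative u (at x)" by (rule has_derivative_bounded_linear[OF d])
  have "frechet_derivative u (at x) h = (\<Sum>l\<in>UNIV. (h$l) *\<^sub>R pd l u x)" for h
  proof -
    have "h = (\<Sum>l\<in>UNIV. (h$l) *\<^sub>R axis l 1)"
      using basis_expansion[of h] by (simp add: scalar_mult_eq_scaleR)
    then have "frechet_derivative u (at x) h = frechet_derivative u (at x) (\<Sum>l\<in>UNIV. (h$l) *\<^sub>R axis l 1)" by simp
    then show ?thesis by (simp add: sum scaleR pd_def)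
  qed
  then have "frechet_derivative u (at x) = (\<lambda>h. \<Sum>l\<in>UNIV. (h$l) *\<^sub>R pd l u x)" by auto
  then show ?thesis using d by simp
qed

text \<open>The zero order terms in the definition of the spherical gradient are those that arise from
  differentiating the moving frame. They cancel, which leaves the components of the derivatives of \<open>u\<close>
  in the two angular directions; by completeness of the frame these are the projection of
  $r\nabla u$ to the tangent plane of the sphere.\<close>

lemma sph_grad_formula:
  fixes u :: "real^3 \<Rightarrow> complex^3"
  assumes u: "u differentiable (at x)" and x: "x = sph_coords (r, t, p)" and dom: "(r, t, p) \<in> sph_dom"
  shows "sph_grad u x $ i $ j = of_real r * (pd i u x $ j) -
     of_real (e_r t p $ i) * (\<Sum>l\<in>UNIV. of_real (e_r t p $ l) * (of_real r * pd l u x $ j))"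
proof -
  note ud = derivative_expand[OF u]
  have st: "sin t > 0" using dom sin_gt_zero[of t] by (auto simp: sph_dom_def)
  define Du where "Du h = (\<Sum>l\<in>UNIV. (h$l) *\<^sub>R pd l u x)" for h
  define A where "A = Du (r *\<^sub>R e_theta t p)"
  define B where "B = Du (r *\<^sub>R (sin t *\<^sub>R e_phi t p))"
  have xr: "r *\<^sub>R e_r t p = x" using x sph_coords_frame by simp
  have U1: "((\<lambda>s. u (sph_coords (r, s, p))) has_vector_derivative A) (at t)"
  proof -
    have "((\<lambda>s. r *\<^sub>R e_r s p) has_vector_derivative r *\<^sub>R e_theta t p) (at t)"
      using has_vector_derivative_scaleR[OF DERIV_const frame_derivs(1)] by simp
    then have 1: "((\<lambda>s. r *\<^sub>R e_r s p) has_derivative (\<lambda>h. h *\<^sub>R (r *\<^sub>R e_theta t p))) (at t)"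
      by (simp only: has_vector_derivative_def)
    have "((\<lambda>s. u (r *\<^sub>R e_r s p)) has_derivative (\<lambda>h. Du (h *\<^sub>R (r *\<^sub>R e_theta t p)))) (at t)"
      by (rule has_derivative_compose[OF 1]) (use ud xr in \<open>simp add: Du_def[abs_def]\<close>)
    moreover have "Du (h *\<^sub>R (r *\<^sub>R e_theta t p)) = h *\<^sub>R A" for h
      by (simp add: Du_def A_def scaleR_sum_right mult.assoc)
    ultimately show ?thesis by (simp add: has_vector_derivative_def sph_coords_frame)
  qed
  have U2: "((\<lambda>s. u (sph_coords (r, t, s))) has_vector_derivative B) (at p)"
  proof -
    have "((\<lambda>s. r *\<^sub>R e_r t s) has_vector_derivative r *\<^sub>R (sin t *\<^sub>R e_phi t p)) (at p)"
      using has_vector_derivative_scaleR[OF DERIV_const frame_derivs(4)] by simp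
    then have 1: "((\<lambda>s. r *\<^sub>R e_r t s) has_derivative (\<lambda>h. h *\<^sub>R (r *\<^sub>R (sin t *\<^sub>R e_phi t p)))) (at p)"
      by (simp only: has_vector_derivative_def)
    have "((\<lambda>s. u (r *\<^sub>R e_r t s)) has_derivative (\<lambda>h. Du (h *\<^sub>R (r *\<^sub>R (sin t *\<^sub>R e_phi t p))))) (at p)"
      by (rule has_derivative_compose[OF 1]) (use ud xr in \<open>simp add: Du_def[abs_def]\<close>)
    moreover have "Du (h *\<^sub>R (r *\<^sub>R (sin t *\<^sub>R e_phi t p))) = h *\<^sub>R B" for h
      by (simp add: Du_def B_def scaleR_sum_right mult.assoc)
    ultimately show ?thesis by (simp add: has_vector_derivative_def sph_coords_frame)
  qed
  let ?R = "e_r t p" and ?T = "e_theta t p" and ?P = "e_phi t p"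
  define c where "c a b = cdot a (vec_of_real b)" for a :: "complex^3" and b
  have clin: "c a (- b) = - c a b" "c a (b + b') = c a b + c a b'" "c a (k *\<^sub>R b) = of_real k * c a b" "c a 0 = 0" for a b b' k
    by (simp_all add: c_def cdot_def vec_of_real_def sum_3 algebra_simps)
  have ux: "u (sph_coords (r, t, p)) = u x" using x by simp
  have dt: "d_theta (sph_comp e u) r t p = c A (e t p) + c (u x) E'" if "((\<lambda>t. e t p) has_vector_derivative E') (at t)" for e E'
    unfolding d_theta_def sph_comp_def c_def ux[symmetric]
    by (rule vector_derivative_at[OF cdot_deriv[OF U1 that]])
  have dp: "d_phi (sph_comp e u) r t p = c B (e t p) + c (u x) E'" if "((\<lambda>p. e t p) has_vector_derivative E') (at p)" for e E'
    unfolding d_phi_def sph_comp_def c_def ux[symmetric]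
    by (rule vector_derivative_at[OF cdot_deriv[OF U2 that]])
  have sc: "sph_comp e u r t p = c (u x) (e t p)" for e
    by (simp add: sph_comp_def c_def ux)
  define s where "s = complex_of_real (1 / sin t)"
  have s: "s * of_real (sin t) = 1" "s * (of_real (sin t) * z) = z" "s * (of_real (cos t) * z) = z * of_real (cot t)" for z
    using st by (auto simp: s_def cot_def)
  have inv: "the_inv_into sph_dom sph_coords x = (r, t, p)"
    unfolding x by (rule the_inv_into_f_f[OF inj_on_sph_coords dom])
  have mem: "x \<in> sph_coords ` sph_dom" using x dom by blast
  have "sph_grad u x = sph_grad_coords u (r, t, p)"
    by (simp add: sph_grad_def mem inv)
  also have "\<dots> = scale_mat (c A ?R) (tensor ?T ?R) + scale_mat (c A ?T) (tensor ?T ?T) + scale_mat (c A ?P) (tensor ?T ?P)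
      + scale_mat (s * c B ?R) (tensor ?P ?R) + scale_mat (s * c B ?T) (tensor ?P ?T) + scale_mat (s * c B ?P) (tensor ?P ?P)"
    unfolding sph_grad_coords_def prod.case Let_def dt[OF frame_derivs(1)] dt[OF frame_derivs(2)] dt[OF frame_derivs(3)]
      dp[OF frame_derivs(4)] dp[OF frame_derivs(5)] dp[OF frame_derivs(6)] sc clin s_def[symmetric]
    by (simp add: algebra_simps s)
  finally have comp: "sph_grad u x $ i $ j = of_real (?T $ i) * (c A ?R * of_real (?R $ j) + c A ?T * of_real (?T $ j) + c A ?P * of_real (?P $ j))
     + of_real (?P $ i) * (s * (c B ?R * of_real (?R $ j) + c B ?T * of_real (?T $ j) + c B ?P * of_real (?P $ j)))"
    by (simp add: scale_mat_def tensor_def algebra_simps)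
  have complete: "c a ?R * of_real (?R $ j) + c a ?T * of_real (?T $ j) + c a ?P * of_real (?P $ j) = a $ j" for a
  proof -
    have "c a ?R * of_real (?R $ j) + c a ?T * of_real (?T $ j) + c a ?P * of_real (?P $ j) =
      (\<Sum>l\<in>UNIV. a $ l * of_real (?R $ l * ?R $ j + ?T $ l * ?T $ j + ?P $ l * ?P $ j))"
      by (simp add: c_def cdot_def vec_of_real_def sum_3 algebra_simps)
    also have "\<dots> = (\<Sum>l\<in>UNIV. if l = j then a $ l else 0)"
      unfolding frame_ortho(2) by (intro sum.cong) auto
    finally show ?thesis by simp
  qed
  have Aj: "A $ j = (\<Sum>l\<in>UNIV. of_real (?T $ l) * (of_real r * pd l u x $ j))"
    unfolding A_def Du_def sum_3 vector_add_component vector_scaleR_component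
    by (simp add: scaleR_conv_of_real algebra_simps)
  have Bj: "s * B $ j = (\<Sum>l\<in>UNIV. of_real (?P $ l) * (of_real r * pd l u x $ j))"
  proof -
    have "B $ j = of_real (sin t) * (\<Sum>l\<in>UNIV. of_real (?P $ l) * (of_real r * pd l u x $ j))"
      unfolding B_def Du_def sum_3 vector_add_component vector_scaleR_component
      by (simp add: scaleR_conv_of_real algebra_simps)
    then show ?thesis using s(2) by simp
  qed
  have "sph_grad u x $ i $ j = (\<Sum>l\<in>UNIV. of_real (?T $ i * ?T $ l + ?P $ i * ?P $ l) * (of_real r * pd l u x $ j))"
    unfolding comp complete Aj Bj by (simp add: sum_3 algebra_simps)
  also have "\<dots> = (\<Sum>l\<in>UNIV. of_real ((if i = l then 1 else 0) - ?R $ i * ?R $ l) * (of_real r * pd l u x $ j))"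
  proof -
    have "?T $ i * ?T $ l + ?P $ i * ?P $ l = (if i = l then 1 else 0) - ?R $ i * ?R $ l" for l
      using frame_ortho(2)[of t p i l] by linarith
    then show ?thesis by (simp only:)
  qed
  also have "\<dots> = (\<Sum>l\<in>UNIV. (if l = i then of_real r * pd l u x $ j else 0) - of_real (?R $ i) * (of_real (?R $ l) * (of_real r * pd l u x $ j)))"
    by (intro sum.cong) (auto simp: algebra_simps)
  also have "\<dots> = of_real r * (pd i u x $ j) - of_real (?R $ i) * (\<Sum>l\<in>UNIV. of_real (?R $ l) * (of_real r * pd l u x $ j))"
    unfolding sum_subtractf by (simp add: sum_distrib_left)
  finally show ?thesis .
qed

lemma pd_component:
  assumes "u differentiable (at x)"
  shows "pd l (\<lambda>y. u y $ j) x = pd l u x $ j"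
proof -
  have "((\<lambda>y. u y $ j) has_derivative (\<lambda>h. (\<Sum>l\<in>UNIV. (h$l) *\<^sub>R pd l u x) $ j)) (at x)"
    by (rule bounded_linear.has_derivative[OF bounded_linear_vec_nth derivative_expand[OF assms]])
  from pd_eq_derivative[OF this] pd_eq_derivative[OF derivative_expand[OF assms]] show ?thesis by metis
qed

text \<open>The identity of Lagrange for the unit vector \<open>R\<close>, in polarized form.\<close>

lemma tangential_product:
  fixes a b :: "3 \<Rightarrow> complex" and R :: "real^3"
  assumes R: "(\<Sum>l\<in>UNIV. R$l * R$l) = 1"
  shows "(\<Sum>i\<in>UNIV. (a i - of_real (R$i) * (\<Sum>l\<in>UNIV. of_real (R$l) * a l)) * cnj (b i - of_real (R$i) * (\<Sum>l\<in>UNIV. of_real (R$l) * b l))) =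
    (\<Sum>i\<in>UNIV. \<Sum>l\<in>UNIV. (of_real (R$i) * a l - of_real (R$l) * a i) * cnj (of_real (R$i) * b l - of_real (R$l) * b i)) / 2"
proof -
  define S where "S = complex_of_real (R$1 * R$1 + R$2 * R$2 + R$3 * R$3)"
  have S1: "S = 1" using R by (simp add: S_def sum_3)
  define s where "s = (\<Sum>l\<in>UNIV. of_real (R$l) * a l)"
  define t where "t = (\<Sum>l\<in>UNIV. of_real (R$l) * cnj (b l))"
  define m where "m = (\<Sum>l\<in>UNIV. a l * cnj (b l))"
  have t': "cnj (\<Sum>l\<in>UNIV. of_real (R$l) * b l) = t" by (simp add: t_def)
  have "(\<Sum>i\<in>UNIV. (a i - of_real (R$i) * s) * cnj (b i - of_real (R$i) * (\<Sum>l\<in>UNIV. of_real (R$l) * b l))) = m - 2 * (s * t) + S * (s * t)"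
    unfolding complex_cnj_diff complex_cnj_mult t' m_def S_def
    by (simp add: sum_3 algebra_simps) (simp add: s_def t_def sum_3 algebra_simps)
  moreover have "(\<Sum>i\<in>UNIV. \<Sum>l\<in>UNIV. (of_real (R$i) * a l - of_real (R$l) * a i) * cnj (of_real (R$i) * b l - of_real (R$l) * b i)) = 2 * (S * m - s * t)"
    unfolding s_def t_def m_def S_def by (simp add: sum_3 algebra_simps)
  ultimately show ?thesis unfolding s_def[symmetric] S1 by simp
qed

text \<open>Expressed by rotation fields, the product of spherical gradients acts on each Cartesian component
  separately and no longer refers to coordinates that are singular on the axis.\<close>

lemma ddot_sph_grad:
  fixes u v :: "real^3 \<Rightarrow> complex^3"
  assumes u: "u differentiable (at x)" and v: "v differentiable (at x)" and x: "x \<in> sph_coords ` sph_dom"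
  shows "ddot (sph_grad u x) (cnj_mat (sph_grad v x)) =
    (\<Sum>j\<in>UNIV. (\<Sum>i\<in>UNIV. \<Sum>l\<in>UNIV. rot i l (\<lambda>y. u y $ j) x * cnj (rot i l (\<lambda>y. v y $ j) x)) / 2)"
proof -
  obtain r t p where rtp: "x = sph_coords (r, t, p)" "(r, t, p) \<in> sph_dom" using x by auto
  let ?R = "e_r t p"
  have xi: "x $ i = r * ?R $ i" for i using rtp(1) by (simp add: sph_coords_frame)
  have rot: "rot i l (\<lambda>y. w y $ j) x = of_real (?R$i) * (of_real r * pd l w x $ j) - of_real (?R$l) * (of_real r * pd i w x $ j)"
    if "w differentiable (at x)" for w :: "real^3 \<Rightarrow> complex^3" and i l j
    by (simp add: rot_def pd_component[OF that] xi scaleR_conv_of_real)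
  have "ddot (sph_grad u x) (cnj_mat (sph_grad v x)) = (\<Sum>i\<in>UNIV. \<Sum>j\<in>UNIV. sph_grad u x $ i $ j * cnj (sph_grad v x $ i $ j))"
    by (simp add: ddot_def cnj_mat_def)
  also have "\<dots> = (\<Sum>j\<in>UNIV. \<Sum>i\<in>UNIV. sph_grad u x $ i $ j * cnj (sph_grad v x $ i $ j))"
    by (rule sum.swap)
  also have "\<dots> = (\<Sum>j\<in>UNIV. (\<Sum>i\<in>UNIV. \<Sum>l\<in>UNIV. rot i l (\<lambda>y. u y $ j) x * cnj (rot i l (\<lambda>y. v y $ j) x)) / 2)"
    unfolding sph_grad_formula[OF u rtp] sph_grad_formula[OF v rtp] rot[OF u] rot[OF v]
    by (intro sum.cong refl tangential_product frame_ortho(1))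
  finally show ?thesis .
qed

lemma H_integrand_eq:
  fixes u v :: "real^3 \<Rightarrow> complex^3"
  assumes u: "u differentiable (at x)" and v: "v differentiable (at x)"
  shows "H_integrand u v x = of_real (yb x ^ 3) * ((\<Sum>j\<in>UNIV. u x $ j * cnj (v x $ j)) +
    (if x \<in> sph_coords ` sph_dom then (\<Sum>j\<in>UNIV. (\<Sum>i\<in>UNIV. \<Sum>l\<in>UNIV. rot i l (\<lambda>y. u y $ j) x * cnj (rot i l (\<lambda>y. v y $ j) x)) / 2) else 0))"
proof -
  have y: "z / of_real (bracket x ^ 3) = of_real (yb x ^ 3) * z" for z :: complex
    by (simp add: yb_def power_divide)
  have g: "ddot (sph_grad u x) (cnj_mat (sph_grad v x)) = (if x \<in> sph_coords ` sph_dom then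
     (\<Sum>j\<in>UNIV. (\<Sum>i\<in>UNIV. \<Sum>l\<in>UNIV. rot i l (\<lambda>y. u y $ j) x * cnj (rot i l (\<lambda>y. v y $ j) x)) / 2) else 0)"
    using ddot_sph_grad[OF u v] by (auto simp: sph_grad_def ddot_def)
  show ?thesis
    unfolding H_integrand_def y g by (simp add: cdot_def cnj_vec_def)
qed

section \<open>Approximation by test functions\<close>

lemma differentiable_continuous_UNIV:
  fixes f :: "real^3 \<Rightarrow> 'b::real_normed_vector"
  assumes "\<And>x. f differentiable (at x)" shows "continuous_on UNIV f"
  using assms differentiable_imp_continuous_within by (auto simp: continuous_on_eq_continuous_within)

lemma Ck_down: "Ck (Suc k) f \<Longrightarrow> Ck k f"
proof (induction k arbitrary: f)
  case 0
  then show ?case using differentiable_continuous_UNIV[of f] by simp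
next
  case (Suc k)
  then show ?case by auto
qed

lemma pd_add:
  assumes "f differentiable (at x)" "g differentiable (at x)"
  shows "pd i (\<lambda>x. f x + g x) x = pd i f x + pd i g x"
  using pd_eq_derivative[OF has_derivative_add[OF derivative_expand[OF assms(1)] derivative_expand[OF assms(2)]], of i]
    pd_eq_derivative[OF derivative_expand[OF assms(1)], of i] pd_eq_derivative[OF derivative_expand[OF assms(2)], of i]
  by simp

lemma pd_scaleR:
  fixes f :: "real^3 \<Rightarrow> real"
  assumes "f differentiable (at x)" "g differentiable (at x)"
  shows "pd i (\<lambda>x. f x *\<^sub>R g x) x = f x *\<^sub>R pd i g x + pd i f x *\<^sub>R g x"
  using pd_eq_derivative[OF has_derivative_scaleR[OF derivative_expand[OF assms(1)] derivative_expand[OF assms(2)]], of i]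
    pd_eq_derivative[OF derivative_expand[OF assms(1)], of i] pd_eq_derivative[OF derivative_expand[OF assms(2)], of i]
  by simp

lemma Ck_add: "Ck k f \<Longrightarrow> Ck k g \<Longrightarrow> Ck k (\<lambda>x. f x + g x)"
proof (induction k arbitrary: f g)
  case 0
  then show ?case by (auto intro: continuous_intros)
next
  case (Suc k)
  have "pd i (\<lambda>x. f x + g x) = (\<lambda>x. pd i f x + pd i g x)" for i
    using Suc.prems by (auto intro!: pd_add)
  then show ?case using Suc by (auto intro!: differentiable_add)
qed

lemma Ck_scaleR:
  fixes f :: "real^3 \<Rightarrow> real"
  shows "Ck k f \<Longrightarrow> Ck k g \<Longrightarrow> Ck k (\<lambda>x. f x *\<^sub>R g x)"
proof (induction k arbitrary: f g)
  case 0
  then show ?case by (auto intro: continuous_intros)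
next
  case (Suc k)
  have eq: "pd i (\<lambda>x. f x *\<^sub>R g x) = (\<lambda>x. f x *\<^sub>R pd i g x + pd i f x *\<^sub>R g x)" for i
    using Suc.prems by (auto intro!: pd_scaleR)
  have "Ck k (\<lambda>x. f x *\<^sub>R pd i g x + pd i f x *\<^sub>R g x)" for i
    using Suc.prems Ck_down[of k f] Ck_down[of k g] by (intro Ck_add Suc.IH) auto
  then show ?case using Suc.prems by (auto simp: eq intro!: differentiable_scaleR)
qed

lemma pd_const: "pd i (\<lambda>x. c) = (\<lambda>x. 0)"
  by (rule ext) (simp add: pd_def)

lemma Ck_const: "Ck k (\<lambda>x. c)"
  by (induction k arbitrary: c) (auto simp: pd_const)

lemma Ck_nth: "Ck k (\<lambda>x. x $ j)"
proof (cases k)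
  case 0 then show ?thesis by (auto intro: continuous_intros)
next
  case (Suc l)
  have d: "((\<lambda>x::real^3. x $ j) has_derivative (\<lambda>h. h $ j)) (at x)" for x
    by (rule bounded_linear_imp_has_derivative[OF bounded_linear_vec_nth])
  have "pd i (\<lambda>x. x $ j) = (\<lambda>x. axis i 1 $ j)" for i
    by (rule ext) (rule pd_eq_derivative[OF d])
  then show ?thesis using d by (auto simp: Suc Ck_const differentiable_def)
qed

lemma Ck_vec:
  fixes u :: "real^3 \<Rightarrow> complex^3"
  shows "(\<And>j. Ck k (\<lambda>x. u x $ j)) \<Longrightarrow> Ck k u"
proof (induction k arbitrary: u)
  case 0
  then have "continuous_on UNIV (\<lambda>x. \<chi> j. u x $ j)" by (intro continuous_on_vec_lambda) simp
  then show ?case by simp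
next
  case (Suc k)
  have d: "u differentiable (at x)" for x
  proof -
    have "((\<lambda>y. u y $ j) has_derivative (\<lambda>h. \<Sum>l\<in>UNIV. (h$l) *\<^sub>R pd l (\<lambda>y. u y $ j) x)) (at x)" for j
      using Suc.prems[of j] by (intro derivative_expand) simp
    then have "(u has_derivative (\<lambda>h. \<chi> j. \<Sum>l\<in>UNIV. (h$l) *\<^sub>R pd l (\<lambda>y. u y $ j) x)) (at x)"
      by (intro has_derivative_vec3I) simp
    then show ?thesis by (auto simp: differentiable_def)
  qed
  have "Ck k (pd i u)" for i
  proof (rule Suc.IH)
    fix j
    have "(\<lambda>x. pd i u x $ j) = pd i (\<lambda>y. u y $ j)" using pd_component[OF d] by auto
    then show "Ck k (\<lambda>x. pd i u x $ j)" using Suc.prems[of j] by simp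
  qed
  then show ?case using d by simp
qed

text \<open>The family $t^{-j}e^{-1/t}$, extended by 0, is closed under differentiation up to linear combinations.
  Smoothness of its compositions therefore follows by induction for all members at once.\<close>

definition exp_flat :: "nat \<Rightarrow> real \<Rightarrow> real" where
  "exp_flat j t = (if t > 0 then exp (- 1 / t) / t ^ j else 0)"

text \<open>Quadratic decay at 0 is exactly what differentiability there needs; it follows from a lower bound for
  the exponential by a power.\<close>

lemma exp_flat_bound: "\<bar>exp_flat j t\<bar> \<le> real (j + 2) ^ (j + 2) * t\<^sup>2"
proof (cases "t > 0")
  case True
  define m where "m = j + 2"
  have "(1 / t / real m) ^ m \<le> (1 + (1 / t) / real m) ^ m"
    using True by (intro power_mono) auto
  also have "\<dots> \<le> exp (1 / t)"
  proof (rule exp_ge_one_plus_x_over_n_power_n)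
    have "0 \<le> 1 / t" using True by simp
    then show "- real m \<le> 1 / t" by linarith
  qed (simp add: m_def)
  finally have "1 / (t ^ m * real m ^ m) \<le> exp (1 / t)"
    by (simp only: power_divide power_one divide_divide_eq_left power_mult_distrib)
  moreover have p: "t ^ m * real m ^ m > 0" using True by (simp add: m_def)
  ultimately have "1 \<le> exp (1 / t) * (t ^ m * real m ^ m)"
    by (simp add: pos_divide_le_eq)
  then have "exp (- 1 / t) * 1 \<le> exp (- 1 / t) * (exp (1 / t) * (t ^ m * real m ^ m))"
    by (intro mult_left_mono) auto
  then have "exp (- 1 / t) \<le> t ^ m * real m ^ m"
    by (simp add: mult.assoc[symmetric] exp_add[symmetric])
  then have "exp (- 1 / t) / t ^ j \<le> t ^ m * real m ^ m / t ^ j"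
    using True by (intro divide_right_mono) auto
  also have "\<dots> = real (j + 2) ^ (j + 2) * t\<^sup>2"
    unfolding m_def using True by (simp only: power_add) simp
  finally show ?thesis using True by (simp add: exp_flat_def)
next
  case False
  then show ?thesis by (simp add: exp_flat_def)
qed

lemma exp_flat_deriv: "(exp_flat j has_real_derivative (exp_flat (j + 2) t - real j * exp_flat (j + 1) t)) (at t)"
proof (cases t "0::real" rule: linorder_cases)
  case less
  have "((\<lambda>t. 0) has_real_derivative 0) (at t)" by simp
  then have "(exp_flat j has_real_derivative 0) (at t)"
    by (rule has_field_derivative_transform_within_open[where S="{..<0}"]) (use less in \<open>auto simp: exp_flat_def\<close>)
  then show ?thesis using less by (simp add: exp_flat_def)
next
  case equal
  have "(exp_flat j has_derivative (\<lambda>h. h * 0)) (at 0)"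
  proof (rule has_derivative_quadratic_bound)
    show "norm (exp_flat j (0 + h) - exp_flat j 0 - h * 0) \<le> real (j + 2) ^ (j + 2) * (norm h)\<^sup>2" for h
      using exp_flat_bound[of j h] by (simp add: exp_flat_def[of j 0])
  qed simp
  moreover have "(*) (0::real) = (\<lambda>h. h * 0)" by auto
  ultimately have "(exp_flat j has_real_derivative 0) (at 0)" unfolding has_field_derivative_def by simp
  then show ?thesis unfolding equal by (simp add: exp_flat_def)
next
  case greater
  have "((\<lambda>t. exp (- 1 / t) / t ^ j) has_real_derivative
     (exp (- 1 / t) * (1 / t\<^sup>2) * t ^ j - exp (- 1 / t) * (real j * t ^ (j - 1))) / (t ^ j * t ^ j)) (at t)"
    using greater by (auto intro!: derivative_eq_intros simp: power2_eq_square)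
  moreover have "(exp (- 1 / t) * (1 / t\<^sup>2) * t ^ j - exp (- 1 / t) * (real j * t ^ (j - 1))) / (t ^ j * t ^ j) = exp_flat (j + 2) t - real j * exp_flat (j + 1) t"
    using greater by (cases j) (auto simp: exp_flat_def field_simps power2_eq_square power_add)
  ultimately have "((\<lambda>t. exp (- 1 / t) / t ^ j) has_real_derivative exp_flat (j + 2) t - real j * exp_flat (j + 1) t) (at t)" by simp
  then show ?thesis
    by (rule has_field_derivative_transform_within_open[where S="{0<..}"]) (use greater in \<open>auto simp: exp_flat_def\<close>)
qed

text \<open>Positive exactly inside the ball of radius $a^{-1/2}$.\<close>

definition bumparg :: "real \<Rightarrow> real^3 \<Rightarrow> real" where
  "bumparg a x = 1 - a * (norm x)\<^sup>2"

lemma bump_deriv: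
  "((\<lambda>x. exp_flat j (bumparg a x)) has_derivative (\<lambda>h. \<Sum>l\<in>UNIV. (h$l) *\<^sub>R ((exp_flat (j + 2) (bumparg a x) - real j * exp_flat (j + 1) (bumparg a x)) * (- 2 * a * x$l)))) (at x)"
proof -
  have 1: "(bumparg a has_derivative (\<lambda>h. - (a * (2 * (x \<bullet> h))))) (at x)"
    unfolding bumparg_def power2_norm_eq_inner by (auto intro!: derivative_eq_intros simp: inner_commute)
  have 2: "(exp_flat j has_derivative (\<lambda>h. (exp_flat (j + 2) (bumparg a x) - real j * exp_flat (j + 1) (bumparg a x)) * h)) (at (bumparg a x))"
    using exp_flat_deriv[of j "bumparg a x"] by (simp add: has_field_derivative_def)
  have "((\<lambda>x. exp_flat j (bumparg a x)) has_derivative (\<lambda>h. (exp_flat (j + 2) (bumparg a x) - real j * exp_flat (j + 1) (bumparg a x)) * (- (a * (2 * (x \<bullet> h)))))) (at x)"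
    by (rule has_derivative_compose[OF 1 2])
  then show ?thesis
    by (rule has_derivative_eq_rhs) (auto simp: fun_eq_iff inner_vec_def sum_3 algebra_simps)
qed

lemma pd_bump: "pd l (\<lambda>x. exp_flat j (bumparg a x)) x = (exp_flat (j + 2) (bumparg a x) - real j * exp_flat (j + 1) (bumparg a x)) * (- 2 * a * x$l)"
proof -
  have "(\<Sum>m\<in>UNIV. (axis l (1::real) $ m) *\<^sub>R z m) = z l" for z :: "3 \<Rightarrow> real"
  proof -
    have "(\<Sum>m\<in>UNIV. (axis l (1::real) $ m) *\<^sub>R z m) = (\<Sum>m\<in>UNIV. if m = l then z m else 0)"
      by (intro sum.cong) (auto simp: axis_def)
    then show ?thesis by simp
  qed
  then show ?thesis unfolding pd_eq_derivative[OF bump_deriv] .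
qed

lemma bump_differentiable: "(\<lambda>x. exp_flat j (bumparg a x)) differentiable (at x)"
  unfolding differentiable_def using bump_deriv by blast

lemma Ck_bump: "Ck k (\<lambda>x. exp_flat j (bumparg a x))"
proof (induction k arbitrary: j)
  case 0
  show ?case using has_derivative_continuous[OF bump_deriv] by (auto simp: continuous_on_eq_continuous_at)
next
  case (Suc k)
  have eq: "pd l (\<lambda>x. exp_flat j (bumparg a x)) = (\<lambda>x. (exp_flat (j + 2) (bumparg a x) + (- real j) *\<^sub>R exp_flat (j + 1) (bumparg a x)) *\<^sub>R ((- 2 * a) *\<^sub>R x$l))" for l
    by (rule ext) (simp only: pd_bump, simp)
  have "Ck k (pd l (\<lambda>x. exp_flat j (bumparg a x)))" for l
    unfolding eq by (intro Ck_scaleR Ck_add Ck_const Ck_nth Suc.IH)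
  then show ?case using bump_differentiable by auto
qed

text \<open>The factor \<open>exp 1\<close> makes the value at the origin equal to 1.\<close>

definition cutoff :: "nat \<Rightarrow> real^3 \<Rightarrow> real" where
  "cutoff n x = exp 1 * exp_flat 0 (bumparg (1 / (real (Suc n))\<^sup>2) x)"

lemma Ck_cutoff: "Ck k (cutoff n)"
proof -
  have "Ck k (\<lambda>x. exp 1 *\<^sub>R exp_flat 0 (bumparg (1 / (real (Suc n))\<^sup>2) x))"
    by (intro Ck_scaleR Ck_const Ck_bump)
  then show ?thesis by (simp add: cutoff_def[abs_def])
qed

lemma cutoff_bounds: "0 \<le> cutoff n x" "cutoff n x \<le> 1"
proof -
  show "0 \<le> cutoff n x" by (simp add: cutoff_def exp_flat_def)
  have "exp 1 * exp (- 1 / t) \<le> 1" if "t > 0" "t \<le> 1" for t :: real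
    using that by (simp add: exp_add[symmetric])
  moreover have "bumparg (1 / (real (Suc n))\<^sup>2) x \<le> 1" by (simp add: bumparg_def)
  ultimately show "cutoff n x \<le> 1" by (simp add: cutoff_def exp_flat_def)
qed

lemma cutoff_support: "norm x > real (Suc n) \<Longrightarrow> cutoff n x = 0"
proof -
  assume x: "norm x > real (Suc n)"
  then have le: "(real (Suc n))\<^sup>2 \<le> (norm x)\<^sup>2" by (intro power_mono) auto
  have N: "(real (Suc n))\<^sup>2 > 0" by simp
  have "1 \<le> (norm x)\<^sup>2 / (real (Suc n))\<^sup>2"
    unfolding le_divide_eq_1_pos[OF N] by (rule le)
  then have "bumparg (1 / (real (Suc n))\<^sup>2) x \<le> 0" by (simp add: bumparg_def)
  then show ?thesis by (simp add: cutoff_def exp_flat_def)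
qed

lemma cutoff_tendsto: "(\<lambda>n. cutoff n x) \<longlonglongrightarrow> 1"
proof -
  have c: "isCont (exp_flat 0) 1" using exp_flat_deriv DERIV_isCont by blast
  have "(\<lambda>n. 1 - (1 / real (Suc n))\<^sup>2 * (norm x)\<^sup>2) \<longlonglongrightarrow> 1 - 0\<^sup>2 * (norm x)\<^sup>2"
    by (intro tendsto_intros LIMSEQ_Suc[OF lim_1_over_n])
  then have "(\<lambda>n. bumparg (1 / (real (Suc n))\<^sup>2) x) \<longlonglongrightarrow> 1"
    by (simp add: bumparg_def power_divide)
  then have "(\<lambda>n. exp 1 * exp_flat 0 (bumparg (1 / (real (Suc n))\<^sup>2) x)) \<longlonglongrightarrow> exp 1 * exp_flat 0 1"
    by (intro tendsto_mult tendsto_const isCont_tendsto_compose[OF c])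
  then show ?thesis by (simp add: cutoff_def exp_flat_def exp_add[symmetric])
qed

text \<open>The gradient of a radial function is radial, so the rotation fields do not see the cutoff.\<close>

lemma rot_cutoff:
  fixes f :: "real^3 \<Rightarrow> complex"
  assumes f: "f differentiable (at x)"
  shows "rot i l (\<lambda>y. (cutoff n y - 1) *\<^sub>R f y) x = (cutoff n x - 1) *\<^sub>R rot i l f x"
proof -
  define a where "a = 1 / (real (Suc n))\<^sup>2"
  have dF: "(\<lambda>y. exp_flat 0 (bumparg a y)) differentiable (at x)"
    by (rule bump_differentiable)
  define F where "F y = exp 1 *\<^sub>R exp_flat 0 (bumparg a y) + (-1)" for y
  have c: "cutoff n y - 1 = F y" for y by (simp add: cutoff_def a_def F_def)
  have dE: "(\<lambda>y. exp 1 *\<^sub>R exp_flat 0 (bumparg a y)) differentiable (at x)" using dF by (intro differentiable_scaleR) auto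
  have dF': "F differentiable (at x)"
    unfolding F_def using dE by (intro differentiable_add) auto
  have "pd m (\<lambda>y. exp 1 *\<^sub>R exp_flat 0 (bumparg a y)) x = exp 1 *\<^sub>R pd m (\<lambda>y. exp_flat 0 (bumparg a y)) x + pd m (\<lambda>y. exp (1::real)) x *\<^sub>R exp_flat 0 (bumparg a x)" for m
    by (rule pd_scaleR[OF _ dF]) simp
  then have pF: "pd m F x = exp 1 * (exp_flat 2 (bumparg a x) * (- 2 * a * x$m))" for m
    unfolding F_def using pd_add[OF dE, of "\<lambda>y. -1" m] by (simp add: pd_const pd_bump numeral_2_eq_2)
  show ?thesis
    unfolding c rot_def pd_scaleR[OF dF' f] pF by (simp add: algebra_simps)
qed

lemma cutoff_test_function:
  fixes u :: "real^3 \<Rightarrow> complex^3"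
  assumes u: "\<And>k. Ck k u"
  shows "(\<lambda>x. cutoff n x *\<^sub>R u x) \<in> test_functions"
proof -
  have "{x. cutoff n x *\<^sub>R u x \<noteq> 0} \<subseteq> cball 0 (real (Suc n))"
  proof
    fix x assume "x \<in> {x. cutoff n x *\<^sub>R u x \<noteq> 0}"
    then have "cutoff n x \<noteq> 0" by auto
    then have "\<not> norm x > real (Suc n)" using cutoff_support by blast
    then show "x \<in> cball 0 (real (Suc n))" by (simp add: dist_norm)
  qed
  then have "closure {x. cutoff n x *\<^sub>R u x \<noteq> 0} \<subseteq> cball 0 (real (Suc n))"
    by (rule closure_minimal) simp
  then have "compact (closure {x. cutoff n x *\<^sub>R u x \<noteq> 0})"
    by (meson bounded_cball bounded_subset closed_closure compact_eq_bounded_closed)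
  then show ?thesis
    unfolding test_functions_def using Ck_scaleR[OF Ck_cutoff u] by blast
qed

lemma H_integrand_cutoff:
  fixes u :: "real^3 \<Rightarrow> complex^3"
  assumes u: "u differentiable (at x)"
  shows "H_integrand (\<lambda>y. cutoff n y *\<^sub>R u y - u y) (\<lambda>y. cutoff n y *\<^sub>R u y - u y) x = of_real ((1 - cutoff n x)\<^sup>2) * H_integrand u u x"
proof -
  let ?w = "\<lambda>y. cutoff n y *\<^sub>R u y - u y"
  have dc: "cutoff n differentiable (at x)" using Ck_cutoff[of 1 n] by simp
  have w: "?w differentiable (at x)" using u dc by (intro differentiable_diff differentiable_scaleR)
  have wj: "?w y $ j = (cutoff n y - 1) *\<^sub>R (u y $ j)" for y j
    by (simp add: algebra_simps)
  have uj: "(\<lambda>y. u y $ j) differentiable (at x)" for j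
    using bounded_linear.has_derivative[OF bounded_linear_vec_nth derivative_expand[OF u]] by (auto simp: differentiable_def)
  have e: "(a *\<^sub>R z) * cnj (a *\<^sub>R z') = of_real (a\<^sup>2) * (z * cnj z')" for a z z'
    by (simp add: scaleR_conv_of_real power2_eq_square)
  have s1: "(\<Sum>j\<in>UNIV. c * b j) = c * (\<Sum>j\<in>UNIV. b j)" for c :: complex and b :: "3 \<Rightarrow> complex"
    by (rule sum_distrib_left[symmetric])
  have s2: "(\<Sum>j\<in>UNIV. c * b j / 2) = c * (\<Sum>j\<in>UNIV. b j / 2)" for c :: complex and b :: "3 \<Rightarrow> complex"
    by (simp add: sum_distrib_left)
  have sq: "(1 - cutoff n x)\<^sup>2 = (cutoff n x - 1)\<^sup>2" by (simp add: power2_commute)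
  show ?thesis
    unfolding H_integrand_eq[OF w w] H_integrand_eq[OF u u] wj rot_cutoff[OF uj] e sq s1 s2
    by (simp only: distrib_left mult.left_commute if_distrib[of "\<lambda>z. _ * z"] mult_zero_right split: if_split)
qed

text \<open>By \<open>H_integrand_cutoff\<close> truncation produces no derivatives of the cutoff in the norm, so the distance
  of \<open>u\<close> to its truncations tends to 0 by dominated convergence alone.\<close>

lemma H_space_memI:
  fixes u :: "real^3 \<Rightarrow> complex^3"
  assumes u: "\<And>k. Ck k u" and I: "integrable lborel (H_integrand u u)"
  shows "u \<in> H_space"
proof -
  have d: "u differentiable (at x)" for x using u[of 1] by simp
  let ?f = "\<lambda>n x. cutoff n x *\<^sub>R u x"
  have [measurable]: "cutoff n \<in> borel_measurable borel" for n
    using Ck_cutoff[of 0 n] by (simp add: borel_measurable_continuous_onI)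
  have eq: "H_integrand (\<lambda>y. ?f n y - u y) (\<lambda>y. ?f n y - u y) = (\<lambda>x. of_real ((1 - cutoff n x)\<^sup>2) * H_integrand u u x)" for n
    by (rule ext) (rule H_integrand_cutoff[OF d])
  have Hm [measurable]: "H_integrand u u \<in> borel_measurable borel" using I by auto
  have m: "(\<lambda>x. complex_of_real ((1 - cutoff n x)\<^sup>2) * H_integrand u u x) \<in> borel_measurable borel" for n
    by measurable
  have b: "(1 - cutoff n x)\<^sup>2 \<le> 1" for n x
    using cutoff_bounds[of n x] by (simp add: power_le_one)
  have bn: "norm (complex_of_real ((1 - cutoff n x)\<^sup>2) * H_integrand u u x) \<le> norm (H_integrand u u x)" for n x
    using b[of n x] by (simp only: norm_mult norm_of_real) (simp add: mult_left_le_one_le)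
  have J: "integrable lborel (\<lambda>x. complex_of_real ((1 - cutoff n x)\<^sup>2) * H_integrand u u x)" for n
    by (rule Bochner_Integration.integrable_bound[OF I]) (use m bn in auto)
  have "(\<lambda>n. LINT x|lborel. complex_of_real ((1 - cutoff n x)\<^sup>2) * H_integrand u u x) \<longlonglongrightarrow> (LINT x|(lborel :: (real^3) measure). (0::complex))"
  proof (rule integral_dominated_convergence[where w="\<lambda>x. norm (H_integrand u u x)"])
    show "integrable lborel (\<lambda>x. norm (H_integrand u u x))" using I by simp
    show "AE x in lborel. (\<lambda>n. complex_of_real ((1 - cutoff n x)\<^sup>2) * H_integrand u u x) \<longlonglongrightarrow> 0"
    proof (rule AE_I2)
      fix x
      have "(\<lambda>n. complex_of_real ((1 - cutoff n x)\<^sup>2) * H_integrand u u x) \<longlonglongrightarrow> complex_of_real ((1 - 1)\<^sup>2) * H_integrand u u x"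
        by (intro tendsto_intros cutoff_tendsto)
      then show "(\<lambda>n. complex_of_real ((1 - cutoff n x)\<^sup>2) * H_integrand u u x) \<longlonglongrightarrow> 0" by simp
    qed
    show "AE x in lborel. norm (complex_of_real ((1 - cutoff n x)\<^sup>2) * H_integrand u u x) \<le> norm (H_integrand u u x)" for n
      using bn by simp
  qed (use m in auto)
  then have "(\<lambda>n. H_inner (\<lambda>y. ?f n y - u y) (\<lambda>y. ?f n y - u y)) \<longlonglongrightarrow> 0"
    unfolding H_inner_def eq by simp
  then have "(\<lambda>n. sqrt (Re (H_inner (\<lambda>y. ?f n y - u y) (\<lambda>y. ?f n y - u y)))) \<longlonglongrightarrow> sqrt (Re 0)"
    by (intro tendsto_real_sqrt tendsto_Re)
  then have lim: "(\<lambda>n. ip_norm H_inner (\<lambda>y. ?f n y - u y)) \<longlonglongrightarrow> 0"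
    unfolding ip_norm_def by simp
  show ?thesis
    unfolding H_space_def mem_Collect_eq
  proof (intro conjI exI[of _ ?f])
    show "Ck 1 u" by (rule u)
    show "integrable lborel (H_integrand u u)" by (rule I)
    show "range ?f \<subseteq> test_functions" using cutoff_test_function[OF u] by auto
    show "\<forall>n. integrable lborel (H_integrand (\<lambda>x. ?f n x - u x) (\<lambda>x. ?f n x - u x))"
      unfolding eq using J by simp
  qed (rule lim)
qed

section \<open>Riesz representation and reproducing kernels\<close>

locale function_hilbert_space =
  fixes H :: "('a \<Rightarrow> complex^'d::finite) set" and ip :: "('a \<Rightarrow> complex^'d) \<Rightarrow> ('a \<Rightarrow> complex^'d) \<Rightarrow> complex"
  assumes H: "hilbert_function_space H ip"
begin

lemma zero: "(\<lambda>_. 0) \<in> H" and add: "\<And>u v. u \<in> H \<Longrightarrow> v \<in> H \<Longrightarrow> (\<lambda>x. u x + v x) \<in> H"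
  and cmult: "\<And>c u. u \<in> H \<Longrightarrow> (\<lambda>x. c *s u x) \<in> H"
  and ip_add: "\<And>u v w. u \<in> H \<Longrightarrow> v \<in> H \<Longrightarrow> w \<in> H \<Longrightarrow> ip (\<lambda>x. u x + v x) w = ip u w + ip v w"
  and ip_cmult: "\<And>c u v. u \<in> H \<Longrightarrow> v \<in> H \<Longrightarrow> ip (\<lambda>x. c *s u x) v = c * ip u v"
  and ip_sym: "\<And>u v. u \<in> H \<Longrightarrow> v \<in> H \<Longrightarrow> ip v u = cnj (ip u v)"
  and ip_nonneg: "\<And>u. u \<in> H \<Longrightarrow> 0 \<le> Re (ip u u)"
  and ip_zero: "\<And>u. u \<in> H \<Longrightarrow> ip u u = 0 \<Longrightarrow> u = (\<lambda>_. 0)"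
  and complete: "\<And>f. range f \<subseteq> H \<Longrightarrow> (\<forall>e>0. \<exists>N. \<forall>m\<ge>N. \<forall>n\<ge>N. ip_norm ip (\<lambda>x. f m x - f n x) < e) \<Longrightarrow>
        \<exists>u\<in>H. (\<lambda>n. ip_norm ip (\<lambda>x. f n x - u x)) \<longlonglongrightarrow> 0"
  using H unfolding hilbert_function_space_def by blast+

abbreviation nrm :: "('a \<Rightarrow> complex^'d) \<Rightarrow> real" where "nrm u \<equiv> ip_norm ip u"

definition comb :: "complex \<Rightarrow> ('a \<Rightarrow> complex^'d) \<Rightarrow> ('a \<Rightarrow> complex^'d) \<Rightarrow> 'a \<Rightarrow> complex^'d" where
  "comb c u v = (\<lambda>x. u x + c *s v x)"

lemma comb_in: "u \<in> H \<Longrightarrow> v \<in> H \<Longrightarrow> comb c u v \<in> H"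
  unfolding comb_def by (intro add cmult)

lemma diff_eq: "(\<lambda>x. u x - v x) = comb (-1) u v"
  by (simp add: comb_def fun_eq_iff vec_eq_iff)

lemma ip_comb_left: "u \<in> H \<Longrightarrow> v \<in> H \<Longrightarrow> w \<in> H \<Longrightarrow> ip (comb c u v) w = ip u w + c * ip v w"
  unfolding comb_def by (simp add: ip_add cmult ip_cmult)

lemma ip_comb_right: "u \<in> H \<Longrightarrow> v \<in> H \<Longrightarrow> w \<in> H \<Longrightarrow> ip w (comb c u v) = ip w u + cnj c * ip w v"
  using ip_sym[OF comb_in[of u v c], of w] ip_comb_left[of u v w c] ip_sym[of u w] ip_sym[of v w] by simp

lemma nrm_sq: "u \<in> H \<Longrightarrow> (nrm u)\<^sup>2 = Re (ip u u)"
  by (simp add: ip_norm_def ip_nonneg)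

lemma nrm_nonneg: "nrm u \<ge> 0" if "u \<in> H" using that by (simp add: ip_norm_def ip_nonneg)

lemma nrm_comb_sq:
  assumes "u \<in> H" "v \<in> H"
  shows "(nrm (comb c u v))\<^sup>2 = (nrm u)\<^sup>2 + 2 * Re (cnj c * ip u v) + (cmod c)\<^sup>2 * (nrm v)\<^sup>2"
proof -
  have "ip (comb c u v) (comb c u v) = ip u u + cnj c * ip u v + c * (cnj (ip u v) + cnj c * ip v v)"
    using assms by (simp add: ip_comb_left ip_comb_right comb_in ip_sym[of u v] algebra_simps)
  then have "Re (ip (comb c u v) (comb c u v)) = Re (ip u u) + 2 * Re (cnj c * ip u v) + Re (c * cnj c * ip v v)"
    by (simp add: algebra_simps)
  also have "c * cnj c * ip v v = of_real ((cmod c)\<^sup>2) * ip v v"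
    by (simp only: complex_norm_square)
  finally show ?thesis using assms by (simp add: nrm_sq comb_in)
qed

text \<open>The representing element minimizes $J(u) = |u|^2 - 2\,\mathrm{Re} f(u)$. By the parallelogram law minimizing
  sequences are Cauchy; the first variation at the minimum gives the real part of the claim, and the
  imaginary part follows by multiplication with $-i$.\<close>

lemma riesz:
  fixes f :: "('a \<Rightarrow> complex^'d) \<Rightarrow> complex"
  assumes fadd: "\<And>u v. u \<in> H \<Longrightarrow> v \<in> H \<Longrightarrow> f (\<lambda>x. u x + v x) = f u + f v"
    and fmult: "\<And>c u. u \<in> H \<Longrightarrow> f (\<lambda>x. c *s u x) = c * f u"
    and C: "\<And>u. u \<in> H \<Longrightarrow> cmod (f u) \<le> C * nrm u"
  shows "\<exists>w\<in>H. \<forall>u\<in>H. f u = ip u w"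
proof -
  define J where "J u = (nrm u)\<^sup>2 - 2 * Re (f u)" for u
  have fcomb: "f (comb c u v) = f u + c * f v" if "u \<in> H" "v \<in> H" for c u v
    unfolding comb_def using that by (simp add: fadd fmult cmult)
  have J_lower: "- C\<^sup>2 \<le> J u" if u: "u \<in> H" for u
  proof -
    have "Re (f u) \<le> C * nrm u" using C[OF u] complex_Re_le_cmod[of "f u"] by linarith
    moreover have "0 \<le> (nrm u - C)\<^sup>2" by simp
    ultimately show ?thesis by (simp add: J_def power2_eq_square algebra_simps)
  qed
  define I where "I = (INF u\<in>H. J u)"
  have bdd: "bdd_below (J ` H)" using J_lower by (auto intro!: bdd_belowI[of _ "- C\<^sup>2"])
  have I_le: "I \<le> J u" if "u \<in> H" for u
    unfolding I_def by (rule cINF_lower[OF bdd that])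
  have ex: "\<exists>u\<in>H. J u < I + 1 / real (Suc n)" for n
  proof -
    have "Inf (J ` H) < I + 1 / real (Suc n)" unfolding I_def by simp
    then show ?thesis using cInf_lessD[of "J ` H"] zero by auto
  qed
  then obtain s where s: "\<And>n. s n \<in> H" "\<And>n. J (s n) < I + 1 / real (Suc n)" by metis
  have par: "(nrm (\<lambda>x. u x - v x))\<^sup>2 \<le> 2 * (J u - I) + 2 * (J v - I)" if u: "u \<in> H" and v: "v \<in> H" for u v
  proof -
    \<comment> \<open>The midpoint of \<open>u\<close> and \<open>v\<close>.\<close>
    define m where "m = comb (1/2) (\<lambda>x. (1/2) *s u x) v"
    have hu: "(\<lambda>x. (1/2) *s u x) = comb (-(1/2)) u u"
      by (simp add: comb_def fun_eq_iff vec_eq_iff algebra_simps)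
    have huH: "(\<lambda>x. (1/2) *s u x) \<in> H" using u by (rule cmult)
    have m: "m \<in> H" unfolding m_def by (rule comb_in[OF huH v])
    have "(nrm m)\<^sup>2 = (nrm (\<lambda>x. (1/2) *s u x))\<^sup>2 + Re (ip (\<lambda>x. (1/2) *s u x) v) + (1/4) * (nrm v)\<^sup>2"
      unfolding m_def using nrm_comb_sq[OF huH v, of "1/2"] by (simp add: power2_eq_square)
    also have "ip (\<lambda>x. (1/2) *s u x) v = (1/2) * ip u v" by (rule ip_cmult[OF u v])
    also have "(nrm (\<lambda>x. (1/2) *s u x))\<^sup>2 = (1/4) * (nrm u)\<^sup>2"
    proof -
      have E: "ip (\<lambda>x. (1/2) *s u x) (\<lambda>x. (1/2) *s u x) = (1/4) * ip u u"
        using ip_cmult[OF u huH, of "1/2"] ip_sym[OF huH u] ip_cmult[OF u u, of "1/2"] ip_sym[OF u u] by simp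
      show ?thesis unfolding nrm_sq[OF huH] nrm_sq[OF u] E by simp
    qed
    finally have nm: "(nrm m)\<^sup>2 = (1/4) * (nrm u)\<^sup>2 + (1/2) * Re (ip u v) + (1/4) * (nrm v)\<^sup>2" by simp
    have fm: "f m = (1/2) * f u + (1/2) * f v" unfolding m_def fcomb[OF huH v] fmult[OF u] ..
    have nd: "(nrm (\<lambda>x. u x - v x))\<^sup>2 = (nrm u)\<^sup>2 - 2 * Re (ip u v) + (nrm v)\<^sup>2"
      unfolding diff_eq using nrm_comb_sq[OF u v, of "-1"] by simp
    have "(nrm (\<lambda>x. u x - v x))\<^sup>2 = 2 * J u + 2 * J v - 4 * J m"
      unfolding nd J_def nm fm by simp
    then show ?thesis using I_le[OF m] by simp
  qed
  have cauchy: "\<forall>e>0. \<exists>N. \<forall>m\<ge>N. \<forall>n\<ge>N. nrm (\<lambda>x. s m x - s n x) < e"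
  proof (intro allI impI)
    fix e :: real assume e: "e > 0"
    then obtain N where N: "4 / e\<^sup>2 < real N" using reals_Archimedean2 by blast
    show "\<exists>N. \<forall>m\<ge>N. \<forall>n\<ge>N. nrm (\<lambda>x. s m x - s n x) < e"
    proof (intro exI allI impI)
      fix m n assume mn: "m \<ge> N" "n \<ge> N"
      have e2: "e\<^sup>2 > 0" using e by simp
      have b: "1 / real (Suc l) < e\<^sup>2 / 4" if "l \<ge> N" for l
      proof -
        have "4 / e\<^sup>2 < real (Suc l)" using N that by linarith
        then show ?thesis using e2 by (simp add: field_simps)
      qed
      have "J (s l) < I + e\<^sup>2 / 4" if "l \<ge> N" for l
        using s(2)[of l] b[OF that] by simp
      from this[OF mn(1)] this[OF mn(2)] have "(nrm (\<lambda>x. s m x - s n x))\<^sup>2 < e\<^sup>2"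
        using par[OF s(1) s(1), of m n] by simp
      then show "nrm (\<lambda>x. s m x - s n x) < e"
        by (rule power2_less_imp_less) (use e in simp)
    qed
  qed
  obtain w where w: "w \<in> H" "(\<lambda>n. nrm (\<lambda>x. s n x - w x)) \<longlonglongrightarrow> 0"
    using complete[OF _ cauchy] s(1) by blast
  have cs: "\<bar>Re (ip u v)\<bar> \<le> nrm u * nrm v" if u: "u \<in> H" and v: "v \<in> H" for u v
  proof -
    have q: "0 \<le> (nrm u)\<^sup>2 + 2 * a * Re (ip u v) + a\<^sup>2 * (nrm v)\<^sup>2" for a :: real
      using nrm_comb_sq[OF u v, of "of_real a"] zero_le_power2[of "nrm (comb (of_real a) u v)"] by simp
    show ?thesis
    proof (cases "nrm v = 0")
      case True
      have "Re (ip u v) = 0"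
      proof (rule ccontr)
        assume r: "Re (ip u v) \<noteq> 0"
        \<comment> \<open>The argument of \<open>q\<close> makes its right-hand side equal to $-1$.\<close>
        show False using q[of "- ((nrm u)\<^sup>2 + 1) / (2 * Re (ip u v))"] True r by (simp add: field_simps)
      qed
      then show ?thesis using True by simp
    next
      case False
      define R where "R = Re (ip u v)"
      define N where "N = (nrm v)\<^sup>2"
      have p: "N > 0" using False by (simp add: N_def)
      have "0 \<le> (nrm u)\<^sup>2 + 2 * (- R / N) * R + (- R / N)\<^sup>2 * N"
        unfolding R_def N_def by (rule q)
      also have "\<dots> = (nrm u)\<^sup>2 - R\<^sup>2 / N"
        using p by (simp add: power2_eq_square)
      finally have "R\<^sup>2 / N \<le> (nrm u)\<^sup>2" by simp
      then have "(Re (ip u v))\<^sup>2 \<le> (nrm u * nrm v)\<^sup>2"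
        using p by (simp add: pos_divide_le_eq power_mult_distrib R_def N_def)
      then show ?thesis
        using nrm_nonneg[OF u] nrm_nonneg[OF v] by (simp add: abs_le_square_iff[symmetric])
    qed
  qed
  have Jw: "J w \<le> I"
  proof -
    have lim: "(\<lambda>n. I + 1 / real (Suc n) + 2 * (nrm w + C + 1) * nrm (\<lambda>x. s n x - w x)) \<longlonglongrightarrow> I + 0 + 2 * (nrm w + C + 1) * 0"
      by (intro tendsto_intros w(2) LIMSEQ_Suc[OF lim_1_over_n])
    have "J w \<le> I + 1 / real (Suc n) + 2 * (nrm w + C + 1) * nrm (\<lambda>x. s n x - w x)" for n
    proof -
      let ?d = "comb (-1) (s n) w"
      have d: "?d \<in> H" by (rule comb_in[OF s(1) w(1)])
      have sn: "s n = comb 1 w ?d" by (simp add: comb_def fun_eq_iff vec_eq_iff)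
      have "J (s n) = (nrm w)\<^sup>2 + 2 * Re (ip w ?d) + (nrm ?d)\<^sup>2 - 2 * Re (f w) - 2 * Re (f ?d)"
        unfolding J_def by (subst (1 2) sn) (simp add: nrm_comb_sq[OF w(1) d] fcomb[OF w(1) d])
      then have "J w \<le> J (s n) + 2 * (nrm w * nrm ?d) + 2 * (C * nrm ?d)"
        using cs[OF w(1) d] C[OF d] abs_Re_le_cmod[of "f ?d"] zero_le_power2[of "nrm ?d"] unfolding J_def by linarith
      also have "\<dots> \<le> I + 1 / real (Suc n) + 2 * (nrm w * nrm ?d) + 2 * (C * nrm ?d) + 2 * nrm ?d"
        using s(2)[of n] nrm_nonneg[OF d] by linarith
      finally show ?thesis unfolding diff_eq by (simp add: algebra_simps)
    qed
    then have "J w \<le> I + 0 + 2 * (nrm w + C + 1) * 0"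
      by (intro LIMSEQ_le_const[OF lim]) auto
    then show ?thesis by simp
  qed
  have re: "Re (f u) = Re (ip u w)" if u: "u \<in> H" for u
  proof -
    let ?b = "Re (ip w u) - Re (f u)"
    \<comment> \<open>The minimum is not lowered in the direction \<open>u\<close>.\<close>
    have q: "0 \<le> 2 * a * ?b + a\<^sup>2 * (nrm u)\<^sup>2" for a :: real
    proof -
      have "J (comb (of_real a) w u) = J w + 2 * a * ?b + a\<^sup>2 * (nrm u)\<^sup>2"
        unfolding J_def nrm_comb_sq[OF w(1) u] fcomb[OF w(1) u] by (simp add: algebra_simps)
      then show ?thesis using I_le[OF comb_in[OF w(1) u]] Jw by (smt (verit))
    qed
    have "?b = 0"
    proof (rule ccontr)
      assume b: "?b \<noteq> 0"
      define n where "n = (nrm u)\<^sup>2 + 1"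
      have n: "n > 0" "(nrm u)\<^sup>2 \<le> n" by (auto simp: n_def add_nonneg_pos)
      have "0 \<le> 2 * (- ?b / n) * ?b + (- ?b / n)\<^sup>2 * (nrm u)\<^sup>2" by (rule q)
      also have "\<dots> \<le> 2 * (- ?b / n) * ?b + (- ?b / n)\<^sup>2 * n" using n by (intro add_left_mono mult_left_mono) auto
      also have "\<dots> = - (?b\<^sup>2 / n)" using n by (simp add: power2_eq_square field_simps)
      also have "\<dots> < 0" using b n by simp
      finally show False by simp
    qed
    then show ?thesis using ip_sym[OF u w(1)] by simp
  qed
  have "f u = ip u w" if u: "u \<in> H" for u
  proof (rule complex_eqI)
    show "Re (f u) = Re (ip u w)" by (rule re[OF u])
    show "Im (f u) = Im (ip u w)"
      using re[OF cmult[OF u, of "-\<i>"]] fmult[OF u, of "-\<i>"] ip_cmult[OF u w(1), of "-\<i>"] by simp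
  qed
  then show ?thesis using w(1) by blast
qed

text \<open>The evaluation of each component at a point has a representing element. These elements are the
  columns of the kernel.\<close>

lemma rkhs:
  assumes C: "\<And>x. \<exists>C. \<forall>u\<in>H. norm (u x) \<le> C * nrm u"
  shows "is_rkhs H ip"
proof -
  have "\<exists>w\<in>H. \<forall>u\<in>H. u x $ i = ip u w" for x i
  proof -
    obtain C where C: "\<And>u. u \<in> H \<Longrightarrow> norm (u x) \<le> C * nrm u" using C by blast
    show ?thesis
    proof (rule riesz[of "\<lambda>u. u x $ i" C])
      show "cmod (u x $ i) \<le> C * nrm u" if "u \<in> H" for u
        using C[OF that] Finite_Cartesian_Product.norm_nth_le[of "u x" i] by linarith
    qed simp_all
  qed
  then obtain K where K: "\<And>x i. K x i \<in> H" "\<And>x i u. u \<in> H \<Longrightarrow> u x $ i = ip u (K x i)" by metis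
  define \<Gamma> where "\<Gamma> x y = (\<chi> a i. K x i y $ a)" for x y
  have \<Gamma>: "(\<lambda>y. \<Gamma> x y *v z) = (\<lambda>y. \<Sum>i\<in>UNIV. z $ i *s K x i y)" for x z
    by (auto simp: \<Gamma>_def matrix_vector_mult_def vec_eq_iff fun_eq_iff mult.commute)
  have sums: "(\<lambda>y. \<Sum>i\<in>A. z $ i *s K x i y) \<in> H \<and> (\<forall>u\<in>H. ip u (\<lambda>y. \<Sum>i\<in>A. z $ i *s K x i y) = (\<Sum>i\<in>A. cnj (z $ i) * u x $ i))"
    for x z and A :: "'d set"
    using finite[of A]
  proof (induction A rule: finite_induct)
    case empty
    have "ip u (\<lambda>_. 0) = 0" if u: "u \<in> H" for u
      using ip_sym[OF zero u] ip_cmult[OF zero u, of 0] by simp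
    then show ?case using zero by simp
  next
    case (insert i A)
    have eq: "(\<lambda>y. \<Sum>i\<in>insert i A. z $ i *s K x i y) = comb (z $ i) (\<lambda>y. \<Sum>i\<in>A. z $ i *s K x i y) (K x i)"
      using insert(1,2) by (simp add: comb_def fun_eq_iff add.commute)
    have IH: "(\<lambda>y. \<Sum>i\<in>A. z $ i *s K x i y) \<in> H"
      "\<And>u. u \<in> H \<Longrightarrow> ip u (\<lambda>y. \<Sum>i\<in>A. z $ i *s K x i y) = (\<Sum>i\<in>A. cnj (z $ i) * u x $ i)"
      using insert(3) by auto
    show ?case
      unfolding eq
    proof (intro conjI ballI)
      show "comb (z $ i) (\<lambda>y. \<Sum>i\<in>A. z $ i *s K x i y) (K x i) \<in> H"
        by (rule comb_in[OF IH(1) K(1)])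
      fix u assume u: "u \<in> H"
      show "ip u (comb (z $ i) (\<lambda>y. \<Sum>i\<in>A. z $ i *s K x i y) (K x i)) = (\<Sum>i\<in>insert i A. cnj (z $ i) * u x $ i)"
        unfolding ip_comb_right[OF IH(1) K(1) u] IH(2)[OF u]
        using insert(1,2) K(2)[OF u, of x i] by simp
    qed
  qed
  show ?thesis
    unfolding is_rkhs_def
  proof (intro conjI exI[of _ \<Gamma>] allI ballI)
    show "hilbert_function_space H ip" by (rule H)
    show "(\<lambda>y. \<Gamma> x y *v z) \<in> H" for x z unfolding \<Gamma> using sums by blast
    show "cdot (u x) (cnj_vec z) = ip u (\<lambda>y. \<Gamma> x y *v z)" if "u \<in> H" for u x z
      unfolding \<Gamma> using sums[where A=UNIV and x=x and z=z] that by (simp add: cdot_def cnj_vec_def mult.commute)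
  qed
qed

end

section \<open>Completeness of the space of densities\<close>

text \<open>Integrate $t \le \delta + t^2/\delta$ over the sphere of mass $4\pi$ and choose $\delta$ as the norm.\<close>

lemma L1_le_nsq:
  assumes h: "h \<in> L2S"
  shows "(LINT \<xi>|sphere_measure. cmod (h \<xi>)) \<le> (4 * pi + 1) * sqrt (nsq h)"
proof -
  have hi: "integrable sphere_measure (\<lambda>\<xi>. cmod (h \<xi>))" using L2S_integrable[OF h] by simp
  have h2: "integrable sphere_measure (\<lambda>\<xi>. (cmod (h \<xi>))\<^sup>2)" using h by (simp add: L2S_def)
  have mass: "measure sphere_measure (space sphere_measure) = 4 * pi"
    by (simp add: measure_def space_sphere_measure emeasure_sphere_space)
  have d: "(LINT \<xi>|sphere_measure. cmod (h \<xi>)) \<le> 4 * pi * \<delta> + nsq h / \<delta>" if \<delta>: "\<delta> > 0" for \<delta>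
  proof -
    have "(LINT \<xi>|sphere_measure. cmod (h \<xi>)) \<le> (LINT \<xi>|sphere_measure. \<delta> + (cmod (h \<xi>))\<^sup>2 / \<delta>)"
    proof (rule integral_mono[OF hi])
      show "integrable sphere_measure (\<lambda>\<xi>. \<delta> + (cmod (h \<xi>))\<^sup>2 / \<delta>)" using h2 by simp
      fix \<xi>
      let ?t = "cmod (h \<xi>)"
      have "0 \<le> (\<delta> - ?t)\<^sup>2 + \<delta> * ?t" using \<delta> by simp
      then have "\<delta> * ?t \<le> \<delta> * \<delta> + ?t\<^sup>2" by (simp add: power2_eq_square algebra_simps)
      then show "?t \<le> \<delta> + ?t\<^sup>2 / \<delta>" using \<delta> by (simp add: field_simps)
    qed
    also have "\<dots> = 4 * pi * \<delta> + nsq h / \<delta>"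
      using h2 by (subst Bochner_Integration.integral_add) (auto simp: mass nsq_def)
    finally show ?thesis .
  qed
  show ?thesis
  proof (cases "nsq h = 0")
    case True
    have "(LINT \<xi>|sphere_measure. cmod (h \<xi>)) \<le> 0 + e" if "e > 0" for e
      using d[of "e / (4 * pi)"] that True by simp
    then show ?thesis using True field_le_epsilon[of "LINT \<xi>|sphere_measure. cmod (h \<xi>)" 0] by simp
  next
    case False
    then have "nsq h > 0" using nsq_nonneg[of h] by simp
    then show ?thesis using d[of "sqrt (nsq h)"] by (simp add: real_div_sqrt algebra_simps)
  qed
qed

lemma wave_eval_bound:
  assumes h: "h \<in> L2S" shows "cmod (wave k h x) \<le> (4 * pi + 1) * sqrt (nsq h)"
  by (rule order_trans[OF norm_wave_le L1_le_nsq[OF h]])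

lemma nsq_cong_AE:
  assumes "g \<in> L2S" "h \<in> L2S" "AE \<xi> in sphere_measure. g \<xi> = h \<xi>"
  shows "nsq g = nsq h"
proof -
  have [measurable]: "g \<in> borel_measurable sphere_measure" "h \<in> borel_measurable sphere_measure"
    using assms L2S_measurable by auto
  show ?thesis
    unfolding nsq_def
  proof (rule integral_cong_AE)
    show "AE \<xi> in sphere_measure. (cmod (g \<xi>))\<^sup>2 = (cmod (h \<xi>))\<^sup>2"
      using assms(3) by eventually_elim simp
  qed measurable
qed

lemma nsq_zero_AE:
  assumes "g \<in> L2S" "nsq g = 0" shows "AE \<xi> in sphere_measure. g \<xi> = 0"
proof -
  have "AE \<xi> in sphere_measure. (cmod (g \<xi>))\<^sup>2 = 0"
    using assms integral_nonneg_eq_0_iff_AE[of sphere_measure "\<lambda>\<xi>. (cmod (g \<xi>))\<^sup>2"]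
    by (simp add: nsq_def L2S_def)
  then show ?thesis by simp
qed

text \<open>A Cauchy sequence is Cauchy in the mean, so a subsequence converges almost everywhere. The lemma of
  Fatou along this subsequence bounds the distance to the limit.\<close>

lemma L2S_complete:
  fixes g :: "nat \<Rightarrow> real^3 \<Rightarrow> complex"
  assumes g: "\<And>n. g n \<in> L2S"
    and C: "\<And>e. e > 0 \<Longrightarrow> \<exists>N. \<forall>m\<ge>N. \<forall>n\<ge>N. nsq (\<lambda>\<xi>. g m \<xi> - g n \<xi>) < e"
  shows "\<exists>h\<in>L2S. (\<lambda>n. nsq (\<lambda>\<xi>. g n \<xi> - h \<xi>)) \<longlonglongrightarrow> 0"
proof -
  have [measurable]: "g n \<in> borel_measurable sphere_measure" for n using g L2S_measurable by auto
  have dL: "(\<lambda>\<xi>. g m \<xi> - g n \<xi>) \<in> L2S" for m n by (intro L2S_diff g)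
  obtain r where r: "strict_mono r" "AE \<xi> in sphere_measure. Cauchy (\<lambda>i. g (r i) \<xi>)"
  proof (rule cauchy_L1_AE_cauchy_subseq[of sphere_measure g])
    show "integrable sphere_measure (g n)" for n by (rule L2S_integrable[OF g])
    fix e :: real assume e: "e > 0"
    define e' where "e' = (e / (4 * pi + 1))\<^sup>2"
    have p: "4 * pi + 1 > 0" using pi_gt_zero by linarith
    have "e' > 0" unfolding e'_def using e p by simp
    then obtain N where N: "\<And>m n. m \<ge> N \<Longrightarrow> n \<ge> N \<Longrightarrow> nsq (\<lambda>\<xi>. g m \<xi> - g n \<xi>) < e'" using C by blast
    show "\<exists>N. \<forall>i\<ge>N. \<forall>j\<ge>N. (LINT \<xi>|sphere_measure. norm (g i \<xi> - g j \<xi>)) < e"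
    proof (intro exI allI impI)
      fix i j assume "i \<ge> N" "j \<ge> N"
      then have "sqrt (nsq (\<lambda>\<xi>. g i \<xi> - g j \<xi>)) < sqrt e'" using N by simp
      also have "sqrt e' = e / (4 * pi + 1)" unfolding e'_def using e p by simp
      finally have "(4 * pi + 1) * sqrt (nsq (\<lambda>\<xi>. g i \<xi> - g j \<xi>)) < e"
        using p by (simp add: pos_less_divide_eq mult.commute)
      then show "(LINT \<xi>|sphere_measure. norm (g i \<xi> - g j \<xi>)) < e"
        using L1_le_nsq[OF dL[of i j]] by linarith
    qed
  qed
  define h where "h \<xi> = lim (\<lambda>i. g (r i) \<xi>)" for \<xi>
  have hm [measurable]: "h \<in> borel_measurable sphere_measure"
    unfolding h_def by (rule borel_measurable_lim_metric) measurable
  have lim: "AE \<xi> in sphere_measure. (\<lambda>i. g (r i) \<xi>) \<longlonglongrightarrow> h \<xi>"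
    using r(2) by eventually_elim (simp add: h_def Cauchy_convergent_iff convergent_LIMSEQ_iff)
  have bound: "(\<integral>\<^sup>+\<xi>. ennreal ((cmod (g n \<xi> - h \<xi>))\<^sup>2) \<partial>sphere_measure) \<le> ennreal e"
    if N: "\<And>m. m \<ge> N \<Longrightarrow> nsq (\<lambda>\<xi>. g n \<xi> - g m \<xi>) \<le> e" for n N e
  proof -
    have "(\<integral>\<^sup>+\<xi>. ennreal ((cmod (g n \<xi> - h \<xi>))\<^sup>2) \<partial>sphere_measure) =
      (\<integral>\<^sup>+\<xi>. liminf (\<lambda>i. ennreal ((cmod (g n \<xi> - g (r i) \<xi>))\<^sup>2)) \<partial>sphere_measure)"
    proof (rule nn_integral_cong_AE)
      show "AE \<xi> in sphere_measure. ennreal ((cmod (g n \<xi> - h \<xi>))\<^sup>2) = liminf (\<lambda>i. ennreal ((cmod (g n \<xi> - g (r i) \<xi>))\<^sup>2))"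
        using lim
      proof eventually_elim
        case (elim \<xi>)
        have "(\<lambda>i. ennreal ((cmod (g n \<xi> - g (r i) \<xi>))\<^sup>2)) \<longlonglongrightarrow> ennreal ((cmod (g n \<xi> - h \<xi>))\<^sup>2)"
          by (intro tendsto_ennrealI tendsto_power tendsto_norm tendsto_diff tendsto_const elim)
        then show ?case by (intro lim_imp_Liminf[symmetric]) auto
      qed
    qed
    also have "\<dots> \<le> liminf (\<lambda>i. \<integral>\<^sup>+\<xi>. ennreal ((cmod (g n \<xi> - g (r i) \<xi>))\<^sup>2) \<partial>sphere_measure)"
      by (rule nn_integral_liminf) measurable
    also have "\<dots> \<le> ennreal e"
    proof (rule Liminf_le)
      show "\<forall>\<^sub>F i in sequentially. (\<integral>\<^sup>+\<xi>. ennreal ((cmod (g n \<xi> - g (r i) \<xi>))\<^sup>2) \<partial>sphere_measure) \<le> ennreal e"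
        using eventually_ge_at_top[of N]
      proof eventually_elim
        case (elim i)
        have "(\<integral>\<^sup>+\<xi>. ennreal ((cmod (g n \<xi> - g (r i) \<xi>))\<^sup>2) \<partial>sphere_measure) = ennreal (nsq (\<lambda>\<xi>. g n \<xi> - g (r i) \<xi>))"
          unfolding nsq_def using dL by (intro nn_integral_eq_integral) (auto simp: L2S_def)
        also have "\<dots> \<le> ennreal e"
          using N[of "r i"] elim seq_suble[OF r(1), of i] by (intro ennreal_leI) simp
        finally show ?case .
      qed
    qed simp
    finally show ?thesis .
  qed
  have diffL: "(\<lambda>\<xi>. g n \<xi> - h \<xi>) \<in> L2S \<and> nsq (\<lambda>\<xi>. g n \<xi> - h \<xi>) \<le> e"
    if N: "\<And>m. m \<ge> N \<Longrightarrow> nsq (\<lambda>\<xi>. g n \<xi> - g m \<xi>) \<le> e" and e: "e \<ge> 0" for n N e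
  proof -
    have I: "integrable sphere_measure (\<lambda>\<xi>. (cmod (g n \<xi> - h \<xi>))\<^sup>2)"
    proof (rule integrableI_bounded)
      show "(\<integral>\<^sup>+\<xi>. ennreal (norm ((cmod (g n \<xi> - h \<xi>))\<^sup>2)) \<partial>sphere_measure) < \<infinity>"
        using le_less_trans[OF bound[of N n e, OF N] ennreal_less_top] by simp
    qed measurable
    have "ennreal (nsq (\<lambda>\<xi>. g n \<xi> - h \<xi>)) \<le> ennreal e"
      using bound[of N n e, OF N] nn_integral_eq_integral[OF I] by (simp add: nsq_def)
    then show ?thesis using I e by (simp add: L2S_def)
  qed
  obtain N1 where N1: "\<And>m n. m \<ge> N1 \<Longrightarrow> n \<ge> N1 \<Longrightarrow> nsq (\<lambda>\<xi>. g m \<xi> - g n \<xi>) < 1" using C[of 1] by auto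
  have "(\<lambda>\<xi>. g N1 \<xi> - h \<xi>) \<in> L2S" using diffL[of N1 N1 1] N1 by (simp add: less_imp_le)
  then have d: "(\<lambda>\<xi>. g N1 \<xi> - (g N1 \<xi> - h \<xi>)) \<in> L2S" by (rule L2S_diff[OF g])
  have "(\<lambda>\<xi>. g N1 \<xi> - (g N1 \<xi> - h \<xi>)) = h" by (simp add: fun_eq_iff)
  from d[unfolded this] have hL: "h \<in> L2S" .
  have "(\<lambda>n. nsq (\<lambda>\<xi>. g n \<xi> - h \<xi>)) \<longlonglongrightarrow> 0"
  proof (rule LIMSEQ_I)
    fix e :: real assume e: "e > 0"
    then obtain N where N: "\<And>m n. m \<ge> N \<Longrightarrow> n \<ge> N \<Longrightarrow> nsq (\<lambda>\<xi>. g m \<xi> - g n \<xi>) < e / 2" using C[of "e/2"] by auto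
    show "\<exists>N. \<forall>n\<ge>N. norm (nsq (\<lambda>\<xi>. g n \<xi> - h \<xi>) - 0) < e"
    proof (intro exI allI impI)
      fix n assume "n \<ge> N"
      then have "nsq (\<lambda>\<xi>. g n \<xi> - h \<xi>) \<le> e / 2" using diffL[of N n "e/2"] N e by (simp add: less_imp_le)
      then show "norm (nsq (\<lambda>\<xi>. g n \<xi> - h \<xi>) - 0) < e" using e nsq_nonneg[of "\<lambda>\<xi>. g n \<xi> - h \<xi>"] by simp
    qed
  qed
  then show ?thesis using hL by blast
qed

section \<open>Elastic Herglotz waves and their densities\<close>

text \<open>The densities \<open>a\<close> and \<open>b\<close> of the longitudinal and the transversal part, by components. That \<open>a\<close> is
  parallel to the direction is expressed by the minors, which are up to sign the components of the
  cross product.\<close>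

definition rep :: "real \<Rightarrow> real \<Rightarrow> (3 \<Rightarrow> real^3 \<Rightarrow> complex) \<Rightarrow> (3 \<Rightarrow> real^3 \<Rightarrow> complex) \<Rightarrow> (real^3 \<Rightarrow> complex^3) \<Rightarrow> bool" where
  "rep kp ks a b u \<longleftrightarrow> (\<forall>j. a j \<in> L2S) \<and> (\<forall>j. b j \<in> L2S) \<and>
     (\<forall>i j. AE \<xi> in sphere_measure. of_real (\<xi>$i) * a j \<xi> - of_real (\<xi>$j) * a i \<xi> = 0) \<and>
     (AE \<xi> in sphere_measure. (\<Sum>j\<in>UNIV. of_real (\<xi>$j) * b j \<xi>) = 0) \<and>
     (\<forall>x j. u x $ j = wave kp (a j) x + wave ks (b j) x)"

lemma repD:
  assumes "rep kp ks a b u"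
  shows "a j \<in> L2S" "b j \<in> L2S" "u x $ j = wave kp (a j) x + wave ks (b j) x"
    "AE \<xi> in sphere_measure. of_real (\<xi>$i) * a j \<xi> - of_real (\<xi>$j) * a i \<xi> = 0"
    "AE \<xi> in sphere_measure. (\<Sum>j\<in>UNIV. of_real (\<xi>$j) * b j \<xi>) = 0"
  using assms by (auto simp: rep_def)

lemma rep_comp: "rep kp ks a b u \<Longrightarrow> (\<lambda>x. u x $ j) = (\<lambda>x. wave kp (a j) x + wave ks (b j) x)"
  by (rule ext) (rule repD)

lemma wave_cong_AE:
  assumes "integrable sphere_measure g" "integrable sphere_measure h" "AE \<xi> in sphere_measure. g \<xi> = h \<xi>"
  shows "wave k g = wave k h"
proof
  fix x
  have [measurable]: "g \<in> borel_measurable sphere_measure" "h \<in> borel_measurable sphere_measure" using assms by auto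
  show "wave k g x = wave k h x"
    unfolding wave_def
  proof (rule integral_cong_AE)
    show "AE \<xi> in sphere_measure. cis (k * (x \<bullet> \<xi>)) * g \<xi> = cis (k * (x \<bullet> \<xi>)) * h \<xi>"
      using assms(3) by eventually_elim simp
  qed measurable
qed

lemma rep_add:
  assumes "rep kp ks a b u" "rep kp ks a' b' u'"
  shows "rep kp ks (\<lambda>j \<xi>. a j \<xi> + a' j \<xi>) (\<lambda>j \<xi>. b j \<xi> + b' j \<xi>) (\<lambda>x. u x + u' x)"
  unfolding rep_def
proof (intro conjI allI)
  note r = repD[OF assms(1)] and r' = repD[OF assms(2)]
  show "(\<lambda>\<xi>. a j \<xi> + a' j \<xi>) \<in> L2S" "(\<lambda>\<xi>. b j \<xi> + b' j \<xi>) \<in> L2S" for j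
    by (intro L2S_add r r')+
  show "AE \<xi> in sphere_measure. of_real (\<xi>$i) * (a j \<xi> + a' j \<xi>) - of_real (\<xi>$j) * (a i \<xi> + a' i \<xi>) = 0" for i j
    using r(4)[of i j] r'(4)[of i j] by eventually_elim (simp add: algebra_simps)
  show "AE \<xi> in sphere_measure. (\<Sum>j\<in>UNIV. of_real (\<xi>$j) * (b j \<xi> + b' j \<xi>)) = 0"
    using r(5) r'(5) by eventually_elim (simp add: distrib_left sum.distrib)
  show "(u x + u' x) $ j = wave kp (\<lambda>\<xi>. a j \<xi> + a' j \<xi>) x + wave ks (\<lambda>\<xi>. b j \<xi> + b' j \<xi>) x" for x j
    using r r' L2S_integrable by (simp add: wave_add)
qed

lemma rep_cmult:
  assumes "rep kp ks a b u"
  shows "rep kp ks (\<lambda>j \<xi>. c * a j \<xi>) (\<lambda>j \<xi>. c * b j \<xi>) (\<lambda>x. c *s u x)"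
  unfolding rep_def
proof (intro conjI allI)
  note r = repD[OF assms(1)]
  show "(\<lambda>\<xi>. c * a j \<xi>) \<in> L2S" "(\<lambda>\<xi>. c * b j \<xi>) \<in> L2S" for j
    by (intro L2S_cmult r)+
  show "AE \<xi> in sphere_measure. of_real (\<xi>$i) * (c * a j \<xi>) - of_real (\<xi>$j) * (c * a i \<xi>) = 0" for i j
    using r(4)[of i j] by eventually_elim (simp add: mult.left_commute right_diff_distrib[symmetric])
  show "AE \<xi> in sphere_measure. (\<Sum>j\<in>UNIV. of_real (\<xi>$j) * (c * b j \<xi>)) = 0"
    using r(5) by eventually_elim (simp add: mult.left_commute sum_distrib_left[symmetric])
  show "(c *s u x) $ j = wave kp (\<lambda>\<xi>. c * a j \<xi>) x + wave ks (\<lambda>\<xi>. c * b j \<xi>) x" for x j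
    using r by (simp add: wave_cmult distrib_left)
qed

lemma rep_diff:
  assumes "rep kp ks a b u" "rep kp ks a' b' u'"
  shows "rep kp ks (\<lambda>j \<xi>. a j \<xi> - a' j \<xi>) (\<lambda>j \<xi>. b j \<xi> - b' j \<xi>) (\<lambda>x. u x - u' x)"
proof -
  have e: "(-1::complex) *s z = - z" for z :: "complex^3" by (simp add: vec_eq_iff)
  show ?thesis using rep_add[OF assms(1) rep_cmult[OF assms(2), of "-1"]] by (simp add: e)
qed

lemma rep_Ck: assumes "rep kp ks a b u" shows "Ck n u"
proof (rule Ck_vec)
  show "Ck n (\<lambda>x. u x $ j)" for j
    unfolding rep_comp[OF assms] by (intro Ck_add Ck_wave L2S_integrable repD[OF assms])
qed

lemma rep_differentiable: assumes "rep kp ks a b u" shows "u differentiable (at x)"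
  using rep_Ck[OF assms, of 1] by simp

text \<open>Transversal waves have no divergence, and the gradient of the divergence of the longitudinal part is
  $-k_p^2$ times this part. What remains are the dispersion relations that define the two wave numbers.\<close>

lemma rep_navier:
  assumes rp: "rep kp ks a b u" and mu: "\<mu> > 0" "2 * \<mu> + lam > 0"
    and kp: "kp\<^sup>2 = \<omega>\<^sup>2 * \<rho> / (2 * \<mu> + lam)" and ks: "ks\<^sup>2 = \<omega>\<^sup>2 * \<rho> / \<mu>"
  shows "entire_navier_solution \<rho> \<omega> lam \<mu> u"
  unfolding entire_navier_solution_def
proof (intro conjI allI)
  note r = repD[OF rp]
  have ai: "integrable sphere_measure (a j)" and bi: "integrable sphere_measure (b j)" for j
    using r L2S_integrable by auto
  have am: "a j \<in> borel_measurable sphere_measure" for j using ai by auto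
  show "Ck 2 u" by (rule rep_Ck[OF rp])
  fix x
  let ?p = "\<lambda>j. wave kp (a j)" and ?q = "\<lambda>j. wave ks (b j)"
  have d0: "(\<lambda>y. u y $ j) = (\<lambda>y. ?p j y + ?q j y)" for j by (rule rep_comp[OF rp])
  have Dp: "?p j differentiable (at y)" "?q j differentiable (at y)" for j y
    unfolding differentiable_def by (rule exI, rule wave_has_derivative[OF ai], rule exI, rule wave_has_derivative[OF bi])
  have pdu: "pd i (\<lambda>y. u y $ j) = (\<lambda>y. wave kp (dens kp i (a j)) y + wave ks (dens ks i (b j)) y)" for i j
    unfolding d0 by (rule ext) (simp add: pd_add[OF Dp] pd_wave ai bi)
  have pd1: "(\<lambda>y. pd i u y $ j) = pd i (\<lambda>y. u y $ j)" for i j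
    using pd_component[OF rep_differentiable[OF rp]] by auto
  have pd2: "pd i (pd i u) x $ j = wave kp (dens kp i (dens kp i (a j))) x + wave ks (dens ks i (dens ks i (b j))) x" for i j
  proof -
    have Ds: "wave kp (dens kp i (a j)) differentiable (at x)" "wave ks (dens ks i (b j)) differentiable (at x)"
      unfolding differentiable_def
      by (rule exI, rule wave_has_derivative[OF dens_integrable[OF ai]], rule exI, rule wave_has_derivative[OF dens_integrable[OF bi]])
    have "pd i u differentiable (at x)" using rep_Ck[OF rp, of 2] by (simp add: numeral_2_eq_2)
    then have "pd i (pd i u) x $ j = pd i (\<lambda>y. pd i u y $ j) x" by (rule pd_component[symmetric])
    also have "\<dots> = wave kp (dens kp i (dens kp i (a j))) x + wave ks (dens ks i (dens ks i (b j))) x"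
      unfolding pd1 pdu by (simp add: pd_add[OF Ds] pd_wave dens_integrable ai bi)
    finally show ?thesis .
  qed
  have lap: "laplacian u x $ j = - of_real (kp\<^sup>2) * ?p j x - of_real (ks\<^sup>2) * ?q j x" for j
    unfolding laplacian_def sum_component pd2 sum.distrib wave_helmholtz_sum[OF ai] wave_helmholtz_sum[OF bi]
    by (simp add: scaleR_conv_of_real)
  define d where "d \<xi> = (\<Sum>i\<in>UNIV. dens kp i (a i) \<xi>)" for \<xi>
  have di: "integrable sphere_measure d"
    unfolding d_def by (intro Bochner_Integration.integrable_sum dens_integrable ai)
  have bs: "wave ks (\<lambda>\<xi>. \<Sum>i\<in>UNIV. dens ks i (b i) \<xi>) = wave ks (\<lambda>\<xi>. 0)"
  proof (rule wave_cong_AE)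
    show "AE \<xi> in sphere_measure. (\<Sum>i\<in>UNIV. dens ks i (b i) \<xi>) = 0"
      using r(5)
    proof eventually_elim
      case (elim \<xi>)
      have "(\<Sum>i\<in>UNIV. dens ks i (b i) \<xi>) = \<i> * of_real ks * (\<Sum>j\<in>UNIV. of_real (\<xi>$j) * b j \<xi>)"
        by (simp add: dens_def sum_distrib_left mult.assoc)
      then show ?case using elim by simp
    qed
  qed (auto intro!: Bochner_Integration.integrable_sum dens_integrable bi)
  have div: "divergence u = wave kp d"
  proof
    fix y
    have "divergence u y = (\<Sum>i\<in>UNIV. wave kp (dens kp i (a i)) y) + (\<Sum>i\<in>UNIV. wave ks (dens ks i (b i)) y)"
      unfolding divergence_def pdu sum.distrib ..
    also have "(\<Sum>i\<in>UNIV. wave kp (dens kp i (a i)) y) = wave kp d y"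
      unfolding d_def by (rule wave_sum[symmetric]) (intro dens_integrable ai)
    also have "(\<Sum>i\<in>UNIV. wave ks (dens ks i (b i)) y) = wave ks (\<lambda>\<xi>. \<Sum>i\<in>UNIV. dens ks i (b i) \<xi>) y"
      by (rule wave_sum[symmetric]) (intro dens_integrable bi)
    also have "\<dots> = 0" unfolding bs by (simp add: wave_def)
    finally show "divergence u y = wave kp d y" by simp
  qed
  have gd: "gradient (divergence u) x $ j = - of_real (kp\<^sup>2) * ?p j x" for j
  proof -
    have "wave kp (dens kp j d) = wave kp (\<lambda>\<xi>. - of_real (kp\<^sup>2) * a j \<xi>)"
    proof (rule wave_cong_AE)
      have "AE \<xi> in sphere_measure. \<forall>i. of_real (\<xi>$i) * a j \<xi> - of_real (\<xi>$j) * a i \<xi> = 0"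
        using r(4) by (subst AE_all_countable) auto
      moreover have "AE \<xi> in sphere_measure. \<xi> \<in> space sphere_measure" by (rule AE_space)
      ultimately show "AE \<xi> in sphere_measure. dens kp j d \<xi> = - of_real (kp\<^sup>2) * a j \<xi>"
      proof eventually_elim
        case (elim \<xi>)
        have "dens kp j d \<xi> = - of_real (kp\<^sup>2) * (\<Sum>i\<in>UNIV. of_real (\<xi>$i) * (of_real (\<xi>$j) * a i \<xi>))"
          by (simp add: dens_def d_def sum_3 power2_eq_square algebra_simps)
        also have "(\<Sum>i\<in>UNIV. of_real (\<xi>$i) * (of_real (\<xi>$j) * a i \<xi>)) = (\<Sum>i\<in>UNIV. of_real (\<xi>$i) * (of_real (\<xi>$i) * a j \<xi>))"
          using elim(1) by simp
        also have "\<dots> = of_real (\<Sum>i\<in>UNIV. (\<xi>$i)\<^sup>2) * a j \<xi>"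
          by (simp add: sum_distrib_right power2_eq_square mult.assoc)
        finally show ?case unfolding sphere_sum_sq[OF elim(2)] by simp
      qed
    qed (use ai di dens_integrable in auto)
    then show ?thesis
      by (simp only: gradient_def div pd_wave[OF di] wave_cmult vec_lambda_beta)
  qed
  have m1: "(2 * \<mu> + lam) * kp\<^sup>2 = \<rho> * \<omega>\<^sup>2" using mu by (simp add: kp)
  have m2: "\<mu> * ks\<^sup>2 = \<rho> * \<omega>\<^sup>2" using mu by (simp add: ks)
  show "\<mu> *\<^sub>R laplacian u x + (lam + \<mu>) *\<^sub>R gradient (divergence u) x + (\<rho> * \<omega>\<^sup>2) *\<^sub>R u x = 0"
  proof (rule vec_eq_iff[THEN iffD2], rule allI)
    fix j
    have "(\<mu> *\<^sub>R laplacian u x + (lam + \<mu>) *\<^sub>R gradient (divergence u) x + (\<rho> * \<omega>\<^sup>2) *\<^sub>R u x) $ j =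
      of_real (\<rho> * \<omega>\<^sup>2 - (2 * \<mu> + lam) * kp\<^sup>2) * ?p j x + of_real (\<rho> * \<omega>\<^sup>2 - \<mu> * ks\<^sup>2) * ?q j x"
      unfolding vector_add_component vector_scaleR_component lap gd r(3)
      by (simp add: scaleR_conv_of_real algebra_simps)
    then show "(\<mu> *\<^sub>R laplacian u x + (lam + \<mu>) *\<^sub>R gradient (divergence u) x + (\<rho> * \<omega>\<^sup>2) *\<^sub>R u x) $ j = 0 $ j"
      unfolding m1 m2 by simp
  qed
qed

lemma norm_vec3_complex_sq: "(norm (z::complex^3))\<^sup>2 = (\<Sum>j\<in>UNIV. (cmod (z $ j))\<^sup>2)"
  by (simp add: norm_vec_def L2_set_def sum_nonneg)

lemma L2_sphere_component:
  assumes g: "g \<in> L2_sphere" shows "(\<lambda>\<xi>. g \<xi> $ j) \<in> L2S"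
proof -
  have gm: "g \<in> borel_measurable sphere_measure" and gi: "integrable sphere_measure (\<lambda>\<xi>. (norm (g \<xi>))\<^sup>2)"
    using g by (auto simp: L2_sphere_def)
  have m: "(\<lambda>\<xi>. g \<xi> $ j) \<in> borel_measurable sphere_measure"
    by (rule measurable_compose[OF gm]) (intro borel_measurable_continuous_onI continuous_intros)
  have "integrable sphere_measure (\<lambda>\<xi>. (cmod (g \<xi> $ j))\<^sup>2)"
    by (rule Bochner_Integration.integrable_bound[OF gi])
       (use m in \<open>auto intro!: power_mono Finite_Cartesian_Product.norm_nth_le\<close>)
  then show ?thesis using m by (simp add: L2S_def)
qed

lemma L2_sphere_vec:
  assumes a: "\<And>j. a j \<in> L2S" shows "(\<lambda>\<xi>. \<chi> j. a j \<xi>) \<in> L2_sphere"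
proof -
  have am: "a j \<in> borel_measurable sphere_measure" for j using a L2S_measurable by auto
  have eq: "(\<lambda>\<xi>. \<chi> j. a j \<xi>) = (\<lambda>\<xi>. \<Sum>j\<in>UNIV. axis j (a j \<xi>) :: complex^3)"
  proof
    fix \<xi> show "(\<chi> j. a j \<xi>) = (\<Sum>j\<in>UNIV. axis j (a j \<xi>))"
      by (auto simp: vec_eq_iff sum_component axis_def)
  qed
  have ax: "axis j \<in> borel_measurable (borel :: complex measure)" for j :: 3
  proof -
    have "bounded_linear (axis j :: complex \<Rightarrow> complex^3)"
      by (rule bounded_linear_intro[where K=1]) (auto simp: vec_eq_iff axis_def norm_vec_def L2_set_def if_distrib[of cmod] if_distrib[of "\<lambda>t. t\<^sup>2"] cong: if_cong)
    then show ?thesis by (intro borel_measurable_continuous_onI linear_continuous_on)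
  qed
  have m: "(\<lambda>\<xi>. \<chi> j. a j \<xi>) \<in> borel_measurable sphere_measure"
    unfolding eq by (intro borel_measurable_sum measurable_compose[OF am ax])
  have "integrable sphere_measure (\<lambda>\<xi>. \<Sum>j\<in>UNIV. (cmod (a j \<xi>))\<^sup>2)"
    using a by (intro Bochner_Integration.integrable_sum) (simp add: L2S_def)
  then show ?thesis using m by (simp add: L2_sphere_def norm_vec3_complex_sq)
qed

lemma L2_sphere_integrable:
  assumes g: "g \<in> L2_sphere" shows "integrable sphere_measure (\<lambda>\<xi>. exp (\<i> * of_real (k * (x \<bullet> \<xi>))) *s g \<xi>)"
proof -
  have gm: "g \<in> borel_measurable sphere_measure" and gi: "integrable sphere_measure (\<lambda>\<xi>. (norm (g \<xi>))\<^sup>2)"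
    using g by (auto simp: L2_sphere_def)
  have eq: "exp (\<i> * of_real (k * (x \<bullet> \<xi>))) *s g \<xi> = (\<chi> j. cis (k * (x \<bullet> \<xi>)) * (g \<xi> $ j))" for \<xi>
    by (simp add: vec_eq_iff cis_conv_exp)
  have "(\<lambda>\<xi>. cis (k * (x \<bullet> \<xi>)) * (g \<xi> $ j)) \<in> L2S" for j
    by (rule L2S_mult(1)[where C=1, OF L2_sphere_component[OF g]]) auto
  from L2_sphere_vec[OF this] have L: "(\<lambda>\<xi>. exp (\<i> * of_real (k * (x \<bullet> \<xi>))) *s g \<xi>) \<in> L2_sphere" unfolding eq .
  then have m: "(\<lambda>\<xi>. exp (\<i> * of_real (k * (x \<bullet> \<xi>))) *s g \<xi>) \<in> borel_measurable sphere_measure"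
    and i2: "integrable sphere_measure (\<lambda>\<xi>. (norm (exp (\<i> * of_real (k * (x \<bullet> \<xi>))) *s g \<xi>))\<^sup>2)"
    by (auto simp: L2_sphere_def)
  show ?thesis
  proof (rule Bochner_Integration.integrable_bound)
    show "integrable sphere_measure (\<lambda>\<xi>. 1 + (norm (exp (\<i> * of_real (k * (x \<bullet> \<xi>))) *s g \<xi>))\<^sup>2)" using i2 by simp
    show "AE \<xi> in sphere_measure. norm (exp (\<i> * of_real (k * (x \<bullet> \<xi>))) *s g \<xi>) \<le> norm (1 + (norm (exp (\<i> * of_real (k * (x \<bullet> \<xi>))) *s g \<xi>))\<^sup>2)"
    proof (rule AE_I2)
      fix \<xi>
      let ?t = "norm (exp (\<i> * of_real (k * (x \<bullet> \<xi>))) *s g \<xi>)"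
      have "0 \<le> (?t - 1)\<^sup>2 + ?t" by simp
      then show "?t \<le> norm (1 + ?t\<^sup>2)" by (simp add: power2_eq_square algebra_simps)
    qed
  qed (rule m)
qed

lemma herglotz_integral_component:
  assumes g1: "g1 \<in> L2_sphere" and g2: "g2 \<in> L2_sphere"
  shows "(LINT \<xi>|sphere_measure. exp (\<i> * of_real (kp * (x \<bullet> \<xi>))) *s g1 \<xi> + exp (\<i> * of_real (ks * (x \<bullet> \<xi>))) *s g2 \<xi>) $ j
    = wave kp (\<lambda>\<xi>. g1 \<xi> $ j) x + wave ks (\<lambda>\<xi>. g2 \<xi> $ j) x"
proof -
  note I = L2_sphere_integrable[OF g1, of kp x] L2_sphere_integrable[OF g2, of ks x]
  have "(LINT \<xi>|sphere_measure. exp (\<i> * of_real (kp * (x \<bullet> \<xi>))) *s g1 \<xi> + exp (\<i> * of_real (ks * (x \<bullet> \<xi>))) *s g2 \<xi>) $ j =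
    (LINT \<xi>|sphere_measure. (exp (\<i> * of_real (kp * (x \<bullet> \<xi>))) *s g1 \<xi> + exp (\<i> * of_real (ks * (x \<bullet> \<xi>))) *s g2 \<xi>) $ j)"
    by (rule integral_bounded_linear[OF bounded_linear_vec_nth, symmetric]) (intro Bochner_Integration.integrable_add I)
  also have "\<dots> = wave kp (\<lambda>\<xi>. g1 \<xi> $ j) x + wave ks (\<lambda>\<xi>. g2 \<xi> $ j) x"
    unfolding wave_def cis_conv_exp
    using wave_integrable[OF L2S_integrable[OF L2_sphere_component[OF g1, of j]], of kp x]
      wave_integrable[OF L2S_integrable[OF L2_sphere_component[OF g2, of j]], of ks x]
    by (simp add: cis_conv_exp Bochner_Integration.integral_add)
  finally show ?thesis .
qed

lemma cross_zero_iff: "cross_rc \<xi> z = 0 \<longleftrightarrow> (\<forall>i j. of_real (\<xi>$i) * z $ j - of_real (\<xi>$j) * z $ i = 0)"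
  by (auto simp: cross_rc_def vec_eq_iff forall_3)

text \<open>The Navier equation holds automatically, so only the densities matter.\<close>

lemma herglotz_rep:
  assumes mu: "\<mu> > 0" "2 * \<mu> + lam > 0"
    and kp: "kp\<^sup>2 = \<omega>\<^sup>2 * \<rho> / (2 * \<mu> + lam)" and ks: "ks\<^sup>2 = \<omega>\<^sup>2 * \<rho> / \<mu>"
  shows "u \<in> herglotz_waves \<rho> \<omega> lam \<mu> kp ks \<longleftrightarrow> (\<exists>a b. rep kp ks a b u)"
proof
  assume "u \<in> herglotz_waves \<rho> \<omega> lam \<mu> kp ks"
  then obtain g1 g2 where g: "g1 \<in> L2_sphere" "g2 \<in> L2_sphere"
    and c: "AE \<xi> in sphere_measure. cross_rc \<xi> (g1 \<xi>) = 0" "AE \<xi> in sphere_measure. cdot (vec_of_real \<xi>) (g2 \<xi>) = 0"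
    and u: "\<And>x. u x = (LINT \<xi>|sphere_measure. exp (\<i> * of_real (kp * (x \<bullet> \<xi>))) *s g1 \<xi> + exp (\<i> * of_real (ks * (x \<bullet> \<xi>))) *s g2 \<xi>)"
    by (auto simp: herglotz_waves_def)
  have "rep kp ks (\<lambda>j \<xi>. g1 \<xi> $ j) (\<lambda>j \<xi>. g2 \<xi> $ j) u"
    unfolding rep_def
  proof (intro conjI allI)
    show "AE \<xi> in sphere_measure. of_real (\<xi>$i) * g1 \<xi> $ j - of_real (\<xi>$j) * g1 \<xi> $ i = 0" for i j
      using c(1) by eventually_elim (simp add: cross_zero_iff)
    show "AE \<xi> in sphere_measure. (\<Sum>j\<in>UNIV. of_real (\<xi>$j) * g2 \<xi> $ j) = 0"
      using c(2) by eventually_elim (simp add: cdot_def vec_of_real_def)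
    show "u x $ j = wave kp (\<lambda>\<xi>. g1 \<xi> $ j) x + wave ks (\<lambda>\<xi>. g2 \<xi> $ j) x" for x j
      unfolding u by (rule herglotz_integral_component[OF g])
  qed (simp_all add: L2_sphere_component g)
  then show "\<exists>a b. rep kp ks a b u" by blast
next
  assume "\<exists>a b. rep kp ks a b u"
  then obtain a b where rp: "rep kp ks a b u" by blast
  note r = repD[OF rp]
  define g1 where "g1 \<xi> = (\<chi> j. a j \<xi>)" for \<xi>
  define g2 where "g2 \<xi> = (\<chi> j. b j \<xi>)" for \<xi>
  have g: "g1 \<in> L2_sphere" "g2 \<in> L2_sphere"
    unfolding g1_def g2_def by (intro L2_sphere_vec r)+
  have c1: "AE \<xi> in sphere_measure. cross_rc \<xi> (g1 \<xi>) = 0"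
  proof -
    have "AE \<xi> in sphere_measure. \<forall>i j. of_real (\<xi>$i) * a j \<xi> - of_real (\<xi>$j) * a i \<xi> = 0"
      using r(4) by (simp add: AE_all_countable)
    then show ?thesis by eventually_elim (simp add: cross_zero_iff g1_def)
  qed
  have c2: "AE \<xi> in sphere_measure. cdot (vec_of_real \<xi>) (g2 \<xi>) = 0"
    using r(5) by eventually_elim (simp add: cdot_def vec_of_real_def g2_def)
  have "u x = (LINT \<xi>|sphere_measure. exp (\<i> * of_real (kp * (x \<bullet> \<xi>))) *s g1 \<xi> + exp (\<i> * of_real (ks * (x \<bullet> \<xi>))) *s g2 \<xi>)" for x
    unfolding vec_eq_iff herglotz_integral_component[OF g] by (simp add: g1_def g2_def r(3))
  then show "u \<in> herglotz_waves \<rho> \<omega> lam \<mu> kp ks"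
    unfolding herglotz_waves_def using rep_navier[OF rp mu kp ks] g c1 c2 by blast
qed

section \<open>The inner product on smooth functions of finite norm\<close>

text \<open>On such functions the form \<open>H_inner\<close> is given by convergent integrals, so that it is sesquilinear.\<close>

definition finite_energy :: "(real^3 \<Rightarrow> complex^3) \<Rightarrow> bool" where
  "finite_energy u \<longleftrightarrow> (\<forall>k. Ck k u) \<and> (\<forall>j. hint (\<lambda>x. u x $ j))"

lemma finite_energy_differentiable: assumes "finite_energy u" shows "u differentiable (at x)" "(\<lambda>y. u y $ j) differentiable (at x)"
proof -
  have "Ck 1 u" using assms by (simp only: finite_energy_def)
  then show d: "u differentiable (at x)" by simp
  show "(\<lambda>y. u y $ j) differentiable (at x)"
    using bounded_linear.has_derivative[OF bounded_linear_vec_nth derivative_expand[OF d]] by (auto simp: differentiable_def)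
qed

lemma finite_energy_measurable:
  assumes u: "finite_energy u"
  shows "(\<lambda>x. u x $ j) \<in> borel_measurable borel" "rot i l (\<lambda>y. u y $ j) \<in> borel_measurable borel"
proof -
  have "Ck 0 u" "Ck 1 u" using u by (simp_all only: finite_energy_def)
  then have c: "continuous_on UNIV u" "\<And>l. continuous_on UNIV (pd l u)" by auto
  show "(\<lambda>x. u x $ j) \<in> borel_measurable borel"
    by (intro borel_measurable_continuous_onI continuous_intros c)
  have "rot i l (\<lambda>y. u y $ j) = (\<lambda>x. (x$i) *\<^sub>R (pd l u x $ j) - (x$l) *\<^sub>R (pd i u x $ j))"
    by (rule ext) (simp add: rot_def pd_component[OF finite_energy_differentiable(1)[OF u]])
  then show "rot i l (\<lambda>y. u y $ j) \<in> borel_measurable borel"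
    by (simp only:) (intro borel_measurable_continuous_onI continuous_intros c)
qed

lemma finite_energy_wint: "finite_energy u \<Longrightarrow> wint (\<lambda>x. u x $ j)" "finite_energy u \<Longrightarrow> wint (rot i l (\<lambda>y. u y $ j))"
  by (auto simp: finite_energy_def hint_def)

definition wprod :: "(real^3 \<Rightarrow> complex) \<Rightarrow> (real^3 \<Rightarrow> complex) \<Rightarrow> real^3 \<Rightarrow> complex" where
  "wprod f g x = of_real (yb x ^ 3) * (f x * cnj (g x))"

lemma wprod_measurable:
  assumes "f \<in> borel_measurable borel" "g \<in> borel_measurable borel"
  shows "wprod f g \<in> borel_measurable borel"
proof -
  note assms [measurable]
  have [measurable]: "yb \<in> borel_measurable borel" by (rule bc_measurable[OF bc_yb(1)])
  have [measurable]: "cnj \<in> borel_measurable borel"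
    by (intro borel_measurable_continuous_onI continuous_intros)
  show ?thesis unfolding wprod_def[abs_def] by measurable
qed

lemma wprod_integrable:
  assumes "wint f" "wint g" "f \<in> borel_measurable borel" "g \<in> borel_measurable borel"
  shows "integrable lborel (wprod f g)"
proof (rule Bochner_Integration.integrable_bound)
  show "integrable lborel (\<lambda>x. yb x ^ 3 * (cmod (f x))\<^sup>2 + yb x ^ 3 * (cmod (g x))\<^sup>2)"
    using assms by (simp add: wint_def)
  show "wprod f g \<in> borel_measurable lborel" using wprod_measurable[OF assms(3,4)] by simp
  show "AE x in lborel. norm (wprod f g x) \<le> norm (yb x ^ 3 * (cmod (f x))\<^sup>2 + yb x ^ 3 * (cmod (g x))\<^sup>2)"
  proof (rule AE_I2)
    fix x
    have y: "0 \<le> yb x ^ 3" using yb_bounds(3)[of x] by simp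
    have "cmod (f x) * cmod (g x) \<le> (cmod (f x))\<^sup>2 + (cmod (g x))\<^sup>2"
    proof -
      have "0 \<le> (cmod (f x) - cmod (g x))\<^sup>2 + cmod (f x) * cmod (g x)" by simp
      then show ?thesis by (simp add: power2_eq_square algebra_simps)
    qed
    then have "yb x ^ 3 * (cmod (f x) * cmod (g x)) \<le> yb x ^ 3 * ((cmod (f x))\<^sup>2 + (cmod (g x))\<^sup>2)"
      using y by (rule mult_left_mono)
    moreover have "norm (wprod f g x) = yb x ^ 3 * (cmod (f x) * cmod (g x))"
      using y yb_bounds(3)[of x] by (simp add: wprod_def norm_mult norm_power)
    ultimately show "norm (wprod f g x) \<le> norm (yb x ^ 3 * (cmod (f x))\<^sup>2 + yb x ^ 3 * (cmod (g x))\<^sup>2)"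
      using y by (simp add: distrib_left)
  qed
qed

text \<open>The integrand of \<open>H_inner\<close> outside the null set that spherical coordinates omit, without the case
  distinction.\<close>

definition Phi :: "(real^3 \<Rightarrow> complex^3) \<Rightarrow> (real^3 \<Rightarrow> complex^3) \<Rightarrow> real^3 \<Rightarrow> complex" where
  "Phi u v x = (\<Sum>j\<in>UNIV. wprod (\<lambda>x. u x $ j) (\<lambda>x. v x $ j) x) +
     (\<Sum>j\<in>UNIV. (\<Sum>i\<in>UNIV. \<Sum>l\<in>UNIV. wprod (rot i l (\<lambda>y. u y $ j)) (rot i l (\<lambda>y. v y $ j)) x) / 2)"

lemma H_integrand_finite_energy:
  assumes u: "finite_energy u" and v: "finite_energy v"
  shows "H_integrand u v x = (\<Sum>j\<in>UNIV. wprod (\<lambda>x. u x $ j) (\<lambda>x. v x $ j) x) +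
     (if x \<in> sph_coords ` sph_dom then (\<Sum>j\<in>UNIV. (\<Sum>i\<in>UNIV. \<Sum>l\<in>UNIV. wprod (rot i l (\<lambda>y. u y $ j)) (rot i l (\<lambda>y. v y $ j)) x) / 2) else 0)"
  unfolding H_integrand_eq[OF finite_energy_differentiable(1)[OF u] finite_energy_differentiable(1)[OF v]] wprod_def
  by (simp add: distrib_left sum_distrib_left)

lemma H_measurable:
  assumes u: "finite_energy u" and v: "finite_energy v"
  shows "H_integrand u v \<in> borel_measurable borel"
proof -
  have [measurable]: "wprod (\<lambda>x. u x $ j) (\<lambda>x. v x $ j) \<in> borel_measurable borel"
    "wprod (rot i l (\<lambda>y. u y $ j)) (rot i l (\<lambda>y. v y $ j)) \<in> borel_measurable borel" for i l j
    by (intro wprod_measurable finite_energy_measurable u v)+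
  have [measurable]: "sph_coords ` sph_dom \<in> sets borel" by (rule borel_open[OF open_sph_image])
  show ?thesis
    unfolding H_integrand_finite_energy[OF u v, abs_def] by measurable
qed

lemma Phi_integrable:
  assumes u: "finite_energy u" and v: "finite_energy v"
  shows "integrable lborel (Phi u v)"
  unfolding Phi_def[abs_def]
  by (intro Bochner_Integration.integrable_add Bochner_Integration.integrable_sum integrable_divide wprod_integrable finite_energy_measurable finite_energy_wint u v)

lemma H_AE:
  assumes u: "finite_energy u" and v: "finite_energy v"
  shows "AE x in lborel. H_integrand u v x = Phi u v x"
  using AE_in_sph_image by eventually_elim (simp add: H_integrand_finite_energy[OF u v] Phi_def)

lemma H_integrable:
  assumes u: "finite_energy u" and v: "finite_energy v"
  shows "integrable lborel (H_integrand u v)"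
proof (rule integrable_cong_AE_imp[OF Phi_integrable[OF u v]])
  show "H_integrand u v \<in> borel_measurable lborel" using H_measurable[OF u v] by simp
  show "AE x in lborel. Phi u v x = H_integrand u v x" using H_AE[OF u v] by eventually_elim simp
qed

lemma H_inner_Phi:
  assumes u: "finite_energy u" and v: "finite_energy v"
  shows "H_inner u v = (LINT x|lborel. Phi u v x)"
  unfolding H_inner_def
  by (rule integral_cong_AE) (use H_measurable[OF u v] Phi_integrable[OF u v] H_AE[OF u v] in auto)

lemma H_inner_self:
  assumes u: "finite_energy u"
  shows "H_inner u u = of_real (\<Sum>j\<in>UNIV. hsq (\<lambda>x. u x $ j))"
proof -
  have w: "wprod f f x = of_real (yb x ^ 3 * (cmod (f x))\<^sup>2)" for f x
    by (simp only: wprod_def of_real_mult complex_norm_square)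
  have ww: "(LINT x|lborel. wprod f f x) = of_real (wsq f)" for f
    unfolding w wsq_def by (rule integral_complex_of_real)
  have I1: "integrable lborel (\<lambda>x. wprod (\<lambda>x. u x $ j) (\<lambda>x. u x $ j) x)" for j
    by (intro wprod_integrable finite_energy_measurable finite_energy_wint u)
  have I2: "integrable lborel (\<lambda>x. wprod (rot i l (\<lambda>y. u y $ j)) (rot i l (\<lambda>y. u y $ j)) x)" for i l j
    by (intro wprod_integrable finite_energy_measurable finite_energy_wint u)
  have I3: "integrable lborel (\<lambda>x. \<Sum>l\<in>UNIV. wprod (rot i l (\<lambda>y. u y $ j)) (rot i l (\<lambda>y. u y $ j)) x)" for i j
    by (intro Bochner_Integration.integrable_sum I2)
  have I4: "integrable lborel (\<lambda>x. (\<Sum>i\<in>UNIV. \<Sum>l\<in>UNIV. wprod (rot i l (\<lambda>y. u y $ j)) (rot i l (\<lambda>y. u y $ j)) x) / 2)" for j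
    by (intro integrable_divide Bochner_Integration.integrable_sum I2)
  have "H_inner u u = (\<Sum>j\<in>UNIV. LINT x|lborel. wprod (\<lambda>x. u x $ j) (\<lambda>x. u x $ j) x)
      + (\<Sum>j\<in>UNIV. LINT x|lborel. (\<Sum>i\<in>UNIV. \<Sum>l\<in>UNIV. wprod (rot i l (\<lambda>y. u y $ j)) (rot i l (\<lambda>y. u y $ j)) x) / 2)"
    unfolding H_inner_Phi[OF u u] Phi_def
    by (subst Bochner_Integration.integral_add)
       (intro Bochner_Integration.integrable_sum I1 I4, intro Bochner_Integration.integrable_sum I1 I4,
        simp add: Bochner_Integration.integral_sum I1 I4)
  moreover have "(LINT x|lborel. (\<Sum>i\<in>UNIV. \<Sum>l\<in>UNIV. wprod (rot i l (\<lambda>y. u y $ j)) (rot i l (\<lambda>y. u y $ j)) x) / 2) =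
     (\<Sum>i\<in>UNIV. \<Sum>l\<in>UNIV. of_real (wsq (rot i l (\<lambda>y. u y $ j)))) / 2" for j
  proof -
    have "(LINT x|lborel. (\<Sum>l\<in>UNIV. wprod (rot i l (\<lambda>y. u y $ j)) (rot i l (\<lambda>y. u y $ j)) x)) =
        (\<Sum>l\<in>UNIV. of_real (wsq (rot i l (\<lambda>y. u y $ j))))" for i
      unfolding ww[symmetric] by (rule Bochner_Integration.integral_sum) (rule I2)
    moreover have "(LINT x|lborel. (\<Sum>i\<in>UNIV. \<Sum>l\<in>UNIV. wprod (rot i l (\<lambda>y. u y $ j)) (rot i l (\<lambda>y. u y $ j)) x)) =
        (\<Sum>i\<in>UNIV. (LINT x|lborel. (\<Sum>l\<in>UNIV. wprod (rot i l (\<lambda>y. u y $ j)) (rot i l (\<lambda>y. u y $ j)) x)))"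
      by (rule Bochner_Integration.integral_sum) (rule I3)
    ultimately show ?thesis by (simp only: integral_divide_zero)
  qed
  ultimately show ?thesis
    unfolding ww by (simp add: hsq_def sum.distrib)
qed

lemma ip_norm_H: assumes "finite_energy u" shows "ip_norm H_inner u = sqrt (\<Sum>j\<in>UNIV. hsq (\<lambda>x. u x $ j))"
  by (simp add: ip_norm_def H_inner_self[OF assms])

lemma hsq_sum_nonneg: "(\<Sum>j\<in>UNIV. hsq (\<lambda>x. u x $ j)) \<ge> 0"
  by (intro sum_nonneg hsq_nonneg)

lemma rot_plus:
  assumes "f differentiable (at x)" "g differentiable (at x)"
  shows "rot i l (\<lambda>y. f y + g y) x = rot i l f x + rot i l g x"
  by (simp add: rot_def pd_add[OF assms] algebra_simps)

lemma pd_cmult: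
  fixes f :: "real^3 \<Rightarrow> complex"
  assumes "f differentiable (at x)"
  shows "pd i (\<lambda>y. c * f y) x = c * pd i f x"
  using pd_eq_derivative[OF has_derivative_mult_right[OF derivative_expand[OF assms], of c], of i] pd_eq_derivative[OF derivative_expand[OF assms], of i]
  by simp

lemma rot_cmult:
  assumes "f differentiable (at x)"
  shows "rot i l (\<lambda>y. c * f y) x = c * rot i l f x"
  by (simp add: rot_def pd_cmult[OF assms] algebra_simps)

lemma Phi_add:
  assumes "finite_energy u" "finite_energy v"
  shows "Phi (\<lambda>x. u x + v x) w x = Phi u w x + Phi v w x"
  by (simp add: Phi_def wprod_def rot_plus[OF finite_energy_differentiable(2)[OF assms(1)] finite_energy_differentiable(2)[OF assms(2)]]
      sum.distrib distrib_left distrib_right add_divide_distrib)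

lemma Phi_cmult:
  assumes "finite_energy u"
  shows "Phi (\<lambda>x. c *s u x) w x = c * Phi u w x"
  by (simp add: Phi_def wprod_def rot_cmult[OF finite_energy_differentiable(2)[OF assms(1)]]
      sum_distrib_left distrib_left mult.left_commute mult.assoc)

lemma Phi_cnj: "Phi v u x = cnj (Phi u v x)"
  by (simp add: Phi_def wprod_def mult.commute mult.left_commute)

section \<open>Equivalence of the norms\<close>

definition hi_const :: "real \<Rightarrow> real" where "hi_const k = 10 * upper_const k / k\<^sup>2 + upper_const k"
definition lo_const :: "real \<Rightarrow> real" where "lo_const k = sqrt pi / 2 / (2 * ah_const) * (26 + 4 * k\<^sup>2)"

lemma hi_const_nonneg: "hi_const k \<ge> 0" using upper_const_nonneg[of k] by (simp add: hi_const_def)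
lemma lo_const_nonneg: "lo_const k \<ge> 0" using ah_const_pos by (simp add: lo_const_def)
lemma sep_const_nonneg: "sep_const k1 k2 \<ge> 0" using gconv_const_nonneg by (simp add: sep_const_def)

context
  fixes kp ks :: real
  assumes kp: "kp > 0" and ks: "ks > 0"
begin

lemma rep_finite_energy:
  assumes "rep kp ks a b u" shows "finite_energy u"
  unfolding finite_energy_def
proof (intro conjI allI)
  show "Ck k u" for k by (rule rep_Ck[OF assms])
  show "hint (\<lambda>x. u x $ j)" for j
    unfolding rep_comp[OF assms] by (intro two_wave_hint(1) kp ks repD[OF assms])
qed

lemma rep_upper:
  assumes "rep kp ks a b u"
  shows "(\<Sum>j\<in>UNIV. hsq (\<lambda>x. u x $ j)) \<le> 2 * (hi_const kp + hi_const ks) * (\<Sum>j\<in>UNIV. nsq (a j) + nsq (b j))"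
  unfolding sum_distrib_left
proof (rule sum_mono)
  fix j
  note r = repD[OF assms]
  have "hsq (\<lambda>x. u x $ j) \<le> 2 * hsq (wave kp (a j)) + 2 * hsq (wave ks (b j))"
    unfolding rep_comp[OF assms] by (intro two_wave_hint(2) kp ks r)
  also have "\<dots> \<le> 2 * (hi_const kp * nsq (a j)) + 2 * (hi_const ks * nsq (b j))"
    using wave_hsq_upper[OF _ r(1), of kp j] wave_hsq_upper[OF _ r(2), of ks j] kp ks
    unfolding hi_const_def by (intro add_mono mult_left_mono) auto
  also have "\<dots> \<le> 2 * (hi_const kp + hi_const ks) * (nsq (a j) + nsq (b j))"
  proof -
    have "0 \<le> hi_const kp * nsq (b j)" "0 \<le> hi_const ks * nsq (a j)"
      by (intro mult_nonneg_nonneg hi_const_nonneg nsq_nonneg)+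
    then show ?thesis by (simp add: algebra_simps)
  qed
  finally show "hsq (\<lambda>x. u x $ j) \<le> 2 * (hi_const kp + hi_const ks) * (nsq (a j) + nsq (b j))" .
qed

text \<open>At each direction \<open>a\<close> is a multiple of the direction and \<open>b\<close> is orthogonal to it.\<close>

lemma rep_orthogonal:
  assumes "rep kp ks a b u"
  shows "(\<Sum>j\<in>UNIV. nsq (\<lambda>\<xi>. a j \<xi> + b j \<xi>)) = (\<Sum>j\<in>UNIV. nsq (a j) + nsq (b j))"
proof -
  note r = repD[OF assms]
  have [measurable]: "a j \<in> borel_measurable sphere_measure" "b j \<in> borel_measurable sphere_measure" for j
    using r L2S_measurable by auto
  have Ia: "integrable sphere_measure (\<lambda>\<xi>. (cmod (a j \<xi>))\<^sup>2)" and Ib: "integrable sphere_measure (\<lambda>\<xi>. (cmod (b j \<xi>))\<^sup>2)"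
    and Iab: "integrable sphere_measure (\<lambda>\<xi>. (cmod (a j \<xi> + b j \<xi>))\<^sup>2)" for j
    using r L2S_add(1)[OF r(1,2), of j j] by (auto simp: L2S_def)
  have "(\<Sum>j\<in>UNIV. nsq (\<lambda>\<xi>. a j \<xi> + b j \<xi>)) = (LINT \<xi>|sphere_measure. (\<Sum>j\<in>UNIV. (cmod (a j \<xi> + b j \<xi>))\<^sup>2))"
    unfolding nsq_def by (rule Bochner_Integration.integral_sum[symmetric]) (rule Iab)
  also have "\<dots> = (LINT \<xi>|sphere_measure. (\<Sum>j\<in>UNIV. (cmod (a j \<xi>))\<^sup>2 + (cmod (b j \<xi>))\<^sup>2))"
  proof (rule integral_cong_AE)
    have "AE \<xi> in sphere_measure. \<forall>i j. of_real (\<xi>$i) * a j \<xi> - of_real (\<xi>$j) * a i \<xi> = 0"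
      using r(4) by (simp add: AE_all_countable)
    moreover have "AE \<xi> in sphere_measure. \<xi> \<in> space sphere_measure" by (rule AE_space)
    ultimately show "AE \<xi> in sphere_measure. (\<Sum>j\<in>UNIV. (cmod (a j \<xi> + b j \<xi>))\<^sup>2) = (\<Sum>j\<in>UNIV. (cmod (a j \<xi>))\<^sup>2 + (cmod (b j \<xi>))\<^sup>2)"
      using r(5)
    proof eventually_elim
      case (elim \<xi>)
      define s where "s = (\<Sum>i\<in>UNIV. of_real (\<xi>$i) * a i \<xi>)"
      have aj: "a j \<xi> = of_real (\<xi>$j) * s" for j
      proof -
        have "of_real (\<xi>$j) * s = (\<Sum>i\<in>UNIV. of_real (\<xi>$i) * (of_real (\<xi>$j) * a i \<xi>))"
          by (simp add: s_def sum_distrib_left mult.left_commute)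
        also have "\<dots> = (\<Sum>i\<in>UNIV. of_real (\<xi>$i) * (of_real (\<xi>$i) * a j \<xi>))"
          using elim(1) by simp
        also have "\<dots> = of_real (\<Sum>i\<in>UNIV. (\<xi>$i)\<^sup>2) * a j \<xi>"
          by (simp add: sum_distrib_right power2_eq_square mult.assoc)
        finally show ?thesis unfolding sphere_sum_sq[OF elim(2)] by simp
      qed
      have "(\<Sum>j\<in>UNIV. a j \<xi> * cnj (b j \<xi>)) = s * cnj (\<Sum>j\<in>UNIV. of_real (\<xi>$j) * b j \<xi>)"
        unfolding aj by (simp add: sum_distrib_left mult.left_commute mult.assoc)
      then have "(\<Sum>j\<in>UNIV. a j \<xi> * cnj (b j \<xi>)) = 0" unfolding elim(3) by simp
      then have z: "(\<Sum>j\<in>UNIV. Re (a j \<xi> * cnj (b j \<xi>))) = 0" by (metis Re_sum zero_complex.sel(1))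
      have "(cmod (p + q))\<^sup>2 = ((cmod p)\<^sup>2 + (cmod q)\<^sup>2) + 2 * Re (p * cnj q)" for p q
        unfolding cmod_power2 by (simp add: power2_eq_square algebra_simps)
      then have "(\<Sum>j\<in>UNIV. (cmod (a j \<xi> + b j \<xi>))\<^sup>2) = (\<Sum>j\<in>UNIV. ((cmod (a j \<xi>))\<^sup>2 + (cmod (b j \<xi>))\<^sup>2) + 2 * Re (a j \<xi> * cnj (b j \<xi>)))"
        by (simp only:)
      also have "\<dots> = (\<Sum>j\<in>UNIV. (cmod (a j \<xi>))\<^sup>2 + (cmod (b j \<xi>))\<^sup>2) + 2 * (\<Sum>j\<in>UNIV. Re (a j \<xi> * cnj (b j \<xi>)))"
        by (simp only: sum.distrib sum_distrib_left)
      finally show ?case unfolding z by simp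
    qed
  qed measurable
  also have "\<dots> = (\<Sum>j\<in>UNIV. nsq (a j) + nsq (b j))"
    unfolding nsq_def using Ia Ib by (simp add: Bochner_Integration.integral_sum Bochner_Integration.integral_add)
  finally show ?thesis .
qed

text \<open>If the wave numbers differ, the two waves are separated by Gaussian convolution. If they coincide, there
  is only one wave with density \<open>a + b\<close>, and the pointwise orthogonality separates the summands.\<close>

lemma rep_lower:
  "\<exists>C\<ge>0. \<forall>a b u. rep kp ks a b u \<longrightarrow> (\<Sum>j\<in>UNIV. nsq (a j) + nsq (b j)) \<le> C * (\<Sum>j\<in>UNIV. hsq (\<lambda>x. u x $ j))"
proof (cases "kp = ks")
  case True
  show ?thesis
  proof (intro exI[of _ "lo_const kp"] conjI allI impI lo_const_nonneg)
    fix a b u assume rp: "rep kp ks a b u"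
    note r = repD[OF rp]
    have "(\<Sum>j\<in>UNIV. nsq (a j) + nsq (b j)) = (\<Sum>j\<in>UNIV. nsq (\<lambda>\<xi>. a j \<xi> + b j \<xi>))"
      by (rule rep_orthogonal[OF rp, symmetric])
    also have "\<dots> \<le> (\<Sum>j\<in>UNIV. lo_const kp * hsq (\<lambda>x. u x $ j))"
    proof (rule sum_mono)
      fix j
      have eq: "(\<lambda>x. u x $ j) = wave kp (\<lambda>\<xi>. a j \<xi> + b j \<xi>)"
        unfolding rep_comp[OF rp] using True r L2S_integrable by (auto simp: wave_add)
      show "nsq (\<lambda>\<xi>. a j \<xi> + b j \<xi>) \<le> lo_const kp * hsq (\<lambda>x. u x $ j)"
        unfolding eq lo_const_def by (rule wave_hsq_lower[OF _ L2S_add(1)[OF r(1,2)]]) (use kp in simp)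
    qed
    finally show "(\<Sum>j\<in>UNIV. nsq (a j) + nsq (b j)) \<le> lo_const kp * (\<Sum>j\<in>UNIV. hsq (\<lambda>x. u x $ j))"
      by (simp add: sum_distrib_left)
  qed
next
  case False
  define C where "C = lo_const kp * sep_const kp ks + lo_const ks * sep_const ks kp"
  show ?thesis
  proof (intro exI[of _ C] conjI allI impI)
    show "0 \<le> C" unfolding C_def by (intro add_nonneg_nonneg mult_nonneg_nonneg lo_const_nonneg sep_const_nonneg)
    fix a b u assume rp: "rep kp ks a b u"
    note r = repD[OF rp]
    have kn: "kp \<noteq> 0" "ks \<noteq> 0" using kp ks by auto
    show "(\<Sum>j\<in>UNIV. nsq (a j) + nsq (b j)) \<le> C * (\<Sum>j\<in>UNIV. hsq (\<lambda>x. u x $ j))"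
      unfolding sum_distrib_left
    proof (rule sum_mono)
      fix j
      have "nsq (a j) \<le> lo_const kp * hsq (wave kp (a j))"
        unfolding lo_const_def by (rule wave_hsq_lower[OF kn(1) r(1)])
      also have "\<dots> \<le> lo_const kp * (sep_const kp ks * hsq (\<lambda>x. u x $ j))"
        unfolding rep_comp[OF rp] by (intro mult_left_mono two_wave_separate kp ks False r lo_const_nonneg)
      finally have 1: "nsq (a j) \<le> lo_const kp * (sep_const kp ks * hsq (\<lambda>x. u x $ j))" .
      have sw: "(\<lambda>x. u x $ j) = (\<lambda>x. wave ks (b j) x + wave kp (a j) x)"
        unfolding rep_comp[OF rp] by (simp add: add.commute)
      have "nsq (b j) \<le> lo_const ks * hsq (wave ks (b j))"
        unfolding lo_const_def by (rule wave_hsq_lower[OF kn(2) r(2)])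
      also have "\<dots> \<le> lo_const ks * (sep_const ks kp * hsq (\<lambda>x. u x $ j))"
        unfolding sw by (intro mult_left_mono two_wave_separate kp ks False[symmetric] r lo_const_nonneg)
      finally show "nsq (a j) + nsq (b j) \<le> C * hsq (\<lambda>x. u x $ j)"
        using 1 by (simp add: C_def algebra_simps)
    qed
  qed
qed

section \<open>The Hilbert space of elastic Herglotz waves\<close>

lemma rep_eval:
  assumes "rep kp ks a b u"
  shows "norm (u x) \<le> (4 * pi + 1) * 6 * sqrt (\<Sum>j\<in>UNIV. nsq (a j) + nsq (b j))"
proof -
  note r = repD[OF assms]
  let ?S = "\<Sum>j\<in>UNIV. nsq (a j) + nsq (b j)"
  have p: "4 * pi + 1 \<ge> 0" using pi_gt_zero by linarith
  have le: "nsq (a j) \<le> ?S" "nsq (b j) \<le> ?S" for j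
  proof -
    have "nsq (a j) + nsq (b j) \<le> ?S" by (rule member_le_sum) (auto simp: nsq_nonneg)
    then show "nsq (a j) \<le> ?S" "nsq (b j) \<le> ?S" using nsq_nonneg[of "a j"] nsq_nonneg[of "b j"] by linarith+
  qed
  have "norm (u x) \<le> (\<Sum>j\<in>UNIV. cmod (u x $ j))"
    unfolding norm_vec_def by (rule L2_set_le_sum) simp
  also have "\<dots> \<le> (\<Sum>j\<in>(UNIV::3 set). (4 * pi + 1) * 2 * sqrt ?S)"
  proof (rule sum_mono)
    fix j :: 3
    have "cmod (u x $ j) \<le> cmod (wave kp (a j) x) + cmod (wave ks (b j) x)" unfolding r(3) by (rule norm_triangle_ineq)
    also have "\<dots> \<le> (4 * pi + 1) * sqrt (nsq (a j)) + (4 * pi + 1) * sqrt (nsq (b j))"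
      by (intro add_mono wave_eval_bound r)
    also have "\<dots> \<le> (4 * pi + 1) * sqrt ?S + (4 * pi + 1) * sqrt ?S"
      using le p by (intro add_mono mult_left_mono) auto
    also have "\<dots> = (4 * pi + 1) * 2 * sqrt ?S" by (simp only: mult_2_right distrib_right distrib_left mult_2)
    finally show "cmod (u x $ j) \<le> (4 * pi + 1) * 2 * sqrt ?S" .
  qed
  also have "\<dots> = (4 * pi + 1) * 6 * sqrt ?S" by (simp add: algebra_simps)
  finally show ?thesis .
qed

text \<open>A Cauchy sequence of waves has Cauchy densities by the lower bound. The limits of the densities
  inherit the algebraic constraints, and the upper bound carries convergence back to the waves.\<close>

lemma rep_complete:
  fixes f :: "nat \<Rightarrow> real^3 \<Rightarrow> complex^3"
  assumes f: "\<And>n. \<exists>a b. rep kp ks a b (f n)"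
    and C: "\<And>e. e > 0 \<Longrightarrow> \<exists>N. \<forall>m\<ge>N. \<forall>n\<ge>N. ip_norm H_inner (\<lambda>x. f m x - f n x) < e"
  shows "\<exists>u. (\<exists>a b. rep kp ks a b u) \<and> (\<lambda>n. ip_norm H_inner (\<lambda>x. f n x - u x)) \<longlonglongrightarrow> 0"
proof -
  obtain A B where AB: "\<And>n. rep kp ks (A n) (B n) (f n)" using f by metis
  note r = repD[OF AB]
  obtain L where L: "L \<ge> 0" "\<And>a b u. rep kp ks a b u \<Longrightarrow> (\<Sum>j\<in>UNIV. nsq (a j) + nsq (b j)) \<le> L * (\<Sum>j\<in>UNIV. hsq (\<lambda>x. u x $ j))"
    using rep_lower by blast
  have cauchy: "\<exists>N. \<forall>m\<ge>N. \<forall>n\<ge>N. (\<Sum>j\<in>UNIV. nsq (\<lambda>\<xi>. A m j \<xi> - A n j \<xi>) + nsq (\<lambda>\<xi>. B m j \<xi> - B n j \<xi>)) < e"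
    if e: "e > 0" for e
  proof -
    have "sqrt (e / (L + 1)) > 0" using e L(1) by simp
    then obtain N where N: "\<And>m n. m \<ge> N \<Longrightarrow> n \<ge> N \<Longrightarrow> ip_norm H_inner (\<lambda>x. f m x - f n x) < sqrt (e / (L + 1))" using C by blast
    show ?thesis
    proof (intro exI allI impI)
      fix m n assume mn: "m \<ge> N" "n \<ge> N"
      have d: "rep kp ks (\<lambda>j \<xi>. A m j \<xi> - A n j \<xi>) (\<lambda>j \<xi>. B m j \<xi> - B n j \<xi>) (\<lambda>x. f m x - f n x)"
        by (rule rep_diff[OF AB AB])
      have "(\<Sum>j\<in>UNIV. hsq (\<lambda>x. (f m x - f n x) $ j)) < e / (L + 1)"
        using N[OF mn] unfolding ip_norm_H[OF rep_finite_energy[OF d]] by simp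
      then have "L * (\<Sum>j\<in>UNIV. hsq (\<lambda>x. (f m x - f n x) $ j)) \<le> L * (e / (L + 1))"
        using L(1) by (intro mult_left_mono) auto
      also have "\<dots> < e" using L(1) e by (simp add: field_simps)
      finally show "(\<Sum>j\<in>UNIV. nsq (\<lambda>\<xi>. A m j \<xi> - A n j \<xi>) + nsq (\<lambda>\<xi>. B m j \<xi> - B n j \<xi>)) < e"
        using L(2)[OF d] by linarith
    qed
  qed
  have comp: "nsq (a j) \<le> (\<Sum>j\<in>UNIV. nsq (a j) + nsq (b j))" "nsq (b j) \<le> (\<Sum>j\<in>UNIV. nsq (a j) + nsq (b j))" for a b :: "3 \<Rightarrow> real^3 \<Rightarrow> complex" and j
  proof -
    have "nsq (a j) + nsq (b j) \<le> (\<Sum>j\<in>UNIV. nsq (a j) + nsq (b j))" by (rule member_le_sum) (auto simp: nsq_nonneg)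
    then show "nsq (a j) \<le> (\<Sum>j\<in>UNIV. nsq (a j) + nsq (b j))" "nsq (b j) \<le> (\<Sum>j\<in>UNIV. nsq (a j) + nsq (b j))"
      using nsq_nonneg[of "a j"] nsq_nonneg[of "b j"] by linarith+
  qed
  have "\<exists>h\<in>L2S. (\<lambda>n. nsq (\<lambda>\<xi>. A n j \<xi> - h \<xi>)) \<longlonglongrightarrow> 0" for j
  proof (rule L2S_complete)
    show "A n j \<in> L2S" for n by (rule r)
    fix e :: real assume "e > 0"
    from cauchy[OF this] obtain N where N: "\<And>m n. m \<ge> N \<Longrightarrow> n \<ge> N \<Longrightarrow>
      (\<Sum>j\<in>UNIV. nsq (\<lambda>\<xi>. A m j \<xi> - A n j \<xi>) + nsq (\<lambda>\<xi>. B m j \<xi> - B n j \<xi>)) < e" by blast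
    show "\<exists>N. \<forall>m\<ge>N. \<forall>n\<ge>N. nsq (\<lambda>\<xi>. A m j \<xi> - A n j \<xi>) < e"
    proof (intro exI allI impI)
      fix m n assume "m \<ge> N" "n \<ge> N"
      from N[OF this] show "nsq (\<lambda>\<xi>. A m j \<xi> - A n j \<xi>) < e"
        by (rule le_less_trans[OF comp(1)[of "\<lambda>j \<xi>. A m j \<xi> - A n j \<xi>" j "\<lambda>j \<xi>. B m j \<xi> - B n j \<xi>"]])
    qed
  qed
  then have "\<forall>j. \<exists>h. h \<in> L2S \<and> (\<lambda>n. nsq (\<lambda>\<xi>. A n j \<xi> - h \<xi>)) \<longlonglongrightarrow> 0" by blast
  from choice[OF this] obtain a where a: "\<And>j. a j \<in> L2S" "\<And>j. (\<lambda>n. nsq (\<lambda>\<xi>. A n j \<xi> - a j \<xi>)) \<longlonglongrightarrow> 0" by blast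
  have "\<exists>h\<in>L2S. (\<lambda>n. nsq (\<lambda>\<xi>. B n j \<xi> - h \<xi>)) \<longlonglongrightarrow> 0" for j
  proof (rule L2S_complete)
    show "B n j \<in> L2S" for n by (rule r)
    fix e :: real assume "e > 0"
    from cauchy[OF this] obtain N where N: "\<And>m n. m \<ge> N \<Longrightarrow> n \<ge> N \<Longrightarrow>
      (\<Sum>j\<in>UNIV. nsq (\<lambda>\<xi>. A m j \<xi> - A n j \<xi>) + nsq (\<lambda>\<xi>. B m j \<xi> - B n j \<xi>)) < e" by blast
    show "\<exists>N. \<forall>m\<ge>N. \<forall>n\<ge>N. nsq (\<lambda>\<xi>. B m j \<xi> - B n j \<xi>) < e"
    proof (intro exI allI impI)
      fix m n assume "m \<ge> N" "n \<ge> N"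
      from N[OF this] show "nsq (\<lambda>\<xi>. B m j \<xi> - B n j \<xi>) < e"
        by (rule le_less_trans[OF comp(2)[of "\<lambda>j \<xi>. B m j \<xi> - B n j \<xi>" j "\<lambda>j \<xi>. A m j \<xi> - A n j \<xi>"]])
    qed
  qed
  then have "\<forall>j. \<exists>h. h \<in> L2S \<and> (\<lambda>n. nsq (\<lambda>\<xi>. B n j \<xi> - h \<xi>)) \<longlonglongrightarrow> 0" by blast
  from choice[OF this] obtain b where b: "\<And>j. b j \<in> L2S" "\<And>j. (\<lambda>n. nsq (\<lambda>\<xi>. B n j \<xi> - b j \<xi>)) \<longlonglongrightarrow> 0" by blast
  define u where "u x = (\<chi> j. wave kp (a j) x + wave ks (b j) x)" for x
  have xi: "(\<lambda>\<xi>. of_real (\<xi>$i) * h \<xi>) \<in> L2S" "nsq (\<lambda>\<xi>. of_real (\<xi>$i) * h \<xi>) \<le> nsq h" if "h \<in> L2S" for i and h :: "real^3 \<Rightarrow> complex"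
  proof -
    have m: "(\<lambda>\<xi>. complex_of_real (\<xi>$i)) \<in> borel_measurable sphere_measure" by measurable
    show "(\<lambda>\<xi>. of_real (\<xi>$i) * h \<xi>) \<in> L2S" "nsq (\<lambda>\<xi>. of_real (\<xi>$i) * h \<xi>) \<le> nsq h"
      using L2S_mult[OF that m, of 1] sphere_comp_le by auto
  qed
  \<comment> \<open>The constraint holds for each \<open>A n\<close>, so its defect at the limit is a combination of differences that tend to 0.\<close>
  have AE1: "AE \<xi> in sphere_measure. of_real (\<xi>$i) * a j \<xi> - of_real (\<xi>$j) * a i \<xi> = 0" for i j
  proof (rule nsq_zero_AE)
    let ?h = "\<lambda>\<xi>. of_real (\<xi>$i) * a j \<xi> - of_real (\<xi>$j) * a i \<xi>"
    show hL: "?h \<in> L2S" by (intro L2S_diff xi a)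
    have "nsq ?h \<le> 2 * nsq (\<lambda>\<xi>. A n i \<xi> - a i \<xi>) + 2 * nsq (\<lambda>\<xi>. A n j \<xi> - a j \<xi>)" for n
    proof -
      let ?d = "\<lambda>l \<xi>. A n l \<xi> - a l \<xi>"
      have dL: "?d l \<in> L2S" for l by (intro L2S_diff r a)
      have m1: "(\<lambda>\<xi>. (-1) * (of_real (\<xi>$i) * ?d j \<xi>)) \<in> L2S" by (intro L2S_cmult xi dL)
      have "nsq ?h = nsq (\<lambda>\<xi>. of_real (\<xi>$j) * ?d i \<xi> + (-1) * (of_real (\<xi>$i) * ?d j \<xi>))"
      proof (rule nsq_cong_AE[OF hL])
        show "(\<lambda>\<xi>. of_real (\<xi>$j) * ?d i \<xi> + (-1) * (of_real (\<xi>$i) * ?d j \<xi>)) \<in> L2S"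
          by (intro L2S_add(1) xi dL m1)
        show "AE \<xi> in sphere_measure. ?h \<xi> = of_real (\<xi>$j) * ?d i \<xi> + (-1) * (of_real (\<xi>$i) * ?d j \<xi>)"
          using r(4)[of i n j] by eventually_elim (simp add: algebra_simps)
      qed
      also have "\<dots> \<le> 2 * nsq (\<lambda>\<xi>. of_real (\<xi>$j) * ?d i \<xi>) + 2 * nsq (\<lambda>\<xi>. (-1) * (of_real (\<xi>$i) * ?d j \<xi>))"
        by (intro L2S_add(2) xi dL m1)
      also have "\<dots> \<le> 2 * nsq (?d i) + 2 * nsq (?d j)"
        unfolding nsq_cmult using xi(2)[OF dL[of i], of j] xi(2)[OF dL[of j], of i] by simp
      finally show ?thesis .
    qed
    moreover have "(\<lambda>n. 2 * nsq (\<lambda>\<xi>. A n i \<xi> - a i \<xi>) + 2 * nsq (\<lambda>\<xi>. A n j \<xi> - a j \<xi>)) \<longlonglongrightarrow> 2 * 0 + 2 * 0"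
      by (intro tendsto_intros a)
    ultimately have "nsq ?h \<le> 2 * 0 + 2 * 0" by (intro LIMSEQ_le_const) auto
    then show "nsq ?h = 0" using nsq_nonneg[of ?h] by simp
  qed
  have AE2: "AE \<xi> in sphere_measure. (\<Sum>j\<in>UNIV. of_real (\<xi>$j) * b j \<xi>) = 0"
    unfolding sum_3
  proof (rule nsq_zero_AE)
    let ?h = "\<lambda>\<xi>. of_real (\<xi>$1) * b 1 \<xi> + of_real (\<xi>$2) * b 2 \<xi> + of_real (\<xi>$3) * b 3 \<xi>"
    show hL: "?h \<in> L2S" by (intro L2S_add(1) xi b)
    have "nsq ?h \<le> 4 * nsq (\<lambda>\<xi>. B n 1 \<xi> - b 1 \<xi>) + 4 * nsq (\<lambda>\<xi>. B n 2 \<xi> - b 2 \<xi>) + 2 * nsq (\<lambda>\<xi>. B n 3 \<xi> - b 3 \<xi>)" for n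
    proof -
      let ?d = "\<lambda>l \<xi>. B n l \<xi> - b l \<xi>"
      let ?e = "\<lambda>l \<xi>. of_real (\<xi>$l) * ?d l \<xi>"
      have dL: "?d l \<in> L2S" for l by (intro L2S_diff r b)
      have eL: "?e l \<in> L2S" for l by (intro xi dL)
      have "nsq ?h = nsq (\<lambda>\<xi>. (-1) * (?e 1 \<xi> + ?e 2 \<xi> + ?e 3 \<xi>))"
      proof (rule nsq_cong_AE[OF hL])
        show "(\<lambda>\<xi>. (-1) * (?e 1 \<xi> + ?e 2 \<xi> + ?e 3 \<xi>)) \<in> L2S" by (intro L2S_cmult L2S_add(1) eL)
        show "AE \<xi> in sphere_measure. ?h \<xi> = (-1) * (?e 1 \<xi> + ?e 2 \<xi> + ?e 3 \<xi>)"
          using r(5)[of n] by eventually_elim (simp add: sum_3 algebra_simps)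
      qed
      also have "\<dots> = nsq (\<lambda>\<xi>. ?e 1 \<xi> + ?e 2 \<xi> + ?e 3 \<xi>)" unfolding nsq_cmult by simp
      also have "\<dots> \<le> 2 * nsq (\<lambda>\<xi>. ?e 1 \<xi> + ?e 2 \<xi>) + 2 * nsq (?e 3)" by (intro L2S_add eL)
      also have "\<dots> \<le> 2 * (2 * nsq (?e 1) + 2 * nsq (?e 2)) + 2 * nsq (?e 3)"
        by (intro add_mono mult_left_mono L2S_add(2) eL) auto
      also have "\<dots> \<le> 4 * nsq (?d 1) + 4 * nsq (?d 2) + 2 * nsq (?d 3)"
        using xi(2)[OF dL[of 1], of 1] xi(2)[OF dL[of 2], of 2] xi(2)[OF dL[of 3], of 3] by simp
      finally show ?thesis .
    qed
    moreover have "(\<lambda>n. 4 * nsq (\<lambda>\<xi>. B n 1 \<xi> - b 1 \<xi>) + 4 * nsq (\<lambda>\<xi>. B n 2 \<xi> - b 2 \<xi>) + 2 * nsq (\<lambda>\<xi>. B n 3 \<xi> - b 3 \<xi>)) \<longlonglongrightarrow> 4 * 0 + 4 * 0 + 2 * 0"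
      by (intro tendsto_intros b)
    ultimately have "nsq ?h \<le> 4 * 0 + 4 * 0 + 2 * 0" by (intro LIMSEQ_le_const) auto
    then show "nsq ?h = 0" using nsq_nonneg[of ?h] by simp
  qed
  have ru: "rep kp ks a b u"
    unfolding rep_def using a(1) b(1) AE1 AE2 by (simp add: u_def)
  define K where "K = 2 * (hi_const kp + hi_const ks)"
  have bound: "ip_norm H_inner (\<lambda>x. f n x - u x) \<le> sqrt (K * (\<Sum>j\<in>UNIV. nsq (\<lambda>\<xi>. A n j \<xi> - a j \<xi>) + nsq (\<lambda>\<xi>. B n j \<xi> - b j \<xi>)))" for n
  proof -
    have d: "rep kp ks (\<lambda>j \<xi>. A n j \<xi> - a j \<xi>) (\<lambda>j \<xi>. B n j \<xi> - b j \<xi>) (\<lambda>x. f n x - u x)"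
      by (rule rep_diff[OF AB ru])
    show ?thesis
      unfolding ip_norm_H[OF rep_finite_energy[OF d]] K_def using rep_upper[OF d] by simp
  qed
  have "(\<lambda>n. sqrt (K * (\<Sum>j\<in>UNIV. nsq (\<lambda>\<xi>. A n j \<xi> - a j \<xi>) + nsq (\<lambda>\<xi>. B n j \<xi> - b j \<xi>)))) \<longlonglongrightarrow> sqrt (K * (\<Sum>j\<in>(UNIV::3 set). 0 + 0))"
    by (intro tendsto_intros a b)
  then have lim: "(\<lambda>n. sqrt (K * (\<Sum>j\<in>UNIV. nsq (\<lambda>\<xi>. A n j \<xi> - a j \<xi>) + nsq (\<lambda>\<xi>. B n j \<xi> - b j \<xi>)))) \<longlonglongrightarrow> 0" by simp
  have n0: "0 \<le> ip_norm H_inner (\<lambda>x. f n x - u x)" for n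
    unfolding ip_norm_H[OF rep_finite_energy[OF rep_diff[OF AB ru]]] by (rule real_sqrt_ge_zero[OF hsq_sum_nonneg])
  have "(\<lambda>n. ip_norm H_inner (\<lambda>x. f n x - u x)) \<longlonglongrightarrow> 0"
    by (rule tendsto_sandwich[OF _ _ tendsto_const lim]) (use bound n0 in auto)
  then show ?thesis using ru by blast
qed

text \<open>Bounded evaluation, which produces the kernel.\<close>

lemma rep_eval_norm: "\<exists>C. \<forall>a b u. rep kp ks a b u \<longrightarrow> norm (u x) \<le> C * ip_norm H_inner u"
proof -
  obtain L where L: "L \<ge> 0" "\<And>a b u. rep kp ks a b u \<Longrightarrow> (\<Sum>j\<in>UNIV. nsq (a j) + nsq (b j)) \<le> L * (\<Sum>j\<in>UNIV. hsq (\<lambda>x. u x $ j))"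
    using rep_lower by blast
  show ?thesis
  proof (intro exI allI impI)
    fix a b u assume rp: "rep kp ks a b u"
    have p: "(4 * pi + 1) * 6 \<ge> 0" using pi_gt_zero by simp
    have "norm (u x) \<le> (4 * pi + 1) * 6 * sqrt (\<Sum>j\<in>UNIV. nsq (a j) + nsq (b j))" by (rule rep_eval[OF rp])
    also have "\<dots> \<le> (4 * pi + 1) * 6 * sqrt (L * (\<Sum>j\<in>UNIV. hsq (\<lambda>x. u x $ j)))"
      using L(2)[OF rp] p by (intro mult_left_mono) auto
    also have "\<dots> = ((4 * pi + 1) * 6 * sqrt L) * ip_norm H_inner u"
      unfolding ip_norm_H[OF rep_finite_energy[OF rp]] by (simp add: real_sqrt_mult)
    finally show "norm (u x) \<le> ((4 * pi + 1) * 6 * sqrt L) * ip_norm H_inner u" .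
  qed
qed

lemma rep_hilbert: "hilbert_function_space {u. \<exists>a b. rep kp ks a b u} H_inner"
proof -
  let ?W = "{u. \<exists>a b. rep kp ks a b u}"
  have nW: "finite_energy u" if "u \<in> ?W" for u using that rep_finite_energy by auto
  have Wadd: "(\<lambda>x. u x + v x) \<in> ?W" if "u \<in> ?W" "v \<in> ?W" for u v using that rep_add by blast
  have Wc: "(\<lambda>x. c *s u x) \<in> ?W" if "u \<in> ?W" for u c using that rep_cmult by blast
  have z: "(\<lambda>_. 0) \<in> ?W"
  proof -
    have "rep kp ks (\<lambda>j \<xi>. 0) (\<lambda>j \<xi>. 0) (\<lambda>_. 0)"
      using L2S_const[of 0] by (simp add: rep_def wave_def)
    then show ?thesis by blast
  qed
  show ?thesis
    unfolding hilbert_function_space_def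
  proof (intro conjI ballI allI impI)
    show "(\<lambda>_. 0) \<in> ?W" by (rule z)
    show "(\<lambda>x. u x + v x) \<in> ?W" if "u \<in> ?W" "v \<in> ?W" for u v using Wadd that .
    show "(\<lambda>x. c *s u x) \<in> ?W" if "u \<in> ?W" for u c using Wc[OF that] .
    show "H_inner (\<lambda>x. u x + v x) w = H_inner u w + H_inner v w" if u: "u \<in> ?W" and v: "v \<in> ?W" and w: "w \<in> ?W" for u v w
      unfolding H_inner_Phi[OF nW[OF Wadd[OF u v]] nW[OF w]] H_inner_Phi[OF nW[OF u] nW[OF w]] H_inner_Phi[OF nW[OF v] nW[OF w]]
        Phi_add[OF nW[OF u] nW[OF v]]
      by (rule Bochner_Integration.integral_add) (intro Phi_integrable nW u v w)+
    show "H_inner (\<lambda>x. c *s u x) v = c * H_inner u v" if u: "u \<in> ?W" and v: "v \<in> ?W" for c u v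
      unfolding H_inner_Phi[OF nW[OF Wc[OF u]] nW[OF v]] H_inner_Phi[OF nW[OF u] nW[OF v]] Phi_cmult[OF nW[OF u]]
      by simp
    show "H_inner v u = cnj (H_inner u v)" if u: "u \<in> ?W" and v: "v \<in> ?W" for u v
      unfolding H_inner_Phi[OF nW[OF v] nW[OF u]] H_inner_Phi[OF nW[OF u] nW[OF v]] Phi_cnj[of v u]
      by (rule Bochner_Integration.integral_cnj)
    show "0 \<le> Re (H_inner u u)" if u: "u \<in> ?W" for u
      unfolding H_inner_self[OF nW[OF u]] using hsq_sum_nonneg[of u] by simp
    show "u = (\<lambda>_. 0)" if u: "u \<in> ?W" and z: "H_inner u u = 0" for u
    proof
      fix x
      obtain C where C: "\<And>a b u. rep kp ks a b u \<Longrightarrow> norm (u x) \<le> C * ip_norm H_inner u" using rep_eval_norm[of x] by blast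
      show "u x = 0" using C[of _ _ u] u z by (auto simp: ip_norm_def)
    qed
    show "\<exists>u\<in>?W. (\<lambda>n. ip_norm H_inner (\<lambda>x. f n x - u x)) \<longlonglongrightarrow> 0"
      if f: "range f \<subseteq> ?W" and C: "\<forall>e>0. \<exists>N. \<forall>m\<ge>N. \<forall>n\<ge>N. ip_norm H_inner (\<lambda>x. f m x - f n x) < e" for f
      using rep_complete[of f] f C by blast
  qed
qed

end

theorem theorem1p3:
  fixes \<rho> \<omega> lam \<mu> kp ks :: real
  assumes "\<rho> > 0" and "\<omega> > 0" and "\<mu> > 0" and "2 * \<mu> + lam > 0"
    and "kp > 0" and "ks > 0"
    and "kp\<^sup>2 = \<omega>\<^sup>2 * \<rho> / (2 * \<mu> + lam)"
    and "ks\<^sup>2 = \<omega>\<^sup>2 * \<rho> / \<mu>"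
  shows "herglotz_waves \<rho> \<omega> lam \<mu> kp ks \<subseteq> H_space \<and>
         is_rkhs (herglotz_waves \<rho> \<omega> lam \<mu> kp ks) H_inner"
proof
  have W: "herglotz_waves \<rho> \<omega> lam \<mu> kp ks = {u. \<exists>a b. rep kp ks a b u}"
    using herglotz_rep[OF assms(3,4,7,8)] by blast
  show "herglotz_waves \<rho> \<omega> lam \<mu> kp ks \<subseteq> H_space"
    unfolding W
  proof
    fix u assume "u \<in> {u. \<exists>a b. rep kp ks a b u}"
    then obtain a b where rp: "rep kp ks a b u" by blast
    have n: "finite_energy u" by (rule rep_finite_energy[OF assms(5,6) rp])
    show "u \<in> H_space" by (rule H_space_memI[OF rep_Ck[OF rp] H_integrable[OF n n]])
  qed
  interpret function_hilbert_space "{u. \<exists>a b. rep kp ks a b u}" H_inner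
    by (rule function_hilbert_space.intro[OF rep_hilbert[OF assms(5,6)]])
  show "is_rkhs (herglotz_waves \<rho> \<omega> lam \<mu> kp ks) H_inner"
    unfolding W
  proof (rule rkhs)
    fix x
    show "\<exists>C. \<forall>u\<in>{u. \<exists>a b. rep kp ks a b u}. norm (u x) \<le> C * ip_norm H_inner u"
      using rep_eval_norm[OF assms(5,6), of x] by blast
  qed
qed

end
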